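(* Let $\nu\in\mathbb N_+\cup\{\infty\}$ and $\mathcal H=\mathcal H_\nu$. For $n\in\mathbb N_\nu$ put $\boldsymbol\alpha_1:=\mathbf a_1$, $\boldsymbol\alpha_n:=\mathbf a_n-\mathbf a_1^{\,n}$ for $n\ge2$, $\widehat{\boldsymbol\alpha}_1:=\hbar\,\boldsymbol\alpha_1$, $\widehat{\boldsymbol\alpha}_n:=\hbar^{n-1}\boldsymbol\alpha_n$ for $n\ge2$, and $\check{\boldsymbol\alpha}_n:=\hbar^{-1}\widehat{\boldsymbol\alpha}_n$. Then: (i) $\boldsymbol\alpha_n\mapsto\widehat{\boldsymbol\alpha}_n|_{\hbar=1}$ $(n\in\mathbb N_\nu)$ defines an isomorphism of graded Hopf $\Bbbk$-algebras $\mathcal H\cong\mathcal H_\hbar'|_{\hbar=1}:=\mathcal H_\hbar'/(\hbar-1)\mathcal H_\hbar'$; (ii) $\check{\boldsymbol\alpha}_n|_{\hbar=1}\mapsto\boldsymbol\alpha_n$ $(n\in\mathbb N_\nu)$ defines an isomorphism of graded Hopf $\Bbbk$-algebras $(\mathcal H_\hbar')^\vee|_{\hbar=1}:=(\mathcal H_\hbar')^\vee/(\hbar-1)(\mathcal H_\hbar')^\vee\cong\mathcal H$.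
   Context: $\Bbbk$ is a field of characteristic zero, $\mathbb N=\{0,1,2,\dots\}$, $\mathbb N_+=\mathbb N\setminus\{0\}$, $\mathbb N_\nu=\{1,\dots,\nu\}$ for $\nu\in\mathbb N_+$, $\mathbb N_\infty=\mathbb N_+$. $\mathcal H_\nu$: the free associative algebra $\Bbbk\langle\mathbf a_n\mid n\in\mathbb N_\nu\rangle$ with $\Delta(\mathbf a_n)=\mathbf a_n\otimes1+1\otimes\mathbf a_n+\sum_{m=1}^{n-1}\mathbf a_m\otimes Q^m_{n-m}(\mathbf a_* )$, $\epsilon(\mathbf a_n)=0$, $S(\mathbf a_n)=-\mathbf a_n-\sum_{m=1}^{n-1}S(\mathbf a_m)Q^m_{n-m}(\mathbf a_* )$ (recursively), where $Q^\ell_t(\mathbf a_* )=\sum_{k=1}^t\binom{\ell+1}{k}P^{(k)}_t(\mathbf a_* )$, $P^{(k)}_t(\mathbf a_* )=\sum_{j_1,\dots,j_k>0,\,j_1+\cdots+j_k=t}\mathbf a_{j_1}\cdots\mathbf a_{j_k}$; graded by $\partial(\mathbf a_n)=n$. $\mathcal H_\hbar=\Bbbk[\hbar]\otimes_\Bbbk\mathcal H$, $\mathcal H(\hbar)=\Bbbk(\hbar)\otimes_\Bbbk\mathcal H$. With $\delta_0=\epsilon$, $\delta_n=(\mathrm{id}-u\circ\epsilon)^{\otimes n}\circ\Delta^n$ ($u$ the unit map, $\Delta^n$ the iterated coproduct into the $n$-fold tensor power, $\Delta^1=\mathrm{id}$) and $D_n=\operatorname{Ker}(\delta_{n+1})\subseteq\mathcal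 H$, one sets $\mathcal H_\hbar'=\sum_{n\ge0}\Bbbk[\hbar]\hbar^nD_n\subseteq\mathcal H_\hbar$ and $(\mathcal H_\hbar')^\vee=\sum_{n\ge0}\hbar^{-n}(J')^n\subseteq\mathcal H(\hbar)$, where $J'=\operatorname{Ker}(\epsilon:\mathcal H_\hbar'\to\Bbbk[\hbar])$; both are graded Hopf $\Bbbk[\hbar]$-algebras. *)

theory Defs
  imports
    "HOL-Algebra.QuotRing"
    "HOL-Algebra.Ideal_Product"
    "HOL-Algebra.Algebraic_Closure_Type"
    "HOL-Library.Poly_Mapping"
    "HOL-Library.Extended_Nat"
    "HOL-Computational_Algebra.Computational_Algebra"
begin

section \<open>Algebras and tensor powers over a commutative ring\<close>

text \<open>
  The scalars are the elements of a type of class \<open>comm_ring_1\<close>; modules and algebras over them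
  are records with a carrier set, so that submodules and quotients can be formed.
\<close>

definition is_algebra :: "('r::comm_ring_1, 'a, 'm) module_scheme \<Rightarrow> bool" where
  "is_algebra A \<longleftrightarrow> module (ring_of_type_algebra :: 'r ring) A \<and> ring A \<and>
     (\<forall>c. \<forall>x\<in>carrier A. \<forall>y\<in>carrier A.
        (c \<odot>\<^bsub>A\<^esub> x) \<otimes>\<^bsub>A\<^esub> y = c \<odot>\<^bsub>A\<^esub> (x \<otimes>\<^bsub>A\<^esub> y) \<and> x \<otimes>\<^bsub>A\<^esub> (c \<odot>\<^bsub>A\<^esub> y) = c \<odot>\<^bsub>A\<^esub> (x \<otimes>\<^bsub>A\<^esub> y))"

definition alg_hom ::
    "('r::comm_ring_1, 'a, 'm) module_scheme \<Rightarrow> ('r, 'b, 'n) module_scheme \<Rightarrow> ('a \<Rightarrow> 'b) set" where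
  "alg_hom A B = {f \<in> ring_hom A B. \<forall>c. \<forall>x\<in>carrier A. f (c \<odot>\<^bsub>A\<^esub> x) = c \<odot>\<^bsub>B\<^esub> f x}"

definition lin_map ::
    "('r::comm_ring_1, 'a, 'm) module_scheme \<Rightarrow> ('r, 'b, 'n) module_scheme \<Rightarrow> ('a \<Rightarrow> 'b) set" where
  "lin_map A B = {f \<in> carrier A \<rightarrow> carrier B.
     (\<forall>x\<in>carrier A. \<forall>y\<in>carrier A. f (x \<oplus>\<^bsub>A\<^esub> y) = f x \<oplus>\<^bsub>B\<^esub> f y) \<and>
     (\<forall>c. \<forall>x\<in>carrier A. f (c \<odot>\<^bsub>A\<^esub> x) = c \<odot>\<^bsub>B\<^esub> f x)}"

text \<open>
  The quotient of an algebra by a two-sided ideal, with scalars acting through a ring homomorphism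
  \<open>\<iota>\<close> into the original scalars.
\<close>

definition quot_algebra ::
    "('s \<Rightarrow> 'r) \<Rightarrow> ('r, 'a, 'm) module_scheme \<Rightarrow> 'a set \<Rightarrow> ('s, 'a set) module" where
  "quot_algebra \<iota> A I = ring.extend (A Quot I)
     (module.fields (\<lambda>c T. \<Union>x\<in>T. I +>\<^bsub>A\<^esub> (\<iota> c \<odot>\<^bsub>A\<^esub> x)))"

text \<open>
  The tensor power \<open>A\<^sup>\<otimes>\<^sup>n\<close>: the free module on the \<open>n\<close>-tuples (lists of length \<open>n\<close>) of elements of
  \<open>A\<close>, multiplied componentwise, modulo the relations of multilinearity.
\<close>

definition free_tensors ::
    "('r::comm_ring_1, 'a, 'm) module_scheme \<Rightarrow> nat \<Rightarrow> ('r, 'a list \<Rightarrow>\<^sub>0 'r) module" where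
  "free_tensors A n =
     \<lparr>carrier = {p. \<forall>xs\<in>Poly_Mapping.keys p. length xs = n \<and> set xs \<subseteq> carrier A},
      monoid.mult = (\<lambda>p q. \<Sum>xs\<in>Poly_Mapping.keys p. \<Sum>ys\<in>Poly_Mapping.keys q.
        Poly_Mapping.single (map2 (\<lambda>x y. x \<otimes>\<^bsub>A\<^esub> y) xs ys)
          (Poly_Mapping.lookup p xs * Poly_Mapping.lookup q ys)),
      one = Poly_Mapping.single (replicate n \<one>\<^bsub>A\<^esub>) 1,
      ring.zero = 0,
      add = (+),
      module.smult = (\<lambda>c. Poly_Mapping.map (\<lambda>d. c * d))\<rparr>"

inductive_set tensor_rels ::
    "('r::comm_ring_1, 'a, 'm) module_scheme \<Rightarrow> nat \<Rightarrow> ('a list \<Rightarrow>\<^sub>0 'r) set"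
  for A :: "('r::comm_ring_1, 'a, 'm) module_scheme" and n :: nat where
  additive: "\<lbrakk>length us + 1 + length vs = n; set us \<subseteq> carrier A; set vs \<subseteq> carrier A;
      x \<in> carrier A; y \<in> carrier A\<rbrakk> \<Longrightarrow>
    Poly_Mapping.single (us @ (x \<oplus>\<^bsub>A\<^esub> y) # vs) c
      - Poly_Mapping.single (us @ x # vs) c - Poly_Mapping.single (us @ y # vs) c
    \<in> tensor_rels A n"
| scalar: "\<lbrakk>length us + 1 + length vs = n; set us \<subseteq> carrier A; set vs \<subseteq> carrier A;
      x \<in> carrier A\<rbrakk> \<Longrightarrow>
    Poly_Mapping.single (us @ (d \<odot>\<^bsub>A\<^esub> x) # vs) c - Poly_Mapping.single (us @ x # vs) (c * d)
    \<in> tensor_rels A n"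
| zero: "0 \<in> tensor_rels A n"
| sum: "\<lbrakk>p \<in> tensor_rels A n; q \<in> tensor_rels A n\<rbrakk> \<Longrightarrow> p + q \<in> tensor_rels A n"

definition tensor_power ::
    "('r::comm_ring_1, 'a, 'm) module_scheme \<Rightarrow> nat \<Rightarrow> ('r, ('a list \<Rightarrow>\<^sub>0 'r) set) module" where
  "tensor_power A n = quot_algebra (\<lambda>c. c) (free_tensors A n) (tensor_rels A n)"

definition tensor_class ::
    "('r::comm_ring_1, 'a, 'm) module_scheme \<Rightarrow> nat \<Rightarrow> ('a list \<Rightarrow>\<^sub>0 'r) \<Rightarrow> ('a list \<Rightarrow>\<^sub>0 'r) set" where
  "tensor_class A n p = tensor_rels A n +>\<^bsub>free_tensors A n\<^esub> p"

definition pure_tensor ::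
    "('r::comm_ring_1, 'a, 'm) module_scheme \<Rightarrow> 'a list \<Rightarrow> ('a list \<Rightarrow>\<^sub>0 'r) set" where
  "pure_tensor A xs = tensor_class A (length xs) (Poly_Mapping.single xs 1)"

text \<open>
  The map out of a tensor power induced by a multilinear map \<open>F\<close> (given on tuples) into \<open>N\<close>; more
  generally \<open>F\<close> may be multilinear up to a ring homomorphism \<open>\<sigma>\<close> of the scalars.  For such \<open>F\<close> the
  result does not depend on the chosen representative.
\<close>

definition tensor_lift ::
    "('r::comm_ring_1 \<Rightarrow> 's) \<Rightarrow> ('s, 'b, 'm) module_scheme \<Rightarrow> ('a list \<Rightarrow> 'b)
     \<Rightarrow> ('a list \<Rightarrow>\<^sub>0 'r) set \<Rightarrow> 'b" where
  "tensor_lift \<sigma> N F T = (let p = (SOME p. p \<in> T) in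
     finsum N (\<lambda>xs. \<sigma> (Poly_Mapping.lookup p xs) \<odot>\<^bsub>N\<^esub> F xs) (Poly_Mapping.keys p))"

definition tensor_map ::
    "('r::comm_ring_1 \<Rightarrow> 's::comm_ring_1) \<Rightarrow> ('s, 'b, 'm) module_scheme \<Rightarrow> nat \<Rightarrow> ('a \<Rightarrow> 'b)
     \<Rightarrow> ('a list \<Rightarrow>\<^sub>0 'r) set \<Rightarrow> ('b list \<Rightarrow>\<^sub>0 's) set" where
  "tensor_map \<sigma> B n f = tensor_lift \<sigma> (tensor_power B n) (\<lambda>xs. pure_tensor B (map f xs))"


section \<open>Graded Hopf algebras\<close>

record (overloaded) ('r, 'a) hopf = "('r, 'a) module" +
  comult :: "'a \<Rightarrow> ('a list \<Rightarrow>\<^sub>0 'r) set"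
  counit :: "'a \<Rightarrow> 'r"
  antipode :: "'a \<Rightarrow> 'a"
  homog :: "nat \<Rightarrow> 'a set"

text \<open>\<open>id \<otimes> \<dots> \<otimes> \<Delta> \<otimes> \<dots> \<otimes> id\<close> from the \<open>n\<close>-th to the \<open>(n+1)\<close>-st tensor power, with \<open>\<Delta>\<close> in slot
  \<open>i\<close> (counted from 0).\<close>

definition comult_at ::
    "('r::comm_ring_1, 'a, 'm) hopf_scheme \<Rightarrow> nat \<Rightarrow> nat
     \<Rightarrow> ('a list \<Rightarrow>\<^sub>0 'r) set \<Rightarrow> ('a list \<Rightarrow>\<^sub>0 'r) set" where
  "comult_at A n i = tensor_lift (\<lambda>c. c) (tensor_power A (Suc n))
     (\<lambda>xs. tensor_lift (\<lambda>c. c) (tensor_power A (Suc n))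
        (\<lambda>uv. pure_tensor A (take i xs @ uv @ drop (Suc i) xs)) (comult A (xs ! i)))"

definition is_hopf_algebra :: "('r::comm_ring_1, 'a, 'm) hopf_scheme \<Rightarrow> bool" where
  "is_hopf_algebra A \<longleftrightarrow>
     is_algebra A \<and>
     comult A \<in> alg_hom A (tensor_power A 2) \<and>
     counit A \<in> ring_hom A (ring_of_type_algebra :: 'r ring) \<and>
     (\<forall>c. \<forall>x\<in>carrier A. counit A (c \<odot>\<^bsub>A\<^esub> x) = c * counit A x) \<and>
     antipode A \<in> lin_map A A \<and>
     (\<forall>x\<in>carrier A. comult_at A 2 0 (comult A x) = comult_at A 2 1 (comult A x)) \<and>
     (\<forall>x\<in>carrier A.
        tensor_lift (\<lambda>c. c) A (\<lambda>xs. counit A (xs ! 0) \<odot>\<^bsub>A\<^esub> (xs ! 1)) (comult A x) = x \<and>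
        tensor_lift (\<lambda>c. c) A (\<lambda>xs. counit A (xs ! 1) \<odot>\<^bsub>A\<^esub> (xs ! 0)) (comult A x) = x) \<and>
     (\<forall>x\<in>carrier A.
        tensor_lift (\<lambda>c. c) A (\<lambda>xs. antipode A (xs ! 0) \<otimes>\<^bsub>A\<^esub> (xs ! 1)) (comult A x)
          = counit A x \<odot>\<^bsub>A\<^esub> \<one>\<^bsub>A\<^esub> \<and>
        tensor_lift (\<lambda>c. c) A (\<lambda>xs. (xs ! 0) \<otimes>\<^bsub>A\<^esub> antipode A (xs ! 1)) (comult A x)
          = counit A x \<odot>\<^bsub>A\<^esub> \<one>\<^bsub>A\<^esub>)"

text \<open>Compatibility of the Hopf structure with a decomposition \<open>A = \<Oplus>\<^sub>d homog A d\<close>.\<close>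

definition is_graded_hopf_algebra :: "('r::comm_ring_1, 'a, 'm) hopf_scheme \<Rightarrow> bool" where
  "is_graded_hopf_algebra A \<longleftrightarrow>
     is_hopf_algebra A \<and>
     (\<forall>d. submodule (homog A d) (ring_of_type_algebra :: 'r ring) A) \<and>
     (\<forall>x\<in>carrier A. \<exists>!f. (\<forall>d. f d \<in> homog A d) \<and> finite {d. f d \<noteq> \<zero>\<^bsub>A\<^esub>} \<and>
        x = finsum A f {d. f d \<noteq> \<zero>\<^bsub>A\<^esub>}) \<and>
     \<one>\<^bsub>A\<^esub> \<in> homog A 0 \<and>
     (\<forall>d e. \<forall>x\<in>homog A d. \<forall>y\<in>homog A e. x \<otimes>\<^bsub>A\<^esub> y \<in> homog A (d + e)) \<and>
     (\<forall>d. \<forall>x\<in>homog A d. \<exists>p. comult A x = tensor_class A 2 p \<and>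
        (\<forall>xs\<in>Poly_Mapping.keys p. \<exists>i j y z. i + j = d \<and> y \<in> homog A i \<and> z \<in> homog A j \<and>
           xs = [y, z])) \<and>
     (\<forall>d>0. \<forall>x\<in>homog A d. counit A x = 0) \<and>
     (\<forall>d. \<forall>x\<in>homog A d. antipode A x \<in> homog A d)"

definition graded_hopf_iso ::
    "('r::comm_ring_1, 'a, 'm) hopf_scheme \<Rightarrow> ('r, 'b, 'n) hopf_scheme \<Rightarrow> ('a \<Rightarrow> 'b) \<Rightarrow> bool" where
  "graded_hopf_iso A B f \<longleftrightarrow>
     is_graded_hopf_algebra A \<and> is_graded_hopf_algebra B \<and>
     f \<in> alg_hom A B \<and> bij_betw f (carrier A) (carrier B) \<and>
     (\<forall>x\<in>carrier A. comult B (f x) = tensor_map (\<lambda>c. c) B 2 f (comult A x)) \<and>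
     (\<forall>x\<in>carrier A. counit B (f x) = counit A x) \<and>
     (\<forall>x\<in>carrier A. antipode B (f x) = f (antipode A x)) \<and>
     (\<forall>d. f ` homog A d = homog B d)"

text \<open>The iterated coproduct \<open>\<Delta>\<^sup>n\<close> into the \<open>n\<close>-th tensor power (\<open>\<Delta>\<^sup>0 = \<epsilon>\<close>, \<open>\<Delta>\<^sup>1 = id\<close>), the maps
  \<open>\<delta>\<^sub>n\<close>, and \<open>D\<^sub>n = Ker \<delta>\<^sub>n\<^sub>+\<^sub>1\<close>.\<close>

fun iter_comult :: "('r::comm_ring_1, 'a, 'm) hopf_scheme \<Rightarrow> nat \<Rightarrow> 'a \<Rightarrow> ('a list \<Rightarrow>\<^sub>0 'r) set" where
  "iter_comult A 0 x = tensor_class A 0 (Poly_Mapping.single [] (counit A x))"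
| "iter_comult A (Suc 0) x = pure_tensor A [x]"
| "iter_comult A (Suc (Suc n)) x = comult_at A (Suc n) 0 (iter_comult A (Suc n) x)"

definition delta_map ::
    "('r::comm_ring_1, 'a, 'm) hopf_scheme \<Rightarrow> nat \<Rightarrow> 'a \<Rightarrow> ('a list \<Rightarrow>\<^sub>0 'r) set" where
  "delta_map A n x =
     tensor_map (\<lambda>c. c) A n (\<lambda>y. y \<ominus>\<^bsub>A\<^esub> (counit A y \<odot>\<^bsub>A\<^esub> \<one>\<^bsub>A\<^esub>)) (iter_comult A n x)"

definition D_ker :: "('r::comm_ring_1, 'a, 'm) hopf_scheme \<Rightarrow> nat \<Rightarrow> 'a set" where
  "D_ker A n = {x \<in> carrier A. delta_map A (Suc n) x = \<zero>\<^bsub>tensor_power A (Suc n)\<^esub>}"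

text \<open>
  The Hopf algebra structure induced on a subset \<open>C\<close> of a Hopf algebra \<open>B\<close> over \<open>'s\<close> that is an
  algebra over \<open>'r\<close> via an injective ring homomorphism \<open>\<sigma>\<close>.  The coproduct takes values in the tensor
  square over \<open>'r\<close> of \<open>C\<close> itself, and is characterised by its image in the tensor square of \<open>B\<close>.
\<close>

definition sub_algebra ::
    "('r \<Rightarrow> 's) \<Rightarrow> ('s, 'a, 'm) module_scheme \<Rightarrow> 'a set \<Rightarrow> ('r, 'a) module" where
  "sub_algebra \<sigma> B C =
     \<lparr>carrier = C, monoid.mult = monoid.mult B, one = \<one>\<^bsub>B\<^esub>, ring.zero = \<zero>\<^bsub>B\<^esub>, add = add B,
      module.smult = (\<lambda>c x. \<sigma> c \<odot>\<^bsub>B\<^esub> x)\<rparr>"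

definition sub_hopf ::
    "('r::comm_ring_1 \<Rightarrow> 's::comm_ring_1) \<Rightarrow> ('s, 'a, 'm) hopf_scheme \<Rightarrow> 'a set \<Rightarrow> ('r, 'a) hopf" where
  "sub_hopf \<sigma> B C = module.extend (sub_algebra \<sigma> B C) (hopf.fields
     (\<lambda>x. THE t. t \<in> carrier (tensor_power (sub_algebra \<sigma> B C) 2) \<and>
            tensor_map \<sigma> B 2 (\<lambda>y. y) t = comult B x)
     (\<lambda>x. THE c. \<sigma> c = counit B x)
     (antipode B)
     (\<lambda>d. C \<inter> homog B d))"


section \<open>Specialisation at \<open>\<hbar> = 1\<close>\<close>

definition hbar :: "'k::comm_ring_1 poly" where
  "hbar = [:0, 1:]"

definition at_one_ideal :: "('k::comm_ring_1 poly, 'a, 'm) module_scheme \<Rightarrow> 'a set" where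
  "at_one_ideal A = (\<lambda>x. (hbar - 1) \<odot>\<^bsub>A\<^esub> x) ` carrier A"

definition at_one_algebra ::
    "('k::comm_ring_1 poly, 'a, 'm) module_scheme \<Rightarrow> ('k, 'a set) module" where
  "at_one_algebra A = quot_algebra (\<lambda>c. [:c:]) A (at_one_ideal A)"

definition at_one_class :: "('k::comm_ring_1 poly, 'a, 'm) module_scheme \<Rightarrow> 'a \<Rightarrow> 'a set" where
  "at_one_class A x = at_one_ideal A +>\<^bsub>A\<^esub> x"

definition at_one :: "('k::comm_ring_1 poly, 'a, 'm) hopf_scheme \<Rightarrow> ('k, 'a set) hopf" where
  "at_one A = module.extend (at_one_algebra A) (hopf.fields
     (\<lambda>T. tensor_map (\<lambda>c. poly c 1) (at_one_algebra A) 2 (at_one_class A)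
            (comult A (SOME x. x \<in> T)))
     (\<lambda>T. poly (counit A (SOME x. x \<in> T)) 1)
     (\<lambda>T. at_one_class A (antipode A (SOME x. x \<in> T)))
     (\<lambda>d. at_one_class A ` homog A d))"


section \<open>The Hopf algebra \<open>\<H>\<^sub>\<nu>\<close>\<close>

text \<open>
  Words form the free monoid under concatenation, so \<open>nat list \<Rightarrow>\<^sub>0 'r\<close> is the free associative
  algebra over \<open>'r\<close> on the generators \<open>a\<^sub>n\<close>, \<open>n \<in> \<nat>\<close>.
\<close>

instantiation list :: (type) monoid_add
begin

definition zero_list :: "'a list" where
  "zero_list = []"

definition plus_list :: "'a list \<Rightarrow> 'a list \<Rightarrow> 'a list" where
  "plus_list = (@)"

instance
  by standard (simp_all add: zero_list_def plus_list_def)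

end

type_synonym 'r falg = "nat list \<Rightarrow>\<^sub>0 'r"

definition gen :: "nat \<Rightarrow> 'r::comm_ring_1 falg" where
  "gen n = Poly_Mapping.single [n] 1"

definition scal :: "'r::comm_ring_1 \<Rightarrow> 'r falg \<Rightarrow> 'r falg" where
  "scal c p = Poly_Mapping.single [] c * p"

definition letters :: "enat \<Rightarrow> nat set" where
  "letters \<nu> = {n. 1 \<le> n \<and> enat n \<le> \<nu>}"

definition free_algebra :: "enat \<Rightarrow> ('r::comm_ring_1, 'r falg) module" where
  "free_algebra \<nu> =
     \<lparr>carrier = {p. \<forall>w\<in>Poly_Mapping.keys p. set w \<subseteq> letters \<nu>},
      monoid.mult = (*), one = 1, ring.zero = 0, add = (+), module.smult = scal\<rparr>"

text \<open>The algebra homomorphism from the free algebra to \<open>B\<close> that sends \<open>a\<^sub>n\<close> to \<open>g n\<close>.\<close>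

definition free_lift ::
    "('r::comm_ring_1, 'b, 'm) module_scheme \<Rightarrow> (nat \<Rightarrow> 'b) \<Rightarrow> 'r falg \<Rightarrow> 'b" where
  "free_lift B g p = finsum B
     (\<lambda>w. Poly_Mapping.lookup p w \<odot>\<^bsub>B\<^esub> foldr (\<lambda>n y. g n \<otimes>\<^bsub>B\<^esub> y) w \<one>\<^bsub>B\<^esub>) (Poly_Mapping.keys p)"

definition P_poly :: "nat \<Rightarrow> nat \<Rightarrow> 'r::comm_ring_1 falg" where
  "P_poly k t = (\<Sum>js | length js = k \<and> (\<forall>j\<in>set js. 0 < j) \<and> sum_list js = t. prod_list (map gen js))"

definition Q_poly :: "nat \<Rightarrow> nat \<Rightarrow> 'r::comm_ring_1 falg" where
  "Q_poly l t = (\<Sum>k=1..t. of_nat ((l + 1) choose k) * P_poly k t)"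

definition comult_gen :: "enat \<Rightarrow> nat \<Rightarrow> ('r::comm_ring_1 falg list \<Rightarrow>\<^sub>0 'r) set" where
  "comult_gen \<nu> n = tensor_class (free_algebra \<nu> :: ('r, 'r falg) module) 2
     (Poly_Mapping.single [gen n, 1] 1 + Poly_Mapping.single [1, gen n] 1 +
      (\<Sum>m\<in>{1..<n}. Poly_Mapping.single [gen m, Q_poly m (n - m)] 1))"

fun antipode_gen :: "nat \<Rightarrow> 'r::comm_ring_1 falg" where
  "antipode_gen n = - gen n - (\<Sum>m\<in>{1..<n}. antipode_gen m * Q_poly m (n - m))"

declare antipode_gen.simps [simp del]

text \<open>
  The counit is the algebra homomorphism annihilating all generators, i.e. the constant term; the
  antipode is the algebra antihomomorphism given by \<open>antipode_gen\<close> on the generators.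

  Over the scalars \<open>'k poly\<close> and \<open>'k poly fract\<close> this Hopf algebra is the scalar extension
  \<open>\<H>\<^sub>\<hbar> = k[\<hbar>] \<otimes> \<H>\<close>, respectively \<open>\<H>(\<hbar>) = k(\<hbar>) \<otimes> \<H>\<close>, of the one over \<open>'k\<close>.
\<close>

definition H_alg :: "enat \<Rightarrow> ('r::comm_ring_1, 'r falg) hopf" where
  "H_alg \<nu> = module.extend (free_algebra \<nu>) (hopf.fields
     (free_lift (tensor_power (free_algebra \<nu>) 2) (comult_gen \<nu>))
     (\<lambda>p. Poly_Mapping.lookup p [])
     (\<lambda>p. \<Sum>w\<in>Poly_Mapping.keys p.
        scal (Poly_Mapping.lookup p w) (prod_list (map antipode_gen (rev w))))
     (\<lambda>d. {p \<in> carrier (free_algebra \<nu>). \<forall>w\<in>Poly_Mapping.keys p. sum_list w = d}))"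


section \<open>\<open>\<H>\<^sub>\<hbar>'\<close> and \<open>(\<H>\<^sub>\<hbar>')\<^sup>\<or>\<close>\<close>

text \<open>The inclusions \<open>\<H> \<subseteq> \<H>\<^sub>\<hbar>\<close> and \<open>\<H>\<^sub>\<hbar> \<subseteq> \<H>(\<hbar>)\<close>.\<close>

definition to_hbar :: "'k::field_char_0 falg \<Rightarrow> 'k poly falg" where
  "to_hbar = Poly_Mapping.map (\<lambda>c. [:c:])"

definition to_frac :: "'k::field_char_0 poly falg \<Rightarrow> 'k poly fract falg" where
  "to_frac = Poly_Mapping.map to_fract"

definition H_prime_set :: "enat \<Rightarrow> 'k::field_char_0 poly falg set" where
  "H_prime_set \<nu> = Modules.module.span scal
     (\<Union>n. (\<lambda>x. scal (hbar ^ n) (to_hbar x)) ` D_ker (H_alg \<nu> :: ('k, 'k falg) hopf) n)"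

definition H_prime :: "enat \<Rightarrow> ('k::field_char_0 poly, 'k poly falg) hopf" where
  "H_prime \<nu> = sub_hopf (\<lambda>c. c) (H_alg \<nu>) (H_prime_set \<nu>)"

definition J_prime :: "enat \<Rightarrow> 'k::field_char_0 poly falg set" where
  "J_prime \<nu> = {x \<in> carrier (H_prime \<nu>). counit (H_prime \<nu>) x = 0}"

definition J_prime_power :: "enat \<Rightarrow> nat \<Rightarrow> 'k::field_char_0 poly falg set" where
  "J_prime_power \<nu> n = (ideal_prod (H_prime \<nu>) (J_prime \<nu>) ^^ n) (carrier (H_prime \<nu>))"

definition H_prime_vee_set :: "enat \<Rightarrow> 'k::field_char_0 poly fract falg set" where
  "H_prime_vee_set \<nu> = Modules.module.span (\<lambda>c. scal (to_fract c))
     (\<Union>n. (\<lambda>x. scal (inverse (to_fract hbar) ^ n) (to_frac x)) ` J_prime_power \<nu> n)"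

definition H_prime_vee :: "enat \<Rightarrow> ('k::field_char_0 poly, 'k poly fract falg) hopf" where
  "H_prime_vee \<nu> = sub_hopf to_fract (H_alg \<nu>) (H_prime_vee_set \<nu>)"

definition alpha :: "nat \<Rightarrow> 'k::field_char_0 falg" where
  "alpha n = (if n = 1 then gen 1 else gen n - gen 1 ^ n)"

definition alpha_hat :: "nat \<Rightarrow> 'k::field_char_0 poly falg" where
  "alpha_hat n = (if n = 1 then scal hbar (to_hbar (alpha 1))
     else scal (hbar ^ (n - 1)) (to_hbar (alpha n)))"

definition alpha_check :: "nat \<Rightarrow> 'k::field_char_0 poly fract falg" where
  "alpha_check n = scal (inverse (to_fract hbar)) (to_frac (alpha_hat n))"

end

theory Submission
  imports Defs "HOL-Library.Product_Plus"
begin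

text \<open>
  For a filtration \<open>F\<close> of \<open>\<H>\<close> compatible with the product, \<open>\<Delta>\<close> and \<open>S\<close>, let \<open>R(F) = \<Sum>\<^sub>n \<hbar>\<^sup>n F\<^sub>n[\<hbar>]\<close> be its Rees
  algebra.  A basis of \<open>\<H>\<close> adapted to \<open>F\<close> shows that the tensor square of \<open>R(F)\<close> embeds into that of
  \<open>\<H>(\<hbar>)\<close>, so that \<open>R(F)\<close> inherits the coproduct, and \<open>\<hbar>\<^sup>n x \<mapsto> x\<close> identifies \<open>R(F)\<close> modulo \<open>\<hbar> - 1\<close> with
  \<open>\<H>\<close> as a graded Hopf algebra.

  \<open>\<H>\<^sub>\<hbar>'\<close> is \<open>R(D)\<close>.  Here \<open>D\<^sub>n\<close> is the annihilator of the \<open>(n+1)\<close>-st power of the augmentation ideal of the dual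
  algebra, which makes \<open>D\<close> compatible with all structure maps.  Likewise \<open>(\<H>\<^sub>\<hbar>')\<^sup>\<or>\<close> is \<open>R(E)\<close> for the
  filtration \<open>E\<close> generated by the sets \<open>D\<^sub>n\<^sub>+\<^sub>1 \<inter> Ker \<epsilon>\<close> placed in degree \<open>n\<close>.  The elements
  \<open>\<alpha>\<^sub>n\<close> enter because \<open>a\<^sub>n\<close> and \<open>a\<^sub>1\<^sup>n\<close> have the same image under \<open>\<delta>\<^sub>n\<close>, so that \<open>\<alpha>\<^sub>n \<in> D\<^sub>n\<^sub>-\<^sub>1\<close>.
\<close>

section \<open>Linear extension along finitely supported functions\<close>

text \<open>The obstacle is the coproduct. In \<open>sub_hopf\<close> it must be a unique element of
  the tensor square of the subalgebra itself over \<open>'k poly\<close>, a quotient of a free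
  module in which equality is not visible. Uniqueness comes from the embedding of tensor squares.
  Existence comes from \<Delta> mapping \<open>F n\<close> into the sum of the products
  \<open>F i \<otimes> F (n - i)\<close>: the factor \<open>\<hbar>\<^sup>n\<close> can then be
  distributed over both sides. The Hopf axioms are never checked on cosets; those of the
  specialisation are transported from \<H>. On \<H> itself they are checked in monoid algebras on
  pairs and triples of words, and only the results are carried to the quotient. There
  coassociativity rests on one uniform formula for \<Delta> on the coefficients of all powers of
  \<open>1 + a\<^sub>1 t + a\<^sub>2 t\<^sup>2 + ...\<close>. The isomorphism of (i) and the inverse
  of that of (ii) send x of filtration degree n to the class of \<open>\<hbar>\<^sup>n x\<close>.
  The elements \<open>\<alpha>\<^sub>n\<close> identify these maps: they generate \<H>, and they lie
  in degree max(1, n - 1), respectively one less, which are the exponents in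
  \<open>alpha_hat\<close> and \<open>alpha_check\<close>.\<close>

definition plin :: "('a \<Rightarrow> 'r \<Rightarrow> 'b) \<Rightarrow> ('a \<Rightarrow>\<^sub>0 'r::zero) \<Rightarrow> 'b::comm_monoid_add" where
  "plin G p = (\<Sum>x\<in>Poly_Mapping.keys p. G x (Poly_Mapping.lookup p x))"

text \<open>The coefficient is an argument of \<open>G\<close> rather than a factor, so linear and
  semilinear extensions and extensions with scalar values are all instances of \<open>plin\<close>.
  Additivity in that argument is what makes \<open>plin G\<close> additive.\<close>

definition additive2 :: "('a \<Rightarrow> 'r::monoid_add \<Rightarrow> 'b::monoid_add) \<Rightarrow> bool" where
  "additive2 G \<longleftrightarrow> (\<forall>x. G x 0 = 0 \<and> (\<forall>a b. G x (a + b) = G x a + G x b))"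

lemma additive2I [intro?]:
  "(\<And>x. G x 0 = 0) \<Longrightarrow> (\<And>x a b. G x (a + b) = G x a + G x b) \<Longrightarrow> additive2 G"
  by (simp add: additive2_def)

lemma plin_superset:
  assumes "additive2 G" "finite K" "Poly_Mapping.keys p \<subseteq> K"
  shows "plin G p = (\<Sum>x\<in>K. G x (Poly_Mapping.lookup p x))"
  unfolding plin_def using assms
  by (intro sum.mono_neutral_left) (auto simp: additive2_def in_keys_iff)

lemma plin_0 [simp]: "plin G 0 = 0"
  by (simp add: plin_def)

lemma plin_single:
  assumes "additive2 G" shows "plin G (Poly_Mapping.single x c) = G x c"
  using assms by (cases "c = 0") (auto simp: plin_def additive2_def)

lemma plin_add:
  assumes G: "additive2 G"
  shows "plin G (p + q) = plin G p + plin G q"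
proof -
  let ?K = "Poly_Mapping.keys p \<union> Poly_Mapping.keys q"
  have "plin G (p + q) = (\<Sum>x\<in>?K. G x (Poly_Mapping.lookup (p + q) x))"
    using plin_superset[OF G _ keys_add, of p q] by simp
  also have "\<dots> = (\<Sum>x\<in>?K. G x (Poly_Mapping.lookup p x)) + (\<Sum>x\<in>?K. G x (Poly_Mapping.lookup q x))"
    using G by (simp add: lookup_add additive2_def sum.distrib)
  also have "\<dots> = plin G p + plin G q"
    using plin_superset[OF G, of ?K p] plin_superset[OF G, of ?K q] by simp
  finally show ?thesis .
qed

lemma plin_sum:
  assumes "additive2 G" shows "plin G (sum f I) = (\<Sum>i\<in>I. plin G (f i))"
  by (induction I rule: infinite_finite_induct) (simp_all add: plin_add assms)

lemma plin_uminus: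
  fixes G :: "'a \<Rightarrow> 'r::ab_group_add \<Rightarrow> 'b::ab_group_add"
  assumes "additive2 G" shows "plin G (- p) = - plin G p"
  using plin_add[OF assms, of "- p" p] by (simp add: eq_neg_iff_add_eq_0)

lemma plin_diff:
  fixes G :: "'a \<Rightarrow> 'r::ab_group_add \<Rightarrow> 'b::ab_group_add"
  assumes "additive2 G" shows "plin G (p - q) = plin G p - plin G q"
  using plin_add[OF assms, of p "- q"] plin_uminus[OF assms, of q] by simp

text \<open>Membership in the carriers below is a condition on keys. The set \<open>K\<close>
  carries this condition through the induction, in which the keys are removed one at a time.\<close>

lemma pm_induct_keys [consumes 1, case_names zero add]:
  fixes p :: "'a \<Rightarrow>\<^sub>0 'r::ab_group_add"
  assumes "Poly_Mapping.keys p \<subseteq> K" "P 0"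
    and step: "\<And>x c p. x \<in> K \<Longrightarrow> Poly_Mapping.keys p \<subseteq> K \<Longrightarrow> P p \<Longrightarrow> P (Poly_Mapping.single x c + p)"
  shows "P p"
  using assms(1)
proof (induction "card (Poly_Mapping.keys p)" arbitrary: p rule: less_induct)
  case less
  show ?case
  proof (cases "Poly_Mapping.keys p = {}")
    case True
    then show ?thesis using \<open>P 0\<close> by (metis in_keys_iff empty_iff lookup_zero poly_mapping_eqI)
  next
    case False
    then obtain x where x: "x \<in> Poly_Mapping.keys p" by (meson ex_in_conv)
    define q where "q = p - Poly_Mapping.single x (Poly_Mapping.lookup p x)"
    have "Poly_Mapping.keys q = Poly_Mapping.keys p - {x}"
      by (auto simp: q_def in_keys_iff lookup_minus lookup_single when_def split: if_splits)
    then have "P q" "Poly_Mapping.keys q \<subseteq> K"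
      using less x by (auto intro!: less(1) psubset_card_mono)
    then have "P (Poly_Mapping.single x (Poly_Mapping.lookup p x) + q)"
      using x less by (intro step) auto
    then show ?thesis by (simp add: q_def)
  qed
qed

lemma pm_induct [case_names zero add]:
  fixes p :: "'a \<Rightarrow>\<^sub>0 'r::ab_group_add"
  assumes "P 0" "\<And>x c p. P p \<Longrightarrow> P (Poly_Mapping.single x c + p)"
  shows "P p"
  by (rule pm_induct_keys[of p UNIV]) (use assms in auto)

lemma plin_single_eq: "plin (\<lambda>x c. Poly_Mapping.single x c) p = (p :: 'a \<Rightarrow>\<^sub>0 'r::ab_group_add)"
proof -
  have A: "additive2 (\<lambda>x c::'r. Poly_Mapping.single x c)"
    by (rule additive2I) (simp_all add: single_add)
  show ?thesis
    by (induction p rule: pm_induct) (simp_all add: plin_add[OF A] plin_single[OF A])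
qed

lemma keys_plin:
  "Poly_Mapping.keys (plin G p) \<subseteq> (\<Union>x\<in>Poly_Mapping.keys p. Poly_Mapping.keys (G x (Poly_Mapping.lookup p x)))"
  unfolding plin_def by (rule keys_sum)

definition smul :: "'r::comm_ring_1 \<Rightarrow> ('a \<Rightarrow>\<^sub>0 'r) \<Rightarrow> ('a \<Rightarrow>\<^sub>0 'r)" where
  "smul c = Poly_Mapping.map (\<lambda>d. c * d)"

lemma lookup_pm_map: "f 0 = 0 \<Longrightarrow> Poly_Mapping.lookup (Poly_Mapping.map f p) x = f (Poly_Mapping.lookup p x)"
  by transfer (auto simp: when_def)

lemma lookup_smul [simp]: "Poly_Mapping.lookup (smul c p) x = c * Poly_Mapping.lookup p x"
  by (simp add: smul_def lookup_pm_map)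

lemma keys_smul: "Poly_Mapping.keys (smul c p) \<subseteq> Poly_Mapping.keys p"
  by (auto simp: in_keys_iff)

lemma smul_0 [simp]: "smul c 0 = 0" "smul 0 p = 0"
  by (auto intro: poly_mapping_eqI)

lemma smul_add: "smul c (p + q) = smul c p + smul c q"
  and smul_add_left: "smul (c + d) p = smul c p + smul d p"
  and smul_smul: "smul c (smul d p) = smul (c * d) p"
  and smul_one [simp]: "smul 1 p = p"
  and smul_single [simp]: "smul c (Poly_Mapping.single x d) = Poly_Mapping.single x (c * d)"
  and smul_minus: "smul c (- p) = - smul c p"
  and smul_diff: "smul c (p - q) = smul c p - smul c q"
  by (auto intro!: poly_mapping_eqI simp: lookup_add lookup_minus algebra_simps lookup_single when_def)

section \<open>Tensor powers of modules\<close>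

abbreviation tc :: "('r::comm_ring_1, 'a, 'm) module_scheme \<Rightarrow> nat \<Rightarrow> ('a list \<Rightarrow>\<^sub>0 'r) \<Rightarrow> ('a list \<Rightarrow>\<^sub>0 'r) set" where
  "tc \<equiv> tensor_class"

abbreviation rot :: "'r::comm_ring_1 ring" where "rot \<equiv> ring_of_type_algebra"

definition tuples :: "('r, 'a, 'm) module_scheme \<Rightarrow> nat \<Rightarrow> 'a list set" where
  "tuples A n = {xs. length xs = n \<and> set xs \<subseteq> carrier A}"

lemma carrier_free_tensors: "carrier (free_tensors A n) = {p. Poly_Mapping.keys p \<subseteq> tuples A n}"
  by (auto simp: free_tensors_def tuples_def)

text \<open>\<open>tensor_rels\<close> is closed by definition only under sums. Negatives, and
  multiples in the next lemma, are available because every generating relation comes with an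
  arbitrary coefficient.\<close>

lemma tensor_rels_uminus: "p \<in> tensor_rels A n \<Longrightarrow> - p \<in> tensor_rels A n"
proof (induction rule: tensor_rels.induct)
  case (additive us vs x y c)
  from tensor_rels.additive[OF this, of "- c"] show ?case
    by (simp add: single_uminus algebra_simps)
next
  case (scalar us vs x d c)
  from tensor_rels.scalar[OF this, of d "- c"] show ?case
    by (simp add: single_uminus algebra_simps)
qed (auto intro: tensor_rels.zero tensor_rels.sum[of "- _" _ _ "- _", simplified] simp: tensor_rels.sum)

lemma tensor_rels_smul: "p \<in> tensor_rels A n \<Longrightarrow> smul b p \<in> tensor_rels A n"
proof (induction rule: tensor_rels.induct)
  case (additive us vs x y c)
  from tensor_rels.additive[OF this, of "b * c"] show ?case
    by (simp add: smul_diff)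
next
  case (scalar us vs x d c)
  from tensor_rels.scalar[OF this, of d "b * c"] show ?case
    by (simp add: smul_diff mult.assoc)
qed (auto intro: tensor_rels.zero tensor_rels.sum simp: smul_add)

lemma tensor_rels_diff: "p \<in> tensor_rels A n \<Longrightarrow> q \<in> tensor_rels A n \<Longrightarrow> p - q \<in> tensor_rels A n"
  using tensor_rels.sum[OF _ tensor_rels_uminus] by fastforce

lemma tensor_rels_sum: "(\<And>i. i \<in> I \<Longrightarrow> f i \<in> tensor_rels A n) \<Longrightarrow> sum f I \<in> tensor_rels A n"
  by (induction I rule: infinite_finite_induct) (auto intro: tensor_rels.intros)

lemma tc_def': "tc A n p = {r + p |r. r \<in> tensor_rels A n}"
  by (auto simp: tensor_class_def a_r_coset_def r_coset_def free_tensors_def)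

lemma tc_self: "p \<in> tc A n p"
  using tensor_rels.zero by (force simp: tc_def')

lemma tc_eq_iff: "tc A n p = tc A n q \<longleftrightarrow> p - q \<in> tensor_rels A n"
proof
  assume "tc A n p = tc A n q"
  then have "p \<in> tc A n q" using tc_self by metis
  then show "p - q \<in> tensor_rels A n" by (auto simp: tc_def')
next
  assume *: "p - q \<in> tensor_rels A n"
  have "\<exists>s. r + p = s + q \<and> s \<in> tensor_rels A n" if "r \<in> tensor_rels A n" for r
    using that * by (intro exI[of _ "r + (p - q)"]) (auto intro: tensor_rels.sum)
  moreover have "\<exists>s. r + q = s + p \<and> s \<in> tensor_rels A n" if "r \<in> tensor_rels A n" for r
    using that * by (intro exI[of _ "r - (p - q)"]) (auto intro: tensor_rels_diff)
  ultimately show "tc A n p = tc A n q" unfolding tc_def' by blast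
qed

lemma mem_tc: "q \<in> tc A n p \<longleftrightarrow> tc A n q = tc A n p"
proof -
  have "q \<in> tc A n p \<longleftrightarrow> q - p \<in> tensor_rels A n"
    by (auto simp: tc_def' intro!: exI[of _ "q - p"])
  then show ?thesis by (simp add: tc_eq_iff)
qed

lemma carrier_tensor_power: "carrier (tensor_power A n) = tc A n ` carrier (free_tensors A n)"
  by (auto simp: tensor_power_def quot_algebra_def ring.defs module.defs FactRing_def
      A_RCOSETS_def RCOSETS_def tensor_class_def a_r_coset_def)

lemma tp_add: "tc A n p \<oplus>\<^bsub>tensor_power A n\<^esub> tc A n q = tc A n (p + q)"
proof -
  have "tc A n p \<oplus>\<^bsub>tensor_power A n\<^esub> tc A n q = {x + y |x y. x \<in> tc A n p \<and> y \<in> tc A n q}"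
    by (auto simp: tensor_power_def quot_algebra_def ring.defs module.defs FactRing_def
      set_add_def set_mult_def free_tensors_def)
  also have "\<dots> = tc A n (p + q)"
  proof (intro equalityI subsetI)
    fix z assume "z \<in> {x + y |x y. x \<in> tc A n p \<and> y \<in> tc A n q}"
    then obtain r s where "z = r + p + (s + q)" "r \<in> tensor_rels A n" "s \<in> tensor_rels A n"
      by (auto simp: tc_def')
    then show "z \<in> tc A n (p + q)"
      by (auto simp: tc_def' intro!: exI[of _ "r + s"] tensor_rels.sum)
  next
    fix z assume "z \<in> tc A n (p + q)"
    then obtain r where r: "z = (r + p) + q" "r \<in> tensor_rels A n" by (auto simp: tc_def' add.assoc)
    then show "z \<in> {x + y |x y. x \<in> tc A n p \<and> y \<in> tc A n q}"
      using tc_self[of q A n] tc_def'[of A n p] by blast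
  qed
  finally show ?thesis .
qed

lemma tp_zero: "\<zero>\<^bsub>tensor_power A n\<^esub> = tc A n 0"
  by (auto simp: tensor_power_def quot_algebra_def ring.defs module.defs FactRing_def tc_def')

lemma tp_smult: "c \<odot>\<^bsub>tensor_power A n\<^esub> tc A n p = tc A n (smul c p)"
proof -
  have "c \<odot>\<^bsub>tensor_power A n\<^esub> tc A n p = (\<Union>x\<in>tc A n p. tc A n (smul c x))"
    by (auto simp: tensor_power_def quot_algebra_def ring.defs module.defs FactRing_def
      tensor_class_def free_tensors_def smul_def)
  also have "\<dots> = (\<Union>x\<in>tc A n p. tc A n (smul c p))"
    by (rule SUP_cong[OF refl]) (metis mem_tc tc_eq_iff smul_diff tensor_rels_smul)
  also have "\<dots> = tc A n (smul c p)" using tc_self by fast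
  finally show ?thesis .
qed

lemma free_tensors_add: "p \<in> carrier (free_tensors A n) \<Longrightarrow> q \<in> carrier (free_tensors A n) \<Longrightarrow>
    p + q \<in> carrier (free_tensors A n)"
  using keys_add by (fastforce simp: carrier_free_tensors)

lemma free_tensors_0 [simp]: "0 \<in> carrier (free_tensors A n)"
  by (simp add: carrier_free_tensors)

lemma free_tensors_smul: "p \<in> carrier (free_tensors A n) \<Longrightarrow> smul c p \<in> carrier (free_tensors A n)"
  using keys_smul by (fastforce simp: carrier_free_tensors)

lemma free_tensors_uminus: "p \<in> carrier (free_tensors A n) \<Longrightarrow> - p \<in> carrier (free_tensors A n)"
  by (auto simp: carrier_free_tensors in_keys_iff subset_iff)

lemma free_tensors_single: "xs \<in> tuples A n \<Longrightarrow> Poly_Mapping.single xs c \<in> carrier (free_tensors A n)"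
  by (auto simp: carrier_free_tensors)

lemma free_tensors_sum: "(\<And>i. i \<in> I \<Longrightarrow> f i \<in> carrier (free_tensors A n)) \<Longrightarrow> sum f I \<in> carrier (free_tensors A n)"
  by (induction I rule: infinite_finite_induct) (auto intro: free_tensors_add)

lemma rot_simps [simp]: "carrier rot = UNIV" "x \<oplus>\<^bsub>rot\<^esub> y = x + y" "x \<otimes>\<^bsub>rot\<^esub> y = x * y"
   "\<one>\<^bsub>rot\<^esub> = 1" "\<zero>\<^bsub>rot\<^esub> = 0"
  by (simp_all add: ring_of_type_algebra_def)

lemma tensor_power_module: "Module.module (rot :: 'r ring) (tensor_power (A :: ('r::comm_ring_1, 'a, 'm) module_scheme) n)"
proof (rule moduleI)
  show "cring (rot :: 'r ring)" by (rule cring_from_type_algebra)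
  show "abelian_group (tensor_power A n)"
  proof (rule abelian_groupI)
    fix x assume "x \<in> carrier (tensor_power A n)"
    then obtain p where p: "p \<in> carrier (free_tensors A n)" "x = tc A n p" by (auto simp: carrier_tensor_power)
    show "\<exists>y\<in>carrier (tensor_power A n). y \<oplus>\<^bsub>tensor_power A n\<^esub> x = \<zero>\<^bsub>tensor_power A n\<^esub>"
      by (rule bexI[of _ "tc A n (- p)"])
        (use p in \<open>auto simp: carrier_tensor_power tp_add tp_zero free_tensors_uminus\<close>)
  qed (auto simp: carrier_tensor_power tp_add tp_zero free_tensors_add add_ac)
qed (auto simp: carrier_tensor_power tp_add tp_smult free_tensors_smul smul_add smul_add_left smul_smul)

lemma tp_finsum:
  assumes "finite I" "\<And>i. i \<in> I \<Longrightarrow> f i \<in> carrier (free_tensors A n)"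
  shows "finsum (tensor_power A n) (\<lambda>i. tc A n (f i)) I = tc A n (sum f I)"
proof -
  interpret M: Module.module rot "tensor_power A n" by (rule tensor_power_module)
  show ?thesis using assms
  proof (induction I rule: finite_induct)
    case empty then show ?case by (simp add: tp_zero)
  next
    case (insert i I)
    then have "(\<lambda>i. tc A n (f i)) \<in> I \<rightarrow> carrier (tensor_power A n)" "tc A n (f i) \<in> carrier (tensor_power A n)"
      by (auto simp: carrier_tensor_power)
    with insert show ?case by (simp add: M.finsum_insert tp_add)
  qed
qed

lemma finsum_plain:
  assumes "ring.zero M = (0::'b::ab_group_add)" "add M = (+)"
    and M: "abelian_monoid M" "finite I" "\<And>i. i \<in> I \<Longrightarrow> f i \<in> carrier M"
  shows "finsum M f I = sum f I"
  using assms(4,5)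
proof (induction I rule: finite_induct)
  case empty then show ?case using abelian_monoid.finsum_empty[OF M(1)] assms by simp
next
  case (insert i I)
  then have "f \<in> I \<rightarrow> carrier M" "f i \<in> carrier M" by auto
  with insert show ?case using abelian_monoid.finsum_insert[OF M(1), of I i f] assms by simp
qed

section \<open>Semilinear and multilinear maps out of a tensor power\<close>

definition rhom :: "('r::comm_ring_1 \<Rightarrow> 's::comm_ring_1) \<Rightarrow> bool" where
  "rhom \<sigma> \<longleftrightarrow> \<sigma> 0 = 0 \<and> \<sigma> 1 = 1 \<and> (\<forall>a b. \<sigma> (a + b) = \<sigma> a + \<sigma> b) \<and> (\<forall>a b. \<sigma> (a * b) = \<sigma> a * \<sigma> b)"

lemma rhomD:
  assumes "rhom \<sigma>"
  shows "\<sigma> 0 = 0" "\<sigma> 1 = 1" "\<sigma> (a + b) = \<sigma> a + \<sigma> b" "\<sigma> (a * b) = \<sigma> a * \<sigma> b"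
  using assms by (simp_all add: rhom_def)

lemma rhom_id: "rhom (\<lambda>c. c)" by (simp add: rhom_def)

lemma rhom_uminus: "rhom \<sigma> \<Longrightarrow> \<sigma> (- a) = - \<sigma> a"
  using rhomD(3)[of \<sigma> "- a" a] rhomD(1)[of \<sigma>] by (simp add: eq_neg_iff_add_eq_0)

lemma rhom_diff: "rhom \<sigma> \<Longrightarrow> \<sigma> (a - b) = \<sigma> a - \<sigma> b"
  using rhomD(3)[of \<sigma> a "- b"] rhom_uminus[of \<sigma> b] by simp

definition slin :: "('r \<Rightarrow> 's) \<Rightarrow> ('r, 'a, 'm) module_scheme \<Rightarrow> ('s, 'b, 'n) module_scheme \<Rightarrow> ('a \<Rightarrow> 'b) set" where
  "slin \<sigma> A B = {f \<in> carrier A \<rightarrow> carrier B.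
     (\<forall>x\<in>carrier A. \<forall>y\<in>carrier A. f (x \<oplus>\<^bsub>A\<^esub> y) = f x \<oplus>\<^bsub>B\<^esub> f y) \<and>
     (\<forall>c. \<forall>x\<in>carrier A. f (c \<odot>\<^bsub>A\<^esub> x) = \<sigma> c \<odot>\<^bsub>B\<^esub> f x)}"

lemma slinD:
  assumes "f \<in> slin \<sigma> A B" "x \<in> carrier A"
  shows "f x \<in> carrier B" "y \<in> carrier A \<Longrightarrow> f (x \<oplus>\<^bsub>A\<^esub> y) = f x \<oplus>\<^bsub>B\<^esub> f y" "f (c \<odot>\<^bsub>A\<^esub> x) = \<sigma> c \<odot>\<^bsub>B\<^esub> f x"
  using assms by (auto simp: slin_def)

definition multilin :: "('r \<Rightarrow> 's) \<Rightarrow> ('r, 'a, 'm) module_scheme \<Rightarrow> nat \<Rightarrow> ('s, 'b, 'n) module_scheme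
    \<Rightarrow> ('a list \<Rightarrow> 'b) \<Rightarrow> bool" where
  "multilin \<sigma> A n N F \<longleftrightarrow> F \<in> tuples A n \<rightarrow> carrier N \<and>
    (\<forall>us vs x y. us @ x # vs \<in> tuples A n \<longrightarrow> y \<in> carrier A \<longrightarrow>
        F (us @ (x \<oplus>\<^bsub>A\<^esub> y) # vs) = F (us @ x # vs) \<oplus>\<^bsub>N\<^esub> F (us @ y # vs)) \<and>
    (\<forall>us vs x c. us @ x # vs \<in> tuples A n \<longrightarrow>
        F (us @ (c \<odot>\<^bsub>A\<^esub> x) # vs) = \<sigma> c \<odot>\<^bsub>N\<^esub> F (us @ x # vs))"

lemma tensor_rels_carrier:
  assumes A: "Module.module rot A"
  shows "p \<in> tensor_rels A n \<Longrightarrow> p \<in> carrier (free_tensors A n)"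
proof (induction rule: tensor_rels.induct)
  interpret A: Module.module rot A by (rule A)
  case (additive us vs x y c)
  then show ?case
    by (intro free_tensors_add[of "_ - _" A n "- _", simplified] free_tensors_add[of "_" A n "- _", simplified]
        free_tensors_uminus free_tensors_single)
      (auto simp: tuples_def)
next
  interpret A: Module.module rot A by (rule A)
  case (scalar us vs x d c)
  then show ?case
    by (intro free_tensors_add[of "_" A n "- _", simplified] free_tensors_uminus free_tensors_single)
      (auto simp: tuples_def A.smult_closed)
qed (auto intro: free_tensors_add)

text \<open>\<open>tensor_lift\<close> evaluates at a representative picked by \<open>SOME\<close>.
  The extension \<open>L\<close> of \<open>F\<close> to the free module vanishes on the relations
  (\<open>L_rels\<close>), which makes the choice immaterial.\<close>

locale tensor_lifting =
  fixes \<sigma> :: "'r::comm_ring_1 \<Rightarrow> 's::comm_ring_1" and A :: "('r, 'a, 'm) module_scheme"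
    and N :: "('s, 'b, 'n) module_scheme" and n F
  assumes hom: "rhom \<sigma>" and A: "Module.module rot A" and N: "Module.module rot N"
    and F: "multilin \<sigma> A n N F"
begin

sublocale N: Module.module rot N by (rule N)
sublocale A: Module.module rot A by (rule A)

definition L where "L p = finsum N (\<lambda>xs. \<sigma> (Poly_Mapping.lookup p xs) \<odot>\<^bsub>N\<^esub> F xs) (Poly_Mapping.keys p)"

lemmas sm_add_left = N.smult_l_distr[simplified]
lemmas sm_assoc = N.smult_assoc1[simplified]
lemma F_closed: "xs \<in> tuples A n \<Longrightarrow> F xs \<in> carrier N"
  using F by (auto simp: multilin_def)

lemma sm_closed: "x \<in> carrier N \<Longrightarrow> c \<odot>\<^bsub>N\<^esub> x \<in> carrier N"
  by (simp add: N.smult_closed)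

lemma sm_zero: "x \<in> carrier N \<Longrightarrow> 0 \<odot>\<^bsub>N\<^esub> x = \<zero>\<^bsub>N\<^esub>"
  using N.smult_l_null[of x] by simp

lemma L_superset:
  assumes "finite K" "Poly_Mapping.keys p \<subseteq> K" "K \<subseteq> tuples A n"
  shows "L p = finsum N (\<lambda>xs. \<sigma> (Poly_Mapping.lookup p xs) \<odot>\<^bsub>N\<^esub> F xs) K"
  unfolding L_def using assms hom
  by (intro N.add.finprod_mono_neutral_cong_left) (auto simp: in_keys_iff rhomD sm_zero sm_closed F_closed subset_iff)

lemma L_closed: "p \<in> carrier (free_tensors A n) \<Longrightarrow> L p \<in> carrier N"
  unfolding L_def by (intro N.finsum_closed) (auto simp: carrier_free_tensors intro!: sm_closed F_closed)

lemma L_add: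
  assumes "p \<in> carrier (free_tensors A n)" "q \<in> carrier (free_tensors A n)"
  shows "L (p + q) = L p \<oplus>\<^bsub>N\<^esub> L q"
proof -
  let ?K = "Poly_Mapping.keys p \<union> Poly_Mapping.keys q"
  have K: "?K \<subseteq> tuples A n" using assms by (auto simp: carrier_free_tensors)
  have "L (p + q) = finsum N (\<lambda>xs. \<sigma> (Poly_Mapping.lookup p xs) \<odot>\<^bsub>N\<^esub> F xs \<oplus>\<^bsub>N\<^esub> \<sigma> (Poly_Mapping.lookup q xs) \<odot>\<^bsub>N\<^esub> F xs) ?K"
    unfolding L_superset[OF _ keys_add K, simplified] using K hom
    by (intro N.finsum_cong') (auto simp: lookup_add rhomD sm_add_left F_closed subset_iff intro!: sm_closed N.add.m_closed)
  also have "\<dots> = L p \<oplus>\<^bsub>N\<^esub> L q" using K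
    by (subst N.finsum_addf)
      (auto simp: L_superset[of ?K, OF _ _ K] subset_iff intro!: sm_closed F_closed)
  finally show ?thesis .
qed

lemma L_single: "xs \<in> tuples A n \<Longrightarrow> L (Poly_Mapping.single xs c) = \<sigma> c \<odot>\<^bsub>N\<^esub> F xs"
  using L_superset[of "{xs}" "Poly_Mapping.single xs c"]
  by (simp add: N.finsum_insert[of "{}", simplified] sm_closed F_closed)

lemma L_0: "L 0 = \<zero>\<^bsub>N\<^esub>" by (simp add: L_def)

lemma L_uminus: "p \<in> carrier (free_tensors A n) \<Longrightarrow> L (- p) = \<ominus>\<^bsub>N\<^esub> L p"
  using L_add[of "- p" p] L_0 N.minus_equality[of "L (- p)" "L p"] by (simp add: L_closed free_tensors_uminus)

lemma L_diff: "p \<in> carrier (free_tensors A n) \<Longrightarrow> q \<in> carrier (free_tensors A n) \<Longrightarrow> L (p - q) = L p \<ominus>\<^bsub>N\<^esub> L q"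
  using L_add[of p "- q"] by (simp add: L_uminus free_tensors_uminus a_minus_def)

lemma L_rels: "p \<in> tensor_rels A n \<Longrightarrow> L p = \<zero>\<^bsub>N\<^esub>"
proof (induction rule: tensor_rels.induct)
  case (additive us vs x y c)
  then have t: "us @ x # vs \<in> tuples A n" "us @ y # vs \<in> tuples A n" "us @ (x \<oplus>\<^bsub>A\<^esub> y) # vs \<in> tuples A n"
    by (auto simp: tuples_def)
  have "L (Poly_Mapping.single (us @ (x \<oplus>\<^bsub>A\<^esub> y) # vs) c - Poly_Mapping.single (us @ x # vs) c - Poly_Mapping.single (us @ y # vs) c)
     = (\<sigma> c \<odot>\<^bsub>N\<^esub> F (us @ (x \<oplus>\<^bsub>A\<^esub> y) # vs) \<ominus>\<^bsub>N\<^esub> \<sigma> c \<odot>\<^bsub>N\<^esub> F (us @ x # vs)) \<ominus>\<^bsub>N\<^esub> \<sigma> c \<odot>\<^bsub>N\<^esub> F (us @ y # vs)"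
    using t free_tensors_add[of "Poly_Mapping.single (us @ (x \<oplus>\<^bsub>A\<^esub> y) # vs) c" A n "- Poly_Mapping.single (us @ x # vs) c"]
    by (simp add: L_diff L_single free_tensors_single free_tensors_uminus)
  also have "F (us @ (x \<oplus>\<^bsub>A\<^esub> y) # vs) = F (us @ x # vs) \<oplus>\<^bsub>N\<^esub> F (us @ y # vs)"
    using F t additive unfolding multilin_def by blast
  also have "(\<sigma> c \<odot>\<^bsub>N\<^esub> (F (us @ x # vs) \<oplus>\<^bsub>N\<^esub> F (us @ y # vs)) \<ominus>\<^bsub>N\<^esub> \<sigma> c \<odot>\<^bsub>N\<^esub> F (us @ x # vs)) \<ominus>\<^bsub>N\<^esub> \<sigma> c \<odot>\<^bsub>N\<^esub> F (us @ y # vs) = \<zero>\<^bsub>N\<^esub>"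
  proof -
    have *: "((u \<oplus>\<^bsub>N\<^esub> v) \<ominus>\<^bsub>N\<^esub> u) \<ominus>\<^bsub>N\<^esub> v = \<zero>\<^bsub>N\<^esub>" if "u \<in> carrier N" "v \<in> carrier N" for u v
    proof -
      have "(u \<oplus>\<^bsub>N\<^esub> v) \<ominus>\<^bsub>N\<^esub> u = (v \<oplus>\<^bsub>N\<^esub> u) \<ominus>\<^bsub>N\<^esub> u" using that by (simp add: N.a_comm)
      also have "\<dots> = v" using that by (simp add: a_minus_def N.a_assoc N.r_neg)
      finally show ?thesis using that by (simp add: a_minus_def N.r_neg)
    qed
    show ?thesis using F_closed[OF t(1)] F_closed[OF t(2)] by (simp add: N.smult_r_distr * sm_closed)
  qed
  finally show ?case .
next
  case (scalar us vs x d c)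
  then have t: "us @ x # vs \<in> tuples A n" "us @ (d \<odot>\<^bsub>A\<^esub> x) # vs \<in> tuples A n"
    by (auto simp: tuples_def A.smult_closed)
  have "L (Poly_Mapping.single (us @ (d \<odot>\<^bsub>A\<^esub> x) # vs) c - Poly_Mapping.single (us @ x # vs) (c * d))
     = \<sigma> c \<odot>\<^bsub>N\<^esub> F (us @ (d \<odot>\<^bsub>A\<^esub> x) # vs) \<ominus>\<^bsub>N\<^esub> \<sigma> (c * d) \<odot>\<^bsub>N\<^esub> F (us @ x # vs)"
    using t by (simp add: L_diff L_single free_tensors_single)
  also have "F (us @ (d \<odot>\<^bsub>A\<^esub> x) # vs) = \<sigma> d \<odot>\<^bsub>N\<^esub> F (us @ x # vs)"
    using F t unfolding multilin_def by blast
  also have "\<sigma> c \<odot>\<^bsub>N\<^esub> (\<sigma> d \<odot>\<^bsub>N\<^esub> F (us @ x # vs)) = \<sigma> (c * d) \<odot>\<^bsub>N\<^esub> F (us @ x # vs)"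
    using F_closed[OF t(1)] hom by (simp add: rhomD sm_assoc)
  finally show ?case using sm_closed[OF F_closed[OF t(1)], of "\<sigma> (c * d)"] by (simp add: a_minus_def N.r_neg)
next
  case zero then show ?case by (rule L_0)
next
  case (sum p q) then show ?case using tensor_rels_carrier[OF A] by (simp add: L_add)
qed

lemma tensor_lift_L:
  assumes "p \<in> carrier (free_tensors A n)"
  shows "tensor_lift \<sigma> N F (tc A n p) = L p"
proof -
  define q where "q = (SOME q. q \<in> tc A n p)"
  have "q \<in> tc A n p" unfolding q_def by (rule someI[of _ p]) (rule tc_self)
  then obtain r where r: "r \<in> tensor_rels A n" "q = r + p" by (auto simp: tc_def')
  have "tensor_lift \<sigma> N F (tc A n p) = L q" by (simp add: tensor_lift_def q_def L_def Let_def)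
  also have "\<dots> = L p" using r assms tensor_rels_carrier[OF A] by (simp add: L_add L_rels L_closed)
  finally show ?thesis .
qed

end

text \<open>If the target is a tensor power too, the induced map can be computed on representatives
  \<open>F' xs\<close>, and the class is taken only once at the end.\<close>

lemma tensor_lift_to_power:
  assumes "rhom \<sigma>" "Module.module rot A" "multilin \<sigma> A n (tensor_power B m) F"
    and "\<And>xs. xs \<in> tuples A n \<Longrightarrow> F xs = tc B m (F' xs)" "\<And>xs. xs \<in> tuples A n \<Longrightarrow> F' xs \<in> carrier (free_tensors B m)"
    and p: "p \<in> carrier (free_tensors A n)"
  shows "tensor_lift \<sigma> (tensor_power B m) F (tc A n p) = tc B m (plin (\<lambda>xs c. smul (\<sigma> c) (F' xs)) p)"
proof -
  interpret tensor_lifting \<sigma> A "tensor_power B m" n F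
    by (rule tensor_lifting.intro) (use assms in \<open>auto intro: tensor_power_module\<close>)
  have "L p = finsum (tensor_power B m) (\<lambda>xs. tc B m (smul (\<sigma> (Poly_Mapping.lookup p xs)) (F' xs))) (Poly_Mapping.keys p)"
    unfolding L_def using p assms(4,5)
    by (intro N.finsum_cong') (auto simp: carrier_free_tensors tp_smult carrier_tensor_power subset_iff intro!: imageI free_tensors_smul[unfolded carrier_free_tensors, simplified])
  also have "\<dots> = tc B m (plin (\<lambda>xs c. smul (\<sigma> c) (F' xs)) p)"
    unfolding plin_def using p assms(5)
    by (intro tp_finsum) (auto simp: carrier_free_tensors[of A] intro!: free_tensors_smul)
  finally show ?thesis using tensor_lift_L[OF p] by simp
qed

lemma tensor_lift_plain:
  fixes N :: "('s::comm_ring_1, 'b::ab_group_add, 'n) module_scheme"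
  assumes "rhom \<sigma>" "Module.module rot A" "Module.module rot N" "multilin \<sigma> A n N F"
    and plain: "ring.zero N = 0" "add N = (+)"
    and p: "p \<in> carrier (free_tensors A n)"
  shows "tensor_lift \<sigma> N F (tc A n p) = plin (\<lambda>xs c. \<sigma> c \<odot>\<^bsub>N\<^esub> F xs) p"
proof -
  interpret tensor_lifting \<sigma> A N n F by (rule tensor_lifting.intro) (use assms in auto)
  have "L p = plin (\<lambda>xs c. \<sigma> c \<odot>\<^bsub>N\<^esub> F xs) p"
    unfolding L_def plin_def using p plain
    by (intro finsum_plain) (auto simp: carrier_free_tensors subset_iff intro!: sm_closed F_closed N.abelian_monoid_axioms)
  then show ?thesis using tensor_lift_L[OF p] by simp
qed

lemma multilin_pure:
  assumes f: "f \<in> slin \<sigma> A B"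
  shows "multilin \<sigma> A n (tensor_power B n) (\<lambda>xs. pure_tensor B (map f xs))"
  unfolding multilin_def
proof (intro conjI allI impI Pi_I)
  fix xs assume "xs \<in> tuples A n"
  then have "map f xs \<in> tuples B n" using slinD(1)[OF f] by (auto simp: tuples_def)
  then show "pure_tensor B (map f xs) \<in> carrier (tensor_power B n)"
    by (auto simp: pure_tensor_def carrier_tensor_power tuples_def intro!: imageI free_tensors_single)
next
  fix us vs x y assume *: "us @ x # vs \<in> tuples A n" "y \<in> carrier A"
  then have us: "set (map f us) \<subseteq> carrier B" and vs: "set (map f vs) \<subseteq> carrier B"
    using slinD(1)[OF f] by (auto simp: tuples_def)
  show "pure_tensor B (map f (us @ (x \<oplus>\<^bsub>A\<^esub> y) # vs)) = pure_tensor B (map f (us @ x # vs)) \<oplus>\<^bsub>tensor_power B n\<^esub> pure_tensor B (map f (us @ y # vs))"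
    using * f tensor_rels.additive[of "map f us" "map f vs" n B "f x" "f y" 1, OF _ us vs]
    by (auto simp: pure_tensor_def tuples_def tp_add tc_eq_iff slinD diff_diff_eq)
next
  fix us vs x c assume *: "us @ x # vs \<in> tuples A n"
  then have us: "set (map f us) \<subseteq> carrier B" and vs: "set (map f vs) \<subseteq> carrier B"
    using slinD(1)[OF f] by (auto simp: tuples_def)
  show "pure_tensor B (map f (us @ (c \<odot>\<^bsub>A\<^esub> x) # vs)) = \<sigma> c \<odot>\<^bsub>tensor_power B n\<^esub> pure_tensor B (map f (us @ x # vs))"
    using * f tensor_rels.scalar[of "map f us" "map f vs" n B "f x" "\<sigma> c" 1, OF _ us vs]
    by (auto simp: pure_tensor_def tuples_def tp_smult tc_eq_iff slinD)
qed

lemma tensor_map_tc: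
  assumes "rhom \<sigma>" "Module.module rot A" "f \<in> slin \<sigma> A B" "p \<in> carrier (free_tensors A n)"
  shows "tensor_map \<sigma> B n f (tc A n p) = tc B n (plin (\<lambda>xs c. Poly_Mapping.single (map f xs) (\<sigma> c)) p)"
proof -
  have "map f xs \<in> tuples B n" if "xs \<in> tuples A n" for xs
    using that slinD(1)[OF assms(3)] by (auto simp: tuples_def)
  then show ?thesis
    unfolding tensor_map_def
    using tensor_lift_to_power[OF assms(1,2) multilin_pure[OF assms(3)] _ _ assms(4), of "\<lambda>xs. Poly_Mapping.single (map f xs) 1"]
    by (auto simp: pure_tensor_def tuples_def free_tensors_single)
qed

lemma additive2_single: "additive2 (\<lambda>x c::'r::ab_group_add. Poly_Mapping.single (h x) c)"
  by (rule additive2I) (simp_all add: single_add)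

lemma additive2_smul: "rhom \<sigma> \<Longrightarrow> additive2 (\<lambda>x c. smul (\<sigma> c) (h x))"
  by (rule additive2I) (simp_all add: rhomD smul_add_left)

section \<open>Filling slots of a tensor, and the coproduct applied in one slot\<close>

definition ins :: "'a list \<Rightarrow> 'a list \<Rightarrow> ('a list \<Rightarrow>\<^sub>0 'r) \<Rightarrow> ('a list \<Rightarrow>\<^sub>0 'r::comm_ring_1)" where
  "ins us vs q = plin (\<lambda>xs c. Poly_Mapping.single (us @ xs @ vs) c) q"

lemma ins_simps [simp]: "ins us vs 0 = 0" "ins us vs (p + q) = ins us vs p + ins us vs q"
  "ins us vs (p - q) = ins us vs p - ins us vs q" "ins us vs (Poly_Mapping.single xs c) = Poly_Mapping.single (us @ xs @ vs) c"
  by (simp_all add: ins_def plin_add plin_diff additive2_single plin_single)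

lemma ins_smul: "ins us vs (smul c q) = smul c (ins us vs q)"
  by (induction q rule: pm_induct) (simp_all add: smul_add)

lemma ins_rels:
  assumes "set us \<subseteq> carrier A" "set vs \<subseteq> carrier A" "m = length us + n + length vs"
  shows "q \<in> tensor_rels A n \<Longrightarrow> ins us vs q \<in> tensor_rels A m"
proof (induction rule: tensor_rels.induct)
  case (additive us' vs' x y c)
  then show ?case
    using assms tensor_rels.additive[of "us @ us'" "vs' @ vs" m A x y c] by simp
next
  case (scalar us' vs' x d c)
  then show ?case
    using assms tensor_rels.scalar[of "us @ us'" "vs' @ vs" m A x d c] by simp
qed (auto intro: tensor_rels.intros)

lemma ins_free:
  assumes "set us \<subseteq> carrier A" "set vs \<subseteq> carrier A" "m = length us + n + length vs"
    "q \<in> carrier (free_tensors A n)"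
  shows "ins us vs q \<in> carrier (free_tensors A m)"
  using assms(4) keys_plin[of "\<lambda>xs c. Poly_Mapping.single (us @ xs @ vs) c" q] assms(1-3)
  unfolding carrier_free_tensors ins_def by (fastforce simp: tuples_def split: if_splits)

text \<open>In \<open>multilin_Fr\<close> the slot in which linearity is tested may lie to the left
  of the comultiplied slot (the first two claims) or to its right (the last two). In both situations
  the inserted tensor \<open>q\<close> stays fixed.\<close>

lemma ins_slot_rels:
  assumes q: "q \<in> carrier (free_tensors A n)" and t: "set us \<subseteq> carrier A" "set ws \<subseteq> carrier A" "set vs \<subseteq> carrier A"
    "x \<in> carrier A"
  shows "y \<in> carrier A \<Longrightarrow> m = length us + 1 + length ws + n + length vs \<Longrightarrow>
      ins (us @ (x \<oplus>\<^bsub>A\<^esub> y) # ws) vs q - ins (us @ x # ws) vs q - ins (us @ y # ws) vs q \<in> tensor_rels A m"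
    and "m = length us + 1 + length ws + n + length vs \<Longrightarrow>
      ins (us @ (d \<odot>\<^bsub>A\<^esub> x) # ws) vs q - smul d (ins (us @ x # ws) vs q) \<in> tensor_rels A m"
    and "y \<in> carrier A \<Longrightarrow> m = length us + n + length ws + 1 + length vs \<Longrightarrow>
      ins us (ws @ (x \<oplus>\<^bsub>A\<^esub> y) # vs) q - ins us (ws @ x # vs) q - ins us (ws @ y # vs) q \<in> tensor_rels A m"
    and "m = length us + n + length ws + 1 + length vs \<Longrightarrow>
      ins us (ws @ (d \<odot>\<^bsub>A\<^esub> x) # vs) q - smul d (ins us (ws @ x # vs) q) \<in> tensor_rels A m"
proof -
  have q': "Poly_Mapping.keys q \<subseteq> tuples A n" using q by (simp add: carrier_free_tensors)
  show "ins (us @ (x \<oplus>\<^bsub>A\<^esub> y) # ws) vs q - ins (us @ x # ws) vs q - ins (us @ y # ws) vs q \<in> tensor_rels A m"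
    if "y \<in> carrier A" "m = length us + 1 + length ws + n + length vs"
    using q'
  proof (induction q rule: pm_induct_keys)
    case (add xs c p)
    from add(1) have "Poly_Mapping.single (us @ (x \<oplus>\<^bsub>A\<^esub> y) # ws @ xs @ vs) c - Poly_Mapping.single (us @ x # ws @ xs @ vs) c -
        Poly_Mapping.single (us @ y # ws @ xs @ vs) c \<in> tensor_rels A m"
      using that t by (intro tensor_rels.additive) (auto simp: tuples_def)
    from tensor_rels.sum[OF this add(3)] show ?case by (simp add: algebra_simps)
  qed (simp add: tensor_rels.zero)
  show "ins us (ws @ (x \<oplus>\<^bsub>A\<^esub> y) # vs) q - ins us (ws @ x # vs) q - ins us (ws @ y # vs) q \<in> tensor_rels A m"
    if "y \<in> carrier A" "m = length us + n + length ws + 1 + length vs"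
    using q'
  proof (induction q rule: pm_induct_keys)
    case (add xs c p)
    from add(1) have "Poly_Mapping.single ((us @ xs @ ws) @ (x \<oplus>\<^bsub>A\<^esub> y) # vs) c - Poly_Mapping.single ((us @ xs @ ws) @ x # vs) c -
        Poly_Mapping.single ((us @ xs @ ws) @ y # vs) c \<in> tensor_rels A m"
      using that t by (intro tensor_rels.additive) (auto simp: tuples_def)
    from tensor_rels.sum[OF this add(3)] show ?case by (simp add: algebra_simps)
  qed (simp add: tensor_rels.zero)
  show "ins (us @ (d \<odot>\<^bsub>A\<^esub> x) # ws) vs q - smul d (ins (us @ x # ws) vs q) \<in> tensor_rels A m"
    if "m = length us + 1 + length ws + n + length vs"
    using q'
  proof (induction q rule: pm_induct_keys)
    case (add xs c p)
    from add(1) have "Poly_Mapping.single (us @ (d \<odot>\<^bsub>A\<^esub> x) # ws @ xs @ vs) c - Poly_Mapping.single (us @ x # ws @ xs @ vs) (c * d) \<in> tensor_rels A m"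
      using that t by (intro tensor_rels.scalar) (auto simp: tuples_def)
    from tensor_rels.sum[OF this add(3)] show ?case by (simp add: algebra_simps smul_add)
  qed (simp add: tensor_rels.zero)
  show "ins us (ws @ (d \<odot>\<^bsub>A\<^esub> x) # vs) q - smul d (ins us (ws @ x # vs) q) \<in> tensor_rels A m"
    if "m = length us + n + length ws + 1 + length vs"
    using q'
  proof (induction q rule: pm_induct_keys)
    case (add xs c p)
    from add(1) have "Poly_Mapping.single ((us @ xs @ ws) @ (d \<odot>\<^bsub>A\<^esub> x) # vs) c - Poly_Mapping.single ((us @ xs @ ws) @ x # vs) (c * d) \<in> tensor_rels A m"
      using that t by (intro tensor_rels.scalar) (auto simp: tuples_def)
    from tensor_rels.sum[OF this add(3)] show ?case by (simp add: algebra_simps smul_add)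
  qed (simp add: tensor_rels.zero)
qed

lemma pure_in_power: "xs \<in> tuples A n \<Longrightarrow> pure_tensor A xs \<in> carrier (tensor_power A n)"
  by (auto simp: pure_tensor_def carrier_tensor_power tuples_def intro!: imageI free_tensors_single)

lemma multilin_ins_pure:
  assumes t: "set us \<subseteq> carrier A" "set vs \<subseteq> carrier A" "m = length us + n + length vs"
  shows "multilin (\<lambda>c. c) A n (tensor_power A m) (\<lambda>uv. pure_tensor A (us @ uv @ vs))"
  unfolding multilin_def
proof (intro conjI allI impI Pi_I)
  fix xs assume "xs \<in> tuples A n"
  then show "pure_tensor A (us @ xs @ vs) \<in> carrier (tensor_power A m)"
    using t by (intro pure_in_power) (auto simp: tuples_def)
next
  fix us' vs' x y assume *: "us' @ x # vs' \<in> tuples A n" "y \<in> carrier A"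
  then have n: "n = Suc (length us' + length vs')" by (auto simp: tuples_def)
  show "pure_tensor A (us @ (us' @ (x \<oplus>\<^bsub>A\<^esub> y) # vs') @ vs) = pure_tensor A (us @ (us' @ x # vs') @ vs) \<oplus>\<^bsub>tensor_power A m\<^esub> pure_tensor A (us @ (us' @ y # vs') @ vs)"
    using t * tensor_rels.additive[of "us @ us'" "vs' @ vs" m A x y 1]
    unfolding t(3) n by (simp add: pure_tensor_def tuples_def tp_add tc_eq_iff diff_diff_eq add.assoc)
next
  fix us' vs' x c assume *: "us' @ x # vs' \<in> tuples A n"
  then have n: "n = Suc (length us' + length vs')" by (auto simp: tuples_def)
  show "pure_tensor A (us @ (us' @ (c \<odot>\<^bsub>A\<^esub> x) # vs') @ vs) = c \<odot>\<^bsub>tensor_power A m\<^esub> pure_tensor A (us @ (us' @ x # vs') @ vs)"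
    using t * tensor_rels.scalar[of "us @ us'" "vs' @ vs" m A x c 1]
    unfolding t(3) n by (simp add: pure_tensor_def tuples_def tp_smult tc_eq_iff add.assoc)
qed

lemma tensor_lift_ins:
  assumes A: "Module.module rot A" and t: "set us \<subseteq> carrier A" "set vs \<subseteq> carrier A" "m = length us + n + length vs"
    and q: "q \<in> carrier (free_tensors A n)"
  shows "tensor_lift (\<lambda>c. c) (tensor_power A m) (\<lambda>uv. pure_tensor A (us @ uv @ vs)) (tc A n q) = tc A m (ins us vs q)"
  unfolding ins_def
  using t q by (subst tensor_lift_to_power[OF rhom_id A multilin_ins_pure[OF t], where F'="\<lambda>uv. Poly_Mapping.single (us @ uv @ vs) 1"])
    (auto simp: pure_tensor_def tuples_def add.assoc intro!: free_tensors_single)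

lemma multilin_cong:
  assumes A: "Module.module rot A" and F: "multilin \<sigma> A n N F"
    and FG: "\<And>xs. xs \<in> tuples A n \<Longrightarrow> F xs = G xs"
  shows "multilin \<sigma> A n N G"
proof -
  interpret A: Module.module rot A by (rule A)
  have *: "us @ y # vs \<in> tuples A n" if "us @ x # vs \<in> tuples A n" "y \<in> carrier A" for us vs x y
    using that by (auto simp: tuples_def)
  show ?thesis
    unfolding multilin_def
  proof (intro conjI allI impI Pi_I)
    fix xs assume "xs \<in> tuples A n"
    then show "G xs \<in> carrier N" using F FG[symmetric, of xs] by (auto simp: multilin_def)
  next
    fix us vs x y assume t: "us @ x # vs \<in> tuples A n" and y: "y \<in> carrier A"
    then have x: "x \<in> carrier A" by (auto simp: tuples_def)
    have "F (us @ (x \<oplus>\<^bsub>A\<^esub> y) # vs) = F (us @ x # vs) \<oplus>\<^bsub>N\<^esub> F (us @ y # vs)"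
      using F t y unfolding multilin_def by blast
    then show "G (us @ (x \<oplus>\<^bsub>A\<^esub> y) # vs) = G (us @ x # vs) \<oplus>\<^bsub>N\<^esub> G (us @ y # vs)"
      using FG[OF t] FG[OF *[OF t y]] FG[OF *[OF t A.a_closed[OF x y]]] by simp
  next
    fix us vs x c assume t: "us @ x # vs \<in> tuples A n"
    then have x: "x \<in> carrier A" by (auto simp: tuples_def)
    have "F (us @ (c \<odot>\<^bsub>A\<^esub> x) # vs) = \<sigma> c \<odot>\<^bsub>N\<^esub> F (us @ x # vs)"
      using F t unfolding multilin_def by blast
    then show "G (us @ (c \<odot>\<^bsub>A\<^esub> x) # vs) = \<sigma> c \<odot>\<^bsub>N\<^esub> G (us @ x # vs)"
      using FG[OF t] FG[OF *[OF t]] A.smult_closed[OF _ x] by simp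
  qed
qed

text \<open>\<open>cop\<close> selects representatives of the coproduct, so that
  \<open>comult_at\<close> becomes the explicit formula of \<open>comult_at_tc\<close>. Such a
  selection is additive and homogeneous only modulo \<open>tensor_rels\<close>;
  \<open>multilin_Fr\<close> absorbs the error.\<close>

locale comodule_data =
  fixes A :: "('r::comm_ring_1, 'a, 'm) hopf_scheme" and cop :: "'a \<Rightarrow> ('a list \<Rightarrow>\<^sub>0 'r)"
  assumes A: "Module.module rot A"
    and comult_slin: "comult A \<in> slin (\<lambda>c. c) A (tensor_power A 2)"
    and cop: "\<And>x. x \<in> carrier A \<Longrightarrow> comult A x = tc A 2 (cop x)"
    and cop_free: "\<And>x. x \<in> carrier A \<Longrightarrow> cop x \<in> carrier (free_tensors A 2)"
begin

definition Fr where "Fr i xs = ins (take i xs) (drop (Suc i) xs) (cop (xs ! i))"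

sublocale Module.module rot A by (rule A)

lemma Fr_free:
  assumes "xs \<in> tuples A n" "i < n" shows "Fr i xs \<in> carrier (free_tensors A (Suc n))"
proof -
  have "xs ! i \<in> carrier A" "set (take i xs) \<subseteq> carrier A" "set (drop (Suc i) xs) \<subseteq> carrier A"
    using assms by (auto simp: tuples_def dest: in_set_takeD in_set_dropD)
  then show ?thesis unfolding Fr_def
    by (intro ins_free[OF _ _ _ cop_free]) (use assms in \<open>auto simp: tuples_def\<close>)
qed

lemma inner_lift:
  assumes "xs \<in> tuples A n" "i < n"
  shows "tensor_lift (\<lambda>c. c) (tensor_power A (Suc n))
        (\<lambda>uv. pure_tensor A (take i xs @ uv @ drop (Suc i) xs)) (comult A (xs ! i)) = tc A (Suc n) (Fr i xs)"
proof -
  have *: "xs ! i \<in> carrier A" "set (take i xs) \<subseteq> carrier A" "set (drop (Suc i) xs) \<subseteq> carrier A"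
    using assms by (auto simp: tuples_def dest: in_set_takeD in_set_dropD)
  then show ?thesis unfolding cop[OF *(1)] Fr_def
    by (intro tensor_lift_ins A cop_free) (use assms in \<open>auto simp: tuples_def\<close>)
qed

lemma cop_add_rels:
  assumes "x \<in> carrier A" "y \<in> carrier A"
  shows "cop (x \<oplus>\<^bsub>A\<^esub> y) - cop x - cop y \<in> tensor_rels A 2"
proof -
  have "tc A 2 (cop (x \<oplus>\<^bsub>A\<^esub> y)) = tc A 2 (cop x + cop y)"
    using slinD(2)[OF comult_slin assms(1,2)] assms by (simp add: cop tp_add)
  then show ?thesis by (simp add: tc_eq_iff diff_diff_eq)
qed

lemma cop_smul_rels:
  assumes "x \<in> carrier A"
  shows "cop (c \<odot>\<^bsub>A\<^esub> x) - smul c (cop x) \<in> tensor_rels A 2"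
proof -
  have "tc A 2 (cop (c \<odot>\<^bsub>A\<^esub> x)) = tc A 2 (smul c (cop x))"
    using slinD(3)[OF comult_slin assms(1)] assms smult_closed[of c x] by (simp add: cop tp_smult)
  then show ?thesis by (simp add: tc_eq_iff)
qed

lemma multilin_Fr:
  assumes "i < n"
  shows "multilin (\<lambda>c. c) A n (tensor_power A (Suc n)) (\<lambda>xs. tc A (Suc n) (Fr i xs))"
  unfolding multilin_def
proof (intro conjI allI impI Pi_I)
  fix xs assume "xs \<in> tuples A n"
  then show "tc A (Suc n) (Fr i xs) \<in> carrier (tensor_power A (Suc n))"
    using Fr_free assms by (auto simp: carrier_tensor_power)
next
  fix us vs x y assume t: "us @ x # vs \<in> tuples A n" and y: "y \<in> carrier A"
  have "Fr i (us @ (x \<oplus>\<^bsub>A\<^esub> y) # vs) - Fr i (us @ x # vs) - Fr i (us @ y # vs) \<in> tensor_rels A (Suc n)"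
  proof (cases i "length us" rule: linorder_cases)
    case equal
    have "ins us vs (cop (x \<oplus>\<^bsub>A\<^esub> y) - cop x - cop y) \<in> tensor_rels A (Suc n)"
      using t y by (intro ins_rels[OF _ _ _ cop_add_rels]) (auto simp: tuples_def)
    then show ?thesis using equal by (simp add: Fr_def)
  next
    case less
    then obtain us1 z us2 where us: "us = us1 @ z # us2" "length us1 = i" using id_take_nth_drop by fastforce
    show ?thesis using ins_slot_rels(3)[of "cop z" A 2 us1 us2 vs x y "Suc n"] t y us
      by (auto simp: Fr_def tuples_def cop_free nth_append add.assoc)
  next
    case greater
    with t assms obtain j where i: "i = length us + Suc j" "j < length vs"
      by (auto simp: tuples_def dest!: less_imp_Suc_add)
    then obtain vs1 z vs2 where vs: "vs = vs1 @ z # vs2" "length vs1 = j" using id_take_nth_drop by fastforce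
    show ?thesis using ins_slot_rels(1)[of "cop z" A 2 us vs1 vs2 x y "Suc n"] t y vs i
      by (auto simp: Fr_def tuples_def cop_free nth_append add.assoc)
  qed
  then show "tc A (Suc n) (Fr i (us @ (x \<oplus>\<^bsub>A\<^esub> y) # vs)) =
     tc A (Suc n) (Fr i (us @ x # vs)) \<oplus>\<^bsub>tensor_power A (Suc n)\<^esub> tc A (Suc n) (Fr i (us @ y # vs))"
    by (simp add: tp_add tc_eq_iff diff_diff_eq)
next
  fix us vs x c assume t: "us @ x # vs \<in> tuples A n"
  have "Fr i (us @ (c \<odot>\<^bsub>A\<^esub> x) # vs) - smul c (Fr i (us @ x # vs)) \<in> tensor_rels A (Suc n)"
  proof (cases i "length us" rule: linorder_cases)
    case equal
    have "ins us vs (cop (c \<odot>\<^bsub>A\<^esub> x) - smul c (cop x)) \<in> tensor_rels A (Suc n)"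
      using t by (intro ins_rels[OF _ _ _ cop_smul_rels]) (auto simp: tuples_def)
    then show ?thesis using equal by (simp add: Fr_def ins_smul)
  next
    case less
    then obtain us1 z us2 where us: "us = us1 @ z # us2" "length us1 = i" using id_take_nth_drop by fastforce
    show ?thesis using ins_slot_rels(4)[of "cop z" A 2 us1 us2 vs x "Suc n"] t us
      by (auto simp: Fr_def tuples_def cop_free nth_append add.assoc)
  next
    case greater
    with t assms obtain j where i: "i = length us + Suc j" "j < length vs"
      by (auto simp: tuples_def dest!: less_imp_Suc_add)
    then obtain vs1 z vs2 where vs: "vs = vs1 @ z # vs2" "length vs1 = j" using id_take_nth_drop by fastforce
    show ?thesis using ins_slot_rels(2)[of "cop z" A 2 us vs1 vs2 x "Suc n"] t vs i
      by (auto simp: Fr_def tuples_def cop_free nth_append add.assoc)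
  qed
  then show "tc A (Suc n) (Fr i (us @ (c \<odot>\<^bsub>A\<^esub> x) # vs)) =
     c \<odot>\<^bsub>tensor_power A (Suc n)\<^esub> tc A (Suc n) (Fr i (us @ x # vs))"
    by (simp add: tp_smult tc_eq_iff)
qed

lemma comult_at_tc:
  assumes i: "i < n" and p: "p \<in> carrier (free_tensors A n)"
  shows "comult_at A n i (tc A n p) = tc A (Suc n) (plin (\<lambda>xs c. smul c (Fr i xs)) p)"
proof -
  let ?G = "\<lambda>xs. tensor_lift (\<lambda>c. c) (tensor_power A (Suc n))
        (\<lambda>uv. pure_tensor A (take i xs @ uv @ drop (Suc i) xs)) (comult A (xs ! i))"
  have m: "multilin (\<lambda>c. c) A n (tensor_power A (Suc n)) ?G"
    by (rule multilin_cong[OF A multilin_Fr[OF i] inner_lift[OF _ i, symmetric]])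
  show ?thesis unfolding comult_at_def
    by (rule tensor_lift_to_power[OF rhom_id A m inner_lift[OF _ i] Fr_free[OF _ i] p])
qed

end

section \<open>Pairings and separation\<close>

text \<open>The value of a tensor product of functionals on an elementary tensor. The value 0 for
  different lengths makes \<open>lookup_expn\<close> true for index lists of any length.\<close>

fun pprod :: "('a \<Rightarrow> 's::comm_ring_1) list \<Rightarrow> 'a list \<Rightarrow> 's" where
  "pprod [] [] = 1"
| "pprod (f # fs) (x # xs) = f x * pprod fs xs"
| "pprod _ _ = 0"

definition pairing :: "('r::comm_ring_1 \<Rightarrow> 's::comm_ring_1) \<Rightarrow> ('a \<Rightarrow> 's) list \<Rightarrow> ('a list \<Rightarrow>\<^sub>0 'r) \<Rightarrow> 's" where
  "pairing \<sigma> fs p = plin (\<lambda>xs c. \<sigma> c * pprod fs xs) p"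

lemma pprod_length: "length fs \<noteq> length xs \<Longrightarrow> pprod fs xs = 0"
  by (induction fs xs rule: pprod.induct) auto

lemma pprod_append: "length us = length fs \<Longrightarrow> pprod (fs @ gs) (us @ vs) = pprod fs us * pprod gs vs"
  by (induction fs us rule: pprod.induct) (auto simp: mult.assoc)

lemma pairing_additive2: "rhom \<sigma> \<Longrightarrow> additive2 (\<lambda>xs c. \<sigma> c * pprod fs xs)"
  by (rule additive2I) (simp_all add: rhomD algebra_simps)

lemma pairing_simps:
  assumes "rhom \<sigma>"
  shows "pairing \<sigma> fs 0 = 0" "pairing \<sigma> fs (p + q) = pairing \<sigma> fs p + pairing \<sigma> fs q"
    "pairing \<sigma> fs (p - q) = pairing \<sigma> fs p - pairing \<sigma> fs q"
    "pairing \<sigma> fs (Poly_Mapping.single xs c) = \<sigma> c * pprod fs xs"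
  by (simp_all add: pairing_def plin_add plin_diff plin_single pairing_additive2 assms)

lemma pairing_smul: "rhom \<sigma> \<Longrightarrow> pairing \<sigma> fs (smul c p) = \<sigma> c * pairing \<sigma> fs p"
  by (induction p rule: pm_induct) (simp_all add: pairing_simps smul_add rhomD algebra_simps)

definition functional :: "('r \<Rightarrow> 's::comm_ring_1) \<Rightarrow> ('r, 'a, 'm) module_scheme \<Rightarrow> ('a \<Rightarrow> 's) \<Rightarrow> bool" where
  "functional \<sigma> A f \<longleftrightarrow> (\<forall>x\<in>carrier A. \<forall>y\<in>carrier A. f (x \<oplus>\<^bsub>A\<^esub> y) = f x + f y) \<and>
     (\<forall>c. \<forall>x\<in>carrier A. f (c \<odot>\<^bsub>A\<^esub> x) = \<sigma> c * f x)"

lemma pairing_rels: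
  assumes \<sigma>: "rhom \<sigma>" and f: "\<forall>f\<in>set fs. functional \<sigma> A f" and n: "length fs = n"
  shows "p \<in> tensor_rels A n \<Longrightarrow> pairing \<sigma> fs p = 0"
proof (induction rule: tensor_rels.induct)
  case (additive us vs x y c)
  then obtain f1 g f2 where fs: "fs = f1 @ g # f2" "length f1 = length us"
    using n id_take_nth_drop[of "length us" fs] by fastforce
  show ?case using f additive fs
    by (auto simp: pairing_simps[OF \<sigma>] pprod_append functional_def algebra_simps)
next
  case (scalar us vs x d c)
  then obtain f1 g f2 where fs: "fs = f1 @ g # f2" "length f1 = length us"
    using n id_take_nth_drop[of "length us" fs] by fastforce
  show ?case using f scalar fs
    by (auto simp: pairing_simps[OF \<sigma>] pprod_append functional_def rhomD[OF \<sigma>] algebra_simps)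
qed (simp_all add: pairing_simps[OF \<sigma>])

lemma pairing_tc:
  assumes "rhom \<sigma>" "\<forall>f\<in>set fs. functional \<sigma> A f" "length fs = n" "tc A n p = tc A n q"
  shows "pairing \<sigma> fs p = pairing \<sigma> fs q"
  using pairing_rels[OF assms(1-3), of "p - q"] assms by (simp add: tc_eq_iff pairing_simps)

lemma tensor_rels_slot_sum:
  assumes A: "Module.module rot A" and "finite S" "set us \<subseteq> carrier A" "set vs \<subseteq> carrier A" "Suc (length us + length vs) = n"
     "f \<in> S \<rightarrow> carrier A"
  shows "Poly_Mapping.single (us @ finsum A f S # vs) c - (\<Sum>s\<in>S. Poly_Mapping.single (us @ f s # vs) c) \<in> tensor_rels A n"
  using assms(2,6)
proof (induction S rule: finite_induct)
  interpret A: Module.module rot A by (rule A)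
  case empty
  have "Poly_Mapping.single (us @ (0 \<odot>\<^bsub>A\<^esub> \<zero>\<^bsub>A\<^esub>) # vs) c - Poly_Mapping.single (us @ \<zero>\<^bsub>A\<^esub> # vs) (c * 0) \<in> tensor_rels A n"
    using assms by (intro tensor_rels.scalar) auto
  moreover have "0 \<odot>\<^bsub>A\<^esub> \<zero>\<^bsub>A\<^esub> = \<zero>\<^bsub>A\<^esub>" using A.smult_l_null by simp
  ultimately show ?case by simp
next
  interpret A: Module.module rot A by (rule A)
  case (insert s S)
  then have f: "f s \<in> carrier A" "f \<in> S \<rightarrow> carrier A" "finsum A f S \<in> carrier A" by auto
  have "Poly_Mapping.single (us @ (f s \<oplus>\<^bsub>A\<^esub> finsum A f S) # vs) c - Poly_Mapping.single (us @ f s # vs) c -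
    Poly_Mapping.single (us @ finsum A f S # vs) c \<in> tensor_rels A n"
    using f assms by (intro tensor_rels.additive) auto
  from tensor_rels.sum[OF this insert(3)[OF f(2)]] show ?case
    using insert f by (simp add: A.finsum_insert algebra_simps)
qed

text \<open>A finite expansion of every element is what the separation argument consumes. It is
  applied to the words in the free algebra and, in \<open>tensor_square_inj\<close>, to the images
  of the elements \<open>hp (deg b) b\<close> in a Rees algebra.\<close>

locale dual_basis =
  fixes A :: "('r::comm_ring_1, 'a, 'm) module_scheme" and Bs :: "'i set" and bv :: "'i \<Rightarrow> 'a" and lam :: "'i \<Rightarrow> 'a \<Rightarrow> 'r"
  assumes A: "Module.module rot A" and bv: "\<And>i. i \<in> Bs \<Longrightarrow> bv i \<in> carrier A"
    and lam_out: "\<And>x i. x \<in> carrier A \<Longrightarrow> i \<notin> Bs \<Longrightarrow> lam i x = 0"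
    and fin: "\<And>x. x \<in> carrier A \<Longrightarrow> finite {i. lam i x \<noteq> 0}"
    and expand: "\<And>x. x \<in> carrier A \<Longrightarrow> x = finsum A (\<lambda>i. lam i x \<odot>\<^bsub>A\<^esub> bv i) {i. lam i x \<noteq> 0}"
begin

sublocale Module.module rot A by (rule A)

text \<open>The expansion of an elementary tensor in the basis of a tensor power; indices are recorded
  instead of basis vectors.\<close>

fun expn :: "'i list \<Rightarrow> 'a list \<Rightarrow> 'r \<Rightarrow> ('i list \<Rightarrow>\<^sub>0 'r)" where
  "expn is [] c = Poly_Mapping.single is c"
| "expn is (x # xs) c = (\<Sum>i\<in>{i. lam i x \<noteq> 0}. expn (is @ [i]) xs (c * lam i x))"

text \<open>Reading off the index that follows the prefix \<open>is\<close> selects one summand of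
  the recursion, so a coefficient is a product of coordinates. For the empty prefix it is, up to the
  factor \<open>c\<close>, the value of a tensor product of coordinate functionals.\<close>

lemma lookup_expn:
  "set xs \<subseteq> carrier A \<Longrightarrow> Poly_Mapping.lookup (expn is xs c) js =
     (if take (length is) js = is then c * pprod (map lam (drop (length is) js)) xs else 0)"
proof (induction xs arbitrary: "is" c)
  case Nil
  show ?case
  proof (cases "js = is")
    case False
    then show ?thesis
      by (cases "drop (length is) js") (auto simp: lookup_single when_def)
  qed simp
next
  case (Cons x xs)
  let ?S = "{i. lam i x \<noteq> 0}"
  have F: "finite ?S" using Cons.prems fin by auto
  have "Poly_Mapping.lookup (expn is (x # xs) c) js =
    (\<Sum>i\<in>?S. if take (Suc (length is)) js = is @ [i] then c * lam i x * pprod (map lam (drop (Suc (length is)) js)) xs else 0)"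
    using Cons by (auto simp: lookup_sum intro!: sum.cong)
  also have "\<dots> = (if take (length is) js = is then c * pprod (map lam (drop (length is) js)) (x # xs) else 0)"
  proof (cases "take (length is) js = is \<and> length is < length js")
    case True
    then have t: "take (Suc (length is)) js = is @ [js ! length is]" by (simp add: take_Suc_conv_app_nth)
    have d: "drop (length is) js = js ! length is # drop (Suc (length is)) js" using True by (simp add: Cons_nth_drop_Suc)
    show ?thesis using True F unfolding t d by (simp add: sum.delta mult.assoc)
  next
    case False
    have "take (Suc (length is)) js \<noteq> is @ [i]" for i
    proof
      assume t: "take (Suc (length is)) js = is @ [i]"
      then have "take (length is) (take (Suc (length is)) js) = is" by simp
      then have "take (length is) js = is" by (simp add: min_def)
      moreover have "length is < length js" using arg_cong[OF t, of length] by simp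
      ultimately show False using False by simp
    qed
    moreover have "pprod (map lam (drop (length is) js)) (x # xs) = 0" if "take (length is) js = is"
      using False that by simp
    ultimately show ?thesis by simp
  qed
  finally show ?case .
qed

lemma single_expn_rels:
  "set us \<subseteq> carrier A \<Longrightarrow> set is \<subseteq> Bs \<Longrightarrow> us = map bv is \<Longrightarrow> set xs \<subseteq> carrier A \<Longrightarrow> length us + length xs = n \<Longrightarrow>
     Poly_Mapping.single (us @ xs) c - plin (\<lambda>js d. Poly_Mapping.single (map bv js) d) (expn is xs c) \<in> tensor_rels A n"
proof (induction xs arbitrary: us "is" c)
  case Nil
  then show ?case by (simp add: plin_single additive2_single tensor_rels.zero)
next
  case (Cons x xs)
  let ?S = "{i. lam i x \<noteq> 0}"
  let ?pl = "plin (\<lambda>js d. Poly_Mapping.single (map bv js) d)"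
  have x: "x \<in> carrier A" using Cons by simp
  have F: "finite ?S" "?S \<subseteq> Bs" using lam_out x fin by auto
  have "Poly_Mapping.single (us @ x # xs) c - (\<Sum>i\<in>?S. Poly_Mapping.single (us @ (lam i x \<odot>\<^bsub>A\<^esub> bv i) # xs) c) \<in> tensor_rels A n"
    (is "?lhs \<in> _")
  proof -
    have "Poly_Mapping.single (us @ finsum A (\<lambda>i. lam i x \<odot>\<^bsub>A\<^esub> bv i) ?S # xs) c -
        (\<Sum>i\<in>?S. Poly_Mapping.single (us @ (lam i x \<odot>\<^bsub>A\<^esub> bv i) # xs) c) \<in> tensor_rels A n"
      using Cons.prems F bv by (intro tensor_rels_slot_sum A) (auto intro!: smult_closed)
    then show ?thesis by (simp only: expand[OF x, symmetric])
  qed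
  moreover have "(\<Sum>i\<in>?S. Poly_Mapping.single (us @ (lam i x \<odot>\<^bsub>A\<^esub> bv i) # xs) c - Poly_Mapping.single (us @ bv i # xs) (c * lam i x)) \<in> tensor_rels A n"
    using Cons.prems F bv by (intro tensor_rels_sum tensor_rels.scalar) auto
  moreover have "(\<Sum>i\<in>?S. Poly_Mapping.single ((us @ [bv i]) @ xs) (c * lam i x) - ?pl (expn (is @ [i]) xs (c * lam i x))) \<in> tensor_rels A n"
    using Cons.prems F bv by (intro tensor_rels_sum Cons.IH) auto
  ultimately have "(Poly_Mapping.single (us @ x # xs) c - (\<Sum>i\<in>?S. Poly_Mapping.single (us @ (lam i x \<odot>\<^bsub>A\<^esub> bv i) # xs) c))
     + ((\<Sum>i\<in>?S. Poly_Mapping.single (us @ (lam i x \<odot>\<^bsub>A\<^esub> bv i) # xs) c - Poly_Mapping.single (us @ bv i # xs) (c * lam i x)) +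
     (\<Sum>i\<in>?S. Poly_Mapping.single ((us @ [bv i]) @ xs) (c * lam i x) - ?pl (expn (is @ [i]) xs (c * lam i x)))) \<in> tensor_rels A n"
    by (intro tensor_rels.sum)
  \<comment> \<open>Additivity, homogeneity and the induction hypothesis for the remaining slots
    give three differences, which telescope.\<close>
  moreover have "(a - b) + ((b - c) + (c - d)) = a - d" for a b c d :: "'a list \<Rightarrow>\<^sub>0 'r" by simp
  ultimately show ?case
    by (simp only: sum_subtractf plin_sum[OF additive2_single] expn.simps append_assoc append.simps)
qed

text \<open>Modulo the relations \<open>p\<close> is the image of its expansion \<open>e\<close>,
  and the coefficients of \<open>e\<close> are the pairings of \<open>p\<close> with the
  coordinates. For linear coordinates \<open>pairing_rels\<close> is the converse, and the two
  together decide equality in a tensor power.\<close>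

lemma rels_if_pairing_zero:
  assumes p: "p \<in> carrier (free_tensors A n)"
    and z: "\<And>js. length js = n \<Longrightarrow> set js \<subseteq> Bs \<Longrightarrow> pairing (\<lambda>c. c) (map lam js) p = 0"
  shows "p \<in> tensor_rels A n"
proof -
  let ?pl = "plin (\<lambda>js d. Poly_Mapping.single (map bv js) d)"
  have k: "xs \<in> Poly_Mapping.keys p \<Longrightarrow> xs \<in> tuples A n" for xs using p by (auto simp: carrier_free_tensors)
  define e where "e = (\<Sum>xs\<in>Poly_Mapping.keys p. expn [] xs (Poly_Mapping.lookup p xs))"
  have "p = (\<Sum>xs\<in>Poly_Mapping.keys p. Poly_Mapping.single xs (Poly_Mapping.lookup p xs))"
    using plin_single_eq[of p] by (simp add: plin_def)
  then have "p - ?pl e = (\<Sum>xs\<in>Poly_Mapping.keys p. Poly_Mapping.single ([] @ xs) (Poly_Mapping.lookup p xs) - ?pl (expn [] xs (Poly_Mapping.lookup p xs)))"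
    by (simp add: e_def plin_sum additive2_single sum_subtractf)
  also have "\<dots> \<in> tensor_rels A n"
    using k by (intro tensor_rels_sum single_expn_rels) (auto simp: tuples_def)
  finally have *: "p - ?pl e \<in> tensor_rels A n" .
  have "Poly_Mapping.lookup e js = 0" for js
  proof -
    have l: "Poly_Mapping.lookup e js = pairing (\<lambda>c. c) (map lam js) p"
      using k by (simp add: e_def lookup_sum pairing_def plin_def lookup_expn tuples_def)
    show ?thesis
    proof (cases "length js = n \<and> set js \<subseteq> Bs")
      case True then show ?thesis using z l by simp
    next
      case False
      have "pprod (map lam js) xs = 0" if "xs \<in> Poly_Mapping.keys p" for xs
      proof (cases "length js = n")
        case True
        with False obtain j where j: "j \<in> set js" "j \<notin> Bs" by auto
        from k[OF that] True have "length js = length xs" "set xs \<subseteq> carrier A" by (auto simp: tuples_def)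
        then show ?thesis using j
          by (induction js xs rule: list_induct2) (auto simp: lam_out)
      next
        case False then show ?thesis using k[OF that] by (auto simp: tuples_def intro!: pprod_length)
      qed
      then show ?thesis unfolding l by (simp add: pairing_def plin_def)
    qed
  qed
  then have "e = 0" by (intro poly_mapping_eqI) simp
  with * show ?thesis by simp
qed

end

section \<open>Multiplication on tensor powers\<close>

definition ftmul :: "('r::comm_ring_1, 'a, 'm) module_scheme \<Rightarrow> ('a list \<Rightarrow>\<^sub>0 'r) \<Rightarrow> ('a list \<Rightarrow>\<^sub>0 'r) \<Rightarrow> ('a list \<Rightarrow>\<^sub>0 'r)" where
  "ftmul A p q = plin (\<lambda>xs c. plin (\<lambda>ys d. Poly_Mapping.single (map2 (monoid.mult A) xs ys) (c * d)) q) p"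

lemma ftmul_eq: "monoid.mult (free_tensors A n) p q = ftmul A p q"
  by (simp add: free_tensors_def ftmul_def plin_def)

lemma additive2_ftmul1: "additive2 (\<lambda>ys d. Poly_Mapping.single (map2 (monoid.mult A) xs ys) (c * d :: 'r::comm_ring_1))"
  by (rule additive2I) (simp_all add: single_add distrib_left)

lemma additive2_ftmul2: "additive2 (\<lambda>xs c. plin (\<lambda>ys d. Poly_Mapping.single (map2 (monoid.mult A) xs ys) (c * d :: 'r::comm_ring_1)) q)"
proof (rule additive2I)
  show "plin (\<lambda>ys d. Poly_Mapping.single (map2 (monoid.mult A) xs ys) (0 * d)) q = 0" for xs
    by (simp add: plin_def)
  show "plin (\<lambda>ys d. Poly_Mapping.single (map2 (monoid.mult A) xs ys) ((a + b) * d)) q =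
     plin (\<lambda>ys d. Poly_Mapping.single (map2 (monoid.mult A) xs ys) (a * d)) q +
     plin (\<lambda>ys d. Poly_Mapping.single (map2 (monoid.mult A) xs ys) (b * d)) q" for xs a b
    by (simp add: plin_def distrib_right single_add sum.distrib)
qed

lemma additive2_ftmul3: "additive2 (\<lambda>xs c. Poly_Mapping.single (map2 (monoid.mult A) xs ys) (c * d :: 'r::comm_ring_1))"
  by (rule additive2I) (simp_all add: single_add distrib_right)

lemma ftmul_simps [simp]:
  "ftmul A 0 q = 0" "ftmul A p 0 = 0"
  "ftmul A (p + p') q = ftmul A p q + ftmul A p' q" "ftmul A p (q + q') = ftmul A p q + ftmul A p q'"
  "ftmul A (p - p') q = ftmul A p q - ftmul A p' q" "ftmul A p (q - q') = ftmul A p q - ftmul A p q'"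
  "ftmul A (Poly_Mapping.single xs c) (Poly_Mapping.single ys d) = Poly_Mapping.single (map2 (monoid.mult A) xs ys) (c * d)"
proof -
  show "ftmul A (p + p') q = ftmul A p q + ftmul A p' q" "ftmul A (p - p') q = ftmul A p q - ftmul A p' q"
    by (simp_all add: ftmul_def plin_add plin_diff additive2_ftmul2)
  show "ftmul A p (q + q') = ftmul A p q + ftmul A p q'" "ftmul A p (q - q') = ftmul A p q - ftmul A p q'"
    by (simp_all add: ftmul_def plin_add plin_diff additive2_ftmul1) (simp_all add: plin_def sum.distrib sum_subtractf)
  show "ftmul A (Poly_Mapping.single xs c) (Poly_Mapping.single ys d) = Poly_Mapping.single (map2 (monoid.mult A) xs ys) (c * d)"
    by (simp only: ftmul_def plin_single[OF additive2_ftmul3] plin_single[OF additive2_ftmul1])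
qed (simp_all add: ftmul_def, simp add: plin_def)

lemma set_map2_mult:
  assumes "ring A"
  shows "set as \<subseteq> carrier A \<Longrightarrow> set bs \<subseteq> carrier A \<Longrightarrow> set (map2 (monoid.mult A) as bs) \<subseteq> carrier A"
proof (induction as arbitrary: bs)
  case (Cons a as)
  interpret ring A by (rule assms)
  show ?case using Cons.prems Cons.IH[of "tl bs"] by (cases bs) auto
qed simp

lemma map2_mult_tuples:
  assumes "ring A" "xs \<in> tuples A n" "ys \<in> tuples A n" shows "map2 (monoid.mult A) xs ys \<in> tuples A n"
  using set_map2_mult[OF assms(1), of xs ys] assms(2,3) by (auto simp: tuples_def)

lemma ftmul_free:
  assumes "ring A" "p \<in> carrier (free_tensors A n)" "q \<in> carrier (free_tensors A n)"
  shows "ftmul A p q \<in> carrier (free_tensors A n)"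
proof -
  from assms(2) have "Poly_Mapping.keys p \<subseteq> tuples A n" by (simp add: carrier_free_tensors)
  then show ?thesis
  proof (induction p rule: pm_induct_keys)
    case (add xs c p)
    from assms(3) have "Poly_Mapping.keys q \<subseteq> tuples A n" by (simp add: carrier_free_tensors)
    then have "ftmul A (Poly_Mapping.single xs c) q \<in> carrier (free_tensors A n)"
      by (induction q rule: pm_induct_keys)
        (use add in \<open>auto intro!: free_tensors_add free_tensors_single map2_mult_tuples assms(1)\<close>)
    then show ?case using add by (auto intro: free_tensors_add)
  qed simp
qed

lemma is_algebraD:
  assumes "is_algebra A"
  shows "Module.module rot A" "ring A"
    "x \<in> carrier A \<Longrightarrow> y \<in> carrier A \<Longrightarrow> (c \<odot>\<^bsub>A\<^esub> x) \<otimes>\<^bsub>A\<^esub> y = c \<odot>\<^bsub>A\<^esub> (x \<otimes>\<^bsub>A\<^esub> y)"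
    "x \<in> carrier A \<Longrightarrow> y \<in> carrier A \<Longrightarrow> x \<otimes>\<^bsub>A\<^esub> (c \<odot>\<^bsub>A\<^esub> y) = c \<odot>\<^bsub>A\<^esub> (x \<otimes>\<^bsub>A\<^esub> y)"
  using assms by (auto simp: is_algebra_def)

lemma single_mult_rels:
  assumes A: "is_algebra A" and zs: "zs \<in> tuples A n"
  shows "q \<in> tensor_rels A n \<Longrightarrow> ftmul A (Poly_Mapping.single zs e) q \<in> tensor_rels A n \<and>
     ftmul A q (Poly_Mapping.single zs e) \<in> tensor_rels A n"
proof (induction rule: tensor_rels.induct)
  interpret ring A using A by (rule is_algebraD)
  case (additive us vs x y c)
  obtain z1 z z2 where z: "zs = z1 @ z # z2" "length z1 = length us" "length z2 = length vs"
    using zs additive id_take_nth_drop[of "length us" zs] by (fastforce simp: tuples_def)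
  have s: "set z1 \<subseteq> carrier A" "set z2 \<subseteq> carrier A" "z \<in> carrier A" using zs z by (auto simp: tuples_def)
  note c = set_map2_mult[OF is_algebraD(2)[OF A]]
  have "Poly_Mapping.single (map2 (monoid.mult A) z1 us @ (z \<otimes>\<^bsub>A\<^esub> x \<oplus>\<^bsub>A\<^esub> z \<otimes>\<^bsub>A\<^esub> y) # map2 (monoid.mult A) z2 vs) (e * c)
      - Poly_Mapping.single (map2 (monoid.mult A) z1 us @ z \<otimes>\<^bsub>A\<^esub> x # map2 (monoid.mult A) z2 vs) (e * c)
      - Poly_Mapping.single (map2 (monoid.mult A) z1 us @ z \<otimes>\<^bsub>A\<^esub> y # map2 (monoid.mult A) z2 vs) (e * c) \<in> tensor_rels A n"
    "Poly_Mapping.single (map2 (monoid.mult A) us z1 @ (x \<otimes>\<^bsub>A\<^esub> z \<oplus>\<^bsub>A\<^esub> y \<otimes>\<^bsub>A\<^esub> z) # map2 (monoid.mult A) vs z2) (c * e)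
      - Poly_Mapping.single (map2 (monoid.mult A) us z1 @ x \<otimes>\<^bsub>A\<^esub> z # map2 (monoid.mult A) vs z2) (c * e)
      - Poly_Mapping.single (map2 (monoid.mult A) us z1 @ y \<otimes>\<^bsub>A\<^esub> z # map2 (monoid.mult A) vs z2) (c * e) \<in> tensor_rels A n"
    by (rule tensor_rels.additive[OF _ c c]; use z s additive in simp)+
  then show ?case
    using z s additive by (simp add: r_distr l_distr)
next
  interpret ring A using A by (rule is_algebraD)
  case (scalar us vs x d c)
  obtain z1 z z2 where z: "zs = z1 @ z # z2" "length z1 = length us" "length z2 = length vs"
    using zs scalar id_take_nth_drop[of "length us" zs] by (fastforce simp: tuples_def)
  have s: "set z1 \<subseteq> carrier A" "set z2 \<subseteq> carrier A" "z \<in> carrier A" using zs z by (auto simp: tuples_def)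
  note c = set_map2_mult[OF is_algebraD(2)[OF A]]
  have "Poly_Mapping.single (map2 (monoid.mult A) z1 us @ (d \<odot>\<^bsub>A\<^esub> (z \<otimes>\<^bsub>A\<^esub> x)) # map2 (monoid.mult A) z2 vs) (e * c)
      - Poly_Mapping.single (map2 (monoid.mult A) z1 us @ z \<otimes>\<^bsub>A\<^esub> x # map2 (monoid.mult A) z2 vs) (e * c * d) \<in> tensor_rels A n"
    "Poly_Mapping.single (map2 (monoid.mult A) us z1 @ (d \<odot>\<^bsub>A\<^esub> (x \<otimes>\<^bsub>A\<^esub> z)) # map2 (monoid.mult A) vs z2) (c * e)
      - Poly_Mapping.single (map2 (monoid.mult A) us z1 @ x \<otimes>\<^bsub>A\<^esub> z # map2 (monoid.mult A) vs z2) (c * e * d) \<in> tensor_rels A n"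
    by (rule tensor_rels.scalar[OF _ c c]; use z s scalar in simp)+
  then show ?case
    using z s scalar by (simp add: is_algebraD(3,4)[OF A] mult_ac)
qed (auto intro: tensor_rels.intros)

lemma mult_rels:
  assumes A: "is_algebra A" and p: "p \<in> carrier (free_tensors A n)" and q: "q \<in> tensor_rels A n"
  shows "ftmul A p q \<in> tensor_rels A n" "ftmul A q p \<in> tensor_rels A n"
proof -
  from p have "Poly_Mapping.keys p \<subseteq> tuples A n" by (simp add: carrier_free_tensors)
  then have "ftmul A p q \<in> tensor_rels A n \<and> ftmul A q p \<in> tensor_rels A n"
  proof (induction p rule: pm_induct_keys)
    case (add xs c p)
    then show ?case using single_mult_rels[OF A add(1) q, of c] by (simp add: tensor_rels.sum)
  qed (simp add: tensor_rels.zero)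
  then show "ftmul A p q \<in> tensor_rels A n" "ftmul A q p \<in> tensor_rels A n" by auto
qed

lemma tp_mult:
  assumes A: "is_algebra A" and p: "p \<in> carrier (free_tensors A n)" and q: "q \<in> carrier (free_tensors A n)"
  shows "tc A n p \<otimes>\<^bsub>tensor_power A n\<^esub> tc A n q = tc A n (ftmul A p q)"
proof -
  have "tc A n p \<otimes>\<^bsub>tensor_power A n\<^esub> tc A n q = (\<Union>a\<in>tc A n p. \<Union>b\<in>tc A n q. tc A n (ftmul A a b))"
    by (simp add: tensor_power_def quot_algebra_def ring.defs module.defs FactRing_def rcoset_mult_def
      tensor_class_def ftmul_eq)
  also have "\<dots> = (\<Union>a\<in>tc A n p. \<Union>b\<in>tc A n q. tc A n (ftmul A p q))"
  proof (rule SUP_cong[OF refl], rule SUP_cong[OF refl])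
    fix a b assume "a \<in> tc A n p" "b \<in> tc A n q"
    then obtain r s where *: "r \<in> tensor_rels A n" "s \<in> tensor_rels A n" "a = r + p" "b = s + q"
      by (auto simp: tc_def')
    have "r \<in> carrier (free_tensors A n)" using tensor_rels_carrier is_algebraD(1)[OF A] * by blast
    then have "ftmul A r s + (ftmul A r q + ftmul A p s) \<in> tensor_rels A n"
      using mult_rels[OF A _ *(2)] mult_rels[OF A _ *(1)] p q by (intro tensor_rels.sum) blast+
    also have "ftmul A r s + (ftmul A r q + ftmul A p s) = ftmul A a b - ftmul A p q"
      using * by simp
    finally have "ftmul A a b - ftmul A p q \<in> tensor_rels A n" .
    then show "tc A n (ftmul A a b) = tc A n (ftmul A p q)" by (simp add: tc_eq_iff)
  qed
  also have "\<dots> = tc A n (ftmul A p q)"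
  proof -
    have "tc A n p \<noteq> {}" "tc A n q \<noteq> {}" using tc_self[of p A n] tc_self[of q A n] by auto
    then show ?thesis by simp
  qed
  finally show ?thesis .
qed

lemma tp_one: "\<one>\<^bsub>tensor_power A n\<^esub> = tc A n (Poly_Mapping.single (replicate n \<one>\<^bsub>A\<^esub>) 1)"
  by (auto simp: tensor_power_def quot_algebra_def ring.defs module.defs FactRing_def
      tensor_class_def free_tensors_def)

section \<open>Functoriality of tensor powers\<close>

text \<open>The effect of \<open>tensor_map\<close> on representatives, written uniformly in the
  number of factors.\<close>

definition push :: "('r \<Rightarrow> 's) \<Rightarrow> ('a \<Rightarrow> 'b) \<Rightarrow> ('a list \<Rightarrow>\<^sub>0 'r::comm_ring_1) \<Rightarrow> ('b list \<Rightarrow>\<^sub>0 's::comm_ring_1)" where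
  "push \<sigma> f p = plin (\<lambda>xs c. Poly_Mapping.single (map f xs) (\<sigma> c)) p"

lemma push_simps:
  assumes "rhom \<sigma>"
  shows "push \<sigma> f 0 = 0" "push \<sigma> f (p + q) = push \<sigma> f p + push \<sigma> f q"
    "push \<sigma> f (Poly_Mapping.single xs c) = Poly_Mapping.single (map f xs) (\<sigma> c)"
    "push \<sigma> f (smul c p) = smul (\<sigma> c) (push \<sigma> f p)"
proof -
  have A: "additive2 (\<lambda>xs c. Poly_Mapping.single (map f xs) (\<sigma> c))"
    by (rule additive2I) (simp_all add: rhomD[OF assms] single_add)
  show "push \<sigma> f 0 = 0" and add: "\<And>p q. push \<sigma> f (p + q) = push \<sigma> f p + push \<sigma> f q"
    and sing: "\<And>xs c. push \<sigma> f (Poly_Mapping.single xs c) = Poly_Mapping.single (map f xs) (\<sigma> c)"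
    by (simp_all add: push_def plin_add plin_single A)
  show "push \<sigma> f (smul c p) = smul (\<sigma> c) (push \<sigma> f p)"
    by (induction p rule: pm_induct) (simp_all add: smul_add add sing rhomD[OF assms], simp add: push_def)
qed

lemma push_free:
  assumes \<sigma>: "rhom \<sigma>" and f: "f \<in> carrier A \<rightarrow> carrier B" and p: "p \<in> carrier (free_tensors A n)"
  shows "push \<sigma> f p \<in> carrier (free_tensors B n)"
proof -
  from p have "Poly_Mapping.keys p \<subseteq> tuples A n" by (simp add: carrier_free_tensors)
  then show ?thesis
    by (induction p rule: pm_induct_keys)
      (use f in \<open>auto simp: push_simps[OF \<sigma>] tuples_def Pi_iff subset_iff intro!: free_tensors_add free_tensors_single\<close>)
qed

lemma tensor_map_push:
  assumes "rhom \<sigma>" "Module.module rot A" "f \<in> slin \<sigma> A B" "p \<in> carrier (free_tensors A n)"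
  shows "tensor_map \<sigma> B n f (tc A n p) = tc B n (push \<sigma> f p)"
  using tensor_map_tc[OF assms] by (simp add: push_def)

lemma push_ftmul:
  assumes \<sigma>: "rhom \<sigma>" and f: "\<And>x y. x \<in> carrier A \<Longrightarrow> y \<in> carrier A \<Longrightarrow> f (x \<otimes>\<^bsub>A\<^esub> y) = f x \<otimes>\<^bsub>B\<^esub> f y"
    and p: "p \<in> carrier (free_tensors A n)" and q: "q \<in> carrier (free_tensors A n)"
  shows "push \<sigma> f (ftmul A p q) = ftmul B (push \<sigma> f p) (push \<sigma> f q)"
proof -
  have m: "map f (map2 (monoid.mult A) xs ys) = map2 (monoid.mult B) (map f xs) (map f ys)"
    if "xs \<in> tuples A n" "ys \<in> tuples A n" for xs ys
  proof -
    have "length xs = length ys" "set xs \<subseteq> carrier A" "set ys \<subseteq> carrier A" using that by (auto simp: tuples_def)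
    then show ?thesis by (induction xs ys rule: list_induct2) (auto simp: f)
  qed
  from p have "Poly_Mapping.keys p \<subseteq> tuples A n" by (simp add: carrier_free_tensors)
  then show ?thesis
  proof (induction p rule: pm_induct_keys)
    case (add xs c p)
    from q have "Poly_Mapping.keys q \<subseteq> tuples A n" by (simp add: carrier_free_tensors)
    then have "push \<sigma> f (ftmul A (Poly_Mapping.single xs c) q) = ftmul B (push \<sigma> f (Poly_Mapping.single xs c)) (push \<sigma> f q)"
    proof (induction q rule: pm_induct_keys)
      case (add ys d q)
      then show ?case using m[OF \<open>xs \<in> tuples A n\<close> add(1)] 
        by (simp add: push_simps[OF \<sigma>] rhomD[OF \<sigma>] del: map_map)
    qed (simp add: push_simps[OF \<sigma>])
    then show ?case using add by (simp add: push_simps[OF \<sigma>])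
  qed (simp add: push_simps[OF \<sigma>])
qed

lemma multilin2:
  assumes A: "Module.module rot A"
    and cl: "\<And>x y. x \<in> carrier A \<Longrightarrow> y \<in> carrier A \<Longrightarrow> f x y \<in> carrier N"
    and a1: "\<And>x x' y. x \<in> carrier A \<Longrightarrow> x' \<in> carrier A \<Longrightarrow> y \<in> carrier A \<Longrightarrow> f (x \<oplus>\<^bsub>A\<^esub> x') y = f x y \<oplus>\<^bsub>N\<^esub> f x' y"
    and a2: "\<And>x y y'. x \<in> carrier A \<Longrightarrow> y \<in> carrier A \<Longrightarrow> y' \<in> carrier A \<Longrightarrow> f x (y \<oplus>\<^bsub>A\<^esub> y') = f x y \<oplus>\<^bsub>N\<^esub> f x y'"
    and s1: "\<And>x y c. x \<in> carrier A \<Longrightarrow> y \<in> carrier A \<Longrightarrow> f (c \<odot>\<^bsub>A\<^esub> x) y = \<sigma> c \<odot>\<^bsub>N\<^esub> f x y"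
    and s2: "\<And>x y c. x \<in> carrier A \<Longrightarrow> y \<in> carrier A \<Longrightarrow> f x (c \<odot>\<^bsub>A\<^esub> y) = \<sigma> c \<odot>\<^bsub>N\<^esub> f x y"
  shows "multilin \<sigma> A 2 N (\<lambda>xs. f (xs ! 0) (xs ! 1))"
proof -
  have *: "(\<exists>y\<in>carrier A. us = [] \<and> vs = [y]) \<or> (\<exists>y\<in>carrier A. us = [y] \<and> vs = [])"
    if "us @ x # vs \<in> tuples A 2" for us vs x
    using that by (cases us; cases vs) (auto simp: tuples_def)
  show ?thesis
    unfolding multilin_def
  proof (intro conjI allI impI Pi_I)
    fix xs assume "xs \<in> tuples A 2"
    then show "f (xs ! 0) (xs ! 1) \<in> carrier N" by (intro cl) (auto simp: tuples_def)
  next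
    fix us vs x y assume t: "us @ x # vs \<in> tuples A 2" and y: "y \<in> carrier A"
    have "x \<in> carrier A" using t by (auto simp: tuples_def)
    then show "f ((us @ (x \<oplus>\<^bsub>A\<^esub> y) # vs) ! 0) ((us @ (x \<oplus>\<^bsub>A\<^esub> y) # vs) ! 1) =
      f ((us @ x # vs) ! 0) ((us @ x # vs) ! 1) \<oplus>\<^bsub>N\<^esub> f ((us @ y # vs) ! 0) ((us @ y # vs) ! 1)"
      using *[OF t] y by (auto simp: a1 a2)
  next
    fix us vs x c assume t: "us @ x # vs \<in> tuples A 2"
    have "x \<in> carrier A" using t by (auto simp: tuples_def)
    then show "f ((us @ (c \<odot>\<^bsub>A\<^esub> x) # vs) ! 0) ((us @ (c \<odot>\<^bsub>A\<^esub> x) # vs) ! 1) = \<sigma> c \<odot>\<^bsub>N\<^esub> f ((us @ x # vs) ! 0) ((us @ x # vs) ! 1)"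
      using *[OF t] by (auto simp: s1 s2)
  qed
qed

section \<open>Monoid algebras\<close>

abbreviation W :: "'a \<Rightarrow> ('a \<Rightarrow>\<^sub>0 'r::comm_ring_1)" where "W u \<equiv> Poly_Mapping.single u 1"

lemma smul_conv_mult: "smul c p = Poly_Mapping.single 0 c * (p :: 'a::monoid_add \<Rightarrow>\<^sub>0 'r::comm_ring_1)"
  unfolding smul_def by (rule mult_map_scale_conv_mult)

lemma mult_smul_right: "p * smul c q = smul c (p * (q :: 'a::monoid_add \<Rightarrow>\<^sub>0 'r::comm_ring_1))"
proof -
  have "p * Poly_Mapping.single 0 c = Poly_Mapping.single 0 c * p"
    by (induction p rule: pm_induct) (simp_all add: algebra_simps mult_single)
  then show ?thesis by (simp add: smul_conv_mult mult.assoc[symmetric])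
qed

lemma mult_smul_left: "smul c p * q = smul c (p * (q :: 'a::monoid_add \<Rightarrow>\<^sub>0 'r::comm_ring_1))"
  by (simp add: smul_conv_mult mult.assoc)

lemma W_mult: "W u * W v = (W (u + v) :: 'a::monoid_add \<Rightarrow>\<^sub>0 'r::comm_ring_1)"
  by (simp add: mult_single)

lemma W_zero: "W 0 = (1 :: 'a::monoid_add \<Rightarrow>\<^sub>0 'r::comm_ring_1)"
  by simp

definition lext :: "('a \<Rightarrow> ('b \<Rightarrow>\<^sub>0 'r::comm_ring_1)) \<Rightarrow> ('a \<Rightarrow>\<^sub>0 'r) \<Rightarrow> ('b \<Rightarrow>\<^sub>0 'r)" where
  "lext F x = plin (\<lambda>u c. smul c (F u)) x"

lemma additive2_lext: "additive2 (\<lambda>u c. smul c (F u))"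
  by (rule additive2I) (simp_all add: smul_add_left)

lemma lext_simps [simp]:
  "lext F 0 = 0" "lext F (x + y) = lext F x + lext F y" "lext F (x - y) = lext F x - lext F y"
  "lext F (- x) = - lext F x" "lext F (Poly_Mapping.single u c) = smul c (F u)"
  by (simp_all add: lext_def plin_add plin_diff plin_uminus plin_single additive2_lext)

lemma lext_sum: "lext F (sum f I) = (\<Sum>i\<in>I. lext F (f i))"
  by (simp add: lext_def plin_sum additive2_lext)

lemma lext_smul: "lext F (smul c x) = smul c (lext F x)"
  by (induction x rule: pm_induct) (simp_all add: smul_add smul_smul)

lemma lext_lext: "lext F (lext G x) = lext (\<lambda>u. lext F (G u)) x"
  by (induction x rule: pm_induct) (simp_all add: lext_smul)

lemma lext_W: "lext W x = x"
  by (induction x rule: pm_induct) simp_all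

lemma lext_cong: "(\<And>u. u \<in> Poly_Mapping.keys x \<Longrightarrow> F u = G u) \<Longrightarrow> lext F x = lext G x"
  unfolding lext_def plin_def by (rule sum.cong) auto

lemma lext_mult:
  assumes "\<And>u v. F (u + v) = F u * F v"
  shows "lext F (x * y) = lext F x * lext F y"
proof (induction x rule: pm_induct)
  case (add u c x)
  have "lext F (Poly_Mapping.single u c * y) = smul c (F u) * lext F y"
    by (induction y rule: pm_induct)
      (simp_all add: algebra_simps mult_single assms mult_smul_left mult_smul_right smul_smul)
  with add show ?case by (simp add: algebra_simps)
qed simp

lemma lext_one: "F 0 = 1 \<Longrightarrow> lext F 1 = 1"
  using lext_simps(5)[of F 0 1] by simp

lemma lext_mult_left: "lext (\<lambda>u. y * F u) x = y * lext F x"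
  by (induction x rule: pm_induct) (simp_all add: algebra_simps mult_smul_right)

lemma lext_mult_right: "lext (\<lambda>u. F u * y) x = lext F x * y"
  by (induction x rule: pm_induct) (simp_all add: algebra_simps mult_smul_left)

lemma keys_lext: "Poly_Mapping.keys (lext F x) \<subseteq> (\<Union>u\<in>Poly_Mapping.keys x. Poly_Mapping.keys (F u))"
  using keys_plin[of "\<lambda>u c. smul c (F u)" x] keys_smul unfolding lext_def by fastforce

lemma keys_multD:
  "w \<in> Poly_Mapping.keys (x * y) \<Longrightarrow> \<exists>u\<in>Poly_Mapping.keys x. \<exists>v\<in>Poly_Mapping.keys y. w = u + v"
  using keys_mult[of x y] by blast

subsection \<open>Tensor squares and cubes of monoid algebras\<close>

text \<open>The monoid algebra of a product monoid is the tensor product of the two monoid algebras,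
  and \<open>tens x y\<close> is \<open>x \<otimes> y\<close> in this model. It is a ring on which
  linear maps are given by their values on pairs of words; all computations with the coproduct take
  place here.\<close>

definition tens :: "('a::monoid_add \<Rightarrow>\<^sub>0 'r::comm_ring_1) \<Rightarrow> ('b::monoid_add \<Rightarrow>\<^sub>0 'r) \<Rightarrow> ('a \<times> 'b \<Rightarrow>\<^sub>0 'r)" where
  "tens x y = lext (\<lambda>u. W (u, 0)) x * lext (\<lambda>v. W (0, v)) y"

lemma tens_add_left: "tens (x + x') y = tens x y + tens x' y"
  and tens_add_right: "tens x (y + y') = tens x y + tens x y'"
  and tens_0 [simp]: "tens 0 y = 0" "tens x 0 = 0"
  and tens_smul_left: "tens (smul c x) y = smul c (tens x y)"
  and tens_smul_right: "tens x (smul c y) = smul c (tens x y)"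
  by (simp_all add: tens_def algebra_simps lext_smul mult_smul_left mult_smul_right)

lemma tens_sum_left: "tens (sum f I) y = (\<Sum>i\<in>I. tens (f i) y)"
  and tens_sum_right: "tens x (sum f I) = (\<Sum>i\<in>I. tens x (f i))"
  by (simp_all add: tens_def lext_sum sum_distrib_left sum_distrib_right)

lemma tens_single: "tens (Poly_Mapping.single u c) (Poly_Mapping.single v d) = Poly_Mapping.single (u, v) (c * d)"
  by (simp add: tens_def mult_single)

lemma tens_lext: "tens x y = lext (\<lambda>u. lext (\<lambda>v. W (u, v)) y) x"
proof (induction x rule: pm_induct)
  case (add u c x)
  have "tens (Poly_Mapping.single u c) y = smul c (lext (\<lambda>v. W (u, v)) y)"
    by (induction y rule: pm_induct) (simp_all add: tens_add_right tens_single smul_add)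
  with add show ?case by (simp add: tens_add_left)
qed simp

lemma tens_one: "tens 1 1 = 1"
  by (simp add: tens_def lext_one zero_prod_def[symmetric])

lemma lext_commute:
  assumes "\<And>u v. F u * G v = G v * F u"
  shows "lext F x * lext G y = lext G y * lext F x"
proof (induction x rule: pm_induct)
  case (add u c x)
  have "F u * lext G y = lext G y * F u"
    by (induction y rule: pm_induct) (simp_all add: algebra_simps mult_smul_left mult_smul_right assms)
  with add show ?case by (simp add: algebra_simps mult_smul_left mult_smul_right)
qed simp

lemma tens_mult: "tens x y * tens x' y' = tens (x * x') (y * y')"
proof -
  let ?i = "lext (\<lambda>u. W (u, 0))" and ?j = "lext (\<lambda>v. W (0, v))"
  have "tens x y * tens x' y' = ?i x * (?j y * ?i x') * ?j y'" by (simp add: tens_def mult.assoc)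
  also have "?j y * ?i x' = ?i x' * ?j y" by (rule lext_commute) (simp add: W_mult)
  also have "?i x * (?i x' * ?j y) * ?j y' = tens (x * x') (y * y')"
    by (subst tens_def, subst (1 2) lext_mult) (simp_all add: W_mult mult.assoc)
  finally show ?thesis .
qed

lemma lookup_tens: "Poly_Mapping.lookup (tens x y) (u, v) = Poly_Mapping.lookup x u * Poly_Mapping.lookup y v"
proof (induction x rule: pm_induct)
  case (add a c x)
  have "Poly_Mapping.lookup (tens (Poly_Mapping.single a c) y) (u, v) = (c when a = u) * Poly_Mapping.lookup y v"
    by (induction y rule: pm_induct)
      (simp_all add: tens_add_right lookup_add tens_single algebra_simps lookup_single when_def)
  with add show ?case by (simp add: tens_add_left lookup_add algebra_simps lookup_single)
qed simp

text \<open>Embeddings into the tensor cube, modelled by the product of three monoids. The digits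
  name the factors that are filled; the other factors contain 1.\<close>

definition e1 :: "('a \<Rightarrow>\<^sub>0 'r::comm_ring_1) \<Rightarrow> ('a::monoid_add \<times> 'b::monoid_add \<times> 'c::monoid_add \<Rightarrow>\<^sub>0 'r)" where
  "e1 = lext (\<lambda>u. W (u, 0, 0))"
definition e2 :: "('b \<Rightarrow>\<^sub>0 'r::comm_ring_1) \<Rightarrow> ('a::monoid_add \<times> 'b::monoid_add \<times> 'c::monoid_add \<Rightarrow>\<^sub>0 'r)" where
  "e2 = lext (\<lambda>u. W (0, u, 0))"
definition e3 :: "('c \<Rightarrow>\<^sub>0 'r::comm_ring_1) \<Rightarrow> ('a::monoid_add \<times> 'b::monoid_add \<times> 'c::monoid_add \<Rightarrow>\<^sub>0 'r)" where
  "e3 = lext (\<lambda>u. W (0, 0, u))"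
definition e12 :: "('a \<times> 'b \<Rightarrow>\<^sub>0 'r::comm_ring_1) \<Rightarrow> ('a::monoid_add \<times> 'b::monoid_add \<times> 'c::monoid_add \<Rightarrow>\<^sub>0 'r)" where
  "e12 = lext (\<lambda>(u, v). W (u, v, 0))"
definition e23 :: "('b \<times> 'c \<Rightarrow>\<^sub>0 'r::comm_ring_1) \<Rightarrow> ('a::monoid_add \<times> 'b::monoid_add \<times> 'c::monoid_add \<Rightarrow>\<^sub>0 'r)" where
  "e23 = lext (\<lambda>(u, v). W (0, u, v))"

lemma e12_tens: "e12 (tens x y) = e1 x * e2 y"
  unfolding tens_def e12_def e1_def e2_def
  by (subst lext_mult) (auto simp: W_mult lext_lext)

lemma e23_tens: "e23 (tens x y) = e2 x * e3 y"
  unfolding tens_def e23_def e2_def e3_def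
  by (subst lext_mult) (auto simp: W_mult lext_lext)

lemma e12_mult: "e12 (x * y) = e12 x * e12 y"
  unfolding e12_def by (rule lext_mult) (auto simp: W_mult)

lemma e23_mult: "e23 (x * y) = e23 x * e23 y"
  unfolding e23_def by (rule lext_mult) (auto simp: W_mult)

lemma e1_mult: "e1 (x * y) = e1 x * e1 y"
  unfolding e1_def by (rule lext_mult) (auto simp: W_mult)

lemma e3_mult: "e3 (x * y) = e3 x * e3 y"
  unfolding e3_def by (rule lext_mult) (auto simp: W_mult)

lemma e_sum: "e12 (sum f I) = (\<Sum>i\<in>I. e12 (f i))" "e23 (sum g I) = (\<Sum>i\<in>I. e23 (g i))"
  by (simp_all add: e12_def e23_def lext_sum)

lemma e_add: "e12 (x + y) = e12 x + e12 y" "e23 (x' + y') = e23 x' + e23 y'"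
  by (simp_all add: e12_def e23_def)

lemma e12_e3_commute: "e12 x * e3 y = e3 y * e12 x"
  and e1_e23_commute: "e1 x' * e23 y' = e23 y' * e1 x'"
  unfolding e12_def e3_def e1_def e23_def by (intro lext_commute; auto simp: W_mult)+

lemma W_zero3: "W (0, 0, 0) = 1"
  by (simp flip: zero_prod_def)

lemma e_one: "e1 1 = 1" "e2 1 = 1" "e3 1 = 1" "e12 1 = 1" "e23 1 = 1"
  unfolding e12_def e3_def e1_def e23_def e2_def
  by (intro lext_one; simp add: W_zero3 zero_prod_def)+

section \<open>The coproduct on words\<close>

definition gser :: "'r::comm_ring_1 falg fps" where
  "gser = Abs_fps (\<lambda>n. if n = 0 then 1 else gen n)"

text \<open>The generating series of \<open>Q\<^sup>l\<^sub>t\<close> in \<open>t\<close> is the power \<open>(1 + a\<^sub>1 t + a\<^sub>2 t\<^sup>2 + \<dots>)\<^sup>l\<^sup>+\<^sup>1\<close>, up to its constant term.\<close>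

definition faa :: "nat \<Rightarrow> nat \<Rightarrow> 'r::comm_ring_1 falg" where
  "faa l t = fps_nth (gser ^ Suc l) t"

lemma faa_0: "faa 0 t = (if t = 0 then 1 else gen t)"
  by (simp add: faa_def gser_def)

lemma faa_split: "faa (Suc (l + m)) t = (\<Sum>s\<le>t. faa l s * faa m (t - s))"
proof -
  have "gser ^ Suc (Suc (l + m)) = (gser ^ Suc l * gser ^ Suc m :: 'a falg fps)"
    by (metis add_Suc add_Suc_right power_add)
  then show ?thesis unfolding faa_def by (simp add: fps_mult_nth atLeast0AtMost del: power_Suc)
qed

lemma faa_Suc: "faa (Suc l) t = (\<Sum>s\<le>t. faa l s * faa 0 (t - s))"
  using faa_split[of l 0 t] by simp

lemma faa_at_0: "faa l 0 = 1"
  by (induction l) (simp_all add: faa_0 faa_Suc)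

text \<open>With \<open>faa 0 0 = 1\<close> and \<open>faa m 0 = 1\<close> the two outer terms of
  the coproduct become the terms \<open>m = n\<close> and \<open>m = 0\<close> of a single sum. The
  letter 0 lies in no \<open>letters \<nu>\<close>; declaring it primitive keeps
  \<open>coassoc\<close>, \<open>counit_delta\<close> and \<open>antipode_delta\<close> valid for
  all words.\<close>

definition com :: "nat \<Rightarrow> (nat list \<times> nat list \<Rightarrow>\<^sub>0 'r::comm_ring_1)" where
  "com n = (if n = 0 then tens (gen 0) 1 + tens 1 (gen 0) else (\<Sum>m\<le>n. tens (faa 0 m) (faa m (n - m))))"

definition cow :: "nat list \<Rightarrow> (nat list \<times> nat list \<Rightarrow>\<^sub>0 'r::comm_ring_1)" where
  "cow w = prod_list (map com w)"

definition delta :: "'r::comm_ring_1 falg \<Rightarrow> (nat list \<times> nat list \<Rightarrow>\<^sub>0 'r)" where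
  "delta = lext cow"

lemma cow_append: "cow (u @ v) = cow u * cow v" "cow [] = 1" "cow [n] = com n" "cow (n # w) = com n * cow w"
  by (simp_all add: cow_def)

lemma delta_mult: "delta (x * y) = delta x * delta y"
  unfolding delta_def by (rule lext_mult) (simp add: plus_list_def cow_append)

lemma delta_one: "delta 1 = 1"
  unfolding delta_def by (rule lext_one) (simp add: zero_list_def cow_append)

lemma delta_gen: "delta (gen n) = com n"
  by (simp add: delta_def gen_def cow_append)

text \<open>The formula that defines the coproduct of a generator is the case \<open>l = 0\<close>.
  It passes to higher powers of the series by multiplying the formulas for \<open>l\<close> and 0
  and sorting by the total degree \<open>N\<close> of the left factor. The right factors are then
  coefficients of the powers with exponents \<open>l + M + 1\<close> and \<open>N - M + 1\<close>,
  whose product has exponent \<open>l + N + 2\<close> whatever \<open>M\<close> is, so that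
  \<open>faa_split\<close> recombines them.\<close>

lemma delta_faa: "delta (faa l t) = (\<Sum>M\<le>t. tens (faa l M) (faa (l + M) (t - M)))"
proof (induction l arbitrary: t)
  case 0
  show ?case by (cases "t = 0") (simp_all add: faa_0 delta_one delta_gen com_def faa_at_0 tens_one)
next
  case (Suc l)
  have z: "delta (faa 0 t) = (\<Sum>M\<le>t. tens (faa 0 M) (faa M (t - M)) :: _ \<Rightarrow>\<^sub>0 'a)" for t
    by (cases "t = 0") (simp_all add: faa_0 delta_one delta_gen com_def faa_at_0 tens_one)
  have ar: "t - (M + m) - (s - M) = t - s - m" if "M \<le> s" for t s M m :: nat
    using that by linarith
  let ?f = "\<lambda>(s::nat) (M::nat) (m::nat). tens (faa l M * faa 0 m) (faa (l + M) (s - M) * faa m (t - s - m)) :: _ \<Rightarrow>\<^sub>0 'a"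
  have "delta (faa (Suc l) t) = (\<Sum>s\<le>t. delta (faa l s) * delta (faa 0 (t - s)) :: _ \<Rightarrow>\<^sub>0 'a)"
    unfolding faa_Suc by (simp add: delta_def lext_sum) (simp add: delta_def[symmetric] delta_mult)
  also have "\<dots> = (\<Sum>s\<le>t. \<Sum>M\<le>s. \<Sum>m\<le>t-s. ?f s M m)"
    by (simp add: Suc z sum_product tens_mult)
  also have "\<dots> = (\<Sum>(s, M, m)\<in>(SIGMA s:{..t}. {..s} \<times> {..t-s}). ?f s M m)"
    by (simp add: sum.Sigma sum.cartesian_product)
  \<comment> \<open>\<open>N = M + m\<close> is the total degree on the left, and
    \<open>s' = s - M\<close> is the degree contributed by the first of the two right
    factors.\<close>
  also have "\<dots> = (\<Sum>(N, M, s')\<in>(SIGMA N:{..t}. {..N} \<times> {..t-N}). 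
      tens (faa l M * faa 0 (N - M)) (faa (l + M) s' * faa (N - M) (t - N - s')))"
    by (rule sum.reindex_bij_witness[where i="\<lambda>(N, M, s'). (M + s', M, N - M)" and j="\<lambda>(s, M, m). (M + m, M, s - M)"])
      (auto simp: ar add.commute)
  also have "\<dots> = (\<Sum>N\<le>t. \<Sum>M\<le>N. \<Sum>s'\<le>t-N. tens (faa l M * faa 0 (N - M)) (faa (l + M) s' * faa (N - M) (t - N - s')))"
    by (simp add: sum.Sigma sum.cartesian_product)
  also have "\<dots> = (\<Sum>N\<le>t. \<Sum>M\<le>N. tens (faa l M * faa 0 (N - M)) (faa (Suc l + N) (t - N)))"
  proof (intro sum.cong refl)
    fix N M :: nat assume "M \<in> {..N}"
    then have "Suc l + N = Suc (l + M + (N - M))" by simp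
    then have "faa (Suc l + N) (t - N) = (\<Sum>s'\<le>t-N. faa (l + M) s' * faa (N - M) (t - N - s') :: 'a falg)"
      by (simp only: faa_split)
    then show "(\<Sum>s'\<le>t-N. tens (faa l M * faa 0 (N - M)) (faa (l + M) s' * faa (N - M) (t - N - s'))) =
       (tens (faa l M * faa 0 (N - M)) (faa (Suc l + N) (t - N)) :: _ \<Rightarrow>\<^sub>0 'a)"
      by (simp only: tens_sum_right)
  qed
  also have "\<dots> = (\<Sum>N\<le>t. tens (faa (Suc l) N) (faa (Suc l + N) (t - N)))"
    by (simp add: faa_Suc tens_sum_left)
  finally show ?case .
qed

definition delta12 :: "(nat list \<times> nat list \<Rightarrow>\<^sub>0 'r::comm_ring_1) \<Rightarrow> (nat list \<times> nat list \<times> nat list \<Rightarrow>\<^sub>0 'r)" where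
  "delta12 = lext (\<lambda>(u, v). e12 (cow u) * e3 (W v))"

definition delta23 :: "(nat list \<times> nat list \<Rightarrow>\<^sub>0 'r::comm_ring_1) \<Rightarrow> (nat list \<times> nat list \<times> nat list \<Rightarrow>\<^sub>0 'r)" where
  "delta23 = lext (\<lambda>(u, v). e1 (W u) * e23 (cow v))"

lemma delta12_sum: "delta12 (sum f I) = (\<Sum>i\<in>I. delta12 (f i))"
  and delta23_sum: "delta23 (sum f I) = (\<Sum>i\<in>I. delta23 (f i))"
  and delta12_add: "delta12 (x + y) = delta12 x + delta12 y"
  and delta23_add: "delta23 (x + y) = delta23 x + delta23 y"
  by (simp_all add: delta12_def delta23_def lext_sum)

lemma delta12_mult: "delta12 (x * y) = delta12 x * delta12 y"
  unfolding delta12_def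
proof (rule lext_mult, clarsimp)
  fix u v u' v' :: "nat list"
  have "e12 (cow (u + u')) * e3 (W (v + v')) = e12 (cow u) * (e12 (cow u') * e3 (W v)) * (e3 (W v') :: _ \<Rightarrow>\<^sub>0 'a)"
    by (simp add: plus_list_def cow_append e12_mult W_mult[symmetric] e3_mult mult.assoc) (simp add: plus_list_def[symmetric] W_mult[symmetric] e3_mult)
  then show "e12 (cow (u + u')) * e3 (W (v + v')) = e12 (cow u) * e3 (W v) * (e12 (cow u') * (e3 (W v') :: _ \<Rightarrow>\<^sub>0 'a))"
    unfolding e12_e3_commute[of "cow u'" "W v"] by (simp add: mult.assoc)
qed

lemma delta23_mult: "delta23 (x * y) = delta23 x * delta23 y"
  unfolding delta23_def
proof (rule lext_mult, clarsimp)
  fix u v u' v' :: "nat list"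
  have "e1 (W (u + u')) * e23 (cow (v + v')) = e1 (W u) * (e1 (W u') * e23 (cow v)) * (e23 (cow v') :: _ \<Rightarrow>\<^sub>0 'a)"
    by (simp add: plus_list_def cow_append e23_mult mult.assoc) (simp add: plus_list_def[symmetric] W_mult[symmetric] e1_mult mult.assoc)
  then show "e1 (W (u + u')) * e23 (cow (v + v')) = e1 (W u) * e23 (cow v) * (e1 (W u') * (e23 (cow v') :: _ \<Rightarrow>\<^sub>0 'a))"
    unfolding e1_e23_commute[of "W u'" "cow v"] by (simp add: mult.assoc)
qed

lemma delta12_one: "delta12 1 = 1" and delta23_one: "delta23 1 = 1"
  unfolding delta12_def delta23_def
  by (rule lext_one; simp add: zero_prod_def zero_list_def cow_append e_one; simp add: zero_list_def[symmetric] e_one)+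

lemma delta12_tens: "delta12 (tens x y) = e12 (delta x) * e3 y"
proof -
  have "delta12 (lext (\<lambda>u. W (u, 0)) x) = e12 (delta x)"
    by (simp add: delta12_def delta_def e12_def lext_lext e_one)
  moreover have "delta12 (lext (\<lambda>v. W (0, v)) y) = e3 y"
    by (simp add: delta12_def lext_lext e_one cow_append zero_list_def) (simp add: e3_def)
  ultimately show ?thesis by (simp add: tens_def delta12_mult)
qed

lemma delta23_tens: "delta23 (tens x y) = e1 x * e23 (delta y)"
proof -
  have "delta23 (lext (\<lambda>v. W (0, v)) y) = e23 (delta y)"
    by (simp add: delta23_def delta_def e23_def lext_lext e_one)
  moreover have "delta23 (lext (\<lambda>u. W (u, 0)) x) = e1 x"
    by (simp add: delta23_def lext_lext e_one cow_append zero_list_def) (simp add: e1_def)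
  ultimately show ?thesis by (simp add: tens_def delta23_mult)
qed

text \<open>Both sides are the sum over \<open>k + M + r = n\<close> of
  \<open>faa 0 k \<otimes> faa k M \<otimes> faa (k + M) r\<close>: on the left by
  \<open>delta_faa\<close> for the power \<open>l = 0\<close>, on the right by
  \<open>delta_faa\<close> for \<open>l = k\<close>. The coproduct formula for all powers is what
  makes the right side computable.\<close>

lemma coassoc_com: "delta12 (com n) = delta23 (com n)"
proof (cases "n = 0")
  case True
  show ?thesis
    by (simp add: True com_def delta12_add delta23_add delta12_tens delta23_tens delta_gen delta_one e_one e_add e12_tens e23_tens add_ac)
next
  case False
  let ?t = "\<lambda>k M r. e1 (faa 0 k) * e2 (faa k M) * e3 (faa (k + M) r) :: _ \<Rightarrow>\<^sub>0 'a"
  have "delta12 (com n) = (\<Sum>m\<le>n. \<Sum>k\<le>m. e1 (faa 0 k) * e2 (faa k (m - k)) * e3 (faa m (n - m)) :: _ \<Rightarrow>\<^sub>0 'a)"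
    using False by (simp add: com_def delta12_sum delta12_tens delta_faa e_sum sum_distrib_right e12_tens)
  also have "\<dots> = (\<Sum>(m, k)\<in>(SIGMA m:{..n}. {..m}). ?t k (m - k) (n - m))"
    by (subst sum.Sigma) (auto intro!: sum.cong)
  also have "\<dots> = (\<Sum>(k, M)\<in>(SIGMA k:{..n}. {..n-k}). ?t k M (n - k - M))"
    by (rule sum.reindex_bij_witness[where i="\<lambda>(k, M). (k + M, k)" and j="\<lambda>(m, k). (k, m - k)"]) auto
  also have "\<dots> = (\<Sum>k\<le>n. \<Sum>M\<le>n-k. ?t k M (n - k - M))"
    by (subst sum.Sigma) auto
  also have "\<dots> = delta23 (com n)"
    using False by (simp add: com_def delta23_sum delta23_tens delta_faa e_sum sum_distrib_left e23_tens mult.assoc)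
  finally show ?thesis .
qed

lemma coassoc: "delta12 (delta x) = delta23 (delta x)"
proof -
  have "delta12 (cow w) = delta23 (cow w :: _ \<Rightarrow>\<^sub>0 'a)" for w
    by (induction w) (simp_all add: cow_append delta12_one delta23_one delta12_mult delta23_mult coassoc_com)
  then have "lext (\<lambda>w. delta12 (cow w)) x = lext (\<lambda>w. delta23 (cow w)) x" by simp
  then show ?thesis by (simp add: delta_def delta12_def delta23_def lext_lext)
qed

section \<open>Degrees and supports\<close>

definition words :: "nat set \<Rightarrow> nat \<Rightarrow> nat list set" where
  "words S d = {w. set w \<subseteq> S \<and> sum_list w = d}"

definition words2 :: "nat set \<Rightarrow> nat \<Rightarrow> (nat list \<times> nat list) set" where
  "words2 S d = {(u, v). set u \<subseteq> S \<and> set v \<subseteq> S \<and> sum_list u + sum_list v = d}"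

lemma keys_mult_words:
  assumes "Poly_Mapping.keys x \<subseteq> words S d" "Poly_Mapping.keys y \<subseteq> words S e"
  shows "Poly_Mapping.keys (x * y) \<subseteq> words S (d + e)"
proof
  fix w assume "w \<in> Poly_Mapping.keys (x * y)"
  then obtain p q where "p \<in> words S d" "q \<in> words S e" "w = p + q"
    using assms by (meson keys_multD subsetD)
  then show "w \<in> words S (d + e)" by (simp add: words_def plus_list_def)
qed

lemma keys_mult_words2:
  assumes "Poly_Mapping.keys x \<subseteq> words2 S d" "Poly_Mapping.keys y \<subseteq> words2 S e"
  shows "Poly_Mapping.keys (x * y) \<subseteq> words2 S (d + e)"
proof
  fix w assume "w \<in> Poly_Mapping.keys (x * y)"
  then obtain p q where "p \<in> words2 S d" "q \<in> words2 S e" "w = p + q"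
    using assms by (meson keys_multD subsetD)
  then show "w \<in> words2 S (d + e)" by (cases p; cases q) (simp add: words2_def plus_list_def)
qed

lemma keys_tens: "Poly_Mapping.keys (tens x y) \<subseteq> Poly_Mapping.keys x \<times> Poly_Mapping.keys y"
  by (auto simp: in_keys_iff lookup_tens)

lemma keys_tens_words2:
  assumes "Poly_Mapping.keys x \<subseteq> words S d" "Poly_Mapping.keys y \<subseteq> words S e"
  shows "Poly_Mapping.keys (tens x y) \<subseteq> words2 S (d + e)"
proof
  fix p assume "p \<in> Poly_Mapping.keys (tens x y)"
  then have "fst p \<in> words S d" "snd p \<in> words S e" using keys_tens[of x y] assms by (auto simp only: subset_iff mem_Times_iff)
  then show "p \<in> words2 S (d + e)" by (cases p) (simp add: words_def words2_def)
qed

lemma keys_sum_subset: "(\<And>i. i \<in> I \<Longrightarrow> Poly_Mapping.keys (f i) \<subseteq> K) \<Longrightarrow> Poly_Mapping.keys (sum f I) \<subseteq> K"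
  using keys_sum[of f I] by blast

lemma keys_one_words: "Poly_Mapping.keys (1 :: 'r::comm_ring_1 falg) \<subseteq> words S 0"
  by (simp add: words_def zero_list_def)

lemma keys_one_words2: "Poly_Mapping.keys (1 :: nat list \<times> nat list \<Rightarrow>\<^sub>0 'r::comm_ring_1) \<subseteq> words2 S 0"
  by (simp add: words2_def zero_prod_def zero_list_def)

lemma keys_gen_words: "n \<in> S \<Longrightarrow> Poly_Mapping.keys (gen n :: 'r::comm_ring_1 falg) \<subseteq> words S n"
  by (simp add: gen_def words_def)

text \<open>The coproduct and the antipode of \<open>gen n\<close> involve smaller positive letters,
  so this is the condition under which they stay among words in \<open>S\<close>.\<close>

definition downset :: "nat set \<Rightarrow> bool" where
  "downset S \<longleftrightarrow> (\<forall>n\<in>S. {1..n} \<subseteq> S)"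

lemma downset_letters: "downset (letters \<nu>)"
  by (auto simp: downset_def letters_def) (meson enat_ord_simps(1) order_trans)

lemma keys_faa_words:
  "{1..t} \<subseteq> S \<Longrightarrow> Poly_Mapping.keys (faa l t :: 'r::comm_ring_1 falg) \<subseteq> words S t"
proof (induction l arbitrary: t)
  case 0
  show ?case
  proof (cases "t = 0")
    case True then show ?thesis using keys_one_words by (simp add: faa_0)
  next
    case False
    then have "t \<in> S" using 0 by auto
    from keys_gen_words[OF this] False show ?thesis by (simp add: faa_0)
  qed
next
  case (Suc l)
  have z: "Poly_Mapping.keys (faa 0 t :: 'r falg) \<subseteq> words S t" if "{1..t} \<subseteq> S" for t
  proof (cases "t = 0")
    case True then show ?thesis using keys_one_words by (simp add: faa_0)
  next
    case False
    then have "t \<in> S" using that by auto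
    from keys_gen_words[OF this] False show ?thesis by (simp add: faa_0)
  qed
  show ?case unfolding faa_Suc
  proof (rule keys_sum_subset)
    fix s assume "s \<in> {..t}"
    then have "{1..s} \<subseteq> {1..t}" "{1..t - s} \<subseteq> {1..t}" "s + (t - s) = t" by auto
    then have "{1..s} \<subseteq> S" "{1..t - s} \<subseteq> S" "s + (t - s) = t" using Suc.prems by blast+
    then show "Poly_Mapping.keys (faa l s * faa 0 (t - s) :: 'r falg) \<subseteq> words S t"
      using keys_mult_words[OF Suc.IH[of s] z[of "t - s"]] by simp
  qed
qed

lemma keys_com_words2:
  assumes "downset S" "n \<in> S"
  shows "Poly_Mapping.keys (com n :: nat list \<times> nat list \<Rightarrow>\<^sub>0 'r::comm_ring_1) \<subseteq> words2 S n"
proof (cases "n = 0")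
  case True
  have "Poly_Mapping.keys (tens (gen 0) 1 :: nat list \<times> nat list \<Rightarrow>\<^sub>0 'r) \<subseteq> words2 S 0"
    "Poly_Mapping.keys (tens 1 (gen 0) :: nat list \<times> nat list \<Rightarrow>\<^sub>0 'r) \<subseteq> words2 S 0"
    using keys_tens_words2[OF keys_gen_words[of 0 S] keys_one_words[of S]] 
      keys_tens_words2[OF keys_one_words[of S] keys_gen_words[of 0 S]] assms True by auto
  moreover have "com n = tens (gen 0) (1 :: 'r falg) + tens 1 (gen 0)" using True by (simp add: com_def)
  ultimately show ?thesis using keys_add[of "tens (gen 0) (1 :: 'r falg)" "tens 1 (gen 0)"] unfolding True by auto
next
  case False
  then show ?thesis
    unfolding com_def
  proof (simp, intro keys_sum_subset)
    fix m assume m: "m \<in> {..n}"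
    have S: "{1..n} \<subseteq> S" using assms by (auto simp: downset_def)
    have "{1..m} \<subseteq> {1..n}" "{1..n - m} \<subseteq> {1..n}" using m by auto
    then have "{1..m} \<subseteq> S" "{1..n - m} \<subseteq> S" using S by blast+
    from keys_tens_words2[OF keys_faa_words[OF this(1)] keys_faa_words[OF this(2)]]
    show "Poly_Mapping.keys (tens (faa 0 m) (faa m (n - m)) :: nat list \<times> nat list \<Rightarrow>\<^sub>0 'r) \<subseteq> words2 S n"
      using m by simp
  qed
qed

lemma keys_cow_words2:
  assumes "downset S" "w \<in> words S d"
  shows "Poly_Mapping.keys (cow w :: nat list \<times> nat list \<Rightarrow>\<^sub>0 'r::comm_ring_1) \<subseteq> words2 S d"
  using assms(2)
proof (induction w arbitrary: d)
  case Nil then show ?case using keys_one_words2 by (simp add: cow_append words_def)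
next
  case (Cons n w)
  then have "n \<in> S" "w \<in> words S (d - n)" and d: "n + (d - n) = d" by (auto simp: words_def)
  from keys_mult_words2[OF keys_com_words2[OF assms(1) this(1)] Cons.IH[OF this(2)]]
  show ?case unfolding d cow_append .
qed

lemma keys_delta_words2:
  assumes "downset S" "Poly_Mapping.keys x \<subseteq> words S d"
  shows "Poly_Mapping.keys (delta x) \<subseteq> words2 S d"
proof
  fix p assume "p \<in> Poly_Mapping.keys (delta x)"
  then obtain w where "w \<in> Poly_Mapping.keys x" "p \<in> Poly_Mapping.keys (cow w :: _ \<Rightarrow>\<^sub>0 'a)"
    using keys_lext[of cow x] unfolding delta_def by blast
  then show "p \<in> words2 S d" using keys_cow_words2[OF assms(1), of w d] assms(2) by blast
qed

lemma keys_delta_letters: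
  assumes "downset S" "\<forall>w\<in>Poly_Mapping.keys x. set w \<subseteq> S" "(u, v) \<in> Poly_Mapping.keys (delta x)"
  shows "set u \<subseteq> S" "set v \<subseteq> S"
proof -
  obtain w where "w \<in> Poly_Mapping.keys x" "(u, v) \<in> Poly_Mapping.keys (cow w :: _ \<Rightarrow>\<^sub>0 'a)"
    using assms(3) keys_lext[of cow x] unfolding delta_def by blast
  then have "(u, v) \<in> words2 S (sum_list w)"
    using keys_cow_words2[OF assms(1), of w "sum_list w"] assms(2) by (auto simp: words_def)
  then show "set u \<subseteq> S" "set v \<subseteq> S" by (auto simp: words2_def)
qed

section \<open>Counit and antipode\<close>

definition eps :: "'r::comm_ring_1 falg \<Rightarrow> 'r" where
  "eps x = Poly_Mapping.lookup x []"

lemma eps_simps [simp]: "eps 0 = 0" "eps (x + y) = eps x + eps y" "eps (x - y) = eps x - eps y" "eps (- x) = - eps x"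
  "eps (smul c x) = c * eps x" "eps (Poly_Mapping.single u c) = (if u = [] then c else 0)"
  by (simp_all add: eps_def lookup_add lookup_minus lookup_single when_def)

lemma eps_one [simp]: "eps 1 = 1"
  by (simp add: eps_def lookup_one zero_list_def)

lemma eps_gen [simp]: "eps (gen n) = 0"
  by (simp add: gen_def)

lemma eps_mult [simp]: "eps (x * y) = eps x * eps y"
proof (induction x rule: pm_induct)
  case (add u c x)
  have "eps (Poly_Mapping.single u c * y) = (if u = [] then c else 0) * eps y"
    by (induction y rule: pm_induct) (auto simp: algebra_simps mult_single plus_list_def)
  with add show ?case by (simp add: algebra_simps)
qed simp

lemma eps_faa: "eps (faa l t) = (if t = 0 then 1 else 0)"
proof (cases "t = 0")
  case False
  then have "[] \<notin> Poly_Mapping.keys (faa l t)"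
    using keys_faa_words[of t UNIV l] by (auto simp: words_def)
  then show ?thesis using False by (simp add: eps_def in_keys_iff)
qed (simp add: faa_at_0)

definition counit_left :: "(nat list \<times> nat list \<Rightarrow>\<^sub>0 'r::comm_ring_1) \<Rightarrow> 'r falg" where
  "counit_left = lext (\<lambda>(u, v). smul (eps (W u)) (W v))"

definition counit_right :: "(nat list \<times> nat list \<Rightarrow>\<^sub>0 'r::comm_ring_1) \<Rightarrow> 'r falg" where
  "counit_right = lext (\<lambda>(u, v). smul (eps (W v)) (W u))"

lemma lext_smul_W: "lext (\<lambda>v. smul c (W v)) y = smul c y"
  by (induction y rule: pm_induct) (simp_all add: smul_add mult.commute)

lemma lext_eps: "lext (\<lambda>u. smul (eps (W u)) y) x = smul (eps x) y"
  by (induction x rule: pm_induct) (auto simp: smul_add_left smul_smul)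

lemma counit_left_tens: "counit_left (tens x y) = smul (eps x) y"
  unfolding counit_left_def tens_lext
  by (simp only: lext_lext prod.case lext_simps(5) smul_one lext_smul_W lext_eps)

lemma counit_right_tens: "counit_right (tens x y) = smul (eps y) x"
  unfolding counit_right_def tens_lext
  by (simp only: lext_lext prod.case lext_simps(5) smul_one lext_smul_W lext_eps)

lemma counit_left_mult: "counit_left (x * y) = counit_left x * counit_left y"
  and counit_right_mult: "counit_right (x' * y') = counit_right x' * counit_right y'"
  unfolding counit_left_def counit_right_def
  by (rule lext_mult; clarsimp simp: plus_list_def W_mult)+

lemma counit_left_com: "counit_left (com n) = gen n"
proof (cases "n = 0")
  case False
  have "counit_left (com n) = (\<Sum>m\<le>n. counit_left (tens (faa 0 m) (faa m (n - m))) :: 'a falg)"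
    using False by (simp add: com_def counit_left_def lext_sum)
  also have "\<dots> = (\<Sum>m\<le>n. if m = 0 then gen n else 0)"
    using False by (intro sum.cong) (auto simp: counit_left_tens eps_faa faa_0)
  finally show ?thesis by simp
next
  case True
  have "counit_left (x + y) = counit_left x + counit_left y" for x y :: "_ \<Rightarrow>\<^sub>0 'a"
    by (simp add: counit_left_def)
  then show ?thesis by (simp add: True com_def counit_left_tens)
qed

lemma counit_right_com: "counit_right (com n) = gen n"
proof (cases "n = 0")
  case False
  have "counit_right (com n) = (\<Sum>m\<le>n. counit_right (tens (faa 0 m) (faa m (n - m))) :: 'a falg)"
    using False by (simp add: com_def counit_right_def lext_sum)
  also have "\<dots> = (\<Sum>m\<le>n. if m = n then gen n else 0)"
    using False by (intro sum.cong) (auto simp: counit_right_tens eps_faa faa_0)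
  finally show ?thesis by simp
next
  case True
  have "counit_right (x + y) = counit_right x + counit_right y" for x y :: "_ \<Rightarrow>\<^sub>0 'a"
    by (simp add: counit_right_def)
  then show ?thesis by (simp add: True com_def counit_right_tens)
qed

lemma gen_W: "gen n * W w = W (n # w)"
  by (simp add: gen_def mult_single plus_list_def)

lemma W_Nil: "W [] = (1 :: 'r::comm_ring_1 falg)"
  using W_zero[where 'a="nat list"] by (simp add: zero_list_def)

lemma counit_delta: "counit_left (delta x) = x" "counit_right (delta x) = x"
proof -
  have o: "counit_left 1 = (1 :: 'a falg)" "counit_right 1 = (1 :: 'a falg)"
    using counit_left_tens[of 1 "1 :: 'a falg"] counit_right_tens[of 1 "1 :: 'a falg"] by (simp_all add: tens_one)
  have "counit_left (cow w) = (W w :: 'a falg)" "counit_right (cow w) = (W w :: 'a falg)" for w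
    by (induction w) (simp_all add: cow_append o W_Nil counit_left_mult counit_right_mult counit_left_com counit_right_com gen_W)
  then show "counit_left (delta x) = x" "counit_right (delta x) = x"
    using lext_W[of x] by (simp_all add: delta_def counit_left_def counit_right_def lext_lext)
qed

definition antw :: "nat list \<Rightarrow> 'r::comm_ring_1 falg" where
  "antw w = prod_list (map antipode_gen (rev w))"

definition ant :: "'r::comm_ring_1 falg \<Rightarrow> 'r falg" where
  "ant = lext antw"

lemma antw_simps [simp]: "antw [] = 1" "antw (u @ v) = antw v * antw u" "antw [n] = antipode_gen n"
  "antw (n # w) = antw w * antipode_gen n"
  by (simp_all add: antw_def)

lemma ant_mult: "ant (x * y) = ant y * ant x"
proof (induction x rule: pm_induct)
  case (add u c x)
  have "ant (Poly_Mapping.single u c * y) = ant y * smul c (antw u)"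
    unfolding ant_def by (induction y rule: pm_induct)
      (simp_all add: algebra_simps mult_single plus_list_def mult_smul_left mult_smul_right smul_smul smul_add mult.commute)
  with add show ?case by (simp add: algebra_simps ant_def)
qed (simp add: ant_def)

lemma ant_simps [simp]: "ant 0 = 0" "ant 1 = 1" "ant (gen n) = antipode_gen n" "ant (x + y) = ant x + ant y" "ant (smul c x) = smul c (ant x)"
  "ant (- x) = - ant x" "ant (x - y) = ant x - ant y"
  by (simp_all add: ant_def gen_def lext_one zero_list_def lext_smul)

definition ant_left :: "(nat list \<times> nat list \<Rightarrow>\<^sub>0 'r::comm_ring_1) \<Rightarrow> 'r falg" where
  "ant_left = lext (\<lambda>(u, v). antw u * W v)"

definition ant_right :: "(nat list \<times> nat list \<Rightarrow>\<^sub>0 'r::comm_ring_1) \<Rightarrow> 'r falg" where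
  "ant_right = lext (\<lambda>(u, v). W u * antw v)"

lemma ant_left_tens: "ant_left (tens x y) = ant x * y"
proof -
  have "lext (\<lambda>v. a * W v) y = a * y" for a :: "'a falg"
    by (simp add: lext_mult_left lext_W)
  then show ?thesis unfolding ant_left_def tens_lext ant_def
    by (simp add: lext_lext lext_mult_right)
qed

lemma ant_right_tens: "ant_right (tens x y) = x * ant y"
  unfolding ant_right_def tens_lext ant_def
  by (simp add: lext_lext lext_mult_right lext_mult_left lext_W)

section \<open>The polynomials \<open>Q_poly\<close> as coefficients of powers of the generating
  series\<close>

text \<open>This is applied to power series over the noncommutative free algebra; the expansion
  holds there because 1 and \<open>b\<close> commute.\<close>

lemma binomial_one: "(1 + b) ^ m = (\<Sum>k\<le>m. of_nat (m choose k) * b ^ k)" for b :: "'a::semiring_1"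
proof (induction m)
  case (Suc m)
  have "(\<Sum>k\<le>m. of_nat (m choose k) * b ^ k) = (\<Sum>k\<le>Suc m. of_nat (m choose k) * b ^ k)" by (simp add: binomial_eq_0)
  also have "\<dots> = 1 + (\<Sum>k\<le>m. of_nat (m choose Suc k) * b ^ Suc k)"
    by (subst sum.atMost_Suc_shift) simp
  finally have 1: "(\<Sum>k\<le>m. of_nat (m choose k) * b ^ k) = 1 + (\<Sum>k\<le>m. of_nat (m choose Suc k) * b ^ Suc k)" .
  have 2: "b * (\<Sum>k\<le>m. of_nat (m choose k) * b ^ k) = (\<Sum>k\<le>m. of_nat (m choose k) * b ^ Suc k)"
  proof -
    have "b * (of_nat c * b ^ k) = of_nat c * b ^ Suc k" for c k
      unfolding mult.assoc[symmetric] mult_of_nat_commute[of c b, symmetric] by (simp add: mult.assoc)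
    then show ?thesis by (simp only: sum_distrib_left)
  qed
  have "(1 + b) ^ Suc m = (\<Sum>k\<le>m. of_nat (m choose k) * b ^ k) + b * (\<Sum>k\<le>m. of_nat (m choose k) * b ^ k)"
    by (simp add: Suc distrib_right)
  also have "\<dots> = 1 + ((\<Sum>k\<le>m. of_nat (m choose k) * b ^ Suc k) + (\<Sum>k\<le>m. of_nat (m choose Suc k) * b ^ Suc k))"
    unfolding 2 unfolding 1 by (simp add: algebra_simps)
  also have "\<dots> = (\<Sum>k\<le>Suc m. of_nat (Suc m choose k) * b ^ k)"
    by (subst sum.atMost_Suc_shift) (simp add: distrib_right sum.distrib)
  finally show ?case .
qed simp

definition bser :: "'r::comm_ring_1 falg fps" where
  "bser = Abs_fps (\<lambda>n. if n = 0 then 0 else gen n)"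

lemma bser_nth: "fps_nth bser n = (if n = 0 then 0 else gen n)"
  by (simp add: bser_def)

lemma gser_bser: "gser = 1 + bser"
  by (rule fps_ext) (simp add: gser_def bser_def)

lemma finite_compositions: "finite {js. length js = k \<and> (\<forall>j\<in>set js. 0 < j) \<and> sum_list js = (t::nat)}"
proof (rule finite_subset)
  show "{js. length js = k \<and> (\<forall>j\<in>set js. 0 < j) \<and> sum_list js = t} \<subseteq> {js. set js \<subseteq> {..t} \<and> length js = k}"
    by (auto dest: member_le_sum_list)
qed (simp add: finite_lists_length_eq)

lemma bser_power: "fps_nth (bser ^ k) t = (P_poly k t :: 'r::comm_ring_1 falg)"
proof (induction k arbitrary: t)
  case 0
  have "{js :: nat list. length js = 0 \<and> (\<forall>j\<in>set js. 0 < j) \<and> sum_list js = t} = (if t = 0 then {[]} else {})" by auto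
  then show ?case by (simp add: P_poly_def)
next
  case (Suc k)
  let ?C = "\<lambda>k t. {js :: nat list. length js = k \<and> (\<forall>j\<in>set js. 0 < j) \<and> sum_list js = t}"
  have "fps_nth (bser ^ Suc k) t = (\<Sum>j\<in>{0..t}. if j = 0 then 0 else gen j * P_poly k (t - j) :: 'r falg)"
    by (simp add: fps_mult_nth Suc bser_nth) (intro sum.cong refl; simp)
  also have "\<dots> = (\<Sum>j\<in>{1..t}. gen j * P_poly k (t - j))"
    by (rule sum.mono_neutral_cong_right) auto
  also have "\<dots> = (\<Sum>j\<in>{1..t}. \<Sum>js\<in>?C k (t - j). prod_list (map gen (j # js)))"
    by (simp add: P_poly_def sum_distrib_left)
  also have "\<dots> = (\<Sum>(j, js)\<in>(SIGMA j:{1..t}. ?C k (t - j)). prod_list (map gen (j # js)))"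
    by (rule sum.Sigma) (simp_all add: finite_compositions)
  also have "\<dots> = (\<Sum>js\<in>?C (Suc k) t. prod_list (map gen js))"
    by (rule sum.reindex_bij_witness[where i="\<lambda>js. (hd js, tl js)" and j="\<lambda>(j, js). j # js"])
      (auto simp: length_Suc_conv)
  finally show ?case by (simp add: P_poly_def)
qed

text \<open>The generating series is \<open>1 + bser\<close>, and the coefficients of
  \<open>bser ^ k\<close> are the sums over compositions with \<open>k\<close> parts
  (\<open>bser_power\<close>). The binomial theorem therefore produces the defining sum of
  \<open>Q_poly\<close>.\<close>

lemma Q_poly_faa:
  assumes "t > 0" shows "Q_poly l t = (faa l t :: 'r::comm_ring_1 falg)"
proof -
  have "fps_nth (of_nat c * f) t = of_nat c * fps_nth f t" for c and f :: "'r falg fps"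
    by (simp flip: fps_of_nat)
  then have "faa l t = (\<Sum>k\<le>Suc l. of_nat (Suc l choose k) * P_poly k t :: 'r falg)"
    unfolding faa_def gser_bser binomial_one by (simp add: fps_sum_nth bser_power del: sum.atMost_Suc binomial_Suc_Suc)
  \<comment> \<open>The range is enlarged so that it contains \<open>{1..t}\<close>. The binomial
    coefficients vanish beyond \<open>Suc l\<close>; for \<open>k = 0\<close> or
    \<open>k > t\<close> there is no composition of the positive number \<open>t\<close> into
    \<open>k\<close> positive parts.\<close>
  also have "\<dots> = (\<Sum>k\<le>Suc l + t. of_nat (Suc l choose k) * P_poly k t)"
    by (rule sum.mono_neutral_left) (auto simp: binomial_eq_0 simp del: binomial_Suc_Suc)
  also have "\<dots> = (\<Sum>k\<in>{1..t}. of_nat (Suc l choose k) * P_poly k t)"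
  proof (rule sum.mono_neutral_right)
    have le: "length js \<le> sum_list js" if "\<forall>j\<in>set js. 0 < j" for js :: "nat list"
      using that by (induction js) auto
    show "\<forall>k\<in>{..Suc l + t} - {1..t}. of_nat (Suc l choose k) * P_poly k t = (0 :: 'r falg)"
    proof
      fix k assume "k \<in> {..Suc l + t} - {1..t}"
      then have "k = 0 \<or> k > t" by auto
      then have e: "{js :: nat list. length js = k \<and> (\<forall>j\<in>set js. 0 < j) \<and> sum_list js = t} = {}"
        using assms le by fastforce
      show "of_nat (Suc l choose k) * P_poly k t = (0 :: 'r falg)"
        by (simp only: P_poly_def e sum.empty mult_zero_right)
    qed
  qed auto
  finally show ?thesis by (simp add: Q_poly_def)
qed

section \<open>The antipode as a two-sided convolution inverse of the identity\<close>

lemma ant_left_single: "ant_left (x * Poly_Mapping.single (u', v') c) = smul c (antw u' * ant_left x * W v')"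
proof (induction x rule: pm_induct)
  case (add p d x)
  have "ant_left (y + z) = ant_left y + ant_left z" for y z :: "_ \<Rightarrow>\<^sub>0 'a" by (simp add: ant_left_def)
  then show ?case using add
    by (cases p) (simp add: ant_left_def distrib_left distrib_right mult.assoc mult_single plus_list_def smul_add mult_smul_left
      mult_smul_right smul_smul W_mult mult.commute[of c d])
qed (simp add: ant_left_def)

lemma ant_right_single: "ant_right (Poly_Mapping.single (u, v) c * y) = smul c (W u * ant_right y * antw v)"
proof (induction y rule: pm_induct)
  case (add p d y)
  have "ant_right (x + z) = ant_right x + ant_right z" for x z :: "_ \<Rightarrow>\<^sub>0 'a" by (simp add: ant_right_def)
  then show ?case using add
    by (cases p) (simp add: ant_right_def distrib_left distrib_right mult.assoc[symmetric] mult_single plus_list_def smul_add mult_smul_left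
      mult_smul_right smul_smul W_mult)
qed (simp add: ant_right_def)

text \<open>Since S reverses products, multiplying out gives
  \<open>S(y\<^sub>1) S(x\<^sub>1) x\<^sub>2 y\<^sub>2\<close>, and the inner product
  \<open>S(x\<^sub>1) x\<^sub>2\<close> can be pulled out as soon as it is a scalar. This reduces
  the antipode identity on words to single letters.\<close>

lemma ant_left_mult: "ant_left x = smul e 1 \<Longrightarrow> ant_left (x * y) = smul e (ant_left y)"
proof (induction y rule: pm_induct)
  case (add p d y)
  then show ?case
    by (cases p) (simp add: distrib_left ant_left_def[of] smul_add ant_left_single[unfolded ant_left_def] mult_smul_left
      mult_smul_right smul_smul mult.commute[of d e] del: smul_single)
qed (simp add: ant_left_def)

lemma ant_right_mult: "ant_right y = smul e 1 \<Longrightarrow> ant_right (x * y) = smul e (ant_right x)"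
proof (induction x rule: pm_induct)
  case (add p d x)
  then show ?case
    by (cases p) (simp add: distrib_right ant_right_def[of] smul_add ant_right_single[unfolded ant_right_def] mult_smul_left
      mult_smul_right smul_smul mult.commute[of d e] del: smul_single)
qed (simp add: ant_right_def)

lemma sum_ends: "(n :: nat) > 0 \<Longrightarrow> (\<Sum>m\<le>n. f m) = f 0 + (\<Sum>m\<in>{1..<n}. f m) + (f n :: 'a::ab_group_add)"
proof -
  assume "n > 0"
  then have "{..n} = insert 0 (insert n {1..<n})" by auto
  then show ?thesis using \<open>n > 0\<close> by (simp add: add_ac)
qed

lemma ant_left_com: "ant_left (com n) = (0 :: 'r::comm_ring_1 falg)"
proof (cases "n = 0")
  case True
  have "ant_left (y + z) = ant_left y + ant_left z" for y z :: "_ \<Rightarrow>\<^sub>0 'r" by (simp add: ant_left_def)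
  then show ?thesis by (simp add: True com_def ant_left_tens antipode_gen.simps[of 0])
next
  case False
  then have "ant_left (com n) = (\<Sum>m\<le>n. ant (faa 0 m) * faa m (n - m) :: 'r falg)"
    by (simp add: com_def ant_left_def lext_sum) (simp add: ant_left_def[symmetric] ant_left_tens)
  also have "\<dots> = gen n + (\<Sum>m\<in>{1..<n}. antipode_gen m * Q_poly m (n - m)) + antipode_gen n"
    using False by (subst sum_ends) (auto simp: faa_0 faa_at_0 Q_poly_faa intro!: sum.cong)
  finally show ?thesis by (simp add: antipode_gen.simps[of n])
qed

lemma ant_left_cow: "ant_left (cow w) = smul (eps (W w)) (1 :: 'r::comm_ring_1 falg)"
proof (cases w)
  case Nil
  then show ?thesis using ant_left_tens[of 1 1] by (simp add: cow_append tens_one)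
next
  case (Cons n w')
  have "ant_left (com n) = smul 0 (1 :: 'r falg)" by (simp add: ant_left_com)
  from ant_left_mult[OF this, of "cow w'"] show ?thesis using Cons by (simp add: cow_append)
qed

definition ant_mid :: "(nat list \<times> nat list \<times> nat list \<Rightarrow>\<^sub>0 'r::comm_ring_1) \<Rightarrow> 'r falg" where
  "ant_mid = lext (\<lambda>(u, v, w). antw u * W v * antw w)"

lemma ant_mid_12: "ant_mid (e12 d * e3 (W b)) = ant_left d * antw b"
proof (induction d rule: pm_induct)
  case (add p c d)
  have "ant_mid (x + z) = ant_mid x + ant_mid z" for x z :: "_ \<Rightarrow>\<^sub>0 'a" by (simp add: ant_mid_def)
  then show ?case using add
    by (cases p) (simp add: e_add distrib_right e12_def e3_def mult_single ant_mid_def ant_left_def mult_smul_left zero_list_def plus_list_def)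
qed (simp add: e12_def ant_mid_def ant_left_def)

lemma ant_mid_23: "ant_mid (e1 (W a) * e23 d) = antw a * ant_right d"
proof (induction d rule: pm_induct)
  case (add p c d)
  have "ant_mid (x + z) = ant_mid x + ant_mid z" for x z :: "_ \<Rightarrow>\<^sub>0 'a" by (simp add: ant_mid_def)
  then show ?case using add
    by (cases p) (simp add: e_add distrib_left e23_def e1_def mult_single ant_mid_def ant_right_def mult_smul_right zero_list_def plus_list_def mult.assoc)
qed (simp add: e23_def ant_mid_def ant_right_def)

text \<open>Coassociativity turns S * (id * S) into (S * id) * S, and S * id is the convolution unit
  by \<open>ant_left_cow\<close>. The map \<open>ant_mid\<close> evaluates both bracketings on the
  tensor cube.\<close>

lemma ant_conv: "lext (\<lambda>(u, v). antw u * ant_right (cow v)) (delta x) = ant x"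
proof -
  have "ant_mid (delta12 d) = ant (counit_left d)" for d :: "_ \<Rightarrow>\<^sub>0 'a"
  proof -
    have "ant_mid (delta12 d) = lext (\<lambda>(u, v). ant_left (cow u) * antw v) d"
      unfolding delta12_def ant_mid_12[symmetric] by (simp add: ant_mid_def lext_lext case_prod_unfold)
    also have "\<dots> = ant (counit_left d)"
      unfolding counit_left_def ant_def lext_lext
      by (intro lext_cong) (auto simp: ant_left_cow lext_smul mult_smul_left simp del: eps_simps)
    finally show ?thesis .
  qed
  moreover have "ant_mid (delta23 d) = lext (\<lambda>(u, v). antw u * ant_right (cow v)) d" for d :: "_ \<Rightarrow>\<^sub>0 'a"
    unfolding delta23_def ant_mid_23[symmetric] by (simp add: ant_mid_def lext_lext case_prod_unfold)
  ultimately have "lext (\<lambda>(u, v). antw u * ant_right (cow v)) (delta x) = ant (counit_left (delta x))"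
    using coassoc[of x] by metis
  then show ?thesis by (simp only: counit_delta)
qed

lemma ant_conv_tens: "lext (\<lambda>(u, v). antw u * F v) (tens x y) = ant x * lext F y"
  unfolding tens_lext ant_def by (simp add: lext_lext lext_mult_right lext_mult_left)

text \<open>This extends the induction hypothesis of \<open>ant_right_com\<close> from single
  letters below \<open>n\<close> to the second tensor factors \<open>faa m (n - m)\<close> with
  \<open>m \<ge> 1\<close>, which are written in those letters.\<close>

lemma ant_right_delta_small:
  assumes "\<And>k. k < n \<Longrightarrow> ant_right (com k) = (0 :: 'r::comm_ring_1 falg)" "\<forall>w\<in>Poly_Mapping.keys x. set w \<subseteq> {..<n}"
  shows "lext (\<lambda>v. ant_right (cow v)) x = smul (eps x) (1 :: 'r falg)"
proof -
  have *: "set w \<subseteq> {..<n} \<Longrightarrow> ant_right (cow w) = smul (eps (W w)) (1 :: 'r falg)" for w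
  proof (induction w)
    case Nil then show ?case using ant_right_tens[of 1 1] by (simp add: cow_append tens_one)
  next
    case (Cons k w)
    then have "ant_right (cow w) = smul (eps (W w)) (1 :: 'r falg)" "ant_right (com k) = (0 :: 'r falg)"
      using assms(1)[of k] by auto
    from ant_right_mult[OF this(1), of "com k"] this(2) show ?case by (simp add: cow_append)
  qed
  have "lext (\<lambda>v. ant_right (cow v)) x = lext (\<lambda>v. smul (eps (W v)) 1) x"
    using assms(2) by (intro lext_cong *) auto
  then show ?thesis by (simp only: lext_eps)
qed

text \<open>The left inverse \<open>S\<close> of the identity for the convolution product satisfies
  \<open>S * (id * S) = S\<close>; evaluated on a generator and by induction on its index, this forces
  \<open>id * S\<close> to vanish there.\<close>

lemma ant_right_com: "ant_right (com n) = (0 :: 'r::comm_ring_1 falg)"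
proof (induction n rule: less_induct)
  case (less n)
  show ?case
  proof (cases "n = 0")
    case True
    have "ant_right (y + z) = ant_right y + ant_right z" for y z :: "_ \<Rightarrow>\<^sub>0 'r" by (simp add: ant_right_def)
    then show ?thesis by (simp add: True com_def ant_right_tens antipode_gen.simps[of 0])
  next
    case False
    let ?X = "lext (\<lambda>v. ant_right (cow v)) :: 'r falg \<Rightarrow> 'r falg"
    have "antipode_gen n = lext (\<lambda>(u, v). antw u * ant_right (cow v)) (com n :: _ \<Rightarrow>\<^sub>0 'r)"
      using ant_conv[of "gen n"] unfolding delta_gen ant_simps by (rule sym)
    also have "\<dots> = (\<Sum>m\<le>n. ant (faa 0 m) * ?X (faa m (n - m)))"
      using False by (simp add: com_def lext_sum ant_conv_tens)
    also have "\<dots> = ?X (gen n) + (\<Sum>m\<in>{1..<n}. antipode_gen m * ?X (faa m (n - m))) + antipode_gen n * ?X 1"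
      using False by (subst sum_ends) (auto simp: faa_0 faa_at_0 intro!: sum.cong)
    also have "(\<Sum>m\<in>{1..<n}. antipode_gen m * ?X (faa m (n - m))) = 0"
    proof (intro sum.neutral ballI)
      fix m assume m: "m \<in> {1..<n}"
      have "Poly_Mapping.keys (faa m (n - m) :: 'r falg) \<subseteq> words {..<n} (n - m)"
        using m by (intro keys_faa_words) auto
      then have "?X (faa m (n - m)) = smul (eps (faa m (n - m) :: 'r falg)) 1"
        by (intro ant_right_delta_small less) (auto simp: words_def)
      then show "antipode_gen m * ?X (faa m (n - m)) = 0" using m by (simp add: eps_faa)
    qed
    also have "?X 1 = 1"
      using ant_right_delta_small[of 0 1] by (simp add: zero_list_def)
    also have "?X (gen n) = ant_right (com n)"
      by (simp add: gen_def cow_append)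
    finally show ?thesis by simp
  qed
qed

lemma antipode_delta: "ant_left (delta x) = smul (eps x) 1" "ant_right (delta x) = smul (eps x) (1 :: 'r::comm_ring_1 falg)"
proof -
  have "ant_right (cow w) = smul (eps (W w)) (1 :: 'r falg)" for w
    using ant_right_delta_small[of "Suc (sum_list w)" "W w", OF ant_right_com] member_le_sum_list[of _ w]
    by (simp add: less_Suc_eq_le subset_iff)
  then show "ant_left (delta x) = smul (eps x) 1" "ant_right (delta x) = smul (eps x) (1 :: 'r falg)"
    unfolding delta_def ant_left_def ant_right_def
    by (simp_all add: lext_lext ant_left_cow[unfolded ant_left_def] lext_eps del: eps_simps)
qed

section \<open>\<open>\<H>\<^sub>\<nu>\<close> is a graded Hopf algebra\<close>

lemma tensor_rels_mono:
  assumes "carrier A = carrier B" "add A = add B" "module.smult A = module.smult B"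
  shows "p \<in> tensor_rels A n \<Longrightarrow> p \<in> tensor_rels B n"
  by (induction rule: tensor_rels.induct) (simp_all add: assms tensor_rels.intros)

lemma tensor_class_cong:
  assumes "carrier A = carrier B" "add A = add B" "module.smult A = module.smult B"
  shows "tensor_class A n = tensor_class B n"
proof -
  have "tensor_rels A n = tensor_rels B n"
    using tensor_rels_mono[of A B] tensor_rels_mono[of B A] assms by auto
  then show ?thesis by (intro ext) (simp add: tc_def')
qed

lemma tensor_power_cong:
  assumes "carrier A = carrier B" "add A = add B" "module.smult A = module.smult B"
    "monoid.mult A = monoid.mult B" "\<one>\<^bsub>A\<^esub> = \<one>\<^bsub>B\<^esub>"
  shows "tensor_power A n = tensor_power B n"
proof -
  have "tensor_rels A n = tensor_rels B n"
    using tensor_rels_mono[of A B] tensor_rels_mono[of B A] assms by auto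
  moreover have "free_tensors A n = free_tensors B n"
    by (simp add: free_tensors_def assms)
  ultimately show ?thesis by (simp add: tensor_power_def)
qed

definition lwords :: "enat \<Rightarrow> nat list set" where
  "lwords \<nu> = {w. set w \<subseteq> letters \<nu>}"

lemma scal_smul: "scal c p = smul c p"
  by (simp add: scal_def smul_conv_mult zero_list_def)

lemma H_alg_simps [simp]:
  "carrier (H_alg \<nu>) = {p. Poly_Mapping.keys p \<subseteq> lwords \<nu>}"
  "monoid.mult (H_alg \<nu>) = (*)" "one (H_alg \<nu>) = 1" "ring.zero (H_alg \<nu>) = 0" "add (H_alg \<nu>) = (+)"
  "module.smult (H_alg \<nu>) = smul"
  "counit (H_alg \<nu>) = eps"
  by (auto simp: H_alg_def free_algebra_def module.defs hopf.defs eps_def lwords_def scal_smul subset_iff intro!: ext)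

text \<open>Tensor classes and tensor powers see only the module and ring fields, which
  \<open>H_alg\<close> inherits from \<open>free_algebra\<close>; \<open>comult_gen\<close> and the
  coproduct are stated over the latter.\<close>

lemma free_algebra_cong:
  "tensor_class (free_algebra \<nu>) = tensor_class (H_alg \<nu>)"
  "tensor_power (free_algebra \<nu>) = tensor_power (H_alg \<nu>)"
  by (intro ext tensor_class_cong tensor_power_cong;
      simp add: H_alg_def module.defs hopf.defs)+

lemma antipode_H_alg [simp]: "antipode (H_alg \<nu>) = ant"
  by (intro ext) (simp add: H_alg_def module.defs hopf.defs ant_def lext_def plin_def scal_smul antw_def)

lemma homog_H_alg: "homog (H_alg \<nu>) d = {p. Poly_Mapping.keys p \<subseteq> words (letters \<nu>) d}"
  by (auto simp: H_alg_def module.defs hopf.defs words_def free_algebra_def)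

lemma keys_mult_lwords:
  "Poly_Mapping.keys x \<subseteq> lwords \<nu> \<Longrightarrow> Poly_Mapping.keys y \<subseteq> lwords \<nu> \<Longrightarrow> Poly_Mapping.keys (x * y) \<subseteq> lwords \<nu>"
proof
  fix w assume "Poly_Mapping.keys x \<subseteq> lwords \<nu>" "Poly_Mapping.keys y \<subseteq> lwords \<nu>" "w \<in> Poly_Mapping.keys (x * y)"
  then obtain p q where "p \<in> lwords \<nu>" "q \<in> lwords \<nu>" "w = p + q" by (meson keys_multD subsetD)
  then show "w \<in> lwords \<nu>" by (simp add: lwords_def plus_list_def)
qed

lemma keys_uminus: "Poly_Mapping.keys (- x :: 'a \<Rightarrow>\<^sub>0 'r::ab_group_add) = Poly_Mapping.keys x"
  by (auto simp: in_keys_iff)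

lemma keys_add_subset: "Poly_Mapping.keys x \<subseteq> K \<Longrightarrow> Poly_Mapping.keys y \<subseteq> K \<Longrightarrow> Poly_Mapping.keys (x + y) \<subseteq> K"
  using keys_add[of x y] by blast

lemma keys_smul_subset: "Poly_Mapping.keys x \<subseteq> K \<Longrightarrow> Poly_Mapping.keys (smul c x) \<subseteq> K"
  using keys_smul[of c x] by blast

lemma H_alg_ring: "ring (H_alg \<nu> :: ('r::comm_ring_1, 'r falg) hopf)"
proof (rule ringI)
  show "abelian_group (H_alg \<nu> :: ('r, 'r falg) hopf)"
  proof (rule abelian_groupI)
    fix x :: "'r falg" assume "x \<in> carrier (H_alg \<nu>)"
    then show "\<exists>y\<in>carrier (H_alg \<nu>). y \<oplus>\<^bsub>H_alg \<nu>\<^esub> x = \<zero>\<^bsub>H_alg \<nu>\<^esub>"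
      by (intro bexI[of _ "- x"]) (auto simp: keys_uminus)
  qed (auto simp: add_ac intro: keys_add_subset[THEN subsetD])
  show "Group.monoid (H_alg \<nu> :: ('r, 'r falg) hopf)"
    by (rule monoidI) (auto simp: mult.assoc lwords_def zero_list_def dest: keys_mult_lwords[unfolded lwords_def, THEN subsetD, rotated 2])
qed (auto simp: algebra_simps)

lemma H_alg_algebra: "is_algebra (H_alg \<nu>)"
  unfolding is_algebra_def
proof (intro conjI)
  interpret ring "H_alg \<nu>" by (rule H_alg_ring)
  show "Module.module rot (H_alg \<nu>)"
    by (rule moduleI[OF cring_from_type_algebra abelian_group_axioms])
      (auto simp: smul_add smul_add_left smul_smul dest: keys_smul[THEN subsetD])
qed (auto simp: H_alg_ring mult_smul_left mult_smul_right)

lemmas H_alg_module = is_algebraD(1)[OF H_alg_algebra]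

lemma H_alg_finsum:
  "finite I \<Longrightarrow> (\<And>i. i \<in> I \<Longrightarrow> f i \<in> carrier (H_alg \<nu>)) \<Longrightarrow> finsum (H_alg \<nu>) f I = sum f I"
proof -
  interpret ring "H_alg \<nu>" by (rule H_alg_ring)
  assume "finite I" "\<And>i. i \<in> I \<Longrightarrow> f i \<in> carrier (H_alg \<nu>)"
  then show ?thesis by (intro finsum_plain abelian_monoid_axioms) simp_all
qed

section \<open>The words as a basis, and the tensor square in coordinates\<close>

interpretation Hdual: dual_basis "H_alg \<nu>" "lwords \<nu>" W "\<lambda>w x. Poly_Mapping.lookup x w" for \<nu>
proof (rule dual_basis.intro)
  fix x :: "'a falg" assume x: "x \<in> carrier (H_alg \<nu>)"
  have k: "{i. Poly_Mapping.lookup x i \<noteq> 0} = Poly_Mapping.keys x" by (auto simp: in_keys_iff)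
  show "finite {i. Poly_Mapping.lookup x i \<noteq> 0}" by simp
  show "x = (\<Oplus>\<^bsub>H_alg \<nu>\<^esub>i\<in>{i. Poly_Mapping.lookup x i \<noteq> 0}. Poly_Mapping.lookup x i \<odot>\<^bsub>H_alg \<nu>\<^esub> W i)"
    unfolding k using x plin_single_eq[of x]
    by (subst H_alg_finsum) (auto simp: plin_def split: if_splits)
  show "Poly_Mapping.lookup x i = 0" if "i \<notin> lwords \<nu>" for i
    using x that by (auto simp: in_keys_iff)
qed (simp_all add: H_alg_module)

text \<open>The bridge from the monoid algebra on pairs of words to representatives in the quotient
  presentation of the tensor square.\<close>

definition rep2 :: "('a \<times> 'a \<Rightarrow>\<^sub>0 'r::comm_ring_1) \<Rightarrow> (('a \<Rightarrow>\<^sub>0 'r) list \<Rightarrow>\<^sub>0 'r)" where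
  "rep2 = lext (\<lambda>(u, v). W [W u, W v])"

definition rep3 :: "('a \<times> 'a \<times> 'a \<Rightarrow>\<^sub>0 'r::comm_ring_1) \<Rightarrow> (('a \<Rightarrow>\<^sub>0 'r) list \<Rightarrow>\<^sub>0 'r)" where
  "rep3 = lext (\<lambda>(u, v, w). W [W u, W v, W w])"

lemma rep_simps [simp]: "rep2 0 = 0" "rep2 (x + y) = rep2 x + rep2 y" "rep2 (Poly_Mapping.single (u, v) c) = Poly_Mapping.single [W u, W v] c"
  "rep3 0 = 0" "rep3 (x' + y') = rep3 x' + rep3 y'" "rep3 (Poly_Mapping.single (u, v, w) c) = Poly_Mapping.single [W u, W v, W w] c"
  "rep2 (smul c x) = smul c (rep2 x)" "rep3 (smul c x') = smul c (rep3 x')"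
  by (simp_all add: rep2_def rep3_def lext_smul)

definition lwords2 :: "enat \<Rightarrow> (nat list \<times> nat list) set" where
  "lwords2 \<nu> = lwords \<nu> \<times> lwords \<nu>"

lemma keys_rep2: "Poly_Mapping.keys (rep2 d) \<subseteq> (\<lambda>(u, v). [W u, W v]) ` Poly_Mapping.keys d"
  unfolding rep2_def using keys_lext[of "\<lambda>(u, v). W [W u, W v]" d] by (fastforce split: if_splits)

lemma rep2_free: "Poly_Mapping.keys d \<subseteq> lwords2 \<nu> \<Longrightarrow> rep2 d \<in> carrier (free_tensors (H_alg \<nu>) 2)"
  using keys_rep2[of d] by (fastforce simp: carrier_free_tensors tuples_def lwords2_def)

lemma pairing_rep2:
  "pairing (\<lambda>c. c) [\<lambda>x. Poly_Mapping.lookup x u, \<lambda>x. Poly_Mapping.lookup x v] (rep2 d) = Poly_Mapping.lookup d (u, v)"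
proof (induction d rule: pm_induct)
  case (add p c d)
  then show ?case
    by (cases p) (auto simp: pairing_simps[OF rhom_id] lookup_add lookup_single when_def)
qed (simp add: pairing_simps[OF rhom_id])

lemma lookup_functional: "functional (\<lambda>c. c) (H_alg \<nu>) (\<lambda>x. Poly_Mapping.lookup x w)"
  by (simp add: functional_def lookup_add)

text \<open>Coefficients are linear functionals and hence constant on classes. Conversely the words
  span, so representatives with the same coefficients differ by a relation
  (\<open>Hdual.rels_if_pairing_zero\<close>).\<close>

lemma rep2_cong_iff:
  assumes "Poly_Mapping.keys d \<subseteq> lwords2 \<nu>" "p \<in> carrier (free_tensors (H_alg \<nu>) 2)"
  shows "tc (H_alg \<nu>) 2 p = tc (H_alg \<nu>) 2 (rep2 d) \<longleftrightarrow>
    (\<forall>u v. pairing (\<lambda>c. c) [\<lambda>x. Poly_Mapping.lookup x u, \<lambda>x. Poly_Mapping.lookup x v] p = Poly_Mapping.lookup d (u, v))"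
proof
  assume "tc (H_alg \<nu>) 2 p = tc (H_alg \<nu>) 2 (rep2 d)"
  then have "pairing (\<lambda>c. c) [\<lambda>x. Poly_Mapping.lookup x u, \<lambda>x. Poly_Mapping.lookup x v] p =
    pairing (\<lambda>c. c) [\<lambda>x. Poly_Mapping.lookup x u, \<lambda>x. Poly_Mapping.lookup x v] (rep2 d)" for u v
    by (rule pairing_tc[OF rhom_id, rotated 2]) (simp_all add: lookup_functional)
  then show "\<forall>u v. pairing (\<lambda>c. c) [\<lambda>x. Poly_Mapping.lookup x u, \<lambda>x. Poly_Mapping.lookup x v] p = Poly_Mapping.lookup d (u, v)"
    by (simp add: pairing_rep2)
next
  assume *: "\<forall>u v. pairing (\<lambda>c. c) [\<lambda>x. Poly_Mapping.lookup x u, \<lambda>x. Poly_Mapping.lookup x v] p = Poly_Mapping.lookup d (u, v)"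
  have "p - rep2 d \<in> tensor_rels (H_alg \<nu>) 2"
  proof (rule Hdual.rels_if_pairing_zero)
    show "p - rep2 d \<in> carrier (free_tensors (H_alg \<nu>) 2)"
      using free_tensors_add[OF assms(2) free_tensors_uminus[OF rep2_free[OF assms(1)]]] by simp
    fix js :: "nat list list" assume "length js = 2"
    then obtain u v where "js = [u, v]" by (auto simp: numeral_2_eq_2 length_Suc_conv)
    then show "pairing (\<lambda>c. c) (map (\<lambda>w x. Poly_Mapping.lookup x w) js) (p - rep2 d) = 0"
      using * by (simp add: pairing_simps[OF rhom_id] pairing_rep2)
  qed
  then show "tc (H_alg \<nu>) 2 p = tc (H_alg \<nu>) 2 (rep2 d)" by (simp add: tc_eq_iff)
qed

lemma keys_tens_lwords2:
  "Poly_Mapping.keys x \<subseteq> lwords \<nu> \<Longrightarrow> Poly_Mapping.keys y \<subseteq> lwords \<nu> \<Longrightarrow> Poly_Mapping.keys (tens x y) \<subseteq> lwords2 \<nu>"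
  using keys_tens[of x y] unfolding lwords2_def by blast

lemma tc_tens:
  assumes "x \<in> carrier (H_alg \<nu>)" "y \<in> carrier (H_alg \<nu>)"
  shows "tc (H_alg \<nu>) 2 (Poly_Mapping.single [x, y] c) = tc (H_alg \<nu>) 2 (rep2 (smul c (tens x y)))"
proof -
  have "Poly_Mapping.keys (smul c (tens x y)) \<subseteq> lwords2 \<nu>"
    using assms by (intro keys_smul_subset keys_tens_lwords2) auto
  moreover have "Poly_Mapping.single [x, y] c \<in> carrier (free_tensors (H_alg \<nu>) 2)"
    using assms by (intro free_tensors_single) (auto simp: tuples_def)
  ultimately show ?thesis
    using rep2_cong_iff[of "smul c (tens x y)" \<nu> "Poly_Mapping.single [x, y] c"]
    by (simp add: pairing_simps[OF rhom_id] lookup_tens)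
qed

lemma rep2_mult: "ftmul (H_alg \<nu>) (rep2 d) (rep2 d') = rep2 (d * d')"
proof (induction d rule: pm_induct)
  case (add p c d)
  have "ftmul (H_alg \<nu>) (rep2 (Poly_Mapping.single p c)) (rep2 d') = rep2 (Poly_Mapping.single p c * d')"
  proof (induction d' rule: pm_induct)
    case (add q e d')
    then show ?case
      by (cases p; cases q) (simp add: distrib_left mult_single)
  qed simp
  with add show ?case by (simp add: distrib_right)
qed simp

lemma keys_faa_lwords: "n \<in> letters \<nu> \<Longrightarrow> t \<le> n \<Longrightarrow> Poly_Mapping.keys (faa l t) \<subseteq> lwords \<nu>"
proof -
  assume "n \<in> letters \<nu>" "t \<le> n"
  then have "{1..t} \<subseteq> letters \<nu>" using downset_letters[of \<nu>] by (fastforce simp: downset_def)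
  from keys_faa_words[OF this, of l] show ?thesis by (auto simp: words_def lwords_def)
qed

lemma delta_W: "delta (W w) = cow w"
  by (simp add: delta_def)

lemma keys_delta_lwords2: "Poly_Mapping.keys x \<subseteq> lwords \<nu> \<Longrightarrow> Poly_Mapping.keys (delta x) \<subseteq> lwords2 \<nu>"
proof (rule subsetI)
  fix p assume x: "Poly_Mapping.keys x \<subseteq> lwords \<nu>" and p: "p \<in> Poly_Mapping.keys (delta x)"
  obtain u v where uv: "p = (u, v)" by (cases p)
  have "\<forall>w\<in>Poly_Mapping.keys x. set w \<subseteq> letters \<nu>" using x by (auto simp: lwords_def)
  from keys_delta_letters[OF downset_letters this p[unfolded uv]]
  show "p \<in> lwords2 \<nu>" by (simp add: uv lwords_def lwords2_def)
qed

lemma comult_gen_rep2: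
  assumes "n \<in> letters \<nu>"
  shows "comult_gen \<nu> n = tc (H_alg \<nu>) 2 (rep2 (com n :: _ \<Rightarrow>\<^sub>0 'r::comm_ring_1))"
proof -
  have n: "n > 0" using assms by (simp add: letters_def)
  have f: "t \<le> n \<Longrightarrow> (faa l t :: 'r falg) \<in> carrier (H_alg \<nu>)" for l t
    using keys_faa_lwords[OF assms] by simp
  note t = tc_tens[OF f f, where c=1, simplified, unfolded tc_eq_iff[of _ 2]]
  have e1: "Poly_Mapping.single [gen n, 1] 1 + Poly_Mapping.single [1, gen n] 1 +
      (\<Sum>m\<in>{1..<n}. Poly_Mapping.single [gen m, Q_poly m (n - m)] (1 :: 'r)) =
     (\<Sum>m\<le>n. Poly_Mapping.single [faa 0 m, faa m (n - m)] 1)"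
    using n by (subst sum_ends) (auto simp: faa_0 faa_at_0 Q_poly_faa add_ac intro!: sum.cong)
  have e2: "(\<Sum>m\<le>n. Poly_Mapping.single [faa 0 m, faa m (n - m)] (1::'r)) - rep2 (com n) =
     (\<Sum>m\<le>n. Poly_Mapping.single [faa 0 m, faa m (n - m)] 1 - rep2 (tens (faa 0 m) (faa m (n - m))))"
    using n by (simp add: com_def rep2_def lext_sum sum_subtractf)
  show ?thesis
    unfolding comult_gen_def free_algebra_cong e1 tc_eq_iff e2 by (intro tensor_rels_sum t) auto
qed

lemma rep2_one: "rep2 (1 :: nat list \<times> nat list \<Rightarrow>\<^sub>0 _) = W [1, 1]"
proof -
  have "rep2 (1 :: nat list \<times> nat list \<Rightarrow>\<^sub>0 'a) = rep2 (W ([], []))" by (simp add: zero_prod_def zero_list_def flip: W_zero)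
  then show ?thesis by (simp add: W_Nil)
qed

lemma foldr_comult_gen:
  assumes "w \<in> lwords \<nu>"
  shows "foldr (\<lambda>n y. comult_gen \<nu> n \<otimes>\<^bsub>tensor_power (H_alg \<nu>) 2\<^esub> y) w \<one>\<^bsub>tensor_power (H_alg \<nu>) 2\<^esub>
     = tc (H_alg \<nu>) 2 (rep2 (cow w :: _ \<Rightarrow>\<^sub>0 'r::comm_ring_1))"
  using assms
proof (induction w)
  case Nil
  show ?case by (simp add: tp_one cow_append rep2_one numeral_2_eq_2)
next
  case (Cons n w)
  have k: "Poly_Mapping.keys (com n :: _ \<Rightarrow>\<^sub>0 'r) \<subseteq> lwords2 \<nu>" "Poly_Mapping.keys (cow w :: _ \<Rightarrow>\<^sub>0 'r) \<subseteq> lwords2 \<nu>"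
    using Cons.prems keys_delta_lwords2[of "gen n :: 'r falg" \<nu>, unfolded delta_gen]
      keys_delta_lwords2[of "W w :: 'r falg" \<nu>, unfolded delta_W]
    by (simp_all add: gen_def lwords_def)
  show ?case using Cons k
    by (simp add: lwords_def comult_gen_rep2 tp_mult[OF H_alg_algebra] rep2_free rep2_mult cow_append)
qed

lemma comult_H_alg_raw: "comult (H_alg \<nu>) = free_lift (tensor_power (free_algebra \<nu>) 2) (comult_gen \<nu>)"
  by (simp add: H_alg_def module.defs hopf.defs)

lemma comult_H_alg:
  assumes x: "x \<in> carrier (H_alg \<nu>)"
  shows "comult (H_alg \<nu>) x = tc (H_alg \<nu>) 2 (rep2 (delta x))"
proof -
  let ?T = "tensor_power (H_alg \<nu>) 2 :: ('a, _) module"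
  interpret M: Module.module rot ?T by (rule tensor_power_module)
  have k: "rep2 (cow w :: _ \<Rightarrow>\<^sub>0 'a) \<in> carrier (free_tensors (H_alg \<nu>) 2)" if "w \<in> lwords \<nu>" for w
    using keys_delta_lwords2[of "W w :: 'a falg" \<nu>] that by (intro rep2_free) (auto simp: delta_def)
  have "comult (H_alg \<nu>) x = finsum ?T (\<lambda>w. Poly_Mapping.lookup x w \<odot>\<^bsub>?T\<^esub>
      foldr (\<lambda>n y. comult_gen \<nu> n \<otimes>\<^bsub>?T\<^esub> y) w \<one>\<^bsub>?T\<^esub>) (Poly_Mapping.keys x)"
    unfolding comult_H_alg_raw free_lift_def free_algebra_cong(2) by (rule refl)
  also have "\<dots> = finsum ?T (\<lambda>w. tc (H_alg \<nu>) 2 (smul (Poly_Mapping.lookup x w) (rep2 (cow w)))) (Poly_Mapping.keys x)"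
    using x k by (intro M.finsum_cong') (auto simp: foldr_comult_gen tp_smult subset_iff carrier_tensor_power intro!: imageI free_tensors_smul)
  also have "\<dots> = tc (H_alg \<nu>) 2 (\<Sum>w\<in>Poly_Mapping.keys x. smul (Poly_Mapping.lookup x w) (rep2 (cow w)))"
    using x k by (intro tp_finsum) (auto intro!: free_tensors_smul)
  also have "(\<Sum>w\<in>Poly_Mapping.keys x. smul (Poly_Mapping.lookup x w) (rep2 (cow w))) = rep2 (delta x)"
    by (simp add: delta_def rep2_def lext_lext) (simp add: lext_def[of "\<lambda>u. lext _ (cow u)"] plin_def)
  finally show ?thesis .
qed

lemma delta_add: "delta (x + y) = delta x + delta y" and delta_smul: "delta (smul c x) = smul c (delta x)"
  by (simp_all add: delta_def lext_smul)

interpretation Hcom: comodule_data "H_alg \<nu>" "\<lambda>x. rep2 (delta x)" for \<nu>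
proof
  show "comult (H_alg \<nu>) \<in> slin (\<lambda>c. c) (H_alg \<nu>) (tensor_power (H_alg \<nu>) 2)"
    by (auto simp: slin_def comult_H_alg carrier_tensor_power tp_add tp_smult delta_add delta_smul
       keys_add_subset keys_smul_subset intro!: imageI rep2_free keys_delta_lwords2)
qed (use H_alg_module in \<open>auto simp: comult_H_alg rep2_free keys_delta_lwords2 module_def module_axioms_def\<close>)

lemma Fr0: "Hcom.Fr 0 [x, y] = ins [] [y] (rep2 (delta x))" and Fr1: "Hcom.Fr 1 [x, y] = ins [x] [] (rep2 (delta y))"
  by (simp_all add: Hcom.Fr_def)

lemma ins_rep_left: "ins [] [W w] (rep2 d) = rep3 (e12 d * e3 (W w))"
proof (induction d rule: pm_induct)
  case (add p c d)
  then show ?case by (cases p) (simp add: e_add distrib_right e12_def e3_def mult_single zero_list_def plus_list_def)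
qed (simp add: e12_def)

lemma ins_rep_right: "ins [W w] [] (rep2 d) = rep3 (e1 (W w) * e23 d)"
proof (induction d rule: pm_induct)
  case (add p c d)
  then show ?case by (cases p) (simp add: e_add distrib_left e23_def e1_def mult_single zero_list_def plus_list_def)
qed (simp add: e23_def)

lemma comult_at_rep2:
  assumes "Poly_Mapping.keys d \<subseteq> lwords2 \<nu>"
  shows "comult_at (H_alg \<nu>) 2 0 (tc (H_alg \<nu>) 2 (rep2 d)) = tc (H_alg \<nu>) 3 (rep3 (delta12 d))"
    "comult_at (H_alg \<nu>) 2 1 (tc (H_alg \<nu>) 2 (rep2 d)) = tc (H_alg \<nu>) 3 (rep3 (delta23 d))"
proof -
  have "plin (\<lambda>xs c. smul c (Hcom.Fr 0 xs)) (rep2 d) = rep3 (delta12 d)"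
  proof (induction d rule: pm_induct)
    case (add p c d)
    then show ?case
      by (cases p) (simp add: plin_add plin_single additive2_lext delta12_add Fr0 delta12_def ins_rep_left delta_W)
  qed (simp add: delta12_def)
  moreover have "plin (\<lambda>xs c. smul c (Hcom.Fr 1 xs)) (rep2 d) = rep3 (delta23 d)"
  proof (induction d rule: pm_induct)
    case (add p c d)
    then show ?case
      by (cases p) (simp add: plin_add plin_single additive2_lext delta23_add Fr1[simplified] delta23_def ins_rep_right delta_W)
  qed (simp add: delta23_def)
  ultimately show "comult_at (H_alg \<nu>) 2 0 (tc (H_alg \<nu>) 2 (rep2 d)) = tc (H_alg \<nu>) 3 (rep3 (delta12 d))"
    "comult_at (H_alg \<nu>) 2 1 (tc (H_alg \<nu>) 2 (rep2 d)) = tc (H_alg \<nu>) 3 (rep3 (delta23 d))"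
    using Hcom.comult_at_tc[of 0 2 "rep2 d" \<nu>] Hcom.comult_at_tc[of 1 2 "rep2 d" \<nu>] rep2_free[OF assms]
    by (simp_all add: eval_nat_numeral)
qed

lemma tensor_lift_rep2:
  assumes "Poly_Mapping.keys d \<subseteq> lwords2 \<nu>" "multilin (\<lambda>c. c) (H_alg \<nu>) 2 (H_alg \<nu>) F"
  shows "tensor_lift (\<lambda>c. c) (H_alg \<nu>) F (tc (H_alg \<nu>) 2 (rep2 d)) = lext (\<lambda>(u, v). F [W u, W v]) d"
proof -
  have "plin (\<lambda>xs c. smul c (F xs)) (rep2 d) = lext (\<lambda>(u, v). F [W u, W v]) d"
  proof (induction d rule: pm_induct)
    case (add p c d)
    then show ?case by (cases p) (simp add: plin_add plin_single additive2_lext)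
  qed simp
  then show ?thesis
    using tensor_lift_plain[OF rhom_id H_alg_module H_alg_module assms(2) _ _ rep2_free[OF assms(1)]] by simp
qed

lemma keys_ant: "Poly_Mapping.keys x \<subseteq> words (letters \<nu>) d \<Longrightarrow> Poly_Mapping.keys (ant x) \<subseteq> words (letters \<nu>) d"
proof -
  have g: "n \<in> letters \<nu> \<Longrightarrow> Poly_Mapping.keys (antipode_gen n :: 'a falg) \<subseteq> words (letters \<nu>) n" for n
  proof (induction n rule: less_induct)
    case (less n)
    have "Poly_Mapping.keys (antipode_gen m * Q_poly m (n - m) :: 'a falg) \<subseteq> words (letters \<nu>) n" if m: "m \<in> {1..<n}" for m
    proof -
      have "{1..n} \<subseteq> letters \<nu>" using less.prems downset_letters[of \<nu>] by (auto simp: downset_def)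
      then have "m \<in> letters \<nu>" and s: "{1..n - m} \<subseteq> letters \<nu>"
        using m subset_trans[of "{1..n - m}" "{1..n}"] by auto
      then have "Poly_Mapping.keys (antipode_gen m :: 'a falg) \<subseteq> words (letters \<nu>) m" using m less.IH by auto
      from keys_mult_words[OF this keys_faa_words[OF s]] show ?thesis using m by (simp add: Q_poly_faa)
    qed
    then have "Poly_Mapping.keys (\<Sum>m\<in>{1..<n}. antipode_gen m * Q_poly m (n - m) :: 'a falg) \<subseteq> words (letters \<nu>) n"
      by (rule keys_sum_subset)
    then show ?case
      using keys_add_subset[of "- gen n :: 'a falg" "words (letters \<nu>) n" "- (\<Sum>m\<in>{1..<n}. antipode_gen m * Q_poly m (n - m))"]
        keys_gen_words[OF less.prems] by (simp add: antipode_gen.simps[of n] keys_uminus)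
  qed
  have w: "w \<in> words (letters \<nu>) d \<Longrightarrow> Poly_Mapping.keys (antw w :: 'a falg) \<subseteq> words (letters \<nu>) d" for w d
  proof (induction w arbitrary: d)
    case Nil then show ?case using keys_one_words by (simp add: words_def)
  next
    case (Cons n w)
    then have "n \<in> letters \<nu>" "w \<in> words (letters \<nu>) (d - n)" and d: "(d - n) + n = d" by (auto simp: words_def)
    from keys_mult_words[OF Cons.IH[OF this(2)] g[OF this(1)]] show ?case unfolding d antw_simps .
  qed
  assume "Poly_Mapping.keys x \<subseteq> words (letters \<nu>) d"
  then show ?thesis using keys_lext[of antw x] w unfolding ant_def by blast
qed

lemma keys_ant_lwords: "Poly_Mapping.keys x \<subseteq> lwords \<nu> \<Longrightarrow> Poly_Mapping.keys (ant x) \<subseteq> lwords \<nu>"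
proof
  fix u assume x: "Poly_Mapping.keys x \<subseteq> lwords \<nu>" and "u \<in> Poly_Mapping.keys (ant x)"
  then obtain w where w: "w \<in> Poly_Mapping.keys x" "u \<in> Poly_Mapping.keys (antw w :: 'a falg)"
    using keys_lext[of antw x] unfolding ant_def by blast
  then show "u \<in> lwords \<nu>"
    using keys_ant[of "W w :: 'a falg" \<nu> "sum_list w"] x by (auto simp: words_def lwords_def ant_def)
qed

lemma multilin_H:
  "multilin (\<lambda>c. c) (H_alg \<nu>) 2 (H_alg \<nu>) (\<lambda>xs. eps (xs ! 0) \<odot>\<^bsub>H_alg \<nu>\<^esub> (xs ! 1))"
  "multilin (\<lambda>c. c) (H_alg \<nu>) 2 (H_alg \<nu>) (\<lambda>xs. eps (xs ! 1) \<odot>\<^bsub>H_alg \<nu>\<^esub> (xs ! 0))"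
  "multilin (\<lambda>c. c) (H_alg \<nu>) 2 (H_alg \<nu>) (\<lambda>xs. ant (xs ! 0) \<otimes>\<^bsub>H_alg \<nu>\<^esub> (xs ! 1))"
  "multilin (\<lambda>c. c) (H_alg \<nu>) 2 (H_alg \<nu>) (\<lambda>xs. (xs ! 0) \<otimes>\<^bsub>H_alg \<nu>\<^esub> ant (xs ! 1))"
proof -
  show "multilin (\<lambda>c. c) (H_alg \<nu>) 2 (H_alg \<nu>) (\<lambda>xs. eps (xs ! 0) \<odot>\<^bsub>H_alg \<nu>\<^esub> (xs ! 1))"
    by (rule multilin2[OF H_alg_module, where f="\<lambda>x y. eps x \<odot>\<^bsub>H_alg \<nu>\<^esub> y"])
      (auto simp: smul_add smul_add_left smul_smul mult.commute intro: keys_smul_subset[THEN subsetD])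
  show "multilin (\<lambda>c. c) (H_alg \<nu>) 2 (H_alg \<nu>) (\<lambda>xs. eps (xs ! 1) \<odot>\<^bsub>H_alg \<nu>\<^esub> (xs ! 0))"
    by (rule multilin2[OF H_alg_module, where f="\<lambda>x y. eps y \<odot>\<^bsub>H_alg \<nu>\<^esub> x"])
      (auto simp: smul_add smul_add_left smul_smul mult.commute intro: keys_smul_subset[THEN subsetD])
  show "multilin (\<lambda>c. c) (H_alg \<nu>) 2 (H_alg \<nu>) (\<lambda>xs. ant (xs ! 0) \<otimes>\<^bsub>H_alg \<nu>\<^esub> (xs ! 1))"
    by (rule multilin2[OF H_alg_module, where f="\<lambda>x y. ant x \<otimes>\<^bsub>H_alg \<nu>\<^esub> y"])
      (simp_all add: keys_mult_lwords keys_ant_lwords distrib_left distrib_right mult_smul_left mult_smul_right)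
  show "multilin (\<lambda>c. c) (H_alg \<nu>) 2 (H_alg \<nu>) (\<lambda>xs. (xs ! 0) \<otimes>\<^bsub>H_alg \<nu>\<^esub> ant (xs ! 1))"
    by (rule multilin2[OF H_alg_module, where f="\<lambda>x y. x \<otimes>\<^bsub>H_alg \<nu>\<^esub> ant y"])
      (simp_all add: keys_mult_lwords keys_ant_lwords distrib_left distrib_right mult_smul_left mult_smul_right)
qed

lemma H_alg_hopf: "is_hopf_algebra (H_alg \<nu> :: ('r::comm_ring_1, 'r falg) hopf)"
  unfolding is_hopf_algebra_def
proof (intro conjI ballI allI)
  let ?H = "H_alg \<nu> :: ('r, 'r falg) hopf"
  show "is_algebra ?H" by (rule H_alg_algebra)
  show "comult ?H \<in> alg_hom ?H (tensor_power ?H 2)"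
    unfolding alg_hom_def
  proof (intro CollectI conjI ring_hom_memI allI ballI)
    fix x y assume x: "x \<in> carrier ?H" and y: "y \<in> carrier ?H"
    show "comult ?H x \<in> carrier (tensor_power ?H 2)" using slinD(1)[OF Hcom.comult_slin x] .
    show "comult ?H (x \<oplus>\<^bsub>?H\<^esub> y) = comult ?H x \<oplus>\<^bsub>tensor_power ?H 2\<^esub> comult ?H y"
      using slinD(2)[OF Hcom.comult_slin x y] .
    show "comult ?H (c \<odot>\<^bsub>?H\<^esub> x) = c \<odot>\<^bsub>tensor_power ?H 2\<^esub> comult ?H x" for c
      using slinD(3)[OF Hcom.comult_slin x] .
    show "comult ?H (x \<otimes>\<^bsub>?H\<^esub> y) = comult ?H x \<otimes>\<^bsub>tensor_power ?H 2\<^esub> comult ?H y"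
      using x y by (simp add: comult_H_alg keys_mult_lwords tp_mult[OF H_alg_algebra] rep2_free keys_delta_lwords2 rep2_mult delta_mult)
  next
    show "comult ?H \<one>\<^bsub>?H\<^esub> = \<one>\<^bsub>tensor_power ?H 2\<^esub>"
      by (subst comult_H_alg) (auto simp: lwords_def zero_list_def delta_one rep2_one tp_one numeral_2_eq_2)
  qed
  show "counit ?H \<in> ring_hom ?H rot" by (rule ring_hom_memI) simp_all
  show "counit ?H (c \<odot>\<^bsub>?H\<^esub> x) = c * counit ?H x" for c x by simp
  show "antipode ?H \<in> lin_map ?H ?H"
    using keys_ant_lwords by (auto simp: lin_map_def subset_iff)
  fix x assume x: "x \<in> carrier ?H"
  then have k: "Poly_Mapping.keys (delta x) \<subseteq> lwords2 \<nu>" by (simp add: keys_delta_lwords2)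
  show "comult_at ?H 2 0 (comult ?H x) = comult_at ?H 2 1 (comult ?H x)"
    using comult_at_rep2[OF k] by (simp add: comult_H_alg[OF x] coassoc)
  note t = tensor_lift_rep2[OF k]
  show "tensor_lift (\<lambda>c. c) ?H (\<lambda>xs. counit ?H (xs ! 0) \<odot>\<^bsub>?H\<^esub> (xs ! 1)) (comult ?H x) = x"
    using t[OF multilin_H(1)] counit_delta(1)[of x] unfolding comult_H_alg[OF x] counit_left_def by simp
  show "tensor_lift (\<lambda>c. c) ?H (\<lambda>xs. counit ?H (xs ! 1) \<odot>\<^bsub>?H\<^esub> (xs ! 0)) (comult ?H x) = x"
    using t[OF multilin_H(2)] counit_delta(2)[of x] unfolding comult_H_alg[OF x] counit_right_def by simp
  show "tensor_lift (\<lambda>c. c) ?H (\<lambda>xs. antipode ?H (xs ! 0) \<otimes>\<^bsub>?H\<^esub> (xs ! 1)) (comult ?H x) = counit ?H x \<odot>\<^bsub>?H\<^esub> \<one>\<^bsub>?H\<^esub>"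
    using t[OF multilin_H(3)] antipode_delta(1)[of x] unfolding comult_H_alg[OF x] ant_left_def by (simp add: ant_def)
  show "tensor_lift (\<lambda>c. c) ?H (\<lambda>xs. (xs ! 0) \<otimes>\<^bsub>?H\<^esub> antipode ?H (xs ! 1)) (comult ?H x) = counit ?H x \<odot>\<^bsub>?H\<^esub> \<one>\<^bsub>?H\<^esub>"
    using t[OF multilin_H(4)] antipode_delta(2)[of x] unfolding comult_H_alg[OF x] ant_right_def by (simp add: ant_def)
qed

subsection \<open>The grading\<close>

definition dcomp :: "nat \<Rightarrow> 'r::comm_ring_1 falg \<Rightarrow> 'r falg" where
  "dcomp d = lext (\<lambda>w. if sum_list w = d then W w else 0)"

lemma lookup_dcomp: "Poly_Mapping.lookup (dcomp d x) w = (if sum_list w = d then Poly_Mapping.lookup x w else 0)"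
proof (induction x rule: pm_induct)
  case (add u c x)
  then show ?case by (auto simp: dcomp_def lookup_add lookup_single when_def)
qed (simp add: dcomp_def)

lemma sum_dcomp:
  assumes "finite D" "sum_list ` Poly_Mapping.keys x \<subseteq> D"
  shows "(\<Sum>d\<in>D. dcomp d x) = x"
proof (rule poly_mapping_eqI)
  fix w
  show "Poly_Mapping.lookup (\<Sum>d\<in>D. dcomp d x) w = Poly_Mapping.lookup x w"
  proof (cases "w \<in> Poly_Mapping.keys x")
    case True
    then have "sum_list w \<in> D" using assms by auto
    then show ?thesis using assms(1) by (simp add: lookup_sum lookup_dcomp)
  next
    case False
    then have "Poly_Mapping.lookup x w = 0" by (simp add: in_keys_iff)
    then show ?thesis by (simp add: lookup_sum lookup_dcomp cong: if_cong)
  qed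
qed

lemma dcomp_homog: "Poly_Mapping.keys x \<subseteq> words S e \<Longrightarrow> dcomp d x = (if d = e then x else 0)"
  by (rule poly_mapping_eqI) (auto simp: lookup_dcomp words_def in_keys_iff subset_iff)

lemma words_lwords: "words (letters \<nu>) d \<subseteq> lwords \<nu>"
  by (auto simp: words_def lwords_def)

lemma H_alg_graded: "is_graded_hopf_algebra (H_alg \<nu> :: ('r::comm_ring_1, 'r falg) hopf)"
  unfolding is_graded_hopf_algebra_def
proof (intro conjI allI ballI impI)
  let ?H = "H_alg \<nu> :: ('r, 'r falg) hopf"
  show "is_hopf_algebra ?H" by (rule H_alg_hopf)
  show "submodule (homog ?H d) rot ?H" for d
  proof (rule Module.module.submoduleI[OF H_alg_module])
    show "homog ?H d \<subseteq> carrier ?H" using words_lwords by (auto simp: homog_H_alg)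
    fix a assume a: "a \<in> homog ?H d"
    then have "- a \<in> carrier ?H" "a \<in> carrier ?H" using words_lwords by (auto simp: homog_H_alg keys_uminus)
    then have "\<ominus>\<^bsub>?H\<^esub> a = - a" by (intro abelian_group.minus_equality) (auto intro: ring.is_abelian_group H_alg_ring)
    then show "\<ominus>\<^bsub>?H\<^esub> a \<in> homog ?H d" using a by (simp add: homog_H_alg keys_uminus)
  qed (simp_all add: homog_H_alg keys_add_subset keys_smul_subset)
  show "\<one>\<^bsub>?H\<^esub> \<in> homog ?H 0" using keys_one_words by (simp add: homog_H_alg)
  show "x \<otimes>\<^bsub>?H\<^esub> y \<in> homog ?H (d + e)" if "x \<in> homog ?H d" "y \<in> homog ?H e" for d e x y
    using that keys_mult_words by (simp add: homog_H_alg)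
  show "counit ?H x = 0" if "0 < d" "x \<in> homog ?H d" for d x
    using that by (force simp: homog_H_alg eps_def words_def in_keys_iff)
  show "antipode ?H x \<in> homog ?H d" if "x \<in> homog ?H d" for d x
    using that by (simp add: homog_H_alg keys_ant)
  show "\<exists>p. comult ?H x = tc ?H 2 p \<and> (\<forall>xs\<in>Poly_Mapping.keys p. \<exists>i j y z. i + j = d \<and> y \<in> homog ?H i \<and> z \<in> homog ?H j \<and> xs = [y, z])"
    if x: "x \<in> homog ?H d" for d x
  proof (intro exI[of _ "rep2 (delta x)"] conjI ballI)
    show "comult ?H x = tc ?H 2 (rep2 (delta x))" using x words_lwords by (intro comult_H_alg) (auto simp: homog_H_alg)
    fix xs assume "xs \<in> Poly_Mapping.keys (rep2 (delta x))"
    then obtain u v where uv: "xs = [W u, W v]" "(u, v) \<in> Poly_Mapping.keys (delta x)" using keys_rep2 by fastforce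
    then have "(u, v) \<in> words2 (letters \<nu>) d"
      using keys_delta_words2[OF downset_letters, of x \<nu> d] x by (auto simp: homog_H_alg)
    then show "\<exists>i j y z. i + j = d \<and> y \<in> homog ?H i \<and> z \<in> homog ?H j \<and> xs = [y, z]"
      using uv by (intro exI[of _ "sum_list u"] exI[of _ "sum_list v"] exI[of _ "W u"] exI[of _ "W v"])
        (simp add: homog_H_alg words_def words2_def)
  qed
  fix x assume x: "x \<in> carrier ?H"
  show "\<exists>!f. (\<forall>d. f d \<in> homog ?H d) \<and> finite {d. f d \<noteq> \<zero>\<^bsub>?H\<^esub>} \<and> x = finsum ?H f {d. f d \<noteq> \<zero>\<^bsub>?H\<^esub>}"
  proof (rule ex1I[of _ "\<lambda>d. dcomp d x"], intro conjI allI)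
    have sub: "{d. dcomp d x \<noteq> 0} \<subseteq> sum_list ` Poly_Mapping.keys x"
    proof (rule subsetI, rule ccontr)
      fix d assume "d \<in> {d. dcomp d x \<noteq> 0}" "d \<notin> sum_list ` Poly_Mapping.keys x"
      then have "dcomp d x = 0" by (intro poly_mapping_eqI) (force simp: lookup_dcomp in_keys_iff)
      then show False using \<open>d \<in> {d. dcomp d x \<noteq> 0}\<close> by simp
    qed
    show h: "dcomp d x \<in> homog ?H d" for d
      using x by (fastforce simp: homog_H_alg in_keys_iff lookup_dcomp words_def lwords_def split: if_splits)
    show fin: "finite {d. dcomp d x \<noteq> \<zero>\<^bsub>?H\<^esub>}" using sub finite_subset by fastforce
    have c: "dcomp d x \<in> carrier ?H" for d using h words_lwords by (fastforce simp: homog_H_alg)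
    have "(\<Sum>d\<in>{d. dcomp d x \<noteq> 0}. dcomp d x) = (\<Sum>d\<in>sum_list ` Poly_Mapping.keys x. dcomp d x)"
      by (rule sum.mono_neutral_left) (use sub in auto)
    then show "x = finsum ?H (\<lambda>d. dcomp d x) {d. dcomp d x \<noteq> \<zero>\<^bsub>?H\<^esub>}"
      using fin c sum_dcomp[of "sum_list ` Poly_Mapping.keys x" x] by (subst H_alg_finsum) auto
    fix f assume f: "(\<forall>d. f d \<in> homog ?H d) \<and> finite {d. f d \<noteq> \<zero>\<^bsub>?H\<^esub>} \<and> x = finsum ?H f {d. f d \<noteq> \<zero>\<^bsub>?H\<^esub>}"
    have fc: "f d \<in> carrier ?H" for d using f words_lwords by (fastforce simp: homog_H_alg)
    have xs: "x = (\<Sum>d\<in>{d. f d \<noteq> 0}. f d)"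
      using f H_alg_finsum[of "{d. f d \<noteq> 0}" f \<nu>] fc by simp
    show "f = (\<lambda>d. dcomp d x)"
    proof
      fix e
      have "dcomp e x = (\<Sum>d\<in>{d. f d \<noteq> 0}. dcomp e (f d))"
        by (subst xs) (simp add: dcomp_def lext_sum)
      also have "\<dots> = (\<Sum>d\<in>{d. f d \<noteq> 0}. if d = e then f e else 0)"
      proof (intro sum.cong refl)
        fix d
        have "Poly_Mapping.keys (f d) \<subseteq> words (letters \<nu>) d" using f by (simp add: homog_H_alg)
        then show "dcomp e (f d) = (if d = e then f e else 0)" by (auto simp: dcomp_homog)
      qed
      also have "\<dots> = f e" using f by (simp add: sum.delta)
      finally show "f e = dcomp e x" by simp
    qed
  qed
qed

section \<open>Change of scalars\<close>

abbreviation pmap :: "('r::zero \<Rightarrow> 's::zero) \<Rightarrow> ('a \<Rightarrow>\<^sub>0 'r) \<Rightarrow> ('a \<Rightarrow>\<^sub>0 's)" where "pmap \<equiv> Poly_Mapping.map"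

lemma lookup_pmap: "rhom \<sigma> \<Longrightarrow> Poly_Mapping.lookup (pmap \<sigma> x) w = \<sigma> (Poly_Mapping.lookup x w)"
  by (simp add: lookup_pm_map rhomD)

lemma pmap_simps:
  assumes "rhom \<sigma>"
  shows "pmap \<sigma> 0 = 0" "pmap \<sigma> (x + y) = pmap \<sigma> x + pmap \<sigma> y" "pmap \<sigma> (smul c x) = smul (\<sigma> c) (pmap \<sigma> x)"
    "pmap \<sigma> (Poly_Mapping.single w c) = Poly_Mapping.single w (\<sigma> c)" "pmap \<sigma> (- x) = - pmap \<sigma> x"
    "pmap \<sigma> (x - y) = pmap \<sigma> x - pmap \<sigma> y"
  using assms by (auto intro!: poly_mapping_eqI simp: lookup_pmap rhomD rhom_diff rhom_uminus lookup_add lookup_minus lookup_single when_def)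

lemma pmap_sum: "rhom \<sigma> \<Longrightarrow> pmap \<sigma> (sum f I) = (\<Sum>i\<in>I. pmap \<sigma> (f i))"
  by (induction I rule: infinite_finite_induct) (simp_all add: pmap_simps)

lemma pmap_W: "rhom \<sigma> \<Longrightarrow> pmap \<sigma> (W w) = W w"
  by (simp add: pmap_simps rhomD)

lemma pmap_one: "rhom \<sigma> \<Longrightarrow> pmap \<sigma> (1 :: 'a::monoid_add \<Rightarrow>\<^sub>0 'r::comm_ring_1) = 1"
  using pmap_W[of \<sigma> "0 :: 'a"] by simp

lemma pmap_lext: "rhom \<sigma> \<Longrightarrow> pmap \<sigma> (lext F x) = lext (\<lambda>w. pmap \<sigma> (F w)) (pmap \<sigma> x)"
  by (induction x rule: pm_induct) (simp_all add: pmap_simps)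

lemma pmap_mult: 
  fixes x y :: "'a::monoid_add \<Rightarrow>\<^sub>0 'r::comm_ring_1"
  assumes "rhom \<sigma>" shows "pmap \<sigma> (x * y) = pmap \<sigma> x * pmap \<sigma> y"
proof (induction x rule: pm_induct)
  case (add u c x)
  have "pmap \<sigma> (Poly_Mapping.single u c * y) = Poly_Mapping.single u (\<sigma> c) * pmap \<sigma> y"
    by (induction y rule: pm_induct) (simp_all add: pmap_simps[OF assms] distrib_left mult_single rhomD[OF assms])
  with add show ?case by (simp add: pmap_simps[OF assms] distrib_right)
qed (simp add: pmap_simps[OF assms])

lemma pmap_gen: "rhom \<sigma> \<Longrightarrow> pmap \<sigma> (gen n) = gen n"
  by (simp add: gen_def pmap_W)

lemma pmap_tens: "rhom \<sigma> \<Longrightarrow> pmap \<sigma> (tens x y) = tens (pmap \<sigma> x) (pmap \<sigma> y)"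
  by (rule poly_mapping_eqI) (auto simp: lookup_pmap lookup_tens rhomD split: prod.splits)

lemma pmap_faa: "rhom \<sigma> \<Longrightarrow> pmap \<sigma> (faa l t) = faa l t"
proof (induction l arbitrary: t)
  case 0
  then show ?case by (simp add: faa_0 pmap_one pmap_gen)
next
  case (Suc l)
  moreover have "pmap \<sigma> (faa 0 t) = faa 0 t" for t using Suc.prems by (simp add: faa_0 pmap_one pmap_gen)
  ultimately show ?case by (simp add: faa_Suc pmap_sum pmap_mult)
qed

lemma pmap_com: "rhom \<sigma> \<Longrightarrow> pmap \<sigma> (com n) = com n"
  by (simp add: com_def pmap_simps pmap_sum pmap_tens pmap_faa pmap_gen pmap_one)

lemma pmap_cow: "rhom \<sigma> \<Longrightarrow> pmap \<sigma> (cow w) = cow w"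
  by (induction w) (simp_all add: cow_append pmap_one pmap_mult pmap_com)

text \<open>The coproduct of a generator has integer coefficients, so it commutes with every change
  of scalars. This relates the coproducts over \<open>'k\<close>, over \<open>'k poly\<close> and
  over its fraction field.\<close>

lemma pmap_delta: "rhom \<sigma> \<Longrightarrow> pmap \<sigma> (delta x) = delta (pmap \<sigma> x)"
  by (simp add: delta_def pmap_lext pmap_cow)

lemma pmap_antipode_gen: "rhom \<sigma> \<Longrightarrow> pmap \<sigma> (antipode_gen n) = antipode_gen n"
proof (induction n rule: less_induct)
  case (less n)
  have "pmap \<sigma> (\<Sum>m\<in>{1..<n}. antipode_gen m * Q_poly m (n - m)) = (\<Sum>m\<in>{1..<n}. antipode_gen m * Q_poly m (n - m))"
    unfolding pmap_sum[OF less.prems]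
    by (intro sum.cong refl) (simp add: less pmap_mult Q_poly_faa pmap_faa)
  then show ?case by (simp add: antipode_gen.simps[of n] pmap_simps[OF less.prems] pmap_gen less.prems)
qed

lemma pmap_ant: "rhom \<sigma> \<Longrightarrow> pmap \<sigma> (ant x) = ant (pmap \<sigma> x)"
proof -
  assume s: "rhom \<sigma>"
  have "pmap \<sigma> (antw w) = antw w" for w
    by (induction w) (simp_all add: pmap_one[OF s] pmap_mult[OF s] pmap_antipode_gen[OF s])
  then show ?thesis by (simp add: ant_def pmap_lext s)
qed

lemma eps_pmap: "rhom \<sigma> \<Longrightarrow> eps (pmap \<sigma> x) = \<sigma> (eps x)"
  by (simp add: eps_def lookup_pmap)

lemma keys_pmap: "rhom \<sigma> \<Longrightarrow> Poly_Mapping.keys (pmap \<sigma> x) \<subseteq> Poly_Mapping.keys x"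
  by (auto simp: in_keys_iff lookup_pmap rhomD)

section \<open>Transport of graded Hopf structures\<close>

lemma tensor_map_slin:
  assumes "rhom \<sigma>" "Module.module rot A" "f \<in> slin \<sigma> A B"
  shows "tensor_map \<sigma> B n f \<in> slin \<sigma> (tensor_power A n) (tensor_power B n)"
proof -
  have f: "f \<in> carrier A \<rightarrow> carrier B" using assms(3) by (simp add: slin_def)
  note m = tensor_map_push[OF assms]
  show ?thesis
    by (auto simp: slin_def carrier_tensor_power m tp_add tp_smult free_tensors_add free_tensors_smul
        push_simps[OF assms(1)] intro!: imageI push_free[OF assms(1) f])
qed

lemma multilin_hopf_ops:
  assumes A: "is_algebra A" and e: "\<And>x y. x \<in> carrier A \<Longrightarrow> y \<in> carrier A \<Longrightarrow> e (x \<oplus>\<^bsub>A\<^esub> y) = e x + e y"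
    "\<And>c x. x \<in> carrier A \<Longrightarrow> e (c \<odot>\<^bsub>A\<^esub> x) = c * e x" and S: "S \<in> lin_map A A"
  shows "multilin (\<lambda>c. c) A 2 A (\<lambda>xs. e (xs ! 0) \<odot>\<^bsub>A\<^esub> (xs ! 1))"
    "multilin (\<lambda>c. c) A 2 A (\<lambda>xs. e (xs ! 1) \<odot>\<^bsub>A\<^esub> (xs ! 0))"
    "multilin (\<lambda>c. c) A 2 A (\<lambda>xs. S (xs ! 0) \<otimes>\<^bsub>A\<^esub> (xs ! 1))"
    "multilin (\<lambda>c. c) A 2 A (\<lambda>xs. (xs ! 0) \<otimes>\<^bsub>A\<^esub> S (xs ! 1))"
proof -
  interpret M: Module.module rot A by (rule is_algebraD[OF A])
  interpret ring A by (rule is_algebraD[OF A])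
  note ml = M.smult_l_distr[simplified] M.smult_assoc1[simplified] M.smult_r_distr[simplified] M.smult_closed[simplified]
  have Sc: "x \<in> carrier A \<Longrightarrow> S x \<in> carrier A" "x \<in> carrier A \<Longrightarrow> y \<in> carrier A \<Longrightarrow> S (x \<oplus>\<^bsub>A\<^esub> y) = S x \<oplus>\<^bsub>A\<^esub> S y"
    "x \<in> carrier A \<Longrightarrow> S (c \<odot>\<^bsub>A\<^esub> x) = c \<odot>\<^bsub>A\<^esub> S x" for x y c
    using S by (auto simp: lin_map_def)
  note mm = multilin2[OF M.module_axioms, where N=A and \<sigma>="\<lambda>c. c"]
  have cm: "c \<odot>\<^bsub>A\<^esub> (d \<odot>\<^bsub>A\<^esub> x) = d \<odot>\<^bsub>A\<^esub> (c \<odot>\<^bsub>A\<^esub> x)" if "x \<in> carrier A" for c d x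
    using ml(2)[of x c d] ml(2)[of x d c] that by (simp add: mult.commute)
  show "multilin (\<lambda>c. c) A 2 A (\<lambda>xs. e (xs ! 0) \<odot>\<^bsub>A\<^esub> (xs ! 1))"
    by (rule mm[where f="\<lambda>x y. e x \<odot>\<^bsub>A\<^esub> y"]) (simp_all add: ml e, simp add: cm)
  show "multilin (\<lambda>c. c) A 2 A (\<lambda>xs. e (xs ! 1) \<odot>\<^bsub>A\<^esub> (xs ! 0))"
    by (rule mm[where f="\<lambda>x y. e y \<odot>\<^bsub>A\<^esub> x"]) (simp_all add: ml e, simp add: cm)
  show "multilin (\<lambda>c. c) A 2 A (\<lambda>xs. S (xs ! 0) \<otimes>\<^bsub>A\<^esub> (xs ! 1))"
    by (rule mm[where f="\<lambda>x y. S x \<otimes>\<^bsub>A\<^esub> y"]) (simp_all add: Sc l_distr r_distr is_algebraD(3,4)[OF A])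
  show "multilin (\<lambda>c. c) A 2 A (\<lambda>xs. (xs ! 0) \<otimes>\<^bsub>A\<^esub> S (xs ! 1))"
    by (rule mm[where f="\<lambda>x y. x \<otimes>\<^bsub>A\<^esub> S y"]) (simp_all add: Sc l_distr r_distr is_algebraD(3,4)[OF A])
qed

lemma tensor_lift_transport:
  assumes A: "Module.module rot A" and B: "Module.module rot B" and f: "f \<in> slin (\<lambda>c. c) A B"
    and F: "multilin (\<lambda>c. c) A n A F" and G: "multilin (\<lambda>c. c) B n B G"
    and FG: "\<And>xs. xs \<in> tuples A n \<Longrightarrow> G (map f xs) = f (F xs)"
    and T: "T \<in> carrier (tensor_power A n)"
  shows "tensor_lift (\<lambda>c. c) B G (tensor_map (\<lambda>c. c) B n f T) = f (tensor_lift (\<lambda>c. c) A F T)"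
proof -
  interpret A: tensor_lifting "\<lambda>c. c" A A n F by (rule tensor_lifting.intro) (use A F rhom_id in auto)
  interpret B: tensor_lifting "\<lambda>c. c" B B n G by (rule tensor_lifting.intro) (use B G rhom_id in auto)
  have fc: "f \<in> carrier A \<rightarrow> carrier B" using f by (simp add: slin_def)
  obtain p where p: "p \<in> carrier (free_tensors A n)" "T = tc A n p" using T by (auto simp: carrier_tensor_power)
  have f0: "f \<zero>\<^bsub>A\<^esub> = \<zero>\<^bsub>B\<^esub>"
    using slinD(3)[OF f A.N.zero_closed, of 0] A.N.smult_l_null[of "\<zero>\<^bsub>A\<^esub>"] B.N.smult_l_null[of "f \<zero>\<^bsub>A\<^esub>"] fc by auto
  from p(1) have "Poly_Mapping.keys p \<subseteq> tuples A n" by (simp add: carrier_free_tensors)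
  then have "B.L (push (\<lambda>c. c) f p) = f (A.L p)"
  proof (induction p rule: pm_induct_keys)
    case zero then show ?case by (simp add: push_simps[OF rhom_id] A.L_0 B.L_0 f0)
  next
    case (add xs c p)
    then have pf: "p \<in> carrier (free_tensors A n)" by (simp add: carrier_free_tensors)
    have xs: "map f xs \<in> tuples B n" using add(1) fc by (auto simp: tuples_def)
    show ?case
      using add(1) xs pf FG[OF add(1)] add(3)
      by (simp add: push_simps[OF rhom_id] A.L_add B.L_add A.L_single B.L_single free_tensors_single
          push_free[OF rhom_id fc] slinD[OF f] A.F_closed A.sm_closed A.L_closed)
  qed
  then show ?thesis
    using p push_free[OF rhom_id fc p(1)] by (simp add: tensor_map_push[OF rhom_id A f] A.tensor_lift_L B.tensor_lift_L)
qed

lemma ex1_eqI: "P h \<Longrightarrow> \<exists>!f. P f \<Longrightarrow> P f \<Longrightarrow> h = f"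
  by blast

text \<open>No axiom is assumed of \<open>B\<close>: its operations are those of \<open>H\<close>
  read through the bijection, and every Hopf axiom follows by rewriting along \<phi>. For the
  specialised algebras this replaces a verification on cosets.\<close>

locale hopf_transport =
  fixes H :: "('r::comm_ring_1, 'a, 'm) hopf_scheme" and B :: "('r, 'b, 'n) hopf_scheme" and \<phi> :: "'a \<Rightarrow> 'b"
  assumes H: "is_graded_hopf_algebra H" and bij: "bij_betw \<phi> (carrier H) (carrier B)"
    and add: "\<And>x y. x \<in> carrier H \<Longrightarrow> y \<in> carrier H \<Longrightarrow> \<phi> x \<oplus>\<^bsub>B\<^esub> \<phi> y = \<phi> (x \<oplus>\<^bsub>H\<^esub> y)"
    and mult: "\<And>x y. x \<in> carrier H \<Longrightarrow> y \<in> carrier H \<Longrightarrow> \<phi> x \<otimes>\<^bsub>B\<^esub> \<phi> y = \<phi> (x \<otimes>\<^bsub>H\<^esub> y)"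
    and smult: "\<And>c x. x \<in> carrier H \<Longrightarrow> c \<odot>\<^bsub>B\<^esub> \<phi> x = \<phi> (c \<odot>\<^bsub>H\<^esub> x)"
    and zero: "\<zero>\<^bsub>B\<^esub> = \<phi> \<zero>\<^bsub>H\<^esub>" and one: "\<one>\<^bsub>B\<^esub> = \<phi> \<one>\<^bsub>H\<^esub>"
    and comult: "\<And>x. x \<in> carrier H \<Longrightarrow> comult B (\<phi> x) = tensor_map (\<lambda>c. c) B 2 \<phi> (comult H x)"
    and counit: "\<And>x. x \<in> carrier H \<Longrightarrow> counit B (\<phi> x) = counit H x"
    and antipode: "\<And>x. x \<in> carrier H \<Longrightarrow> antipode B (\<phi> x) = \<phi> (antipode H x)"
    and homog: "\<And>d. homog B d = \<phi> ` homog H d"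
begin

lemma hopf: "is_hopf_algebra H" using H by (simp add: is_graded_hopf_algebra_def)
lemma algH: "is_algebra H" using hopf by (simp add: is_hopf_algebra_def)

sublocale R: ring H by (rule is_algebraD[OF algH])
sublocale M: Module.module rot H by (rule is_algebraD[OF algH])

lemma carB: "carrier B = \<phi> ` carrier H" using bij by (simp add: bij_betw_def)
lemma inj: "inj_on \<phi> (carrier H)" using bij by (simp add: bij_betw_def)

lemma ringB: "ring B"
proof (rule ringI)
  show "abelian_group B"
  proof (rule abelian_groupI)
    fix y assume "y \<in> carrier B"
    then obtain x where x: "x \<in> carrier H" "y = \<phi> x" by (auto simp: carB)
    show "\<exists>z\<in>carrier B. z \<oplus>\<^bsub>B\<^esub> y = \<zero>\<^bsub>B\<^esub>"
      by (rule bexI[of _ "\<phi> (\<ominus>\<^bsub>H\<^esub> x)"]) (use x in \<open>auto simp: carB add zero R.l_neg\<close>)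
  qed (auto simp: carB add zero R.a_ac)
  show "Group.monoid B"
    by (rule monoidI) (auto simp: carB mult one R.m_assoc)
qed (auto simp: carB add mult R.l_distr R.r_distr)

lemma algB: "is_algebra B"
  unfolding is_algebra_def
proof (intro conjI)
  interpret B: ring B by (rule ringB)
  note ml = M.smult_l_distr[simplified] M.smult_assoc1[simplified] M.smult_r_distr[simplified] M.smult_closed[simplified] M.smult_one[simplified]
  show "Module.module rot B"
    by (rule moduleI[OF cring_from_type_algebra B.abelian_group_axioms]) (auto simp: carB smult add ml)
qed (auto simp: ringB carB mult smult is_algebraD(3,4)[OF algH] M.smult_closed[simplified])

lemma \<phi>_slin: "\<phi> \<in> slin (\<lambda>c. c) H B"
  by (auto simp: slin_def carB add smult)

lemma \<phi>_Pi: "\<phi> \<in> carrier H \<rightarrow> carrier B"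
  by (simp add: carB)

abbreviation "\<Phi> n \<equiv> tensor_map (\<lambda>c. c) B n \<phi>"
abbreviation "pu \<equiv> push (\<lambda>c::'r. c) \<phi>"

lemmas \<Phi>_tc = tensor_map_push[OF rhom_id M.module_axioms \<phi>_slin]
lemmas \<Phi>_slin = tensor_map_slin[OF rhom_id M.module_axioms \<phi>_slin]
lemmas pu_free = push_free[OF rhom_id \<phi>_Pi]
lemmas pu_simps = push_simps[OF rhom_id, of \<phi>]

lemma comultH: "comult H \<in> alg_hom H (tensor_power H 2)"
  using hopf by (simp add: is_hopf_algebra_def)

lemma comultH_slin: "comult H \<in> slin (\<lambda>c. c) H (tensor_power H 2)"
  using comultH by (auto simp: alg_hom_def ring_hom_def slin_def)

definition cop where "cop x = (SOME p. p \<in> carrier (free_tensors H 2) \<and> comult H x = tc H 2 p)"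

lemma cop: "x \<in> carrier H \<Longrightarrow> cop x \<in> carrier (free_tensors H 2) \<and> comult H x = tc H 2 (cop x)"
proof -
  assume "x \<in> carrier H"
  then have "comult H x \<in> carrier (tensor_power H 2)" using slinD(1)[OF comultH_slin] by blast
  then have "\<exists>p. p \<in> carrier (free_tensors H 2) \<and> comult H x = tc H 2 p" by (auto simp: carrier_tensor_power)
  then show ?thesis unfolding cop_def by (rule someI_ex)
qed

definition copB where "copB y = pu (cop (inv_into (carrier H) \<phi> y))"

lemma copB: "x \<in> carrier H \<Longrightarrow> copB (\<phi> x) = pu (cop x)"
  by (simp add: copB_def inj)

lemma comultB_slin: "comult B \<in> slin (\<lambda>c. c) B (tensor_power B 2)"
proof -
  have *: "comult H x \<in> carrier (tensor_power H 2)" if "x \<in> carrier H" for x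
    using slinD(1)[OF comultH_slin that] .
  show ?thesis
    unfolding slin_def carB
    by (auto simp: add smult comult slinD[OF comultH_slin] slinD[OF \<Phi>_slin *] * M.smult_closed[simplified])
qed

sublocale CH: comodule_data H cop
  by (rule comodule_data.intro) (auto simp: cop comultH_slin M.module_axioms)

sublocale CB: comodule_data B copB
  by (rule comodule_data.intro)
    (auto simp: is_algebraD[OF algB] comultB_slin carB comult copB \<Phi>_tc cop pu_free)

lemma pu_ins: "pu (ins us vs q) = ins (map \<phi> us) (map \<phi> vs) (pu q)"
  by (induction q rule: pm_induct) (simp_all add: pu_simps)

lemma pu_Fr: "xs \<in> tuples H n \<Longrightarrow> i < n \<Longrightarrow> CB.Fr i (map \<phi> xs) = pu (CH.Fr i xs)"
proof -
  assume "xs \<in> tuples H n" "i < n"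
  then have "xs ! i \<in> carrier H" "i < length xs" by (auto simp: tuples_def)
  then show ?thesis by (simp add: CH.Fr_def CB.Fr_def pu_ins copB take_map drop_map)
qed

lemma comult_at_transport:
  assumes i: "i < n" and T: "T \<in> carrier (tensor_power H n)"
  shows "comult_at B n i (\<Phi> n T) = \<Phi> (Suc n) (comult_at H n i T)"
proof -
  obtain p where p: "p \<in> carrier (free_tensors H n)" "T = tc H n p" using T by (auto simp: carrier_tensor_power)
  from p(1) have k: "Poly_Mapping.keys p \<subseteq> tuples H n" by (simp add: carrier_free_tensors)
  have eq: "plin (\<lambda>xs c. smul c (CB.Fr i xs)) (pu p) = pu (plin (\<lambda>xs c. smul c (CH.Fr i xs)) p)"
    using k
  proof (induction p rule: pm_induct_keys)
    case (add xs c p)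
    then show ?case by (simp add: pu_simps plin_add additive2_lext plin_single pu_Fr[OF _ i])
  qed (simp add: pu_simps)
  have fr: "plin (\<lambda>xs c. smul c (CH.Fr i xs)) p \<in> carrier (free_tensors H (Suc n))"
    using k by (auto simp: plin_def intro!: free_tensors_sum free_tensors_smul CH.Fr_free[OF _ i])
  show ?thesis
    unfolding p(2) CH.comult_at_tc[OF i p(1)] \<Phi>_tc[OF p(1)] \<Phi>_tc[OF fr] CB.comult_at_tc[OF i pu_free[OF p(1)]] eq ..
qed

lemma \<Phi>_mult:
  assumes "S \<in> carrier (tensor_power H n)" "T \<in> carrier (tensor_power H n)"
  shows "\<Phi> n (S \<otimes>\<^bsub>tensor_power H n\<^esub> T) = \<Phi> n S \<otimes>\<^bsub>tensor_power B n\<^esub> \<Phi> n T"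
proof -
  obtain p q where p: "p \<in> carrier (free_tensors H n)" "S = tc H n p" and q: "q \<in> carrier (free_tensors H n)" "T = tc H n q"
    using assms by (auto simp: carrier_tensor_power)
  have "pu (ftmul H p q) = ftmul B (pu p) (pu q)"
    by (rule push_ftmul[OF rhom_id _ p(1) q(1)]) (simp add: mult)
  then show ?thesis
    using p q by (simp add: tp_mult[OF algH] tp_mult[OF algB] \<Phi>_tc ftmul_free[OF R.ring_axioms] pu_free)
qed

lemma \<Phi>_one: "\<Phi> n \<one>\<^bsub>tensor_power H n\<^esub> = \<one>\<^bsub>tensor_power B n\<^esub>"
proof -
  have "Poly_Mapping.single (replicate n \<one>\<^bsub>H\<^esub>) 1 \<in> carrier (free_tensors H n)"
    by (intro free_tensors_single) (auto simp: tuples_def)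
  then show ?thesis by (simp add: tp_one \<Phi>_tc pu_simps one)
qed

lemma comultH_closed: "x \<in> carrier H \<Longrightarrow> comult H x \<in> carrier (tensor_power H 2)"
  using slinD(1)[OF comultH_slin] .

lemma counitH: "x \<in> carrier H \<Longrightarrow> y \<in> carrier H \<Longrightarrow> counit H (x \<oplus>\<^bsub>H\<^esub> y) = counit H x + counit H y"
   "x \<in> carrier H \<Longrightarrow> y \<in> carrier H \<Longrightarrow> counit H (x \<otimes>\<^bsub>H\<^esub> y) = counit H x * counit H y"
   "counit H \<one>\<^bsub>H\<^esub> = 1"
   "x \<in> carrier H \<Longrightarrow> counit H (c \<odot>\<^bsub>H\<^esub> x) = c * counit H x"
  using hopf by (auto simp: is_hopf_algebra_def ring_hom_def)

lemma antipodeH: "antipode H \<in> lin_map H H"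
  using hopf by (auto simp: is_hopf_algebra_def)

lemma antipodeH': "x \<in> carrier H \<Longrightarrow> antipode H x \<in> carrier H"
  "x \<in> carrier H \<Longrightarrow> y \<in> carrier H \<Longrightarrow> antipode H (x \<oplus>\<^bsub>H\<^esub> y) = antipode H x \<oplus>\<^bsub>H\<^esub> antipode H y"
  "x \<in> carrier H \<Longrightarrow> antipode H (c \<odot>\<^bsub>H\<^esub> x) = c \<odot>\<^bsub>H\<^esub> antipode H x"
  using antipodeH by (auto simp: lin_map_def)

lemma sm_closed: "x \<in> carrier H \<Longrightarrow> c \<odot>\<^bsub>H\<^esub> x \<in> carrier H"
  by (simp add: M.smult_closed)

lemma counitB: "x \<in> carrier B \<Longrightarrow> y \<in> carrier B \<Longrightarrow> counit B (x \<oplus>\<^bsub>B\<^esub> y) = counit B x + counit B y"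
   "x \<in> carrier B \<Longrightarrow> counit B (c \<odot>\<^bsub>B\<^esub> x) = c * counit B x"
  by (auto simp: carB add smult counit counitH sm_closed)

lemma antipodeB: "antipode B \<in> lin_map B B"
  by (auto simp: lin_map_def carB add smult antipode antipodeH' sm_closed)

lemma hopfB: "is_hopf_algebra B"
  unfolding is_hopf_algebra_def
proof (intro conjI ballI allI)
  show "is_algebra B" by (rule algB)
  show "comult B \<in> alg_hom B (tensor_power B 2)"
    unfolding alg_hom_def
  proof (intro CollectI conjI ring_hom_memI allI ballI)
    fix x y assume x: "x \<in> carrier B" and y: "y \<in> carrier B"
    show "comult B x \<in> carrier (tensor_power B 2)" using slinD(1)[OF comultB_slin x] .
    show "comult B (x \<oplus>\<^bsub>B\<^esub> y) = comult B x \<oplus>\<^bsub>tensor_power B 2\<^esub> comult B y"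
      using slinD(2)[OF comultB_slin x y] .
    show "comult B (c \<odot>\<^bsub>B\<^esub> x) = c \<odot>\<^bsub>tensor_power B 2\<^esub> comult B x" for c
      using slinD(3)[OF comultB_slin x] .
    show "comult B (x \<otimes>\<^bsub>B\<^esub> y) = comult B x \<otimes>\<^bsub>tensor_power B 2\<^esub> comult B y"
    proof -
      obtain u v where u: "u \<in> carrier H" "x = \<phi> u" and v: "v \<in> carrier H" "y = \<phi> v" using x y by (auto simp: carB)
      have "comult H (u \<otimes>\<^bsub>H\<^esub> v) = comult H u \<otimes>\<^bsub>tensor_power H 2\<^esub> comult H v"
        using comultH u v by (auto simp: alg_hom_def ring_hom_def)
      then show ?thesis using u v by (simp add: mult comult \<Phi>_mult comultH_closed)
    qed
  next
    have "comult H \<one>\<^bsub>H\<^esub> = \<one>\<^bsub>tensor_power H 2\<^esub>" using comultH by (auto simp: alg_hom_def ring_hom_def)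
    then show "comult B \<one>\<^bsub>B\<^esub> = \<one>\<^bsub>tensor_power B 2\<^esub>" by (simp add: one comult \<Phi>_one)
  qed
  show "counit B \<in> ring_hom B rot"
    by (rule ring_hom_memI) (auto simp: carB add mult one counit counitH)
  show "counit B (c \<odot>\<^bsub>B\<^esub> x) = c * counit B x" if "x \<in> carrier B" for c x
    using that by (rule counitB)
  show "antipode B \<in> lin_map B B" by (rule antipodeB)
  fix y assume "y \<in> carrier B"
  then obtain x where x: "x \<in> carrier H" "y = \<phi> x" by (auto simp: carB)
  have c: "comult B y = \<Phi> 2 (comult H x)" using x comult by simp
  note cl = comultH_closed[OF x(1)]
  have hx: "comult_at H 2 0 (comult H x) = comult_at H 2 1 (comult H x)"
    "tensor_lift (\<lambda>c. c) H (\<lambda>xs. counit H (xs ! 0) \<odot>\<^bsub>H\<^esub> (xs ! 1)) (comult H x) = x"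
    "tensor_lift (\<lambda>c. c) H (\<lambda>xs. counit H (xs ! 1) \<odot>\<^bsub>H\<^esub> (xs ! 0)) (comult H x) = x"
    "tensor_lift (\<lambda>c. c) H (\<lambda>xs. antipode H (xs ! 0) \<otimes>\<^bsub>H\<^esub> (xs ! 1)) (comult H x) = counit H x \<odot>\<^bsub>H\<^esub> \<one>\<^bsub>H\<^esub>"
    "tensor_lift (\<lambda>c. c) H (\<lambda>xs. (xs ! 0) \<otimes>\<^bsub>H\<^esub> antipode H (xs ! 1)) (comult H x) = counit H x \<odot>\<^bsub>H\<^esub> \<one>\<^bsub>H\<^esub>"
    using hopf x(1) unfolding is_hopf_algebra_def by blast+
  show "comult_at B 2 0 (comult B y) = comult_at B 2 1 (comult B y)"
    unfolding c using hx(1) comult_at_transport[OF _ cl, of 0] comult_at_transport[OF _ cl, of 1] by simp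
  note mH = multilin_hopf_ops[OF algH counitH(1,4) antipodeH]
  note mB = multilin_hopf_ops[OF algB counitB antipodeB]
  note lt = tensor_lift_transport[OF M.module_axioms is_algebraD(1)[OF algB] \<phi>_slin _ _ _ cl]
  have t: "xs ! 0 \<in> carrier H" "xs ! 1 \<in> carrier H" "length xs = 2" if "xs \<in> tuples H 2" for xs
    using that by (auto simp: tuples_def)
  have rhs: "counit B y \<odot>\<^bsub>B\<^esub> \<one>\<^bsub>B\<^esub> = \<phi> (counit H x \<odot>\<^bsub>H\<^esub> \<one>\<^bsub>H\<^esub>)"
    using x by (simp add: one smult counit)
  show "tensor_lift (\<lambda>c. c) B (\<lambda>xs. counit B (xs ! 0) \<odot>\<^bsub>B\<^esub> (xs ! 1)) (comult B y) = y"
    using lt[OF mH(1) mB(1)] hx(2) x(2) unfolding c by (simp add: t[simplified] counit smult)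
  show "tensor_lift (\<lambda>c. c) B (\<lambda>xs. counit B (xs ! 1) \<odot>\<^bsub>B\<^esub> (xs ! 0)) (comult B y) = y"
    using lt[OF mH(2) mB(2)] hx(3) x(2) unfolding c by (simp add: t[simplified] counit smult)
  show "tensor_lift (\<lambda>c. c) B (\<lambda>xs. antipode B (xs ! 0) \<otimes>\<^bsub>B\<^esub> (xs ! 1)) (comult B y) = counit B y \<odot>\<^bsub>B\<^esub> \<one>\<^bsub>B\<^esub>"
    using lt[OF mH(3) mB(3)] hx(4) unfolding c rhs by (simp add: t[simplified] antipode mult antipodeH')
  show "tensor_lift (\<lambda>c. c) B (\<lambda>xs. (xs ! 0) \<otimes>\<^bsub>B\<^esub> antipode B (xs ! 1)) (comult B y) = counit B y \<odot>\<^bsub>B\<^esub> \<one>\<^bsub>B\<^esub>"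
    using lt[OF mH(4) mB(4)] hx(5) unfolding c rhs by (simp add: t[simplified] antipode mult antipodeH')
qed

lemma gradedH:
  "submodule (homog H d) rot H" "\<one>\<^bsub>H\<^esub> \<in> homog H 0"
  "x \<in> homog H d \<Longrightarrow> y \<in> homog H e \<Longrightarrow> x \<otimes>\<^bsub>H\<^esub> y \<in> homog H (d + e)"
  "0 < d \<Longrightarrow> x \<in> homog H d \<Longrightarrow> counit H x = 0"
  "x \<in> homog H d \<Longrightarrow> antipode H x \<in> homog H d"
  "x \<in> homog H d \<Longrightarrow> \<exists>p. comult H x = tc H 2 p \<and>
     (\<forall>xs\<in>Poly_Mapping.keys p. \<exists>i j y z. i + j = d \<and> y \<in> homog H i \<and> z \<in> homog H j \<and> xs = [y, z])"
  "x \<in> carrier H \<Longrightarrow> \<exists>!f. (\<forall>d. f d \<in> homog H d) \<and> finite {d. f d \<noteq> \<zero>\<^bsub>H\<^esub>} \<and> x = finsum H f {d. f d \<noteq> \<zero>\<^bsub>H\<^esub>}"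
  using H unfolding is_graded_hopf_algebra_def by ((elim conjE)?, simp)+

lemma homogH: "homog H d \<subseteq> carrier H"
proof -
  show ?thesis using M.submoduleE(1)[OF gradedH(1)] .
qed

lemma \<phi>_finsum: "finite D \<Longrightarrow> f \<in> D \<rightarrow> carrier H \<Longrightarrow> finsum B (\<lambda>d. \<phi> (f d)) D = \<phi> (finsum H f D)"
proof (induction D rule: finite_induct)
  interpret B: ring B by (rule ringB)
  case empty show ?case by (simp add: zero)
next
  interpret B: ring B by (rule ringB)
  case (insert d D)
  then have "f d \<in> carrier H" "f \<in> D \<rightarrow> carrier H" "(\<lambda>d. \<phi> (f d)) \<in> D \<rightarrow> carrier B" "\<phi> (f d) \<in> carrier B"
    by (auto simp: carB)
  with insert show ?case by (simp add: CB.finsum_insert R.finsum_insert add)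
qed

lemma graded_iso: "graded_hopf_iso H B \<phi>"
  unfolding graded_hopf_iso_def
proof (intro conjI)
  show "is_graded_hopf_algebra H" by (rule H)
  show "\<phi> \<in> alg_hom H B"
    by (auto simp: alg_hom_def smult add mult one carB intro!: ring_hom_memI)
  show "is_graded_hopf_algebra B"
    unfolding is_graded_hopf_algebra_def
  proof (intro conjI allI ballI impI)
    show "is_hopf_algebra B" by (rule hopfB)
    show "submodule (homog B d) rot B" for d
    proof (rule Module.module.submoduleI[OF is_algebraD(1)[OF algB]])
      have sub: "submodule (homog H d) rot H" by (rule gradedH)
      note sE = M.submoduleE[OF sub]
      show "homog B d \<subseteq> carrier B" using homogH by (auto simp: homog carB)
      obtain z where z: "z \<in> homog H d" using sE(2) by blast
      have "z \<oplus>\<^bsub>H\<^esub> \<ominus>\<^bsub>H\<^esub> z \<in> homog H d" using sE(3,5) z by blast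
      moreover have "z \<oplus>\<^bsub>H\<^esub> \<ominus>\<^bsub>H\<^esub> z = \<zero>\<^bsub>H\<^esub>" using subsetD[OF homogH z] by (simp add: R.r_neg)
      ultimately show "\<zero>\<^bsub>B\<^esub> \<in> homog B d" by (auto simp: homog zero)
      show "\<ominus>\<^bsub>B\<^esub> a \<in> homog B d" if hh: "a \<in> homog B d" for a
      proof -
        obtain x where x: "x \<in> homog H d" "a = \<phi> x" using hh by (auto simp: homog)
        then have "x \<in> carrier H" using homogH by blast
        then have "\<ominus>\<^bsub>B\<^esub> a = \<phi> (\<ominus>\<^bsub>H\<^esub> x)"
          by (intro CB.minus_equality) (auto simp: x carB add zero R.l_neg)
        then show ?thesis using sE(3)[OF x(1)] by (simp add: homog)
      qed
      show "a \<oplus>\<^bsub>B\<^esub> b \<in> homog B d" if "a \<in> homog B d" "b \<in> homog B d" for a b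
        using that sE(5) homogH by (auto simp: homog add subset_iff)
      show "c \<odot>\<^bsub>B\<^esub> a \<in> homog B d" if "a \<in> homog B d" for c a
        using that sE(4) homogH by (auto simp: homog smult subset_iff)
    qed
    show "\<one>\<^bsub>B\<^esub> \<in> homog B 0" using gradedH(2) by (simp add: one homog)
    show "x \<otimes>\<^bsub>B\<^esub> y \<in> homog B (d + e)" if "x \<in> homog B d" "y \<in> homog B e" for d e x y
    proof -
      obtain u v where uv: "u \<in> homog H d" "x = \<phi> u" "v \<in> homog H e" "y = \<phi> v" using \<open>x \<in> homog B d\<close> \<open>y \<in> homog B e\<close> by (auto simp: homog)
      moreover have "u \<otimes>\<^bsub>H\<^esub> v \<in> homog H (d + e)" using gradedH(3) uv by blast
      ultimately show ?thesis using homogH by (auto simp: homog mult subset_iff)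
    qed
    show "counit B x = 0" if hh: "0 < d" "x \<in> homog B d" for d x
    proof -
      obtain u where u: "u \<in> homog H d" "x = \<phi> u" using hh by (auto simp: homog)
      then have "counit H u = 0" using gradedH(4) hh by blast
      then show ?thesis using u homogH by (auto simp: counit subset_iff)
    qed
    show "antipode B x \<in> homog B d" if hh: "x \<in> homog B d" for d x
    proof -
      obtain u where u: "u \<in> homog H d" "x = \<phi> u" using hh by (auto simp: homog)
      then have "antipode H u \<in> homog H d" using gradedH(5) by blast
      then show ?thesis using u homogH by (auto simp: antipode homog subset_iff)
    qed
    show "\<exists>p. comult B x = tc B 2 p \<and> (\<forall>xs\<in>Poly_Mapping.keys p. \<exists>i j y z. i + j = d \<and> y \<in> homog B i \<and> z \<in> homog B j \<and> xs = [y, z])"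
      if hh: "x \<in> homog B d" for d x
    proof -
      obtain u where u: "u \<in> homog H d" "x = \<phi> u" using hh by (auto simp: homog)
      then obtain p where p: "comult H u = tc H 2 p"
        "\<forall>xs\<in>Poly_Mapping.keys p. \<exists>i j y z. i + j = d \<and> y \<in> homog H i \<and> z \<in> homog H j \<and> xs = [y, z]"
        using gradedH(6) by blast
      have "p \<in> carrier (free_tensors H 2)"
        using p(2) homogH by (fastforce simp: carrier_free_tensors tuples_def)
      then have "comult B x = tc B 2 (pu p)" using u homogH p(1) by (auto simp: comult \<Phi>_tc subset_iff)
      moreover have "\<exists>i j y z. i + j = d \<and> y \<in> homog B i \<and> z \<in> homog B j \<and> xs = [y, z]"
        if xs: "xs \<in> Poly_Mapping.keys (pu p)" for xs
      proof -
        obtain xs' where "xs' \<in> Poly_Mapping.keys p" "xs = map \<phi> xs'"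
          using xs keys_plin[of "\<lambda>xs c. Poly_Mapping.single (map \<phi> xs) c" p] by (auto simp: push_def split: if_splits)
        then show ?thesis using p(2) by (fastforce simp: homog)
      qed
      ultimately show ?thesis by blast
    qed
    fix y assume "y \<in> carrier B"
    then obtain x where x: "x \<in> carrier H" "y = \<phi> x" by (auto simp: carB)
    let ?P = "\<lambda>f. (\<forall>d. f d \<in> homog H d) \<and> finite {d. f d \<noteq> \<zero>\<^bsub>H\<^esub>} \<and> x = finsum H f {d. f d \<noteq> \<zero>\<^bsub>H\<^esub>}"
    have ex1: "\<exists>!f. ?P f" by (rule gradedH(7)[OF x(1)])
    then obtain f where f: "?P f" by (rule ex1E)
    have nz: "{d. \<phi> (g d) \<noteq> \<zero>\<^bsub>B\<^esub>} = {d. g d \<noteq> \<zero>\<^bsub>H\<^esub>}" if "\<forall>d. g d \<in> carrier H" for g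
      using that inj by (auto simp: zero inj_on_def)
    show "\<exists>!f. (\<forall>d. f d \<in> homog B d) \<and> finite {d. f d \<noteq> \<zero>\<^bsub>B\<^esub>} \<and> y = finsum B f {d. f d \<noteq> \<zero>\<^bsub>B\<^esub>}"
    proof (rule ex1I[of _ "\<lambda>d. \<phi> (f d)"])
      have fc: "\<forall>d. f d \<in> carrier H" using f homogH by blast
      show "(\<forall>d. \<phi> (f d) \<in> homog B d) \<and> finite {d. \<phi> (f d) \<noteq> \<zero>\<^bsub>B\<^esub>} \<and> y = finsum B (\<lambda>d. \<phi> (f d)) {d. \<phi> (f d) \<noteq> \<zero>\<^bsub>B\<^esub>}"
        unfolding nz[OF fc] using f fc x(2) \<phi>_finsum[of "{d. f d \<noteq> \<zero>\<^bsub>H\<^esub>}" f] by (auto simp: homog)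
      fix g assume g: "(\<forall>d. g d \<in> homog B d) \<and> finite {d. g d \<noteq> \<zero>\<^bsub>B\<^esub>} \<and> y = finsum B g {d. g d \<noteq> \<zero>\<^bsub>B\<^esub>}"
      have "\<exists>h. h \<in> homog H d \<and> g d = \<phi> h" for d using g by (auto simp: homog)
      then obtain h where h: "\<And>d. h d \<in> homog H d" "\<And>d. g d = \<phi> (h d)" by metis
      then have gh: "g = (\<lambda>d. \<phi> (h d))" by auto
      have hc: "\<forall>d. h d \<in> carrier H" using h(1) homogH by blast
      have fin: "finite {d. h d \<noteq> \<zero>\<^bsub>H\<^esub>}" using g unfolding gh nz[OF hc] by blast
      have "\<phi> x = \<phi> (finsum H h {d. h d \<noteq> \<zero>\<^bsub>H\<^esub>})"
        using g x(2) \<phi>_finsum[OF fin, of h] hc unfolding gh nz[OF hc] by auto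
      then have "x = finsum H h {d. h d \<noteq> \<zero>\<^bsub>H\<^esub>}"
        using inj x(1) hc by (auto dest!: inj_onD intro!: R.finsum_closed)
      then have Ph: "?P h" using h(1) fin by blast
      have "h = f" by (rule ex1_eqI[of ?P, OF Ph ex1 f])
      then show "g = (\<lambda>d. \<phi> (f d))" using gh by simp
    qed
  qed
qed (use bij comult counit antipode homog in auto)

end

section \<open>Filtered vector spaces\<close>

interpretation fv: vector_space "smul :: 'k::field \<Rightarrow> ('a \<Rightarrow>\<^sub>0 'k) \<Rightarrow> ('a \<Rightarrow>\<^sub>0 'k)"
  by unfold_locales (simp_all add: smul_add smul_add_left smul_smul)

text \<open>A basis adapted to a filtration, given by its coordinate functions \<open>\<chi>\<close>.\<close>

lemma adapted_basis:
  fixes F :: "nat \<Rightarrow> ('a \<Rightarrow>\<^sub>0 'k::field) set"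
  assumes mono: "\<And>n. F n \<subseteq> F (Suc n)"
  obtains Bs :: "('a \<Rightarrow>\<^sub>0 'k) set" and deg \<chi> where
    "\<And>b. b \<in> Bs \<Longrightarrow> b \<in> F (deg b)"
    "\<And>n x b. x \<in> F n \<Longrightarrow> \<chi> b x \<noteq> 0 \<Longrightarrow> b \<in> Bs \<and> deg b \<le> n"
    "\<And>n x. x \<in> F n \<Longrightarrow> finite {b. \<chi> b x \<noteq> 0}"
    "\<And>n x. x \<in> F n \<Longrightarrow> x = (\<Sum>b\<in>{b. \<chi> b x \<noteq> 0}. smul (\<chi> b x) b)"
    "\<And>m n x y b. x \<in> F m \<Longrightarrow> y \<in> F n \<Longrightarrow> \<chi> b (x + y) = \<chi> b x + \<chi> b y"
    "\<And>n x c b. x \<in> F n \<Longrightarrow> \<chi> b (smul c x) = c * \<chi> b x"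
proof -
  \<comment> \<open>Independent sets \<open>B n\<close> in \<open>F n\<close> whose spans contain
    \<open>F n\<close> are chosen successively, each extending the previous one. Elements of
    \<open>F n\<close> then have nonzero coordinates only at members of \<open>B n\<close>, and
    \<open>deg b\<close> is the first stage at which \<open>b\<close> occurs.\<close>
  have "\<exists>B. \<forall>n. (B n \<subseteq> F n \<and> fv.independent (B n) \<and> F n \<subseteq> fv.span (B n)) \<and> B n \<subseteq> B (Suc n)"
  proof (rule dependent_nat_choice)
    show "\<exists>B. B \<subseteq> F 0 \<and> fv.independent B \<and> F 0 \<subseteq> fv.span B"
      using fv.maximal_independent_subset[of "F 0"] by metis
    fix B n assume "B \<subseteq> F n \<and> fv.independent B \<and> F n \<subseteq> fv.span B"
    then show "\<exists>B'. (B' \<subseteq> F (Suc n) \<and> fv.independent B' \<and> F (Suc n) \<subseteq> fv.span B') \<and> B \<subseteq> B'"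
      using fv.maximal_independent_subset_extend[of B "F (Suc n)"] mono[of n] by (metis order_trans)
  qed
  then obtain B where B: "\<And>n. B n \<subseteq> F n" "\<And>n. fv.independent (B n)" "\<And>n. F n \<subseteq> fv.span (B n)" "\<And>n. B n \<subseteq> B (Suc n)"
    by metis
  have mono_B: "m \<le> n \<Longrightarrow> B m \<subseteq> B n" for m n using B(4) by (rule lift_Suc_mono_le)
  define Bs where "Bs = (\<Union>n. B n)"
  define deg where "deg b = (LEAST n. b \<in> B n)" for b
  define \<chi> where "\<chi> b x = fv.representation Bs x b" for b x
  have indep: "fv.independent Bs"
    unfolding Bs_def
  proof (rule fv.independent_Union_directed)
    fix c d assume "c \<in> range B" "d \<in> range B"
    then obtain m n where "c = B m" "d = B n" by auto
    then show "c \<subseteq> d \<or> d \<subseteq> c" using mono_B[of m n] mono_B[of n m] by (cases "m \<le> n") auto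
  qed (use B in auto)
  have sp: "x \<in> F n \<Longrightarrow> x \<in> fv.span (B n)" for x n using B(3) by blast
  have spB: "x \<in> F n \<Longrightarrow> x \<in> fv.span Bs" for x n
    using sp fv.span_mono[of "B n" Bs] by (auto simp: Bs_def)
  show ?thesis
  proof (rule that[of Bs deg \<chi>])
    show "b \<in> F (deg b)" if "b \<in> Bs" for b
      using that LeastI_ex[of "\<lambda>n. b \<in> B n"] B(1) by (auto simp: Bs_def deg_def)
    show "b \<in> Bs \<and> deg b \<le> n" if "x \<in> F n" "\<chi> b x \<noteq> 0" for n x b
    proof -
      have "fv.representation Bs x = fv.representation (B n) x"
        by (rule fv.representation_extend[OF indep sp[OF that(1)]]) (auto simp: Bs_def)
      then have "b \<in> B n" using that(2) fv.representation_ne_zero[of "B n" x b] by (simp add: \<chi>_def)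
      then show ?thesis by (auto simp: Bs_def deg_def intro: Least_le)
    qed
    show "finite {b. \<chi> b x \<noteq> 0}" for x
      unfolding \<chi>_def by (rule fv.finite_representation)
    show "x = (\<Sum>b\<in>{b. \<chi> b x \<noteq> 0}. smul (\<chi> b x) b)" if "x \<in> F n" for n x
      unfolding \<chi>_def using fv.sum_nonzero_representation_eq[OF indep spB[OF that]] by simp
    show "\<chi> b (x + y) = \<chi> b x + \<chi> b y" if "x \<in> F m" "y \<in> F n" for m n x y b
      unfolding \<chi>_def by (simp add: fv.representation_add[OF indep spB[OF that(2)] spB[OF that(1)]])
    show "\<chi> b (smul c x) = c * \<chi> b x" if "x \<in> F n" for n x c b
      unfolding \<chi>_def by (simp add: fv.representation_scale[OF indep spB[OF that]])
  qed
qed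

section \<open>Hopf filtrations and their Rees algebras\<close>

text \<open>The degree \<open>n\<close> part of the product filtration on the tensor square,
  generated additively by the products \<open>F i \<otimes> F (n - i)\<close>. Closure under scalars
  is inherited from \<open>F\<close> (\<open>ftens_smul\<close>).\<close>

inductive_set ftens :: "(nat \<Rightarrow> 'r::comm_ring_1 falg set) \<Rightarrow> nat \<Rightarrow> (nat list \<times> nat list \<Rightarrow>\<^sub>0 'r) set"
  for F n where
  zero: "0 \<in> ftens F n"
| add: "i \<le> n \<Longrightarrow> p \<in> F i \<Longrightarrow> q \<in> F (n - i) \<Longrightarrow> d \<in> ftens F n \<Longrightarrow> tens p q + d \<in> ftens F n"

lemma ftens_sum_mem: "d \<in> ftens F n \<Longrightarrow> e \<in> ftens F n \<Longrightarrow> d + e \<in> ftens F n"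
  by (induction rule: ftens.induct) (auto simp: add.assoc intro: ftens.add)

lemma ftens_tens: "i \<le> n \<Longrightarrow> p \<in> F i \<Longrightarrow> q \<in> F (n - i) \<Longrightarrow> tens p q \<in> ftens F n"
  using ftens.add[OF _ _ _ ftens.zero] by fastforce

lemma ftens_sum: "(\<And>i. i \<in> I \<Longrightarrow> f i \<in> ftens F n) \<Longrightarrow> sum f I \<in> ftens F n"
  by (induction I rule: infinite_finite_induct) (auto intro: ftens.zero ftens_sum_mem)

locale hopf_filtration =
  fixes \<nu> :: enat and F :: "nat \<Rightarrow> 'k::field_char_0 falg set"
  assumes F_sub: "F n \<subseteq> {x. Poly_Mapping.keys x \<subseteq> lwords \<nu>}"
    and F_zero: "0 \<in> F n" and F_add: "x \<in> F n \<Longrightarrow> y \<in> F n \<Longrightarrow> x + y \<in> F n"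
    and F_smul: "x \<in> F n \<Longrightarrow> smul c x \<in> F n"
    and F_Suc: "F n \<subseteq> F (Suc n)"
    and F_exh: "Poly_Mapping.keys x \<subseteq> lwords \<nu> \<Longrightarrow> \<exists>n. x \<in> F n"
    and F_one: "1 \<in> F 0"
    and F_mult: "x \<in> F m \<Longrightarrow> y \<in> F n \<Longrightarrow> x * y \<in> F (m + n)"
    and F_ant: "x \<in> F n \<Longrightarrow> ant x \<in> F n"
    and F_delta: "x \<in> F n \<Longrightarrow> delta x \<in> ftens F n"
begin

lemma F_mono: "m \<le> n \<Longrightarrow> F m \<subseteq> F n"
  using F_Suc by (rule lift_Suc_mono_le)

end

lemma rhom_const: "rhom (\<lambda>c::'k::comm_ring_1. [:c:])"
  by (simp add: rhom_def one_pCons)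

lemma rhom_ev: "rhom (\<lambda>p::'k::comm_ring_1 poly. poly p 1)"
  by (simp add: rhom_def)

lemma rhom_comp: "rhom \<sigma> \<Longrightarrow> rhom \<tau> \<Longrightarrow> rhom (\<lambda>x. \<tau> (\<sigma> x))"
  by (simp add: rhom_def)

lemma pmap_pmap: "rhom \<sigma> \<Longrightarrow> rhom \<tau> \<Longrightarrow> pmap \<tau> (pmap \<sigma> x) = pmap (\<lambda>c. \<tau> (\<sigma> c)) x"
  by (rule poly_mapping_eqI) (simp add: lookup_pmap rhom_comp)

lemma pmap_id: "pmap (\<lambda>c. c) x = x"
  by (rule poly_mapping_eqI) (simp add: lookup_pm_map)

text \<open>The element \<open>\<hbar>\<^sup>n x\<close>. Setting \<hbar> = 1 forgets the exponent
  (\<open>ev_hp\<close>), so lifting an element of \<H> to the Rees algebra amounts to choosing a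
  filtration degree for it.\<close>

definition hp :: "nat \<Rightarrow> ('a \<Rightarrow>\<^sub>0 'k::field_char_0) \<Rightarrow> ('a \<Rightarrow>\<^sub>0 'k poly)" where
  "hp n x = smul (hbar ^ n) (pmap (\<lambda>c. [:c:]) x)"

abbreviation ev :: "('a \<Rightarrow>\<^sub>0 'k::field_char_0 poly) \<Rightarrow> ('a \<Rightarrow>\<^sub>0 'k)" where
  "ev \<equiv> pmap (\<lambda>p. poly p 1)"

lemma hp_simps: "hp n 0 = 0" "hp n (x + y) = hp n x + hp n y" "hp n (smul c x) = smul [:c:] (hp n x)"
  "hp n (- x) = - hp n x"
  by (simp_all add: hp_def pmap_simps[OF rhom_const] smul_add smul_smul mult.commute smul_minus)

lemma hp_sum: "hp n (sum f I) = (\<Sum>i\<in>I. hp n (f i))"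
  by (induction I rule: infinite_finite_induct) (simp_all add: hp_simps)

lemma smul_hbar_hp: "smul hbar (hp n x) = hp (Suc n) x" "smul (hbar ^ m) (hp n x) = hp (m + n) x"
  by (simp_all add: hp_def smul_smul power_add)

lemma hp_mult: "hp m x * hp n y = hp (m + n) (x * y)" for x y :: "'a::monoid_add \<Rightarrow>\<^sub>0 'k::field_char_0"
  by (simp add: hp_def mult_smul_left mult_smul_right smul_smul pmap_mult[OF rhom_const] power_add mult.commute)

lemma hp_one: "hp 0 1 = (1 :: 'a::monoid_add \<Rightarrow>\<^sub>0 'k::field_char_0 poly)"
  by (simp add: hp_def pmap_one[OF rhom_const])

lemma poly_hbar: "poly hbar 1 = (1 :: 'k::field_char_0)"
  by (simp add: hbar_def)

lemma ev_hp: "ev (hp n x) = x"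
  by (simp add: hp_def pmap_simps[OF rhom_ev] poly_hbar pmap_pmap rhom_const rhom_ev pmap_id)

lemma ant_hp: "ant (hp n x) = hp n (ant x)"
  by (simp add: hp_def pmap_ant[OF rhom_const])

lemma keys_hp: "Poly_Mapping.keys (hp n x) \<subseteq> Poly_Mapping.keys x"
  unfolding hp_def by (rule order_trans[OF keys_smul keys_pmap[OF rhom_const]])

lemma smul_poly_induct:
  assumes "P 0" "\<And>y z. P y \<Longrightarrow> P z \<Longrightarrow> P (y + z)" "\<And>c y. P y \<Longrightarrow> P (smul [:c:] y)" "\<And>y. P y \<Longrightarrow> P (smul hbar y)"
    and "P y"
  shows "P (smul (p :: 'k::field_char_0 poly) y)"
proof (induction p)
  case 0 show ?case using assms(1) by simp
next
  case (pCons a p)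
  have "pCons a p = [:a:] + hbar * p" by (simp add: hbar_def)
  then have "smul (pCons a p) y = smul [:a:] y + smul hbar (smul p y)"
    by (simp only: smul_add_left smul_smul)
  then show ?case using assms pCons by simp
qed

context hopf_filtration
begin

inductive_set rees :: "'k poly falg set" where
  zero: "0 \<in> rees"
| add: "x \<in> F n \<Longrightarrow> y \<in> rees \<Longrightarrow> hp n x + y \<in> rees"

lemma rees_hp: "x \<in> F n \<Longrightarrow> hp n x \<in> rees"
  using rees.add[OF _ rees.zero] by fastforce

lemma rees_add: "y \<in> rees \<Longrightarrow> z \<in> rees \<Longrightarrow> y + z \<in> rees"
  by (induction rule: rees.induct) (auto simp: add.assoc intro: rees.add)

lemma rees_hbar: "y \<in> rees \<Longrightarrow> smul hbar y \<in> rees"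
  by (induction rule: rees.induct) (auto simp: smul_add smul_hbar_hp intro!: rees.intros intro: F_Suc[THEN subsetD])

lemma rees_const: "y \<in> rees \<Longrightarrow> smul [:c:] y \<in> rees"
  by (induction rule: rees.induct) (auto simp: smul_add hp_simps(3)[symmetric] intro: rees.intros F_smul)

lemma rees_smul: "y \<in> rees \<Longrightarrow> smul p y \<in> rees"
  by (rule smul_poly_induct[where P="\<lambda>y. y \<in> rees"]) (auto intro: rees.zero rees_add rees_hbar rees_const)

lemma rees_uminus: "y \<in> rees \<Longrightarrow> - y \<in> rees"
proof -
  assume "y \<in> rees"
  moreover have "- y = smul (- 1) y" by (rule poly_mapping_eqI) simp
  ultimately show ?thesis using rees_smul by metis
qed

lemma rees_diff: "y \<in> rees \<Longrightarrow> z \<in> rees \<Longrightarrow> y - z \<in> rees"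
  using rees_add[of y "- z"] rees_uminus by simp

lemma rees_one: "1 \<in> rees"
  using rees_hp[OF F_one] by (simp add: hp_one)

lemma rees_mult: "y \<in> rees \<Longrightarrow> z \<in> rees \<Longrightarrow> y * z \<in> rees"
proof (induction rule: rees.induct)
  case (add x n y)
  have "hp n x * z \<in> rees" using \<open>z \<in> rees\<close>
    by (induction rule: rees.induct) (auto simp: distrib_left hp_mult intro: rees.intros F_mult add(1))
  then show ?case using add by (simp add: distrib_right rees_add)
qed (simp add: rees.zero)

lemma rees_ant: "y \<in> rees \<Longrightarrow> ant y \<in> rees"
  by (induction rule: rees.induct) (auto simp: ant_hp intro: rees.intros F_ant)

lemma rees_keys: "y \<in> rees \<Longrightarrow> Poly_Mapping.keys y \<subseteq> lwords \<nu>"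
proof (induction rule: rees.induct)
  case (add x n y)
  then have "Poly_Mapping.keys (hp n x) \<subseteq> lwords \<nu>" using keys_hp[of n x] F_sub by blast
  then show ?case using add by (intro keys_add_subset) auto
qed simp

text \<open>For \<open>u\<close> in \<open>F m\<close> the difference of \<open>hp (Suc m) u\<close>
  and \<open>hp m u\<close> is \<open>hbar - 1\<close> times \<open>hp m u\<close>, a multiple taken
  inside the Rees algebra. Repeating this raises all terms of \<open>y\<close> to a common exponent
  \<open>N\<close>, where they add up to a single term, whose coefficient is the specialisation of
  \<open>y\<close>.\<close>

lemma rees_homogenize:
  "y \<in> rees \<Longrightarrow> \<exists>N. ev y \<in> F N \<and> (\<exists>z\<in>rees. y = hp N (ev y) + smul (hbar - 1) z)"
proof (induction rule: rees.induct)
  case zero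
  show ?case by (intro exI[of _ 0] conjI bexI[of _ 0]) (simp_all add: pmap_simps[OF rhom_ev] F_zero hp_simps rees.zero)
next
  case (add x n y)
  have lift: "\<exists>z\<in>rees. hp m u = hp (m + k) u + smul (hbar - 1) z" if "u \<in> F m" for u m k
  proof (induction k)
    case 0 show ?case by (intro bexI[of _ 0]) (simp_all add: rees.zero)
  next
    case (Suc k)
    then obtain z where z: "z \<in> rees" "hp m u = hp (m + k) u + smul (hbar - 1) z" by blast
    have "u \<in> F (m + k)" using that F_mono[of m "m + k"] by auto
    then have "z - hp (m + k) u \<in> rees" using z rees_diff rees_hp by blast
    moreover have "hp m u = hp (m + Suc k) u + smul (hbar - 1) (z - hp (m + k) u)"
    proof -
      have "smul (hbar - 1) (hp (m + k) u) = hp (m + Suc k) u - hp (m + k) u"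
        using smul_add_left[of "hbar - 1" 1 "hp (m + k) u"] by (simp add: smul_hbar_hp algebra_simps)
      then show ?thesis using z(2) by (simp add: smul_diff)
    qed
    ultimately show ?case by blast
  qed
  from add obtain N z where z: "ev y \<in> F N" "z \<in> rees" "y = hp N (ev y) + smul (hbar - 1) z" by blast
  obtain z1 where z1: "z1 \<in> rees" "hp n x = hp (n + N) x + smul (hbar - 1) z1" using lift[OF add(1), of N] by blast
  obtain z2 where z2: "z2 \<in> rees" "hp N (ev y) = hp (N + n) (ev y) + smul (hbar - 1) z2" using lift[OF z(1), of n] by blast
  have e: "ev (hp n x + y) = x + ev y" by (simp add: pmap_simps[OF rhom_ev] ev_hp)
  have "hp n x + y = hp (n + N) x + smul (hbar - 1) z1 + (hp (N + n) (ev y) + smul (hbar - 1) z2 + smul (hbar - 1) z)"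
    using z1(2) z2(2) z(3) by metis
  also have "\<dots> = hp (n + N) (x + ev y) + smul (hbar - 1) (z1 + z2 + z)"
    by (simp add: hp_simps smul_add algebra_simps)
  finally have "hp n x + y = hp (n + N) (ev (hp n x + y)) + smul (hbar - 1) (z1 + z2 + z)" unfolding e .
  moreover have "ev (hp n x + y) \<in> F (n + N)"
    unfolding e using add(1) z(1) F_mono[of n "n + N"] F_mono[of N "n + N"] by (intro F_add) auto
  ultimately show ?case using z1(1) z2(1) z(2) rees_add by blast
qed

text \<open>The point is that the quotient by \<open>hbar - 1\<close> lies in \<open>rees\<close>
  again and not just in the ambient module. Hence \<open>ev\<close> identifies the Rees algebra
  modulo \<open>hbar - 1\<close> with its image.\<close>

lemma ev_eq_iff:
  assumes "y \<in> rees" "z \<in> rees"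
  shows "ev y = ev z \<longleftrightarrow> (\<exists>u\<in>rees. y = z + smul (hbar - 1) u)"
proof
  assume "\<exists>u\<in>rees. y = z + smul (hbar - 1) u"
  then show "ev y = ev z" by (auto simp: pmap_simps[OF rhom_ev] hbar_def)
next
  assume *: "ev y = ev z"
  have d: "y - z \<in> rees" "ev (y - z) = 0" using assms * by (auto simp: rees_diff pmap_simps[OF rhom_ev])
  then obtain u where "u \<in> rees" "y - z = smul (hbar - 1) u"
    using rees_homogenize[OF d(1)] by (auto simp: hp_simps)
  then show "\<exists>u\<in>rees. y = z + smul (hbar - 1) u" by (intro bexI[of _ u]) (auto simp: algebra_simps)
qed

lemma ev_keys: "y \<in> rees \<Longrightarrow> Poly_Mapping.keys (ev y) \<subseteq> lwords \<nu>"
  using rees_keys keys_pmap[OF rhom_ev, of y] by blast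

lemma ev_surj: "Poly_Mapping.keys x \<subseteq> lwords \<nu> \<Longrightarrow> \<exists>y\<in>rees. ev y = x"
  using F_exh rees_hp ev_hp by metis

end

section \<open>Specialising the Rees algebra of a Hopf filtration\<close>

text \<open>Every linear functional on a monoid algebra has this form, with \<open>f\<close> its
  values on the basis. Functionals can thus be handled as functions on words.\<close>

definition wsum :: "('a \<Rightarrow> 'r::comm_ring_1) \<Rightarrow> ('a \<Rightarrow>\<^sub>0 'r) \<Rightarrow> 'r" where
  "wsum f x = plin (\<lambda>w c. c * f w) x"

lemma additive2_wsum: "additive2 (\<lambda>w c. c * (f w :: 'r::comm_ring_1))"
  by (rule additive2I) (simp_all add: distrib_right)

lemma wsum_simps [simp]: "wsum f 0 = 0" "wsum f (x + y) = wsum f x + wsum f y" "wsum f (x - y) = wsum f x - wsum f y"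
  "wsum f (- x) = - wsum f x" "wsum f (Poly_Mapping.single w c) = c * f w"
  unfolding wsum_def
  by (rule plin_0 plin_add[OF additive2_wsum] plin_diff[OF additive2_wsum] plin_uminus[OF additive2_wsum] plin_single[OF additive2_wsum])+

lemma wsum_smul [simp]: "wsum f (smul c x) = c * wsum f x"
  by (induction x rule: pm_induct) (simp_all add: smul_add distrib_left)

lemma wsum_pmap: "rhom \<sigma> \<Longrightarrow> wsum (\<lambda>w. \<sigma> (f w)) (pmap \<sigma> x) = \<sigma> (wsum f x)"
  by (induction x rule: pm_induct) (simp_all add: pmap_simps rhomD)

text \<open>The embedding \<sigma> of \<open>'k poly\<close> into the scalars of the ambient algebra
  lets one argument serve both cases: it is the identity for \<open>H_prime\<close> and
  \<open>to_fract\<close> for \<open>H_prime_vee\<close>.\<close>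

locale rees_hopf = hopf_filtration \<nu> F for \<nu> :: enat and F :: "nat \<Rightarrow> 'k::field_char_0 falg set" +
  fixes \<sigma> :: "'k poly \<Rightarrow> 's::idom"
  assumes \<sigma>: "rhom \<sigma>" and \<sigma>_inj: "inj \<sigma>"
begin

abbreviation "\<iota> \<equiv> pmap \<sigma> :: 'k poly falg \<Rightarrow> 's falg"
abbreviation "B \<equiv> H_alg \<nu> :: ('s, 's falg) hopf"
abbreviation "Hk \<equiv> H_alg \<nu> :: ('k, 'k falg) hopf"
definition "AC = sub_algebra \<sigma> B (\<iota> ` rees)"
definition "Hh = sub_hopf \<sigma> B (\<iota> ` rees)"

lemma AC_simps [simp]: "carrier AC = \<iota> ` rees" "monoid.mult AC = (*)" "one AC = 1" "ring.zero AC = 0" "add AC = (+)"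
  "module.smult AC = (\<lambda>c x. smul (\<sigma> c) x)"
  by (simp_all add: AC_def sub_algebra_def)

lemma Hh_simps [simp]: "carrier Hh = \<iota> ` rees" "monoid.mult Hh = (*)" "one Hh = 1" "ring.zero Hh = 0" "add Hh = (+)"
  "module.smult Hh = (\<lambda>c x. smul (\<sigma> c) x)" "antipode Hh = ant"
  by (simp_all add: Hh_def sub_hopf_def sub_algebra_def module.defs hopf.defs)

lemma \<sigma>_eq: "\<sigma> a = \<sigma> b \<longleftrightarrow> a = b"
  using \<sigma>_inj by (auto dest: injD)

lemma \<iota>_eq: "\<iota> y = \<iota> z \<longleftrightarrow> y = z"
proof
  assume "\<iota> y = \<iota> z"
  then have "Poly_Mapping.lookup (\<iota> y) w = Poly_Mapping.lookup (\<iota> z) w" for w by simp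
  then show "y = z" by (intro poly_mapping_eqI) (simp add: lookup_pmap[OF \<sigma>] \<sigma>_eq)
qed simp

lemmas \<iota>_simps = pmap_simps[OF \<sigma>] pmap_mult[OF \<sigma>] pmap_one[OF \<sigma>]

lemma \<iota>_keys: "Poly_Mapping.keys (\<iota> y) = Poly_Mapping.keys y"
proof -
  have "\<sigma> c = 0 \<longleftrightarrow> c = 0" for c using \<sigma>_eq[of c 0] rhomD(1)[OF \<sigma>] by simp
  then show ?thesis by (simp add: set_eq_iff in_keys_iff lookup_pmap[OF \<sigma>])
qed

lemma AC_ring: "ring AC"
proof (rule ringI)
  show "abelian_group AC"
  proof (rule abelian_groupI)
    fix x assume "x \<in> carrier AC"
    then obtain y where "y \<in> rees" "x = \<iota> y" by auto
    then show "\<exists>z\<in>carrier AC. z \<oplus>\<^bsub>AC\<^esub> x = \<zero>\<^bsub>AC\<^esub>"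
      by (intro bexI[of _ "\<iota> (- y)"]) (simp add: \<iota>_simps, simp add: rees_uminus)
  next
    show "\<zero>\<^bsub>AC\<^esub> \<in> carrier AC" using rees.zero by (force simp: \<iota>_simps)
  qed (auto simp: \<iota>_simps(2)[symmetric] rees_add add_ac)
  show "Group.monoid AC"
  proof (rule monoidI)
    show "\<one>\<^bsub>AC\<^esub> \<in> carrier AC" using rees_one by (force simp: \<iota>_simps)
  qed (auto simp: pmap_mult[OF \<sigma>, symmetric] rees_mult mult.assoc)
qed (auto simp: algebra_simps)

lemma AC_algebra: "is_algebra AC"
  unfolding is_algebra_def
proof (intro conjI)
  interpret ring AC by (rule AC_ring)
  show "Module.module rot AC"
    by (rule moduleI[OF cring_from_type_algebra abelian_group_axioms])
      (auto simp: \<iota>_simps(3)[symmetric] rees_smul smul_add smul_add_left smul_smul rhomD[OF \<sigma>])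
qed (auto simp: AC_ring mult_smul_left mult_smul_right)

lemmas AC_module = is_algebraD(1)[OF AC_algebra]

lemma id_slin: "(\<lambda>x. x) \<in> slin \<sigma> AC B"
  by (auto simp: slin_def \<iota>_keys dest!: rees_keys)

abbreviation "pB \<equiv> push \<sigma> (\<lambda>x. x)"

text \<open>The tensor square of the Rees algebra embeds into that of the ambient algebra: for a basis
  \<open>b\<close> adapted to the filtration, the functionals \<open>\<hbar>\<^sup>-\<^sup>d\<^sup>e\<^sup>g \<^sup>b \<chi>\<^sub>b\<close> form a dual basis of the Rees algebra.\<close>

lemma tensor_square_inj:
  assumes p: "p \<in> carrier (free_tensors AC 2)" and p': "p' \<in> carrier (free_tensors AC 2)"
    and eq: "tc B 2 (pB p) = tc B 2 (pB p')"
  shows "tc AC 2 p = tc AC 2 p'"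
proof -
  obtain Bs :: "'k falg set" and deg \<chi> where
    b1: "\<And>b. b \<in> Bs \<Longrightarrow> b \<in> F (deg b)" and
    b2: "\<And>n x b. x \<in> F n \<Longrightarrow> \<chi> b x \<noteq> 0 \<Longrightarrow> b \<in> Bs \<and> deg b \<le> n" and
    b3: "\<And>n x. x \<in> F n \<Longrightarrow> finite {b. \<chi> b x \<noteq> 0}" and
    b4: "\<And>n x. x \<in> F n \<Longrightarrow> x = (\<Sum>b\<in>{b. \<chi> b x \<noteq> 0}. smul (\<chi> b x) b)" and
    b5: "\<And>m n x y b. x \<in> F m \<Longrightarrow> y \<in> F n \<Longrightarrow> \<chi> b (x + y) = \<chi> b x + \<chi> b y" and
    b6: "\<And>n x c b. x \<in> F n \<Longrightarrow> \<chi> b (smul c x) = c * \<chi> b x"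
    by (rule adapted_basis[of F, OF F_Suc], rule that; assumption)
  define ch where "ch b = wsum (\<lambda>w. [:\<chi> b (W w):])" for b
  define cs where "cs b = wsum (\<lambda>w. \<sigma> [:\<chi> b (W w):])" for b
  \<comment> \<open>Division by \<open>hbar ^ deg b\<close>. It is exact on the Rees algebra
    (\<open>ch_la\<close>), because \<open>b\<close> occurs only in elements of filtration degree at
    least \<open>deg b\<close>.\<close>
  define la where "la b y = poly_shift (deg b) (ch b y)" for b y
  define lam where "lam b c = la b (inv_into rees \<iota> c)" for b c
  have ch_add: "ch b (y + z) = ch b y + ch b z" for b y z by (simp add: ch_def)
  have ch_smul: "ch b (smul c y) = c * ch b y" for b c y by (simp add: ch_def)
  have cs_\<iota>: "cs b (\<iota> y) = \<sigma> (ch b y)" for b y by (simp add: cs_def ch_def wsum_pmap[OF \<sigma>])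
  have ch_const: "ch b (pmap (\<lambda>c. [:c:]) x) = [:\<chi> b x:]" if "Poly_Mapping.keys x \<subseteq> lwords \<nu>" for b x
    using that
  proof (induction x rule: pm_induct_keys)
    case zero
    have "\<chi> b 0 = 0" using b6[OF F_zero[of 0], of b 0] by simp
    then show ?case by (simp add: ch_def pmap_simps[OF rhom_const])
  next
    case (add w c x)
    obtain m where m: "W w \<in> F m" using F_exh[of "W w"] add(1) by auto
    obtain n where n: "x \<in> F n" using F_exh add(2) by blast
    have "smul c (W w) \<in> F m" using m by (rule F_smul)
    from b5[OF this n, of b] b6[OF m, of b c] show ?case
      using add(3) by (simp add: pmap_simps[OF rhom_const] ch_def)
  qed
  have ch_hp: "ch b (hp n x) = monom (\<chi> b x) n" if "x \<in> F n" for b n x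
  proof -
    have "[:0, 1:] ^ n = monom (1::'k) n" by (simp add: monom_altdef)
    then show ?thesis
      using that F_sub[of n] by (simp add: hp_def ch_smul ch_const subset_iff hbar_def mult_monom smult_monom)
  qed
  have coeff_shift: "coeff (poly_shift d q) i = coeff q (d + i)" for d i and q :: "'k poly"
    by (simp add: coeff_poly_shift add.commute)
  have la_add: "la b (y + z) = la b y + la b z" for b y z
    by (rule poly_eqI) (simp add: la_def ch_add coeff_shift)
  have la_0: "la b 0 = 0" for b by (rule poly_eqI) (simp add: la_def ch_def coeff_shift)
  have la_hp: "la b (hp n x) = monom (\<chi> b x) (n - deg b)" if "x \<in> F n" for b n x
    using b2[OF that, of b]
    by (cases "\<chi> b x = 0"; intro poly_eqI) (auto simp: la_def ch_hp[OF that] coeff_shift)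
  have mon: "hbar ^ d * monom c i = monom c (d + i)" for d i and c :: 'k
    by (simp add: hbar_def monom_altdef power_add mult_ac)
  have ch_la: "ch b y = hbar ^ deg b * la b y" if "y \<in> rees" for b y
    using that
  proof (induction rule: rees.induct)
    case zero then show ?case by (simp add: la_0) (simp add: ch_def)
  next
    case (add x n y)
    have "ch b (hp n x) = hbar ^ deg b * la b (hp n x)"
      using b2[OF add(1), of b] by (cases "\<chi> b x = 0") (simp_all add: ch_hp la_hp add(1) mon)
    then show ?case using add by (simp add: ch_add la_add distrib_left)
  qed
  let ?e = "\<lambda>b. hp (deg b) b"
  have ex: "\<exists>S. finite S \<and> {b. la b y \<noteq> 0} \<subseteq> S \<and> S \<subseteq> Bs \<and> y = (\<Sum>b\<in>S. smul (la b y) (?e b))" if "y \<in> rees" for y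
    using that
  proof (induction rule: rees.induct)
    case zero then show ?case by (intro exI[of _ "{}"]) (simp add: la_0)
  next
    case (add x n y)
    then obtain S where S: "finite S" "{b. la b y \<noteq> 0} \<subseteq> S" "S \<subseteq> Bs" "y = (\<Sum>b\<in>S. smul (la b y) (?e b))" by blast
    let ?T = "{b. \<chi> b x \<noteq> 0}"
    have T: "finite ?T" "?T \<subseteq> Bs" "{b. la b (hp n x) \<noteq> 0} \<subseteq> ?T" using b3 b2 add(1) by (auto simp: la_hp)
    have "hp n x = (\<Sum>b\<in>?T. hp n (smul (\<chi> b x) b))" by (subst b4[OF add(1)]) (simp add: hp_sum)
    also have "\<dots> = (\<Sum>b\<in>?T. smul (la b (hp n x)) (?e b))"
    proof (rule sum.cong[OF refl])
      fix b assume "b \<in> ?T"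
      then have "deg b \<le> n" using b2 add(1) by blast
      then have "hp n (smul (\<chi> b x) b) = smul [:\<chi> b x:] (smul (hbar ^ (n - deg b)) (?e b))"
        by (simp add: hp_simps smul_hbar_hp)
      also have "\<dots> = smul (la b (hp n x)) (?e b)"
        using mon[of "n - deg b" "\<chi> b x" 0] by (simp add: smul_smul la_hp add(1) monom_0 mult.commute)
      finally show "hp n (smul (\<chi> b x) b) = smul (la b (hp n x)) (?e b)" .
    qed
    also have "\<dots> = (\<Sum>b\<in>S \<union> ?T. smul (la b (hp n x)) (?e b))"
      by (rule sum.mono_neutral_left) (use S T in \<open>auto simp: la_hp add(1)\<close>)
    finally have 1: "hp n x = \<dots>" .
    have z: "la i y = 0" if "i \<notin> S" for i using S(2) that by auto
    have 2: "y = (\<Sum>b\<in>S \<union> ?T. smul (la b y) (?e b))"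
      by (subst S(4), rule sum.mono_neutral_left) (auto simp: S(1) T(1) z)
    have "hp n x + y = (\<Sum>b\<in>S \<union> ?T. smul (la b (hp n x + y)) (?e b))"
      by (subst 1, subst 2) (simp add: la_add smul_add_left sum.distrib)
    moreover have "{b. la b (hp n x + y) \<noteq> 0} \<subseteq> S \<union> ?T" by (auto simp: la_add z la_hp add(1))
    ultimately show ?case using S T by (intro exI[of _ "S \<union> ?T"]) auto
  qed
  have inv: "inv_into rees \<iota> (\<iota> y) = y" if "y \<in> rees" for y
    using that by (intro inv_into_f_f) (auto simp: inj_on_def \<iota>_eq)
  have lam: "lam b (\<iota> y) = la b y" if "y \<in> rees" for b y by (simp add: lam_def inv that)
  have db: "dual_basis AC Bs (\<lambda>b. \<iota> (?e b)) lam"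
  proof (rule dual_basis.intro)
    show "Module.module rot AC" by (rule AC_module)
    show "\<iota> (?e b) \<in> carrier AC" if "b \<in> Bs" for b using b1[OF that] rees_hp by auto
    fix x assume "x \<in> carrier AC"
    then obtain y where y: "y \<in> rees" "x = \<iota> y" by auto
    obtain S where S: "finite S" "{b. la b y \<noteq> 0} \<subseteq> S" "S \<subseteq> Bs" "y = (\<Sum>b\<in>S. smul (la b y) (?e b))"
      using ex[OF y(1)] by blast
    have l: "lam b x = la b y" for b using y lam by simp
    show "lam b x = 0" if "b \<notin> Bs" for b using that S l by auto
    show fin: "finite {b. lam b x \<noteq> 0}" using S finite_subset by (auto simp: l)
    have "(\<Sum>b\<in>{b. la b y \<noteq> 0}. smul (la b y) (?e b)) = y"
    proof -
      have "(\<Sum>b\<in>{b. la b y \<noteq> 0}. smul (la b y) (?e b)) = (\<Sum>b\<in>S. smul (la b y) (?e b))"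
        by (rule sum.mono_neutral_left) (use S(1,2) in auto)
      then show ?thesis using S(4) by simp
    qed
    moreover have "finsum AC (\<lambda>b. lam b x \<odot>\<^bsub>AC\<^esub> \<iota> (?e b)) {b. lam b x \<noteq> 0} = (\<Sum>b\<in>{b. lam b x \<noteq> 0}. \<iota> (smul (la b y) (?e b)))"
    proof -
      have "finsum AC (\<lambda>b. lam b x \<odot>\<^bsub>AC\<^esub> \<iota> (?e b)) {b. lam b x \<noteq> 0} = (\<Sum>b\<in>{b. lam b x \<noteq> 0}. lam b x \<odot>\<^bsub>AC\<^esub> \<iota> (?e b))"
      proof (rule finsum_plain)
        interpret M: Module.module rot AC by (rule AC_module)
        show "abelian_monoid AC" by (rule M.abelian_monoid_axioms)
        show "lam b x \<odot>\<^bsub>AC\<^esub> \<iota> (?e b) \<in> carrier AC" if "b \<in> {b. lam b x \<noteq> 0}" for b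
        proof -
          have "b \<in> Bs" using that S l by auto
          then show ?thesis using b1 rees_hp rees_smul by (auto simp: \<iota>_simps(3)[symmetric])
        qed
      qed (use fin in simp_all)
      then show ?thesis by (simp add: \<iota>_simps l)
    qed
    ultimately show "x = finsum AC (\<lambda>b. lam b x \<odot>\<^bsub>AC\<^esub> \<iota> (?e b)) {b. lam b x \<noteq> 0}"
      using y(2) by (simp add: lam[OF y(1)] pmap_sum[OF \<sigma>, symmetric])
  qed
  \<comment> \<open>In the ambient algebra the coordinates are not divided, so the pairing changes
    by the factor \<open>hbar ^ deg b * hbar ^ deg b'\<close>. Since \<sigma> is injective and this
    factor is nonzero in an integral domain, equality of the ambient pairings descends.\<close>
  have pair: "pairing (\<lambda>c. c) [cs b, cs b'] (pB q) = \<sigma> (hbar ^ deg b * hbar ^ deg b' * pairing (\<lambda>c. c) [lam b, lam b'] q)"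
    if "q \<in> carrier (free_tensors AC 2)" for b b' q
  proof -
    have "Poly_Mapping.keys q \<subseteq> tuples AC 2" using that by (simp add: carrier_free_tensors)
    then show ?thesis
    proof (induction q rule: pm_induct_keys)
      case zero show ?case by (simp add: push_simps[OF \<sigma>] pairing_simps[OF rhom_id] rhomD[OF \<sigma>])
    next
      case (add xs c q)
      then obtain y z where yz: "y \<in> rees" "z \<in> rees" "xs = [\<iota> y, \<iota> z]"
        by (auto simp: tuples_def numeral_2_eq_2 length_Suc_conv)
      have "cs b (\<iota> y) = \<sigma> (hbar ^ deg b) * \<sigma> (lam b (\<iota> y))" "cs b' (\<iota> z) = \<sigma> (hbar ^ deg b') * \<sigma> (lam b' (\<iota> z))"
        using yz by (simp_all add: cs_\<iota> ch_la lam rhomD[OF \<sigma>])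
      then show ?case using add(3) yz(3)
        by (simp add: push_simps[OF \<sigma>] pairing_simps[OF rhom_id] rhomD[OF \<sigma>] distrib_left mult_ac)
    qed
  qed
  have fnl: "functional (\<lambda>c. c) B (cs b)" for b
    by (simp add: functional_def cs_def)
  have "p - p' \<in> tensor_rels AC 2"
  proof (rule dual_basis.rels_if_pairing_zero[OF db])
    show "p - p' \<in> carrier (free_tensors AC 2)"
      using free_tensors_add[OF p free_tensors_uminus[OF p']] by simp
    fix js :: "'k falg list" assume "length js = 2"
    then obtain b b' where js: "js = [b, b']" by (auto simp: numeral_2_eq_2 length_Suc_conv)
    have "pairing (\<lambda>c. c) [cs b, cs b'] (pB p) = pairing (\<lambda>c. c) [cs b, cs b'] (pB p')"
      by (rule pairing_tc[OF rhom_id _ _ eq]) (simp_all add: fnl)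
    then have "pairing (\<lambda>c. c) [lam b, lam b'] p = pairing (\<lambda>c. c) [lam b, lam b'] p'"
      by (simp add: pair p p' \<sigma>_eq hbar_def)
    then show "pairing (\<lambda>c. c) (map lam js) (p - p') = 0" by (simp add: js pairing_simps[OF rhom_id])
  qed
  then show ?thesis by (simp add: tc_eq_iff)
qed

end

section \<open>The specialisation of a Rees algebra at \<hbar> = 1\<close>

context rees_hopf
begin

definition "K y = at_one_class Hh (\<iota> y)"
abbreviation "OA \<equiv> at_one_algebra Hh"
abbreviation "Ho \<equiv> at_one Hh"

lemma ideal_eq: "at_one_ideal Hh = {\<iota> z |z. z \<in> rees \<and> ev z = 0}"
proof -
  have "at_one_ideal Hh = {\<iota> (smul (hbar - 1) u) |u. u \<in> rees}"
    by (auto simp: at_one_ideal_def \<iota>_simps)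
  also have "\<dots> = {\<iota> z |z. z \<in> rees \<and> ev z = 0}"
  proof -
    have "(z \<in> rees \<and> ev z = 0) \<longleftrightarrow> (\<exists>u. u \<in> rees \<and> z = smul (hbar - 1) u)" for z
    proof (cases "z \<in> rees")
      case True
      then show ?thesis using ev_eq_iff[OF True rees.zero] by (auto simp: pmap_simps[OF rhom_ev])
    next
      case False
      then show ?thesis using rees_smul by blast
    qed
    then show ?thesis by auto
  qed
  finally show ?thesis .
qed

lemma coset_eq: "y \<in> rees \<Longrightarrow> at_one_ideal Hh +>\<^bsub>Hh\<^esub> \<iota> y = {\<iota> z |z. z \<in> rees \<and> ev z = ev y}"
proof -
  assume y: "y \<in> rees"
  have "at_one_ideal Hh +>\<^bsub>Hh\<^esub> \<iota> y = {\<iota> z + \<iota> y |z. z \<in> rees \<and> ev z = 0}"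
    by (auto simp: a_r_coset_def r_coset_def ideal_eq)
  also have "\<dots> = {\<iota> z |z. z \<in> rees \<and> ev z = ev y}"
  proof (intro equalityI subsetI)
    fix x assume "x \<in> {\<iota> z + \<iota> y |z. z \<in> rees \<and> ev z = 0}"
    then obtain z where "z \<in> rees" "ev z = 0" "x = \<iota> (z + y)" by (auto simp: \<iota>_simps)
    then show "x \<in> {\<iota> z |z. z \<in> rees \<and> ev z = ev y}" using y rees_add by (force simp: pmap_simps[OF rhom_ev])
  next
    fix x assume "x \<in> {\<iota> z |z. z \<in> rees \<and> ev z = ev y}"
    then obtain z where z: "z \<in> rees" "ev z = ev y" "x = \<iota> z" by auto
    then have "x = \<iota> (z - y) + \<iota> y" "z - y \<in> rees" "ev (z - y) = 0"
      using y rees_diff by (auto simp: \<iota>_simps pmap_simps[OF rhom_ev])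
    then show "x \<in> {\<iota> z + \<iota> y |z. z \<in> rees \<and> ev z = 0}" by blast
  qed
  finally show ?thesis .
qed

lemma K_eq: "y \<in> rees \<Longrightarrow> K y = {\<iota> z |z. z \<in> rees \<and> ev z = ev y}"
  by (simp add: K_def at_one_class_def coset_eq)

lemma K_self: "y \<in> rees \<Longrightarrow> \<iota> y \<in> K y"
  by (auto simp: K_eq)

lemma K_eq_iff: "y \<in> rees \<Longrightarrow> z \<in> rees \<Longrightarrow> K y = K z \<longleftrightarrow> ev y = ev z"
proof
  assume "y \<in> rees" "z \<in> rees" "K y = K z"
  then have "\<iota> y \<in> K z" using K_self by auto
  then show "ev y = ev z" using \<open>z \<in> rees\<close> by (auto simp: K_eq \<iota>_eq)
qed (auto simp: K_eq)

lemma OA_carrier: "carrier OA = K ` rees"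
  by (auto simp: at_one_algebra_def quot_algebra_def ring.defs module.defs FactRing_def
      A_RCOSETS_def RCOSETS_def K_def at_one_class_def a_r_coset_def)

lemma OA_add: 
  assumes y: "y \<in> rees" and z: "z \<in> rees" shows "K y \<oplus>\<^bsub>OA\<^esub> K z = K (y + z)"
proof -
  have "K y \<oplus>\<^bsub>OA\<^esub> K z = {a + b |a b. a \<in> K y \<and> b \<in> K z}"
    by (auto simp: at_one_algebra_def quot_algebra_def ring.defs module.defs FactRing_def set_add_def set_mult_def)
  also have "\<dots> = K (y + z)"
  proof (intro equalityI subsetI)
    fix x assume "x \<in> {a + b |a b. a \<in> K y \<and> b \<in> K z}"
    then obtain y' z' where "y' \<in> rees" "z' \<in> rees" "ev y' = ev y" "ev z' = ev z" "x = \<iota> (y' + z')"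
      using y z by (auto simp: K_eq \<iota>_simps)
    then show "x \<in> K (y + z)" using y z rees_add by (force simp: K_eq pmap_simps[OF rhom_ev])
  next
    fix x assume "x \<in> K (y + z)"
    then obtain u where u: "u \<in> rees" "ev u = ev y + ev z" "x = \<iota> u"
      using y z rees_add by (auto simp: K_eq pmap_simps[OF rhom_ev])
    then have "x = \<iota> (u - z) + \<iota> z" "\<iota> (u - z) \<in> K y"
      using y z rees_diff[OF u(1) z] by (auto simp: K_eq \<iota>_simps(6) pmap_simps[OF rhom_ev] intro!: exI[of _ "u - z"])
    then show "x \<in> {a + b |a b. a \<in> K y \<and> b \<in> K z}" using K_self[OF z] by blast
  qed
  finally show ?thesis .
qed

lemma OA_mult: 
  assumes y: "y \<in> rees" and z: "z \<in> rees" shows "K y \<otimes>\<^bsub>OA\<^esub> K z = K (y * z)"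
proof -
  have "K y \<otimes>\<^bsub>OA\<^esub> K z = (\<Union>a\<in>K y. \<Union>b\<in>K z. at_one_ideal Hh +>\<^bsub>Hh\<^esub> (a * b))"
    by (simp add: at_one_algebra_def quot_algebra_def ring.defs module.defs FactRing_def rcoset_mult_def)
  also have "\<dots> = (\<Union>a\<in>K y. \<Union>b\<in>K z. K (y * z))"
  proof (rule SUP_cong[OF refl], rule SUP_cong[OF refl])
    fix a b assume "a \<in> K y" "b \<in> K z"
    then obtain y' z' where *: "y' \<in> rees" "z' \<in> rees" "ev y' = ev y" "ev z' = ev z" "a * b = \<iota> (y' * z')"
      using y z by (auto simp: K_eq \<iota>_simps)
    then show "at_one_ideal Hh +>\<^bsub>Hh\<^esub> (a * b) = K (y * z)"
      using y z by (simp add: K_eq rees_mult coset_eq pmap_mult[OF rhom_ev])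
  qed
  also have "\<dots> = K (y * z)" using K_self[OF y] K_self[OF z] by auto
  finally show ?thesis .
qed

lemma OA_smult: 
  assumes y: "y \<in> rees" shows "c \<odot>\<^bsub>OA\<^esub> K y = K (smul [:c:] y)"
proof -
  have "c \<odot>\<^bsub>OA\<^esub> K y = (\<Union>a\<in>K y. at_one_ideal Hh +>\<^bsub>Hh\<^esub> (smul (\<sigma> [:c:]) a))"
    by (simp add: at_one_algebra_def quot_algebra_def ring.defs module.defs FactRing_def)
  also have "\<dots> = (\<Union>a\<in>K y. K (smul [:c:] y))"
  proof (rule SUP_cong[OF refl])
    fix a assume "a \<in> K y"
    then obtain y' where *: "y' \<in> rees" "ev y' = ev y" "smul (\<sigma> [:c:]) a = \<iota> (smul [:c:] y')"
      using y by (auto simp: K_eq \<iota>_simps)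
    then show "at_one_ideal Hh +>\<^bsub>Hh\<^esub> (smul (\<sigma> [:c:]) a) = K (smul [:c:] y)"
      using y by (simp add: K_eq rees_smul coset_eq pmap_simps[OF rhom_ev])
  qed
  also have "\<dots> = K (smul [:c:] y)" using K_self[OF y] by auto
  finally show ?thesis .
qed

lemma OA_one: "\<one>\<^bsub>OA\<^esub> = K 1"
  by (simp add: at_one_algebra_def quot_algebra_def ring.defs module.defs FactRing_def K_def at_one_class_def \<iota>_simps)

lemma OA_zero: "\<zero>\<^bsub>OA\<^esub> = K 0"
proof -
  have "\<zero>\<^bsub>OA\<^esub> = at_one_ideal Hh" by (simp add: at_one_algebra_def quot_algebra_def ring.defs module.defs FactRing_def)
  then show ?thesis by (simp add: ideal_eq K_eq rees.zero pmap_simps[OF rhom_ev])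
qed

lemma Ho_simps [simp]: "carrier Ho = carrier OA" "monoid.mult Ho = monoid.mult OA" "one Ho = one OA"
  "ring.zero Ho = ring.zero OA" "add Ho = add OA" "module.smult Ho = module.smult OA"
  by (simp_all add: at_one_def module.defs hopf.defs)

lemma Ho_OA: "tensor_class Ho n = tensor_class OA n" "tensor_power Ho n = tensor_power OA n"
  by (rule tensor_class_cong tensor_power_cong; simp)+

text \<open>The inverse of the bijection that \<open>ev\<close> induces on classes. The chosen
  preimage does not matter by \<open>K_eq_iff\<close>; for \<open>x\<close> in \<open>F n\<close> it
  may be taken to be \<open>hp n x\<close>.\<close>

definition "\<phi> x = K (SOME y. y \<in> rees \<and> ev y = x)"

lemma \<phi>_ev: "y \<in> rees \<Longrightarrow> \<phi> (ev y) = K y"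
proof -
  assume y: "y \<in> rees"
  let ?z = "SOME z. z \<in> rees \<and> ev z = ev y"
  have "?z \<in> rees \<and> ev ?z = ev y" by (rule someI[of _ y]) (use y in simp)
  then show ?thesis using y by (simp add: \<phi>_def K_eq_iff)
qed

lemma \<phi>_hp: "x \<in> F n \<Longrightarrow> \<phi> x = K (hp n x)"
  using \<phi>_ev[OF rees_hp, of x n] by (simp add: ev_hp)

lemma Hk_ev: "x \<in> carrier Hk \<Longrightarrow> \<exists>y\<in>rees. x = ev y"
  using ev_surj by auto

lemma \<phi>_slin: "\<phi> \<in> slin (\<lambda>c. c) Hk Ho"
proof -
  have a: "\<phi> (x + y) = \<phi> x \<oplus>\<^bsub>OA\<^esub> \<phi> y" if xy: "x \<in> carrier Hk" "y \<in> carrier Hk" for x y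
  proof -
    obtain u v where "u \<in> rees" "x = ev u" "v \<in> rees" "y = ev v" using Hk_ev xy by meson
    then show ?thesis using \<phi>_ev[OF rees_add[of u v]] by (simp add: \<phi>_ev OA_add pmap_simps[OF rhom_ev])
  qed
  have s: "\<phi> (smul c x) = c \<odot>\<^bsub>OA\<^esub> \<phi> x" if x: "x \<in> carrier Hk" for c x
  proof -
    obtain u where "u \<in> rees" "x = ev u" using Hk_ev x by meson
    then show ?thesis using \<phi>_ev[OF rees_smul[of u "[:c:]"]] by (simp add: \<phi>_ev OA_smult pmap_simps[OF rhom_ev])
  qed
  have c: "\<phi> x \<in> carrier OA" if x: "x \<in> carrier Hk" for x
  proof -
    obtain u where "u \<in> rees" "x = ev u" using Hk_ev x by meson
    then show ?thesis by (simp add: \<phi>_ev OA_carrier)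
  qed
  show ?thesis using a s c by (simp add: slin_def)
qed

text \<open>A class depends only on the value under \<open>ev\<close>, so a polynomial
  \<open>p\<close> acts on the quotient through the number \<open>poly p 1\<close>.\<close>

lemma cls_slin: "at_one_class Hh \<in> slin (\<lambda>p. poly p 1) AC OA"
proof -
  have Kp: "K (smul p y) = K (smul [:poly p 1:] y)" if "y \<in> rees" for p y
    using that by (simp add: K_eq_iff rees_smul pmap_simps[OF rhom_ev])
  have "at_one_class Hh (smul (\<sigma> p) (\<iota> y)) = poly p 1 \<odot>\<^bsub>OA\<^esub> at_one_class Hh (\<iota> y)" if "y \<in> rees" for p y
  proof -
    have "at_one_class Hh (smul (\<sigma> p) (\<iota> y)) = K (smul p y)" by (simp add: K_def \<iota>_simps)
    also have "\<dots> = poly p 1 \<odot>\<^bsub>OA\<^esub> K y" using Kp[OF that, of p] OA_smult[OF that, of "poly p 1"] by (rule trans[OF _ sym])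
    finally show ?thesis by (simp add: K_def)
  qed
  moreover have "at_one_class Hh (\<iota> y + \<iota> z) = at_one_class Hh (\<iota> y) \<oplus>\<^bsub>OA\<^esub> at_one_class Hh (\<iota> z)"
    if "y \<in> rees" "z \<in> rees" for y z
    using OA_add[OF that] by (simp add: K_def \<iota>_simps)
  moreover have "at_one_class Hh (\<iota> y) \<in> carrier OA" if "y \<in> rees" for y
    using that by (simp add: K_def[symmetric] OA_carrier)
  ultimately show ?thesis by (simp add: slin_def image_subset_iff_funcset[symmetric] image_subset_iff)
qed

section \<open>The coproduct of a Rees algebra and its specialisation\<close>

abbreviation "\<kappa> \<equiv> (\<lambda>c::'k. \<sigma> [:c:])"

lemma \<kappa>: "rhom \<kappa>" using rhom_comp[OF rhom_const \<sigma>] .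

lemma \<iota>_hp: "\<iota> (hp n x) = smul (\<sigma> hbar ^ n) (pmap \<kappa> x)"
proof -
  have "\<sigma> (hbar ^ n) = \<sigma> hbar ^ n" by (induction n) (simp_all add: rhomD[OF \<sigma>])
  then show ?thesis by (simp add: hp_def \<iota>_simps pmap_pmap[OF rhom_const \<sigma>])
qed

text \<open>For a summand \<open>u \<otimes> v\<close> with \<open>u\<close> in \<open>F i\<close>
  and \<open>v\<close> in \<open>F (n - i)\<close>, the multiple by \<open>\<hbar>\<^sup>n\<close>
  is \<open>\<hbar>\<^sup>i u \<otimes> \<hbar>\<^sup>n\<^sup>-\<^sup>i v\<close>, a tensor over the
  Rees algebra. The representatives \<open>p\<close> over the Rees algebra and \<open>q\<close> over
  \<H> are built in parallel, so that specialising \<open>p\<close> and applying \<phi> to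
  \<open>q\<close> give literally the same representative.\<close>

lemma ftens_lift:
  "d \<in> ftens F n \<Longrightarrow> \<exists>p q. p \<in> carrier (free_tensors AC 2) \<and> q \<in> carrier (free_tensors Hk 2) \<and>
     Poly_Mapping.keys d \<subseteq> lwords2 \<nu> \<and>
     tc B 2 (pB p) = tc B 2 (rep2 (smul (\<sigma> hbar ^ n) (pmap \<kappa> d))) \<and>
     tc Hk 2 q = tc Hk 2 (rep2 d) \<and>
     push (\<lambda>c. poly c 1) (at_one_class Hh) p = push (\<lambda>c. c) \<phi> q"
proof (induction rule: ftens.induct)
  case zero
  show ?case
    by (intro exI[of _ 0]) (simp add: push_simps[OF \<sigma>] push_simps[OF rhom_ev] push_simps[OF rhom_id] pmap_simps[OF \<kappa>])
next
  case (add i u v d)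
  then obtain p q where pq: "p \<in> carrier (free_tensors AC 2)" "q \<in> carrier (free_tensors Hk 2)"
    "Poly_Mapping.keys d \<subseteq> lwords2 \<nu>"
    "tc B 2 (pB p) = tc B 2 (rep2 (smul (\<sigma> hbar ^ n) (pmap \<kappa> d)))" "tc Hk 2 q = tc Hk 2 (rep2 d)"
    "push (\<lambda>c. poly c 1) (at_one_class Hh) p = push (\<lambda>c. c) \<phi> q" by blast
  let ?p = "Poly_Mapping.single [\<iota> (hp i u), \<iota> (hp (n - i) v)] 1"
  let ?q = "Poly_Mapping.single [u, v] 1"
  have c: "\<iota> (hp i u) \<in> carrier B" "\<iota> (hp (n - i) v) \<in> carrier B" "u \<in> carrier Hk" "v \<in> carrier Hk"
    using rees_keys[OF rees_hp[OF add(2)]] rees_keys[OF rees_hp[OF add(3)]] subsetD[OF F_sub add(2)] subsetD[OF F_sub add(3)] by (simp_all add: \<iota>_keys)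
  have "tens (\<iota> (hp i u)) (\<iota> (hp (n - i) v)) = smul (\<sigma> hbar ^ n) (pmap \<kappa> (tens u v))"
    using add(1) by (simp add: \<iota>_hp tens_smul_left tens_smul_right smul_smul pmap_tens[OF \<kappa>] power_add[symmetric])
  then have 1: "tc B 2 (pB (?p + p)) = tc B 2 (rep2 (smul (\<sigma> hbar ^ n) (pmap \<kappa> (tens u v + d))))"
    using tc_tens[OF c(1,2), of 1] pq(4)
    by (simp add: push_simps[OF \<sigma>] rhomD[OF \<sigma>] pmap_simps[OF \<kappa>] smul_add flip: tp_add)
  have 2: "tc Hk 2 (?q + q) = tc Hk 2 (rep2 (tens u v + d))"
    using tc_tens[OF c(3,4), of 1] pq(5) by (simp flip: tp_add)
  have 3: "push (\<lambda>c. poly c 1) (at_one_class Hh) (?p + p) = push (\<lambda>c. c) \<phi> (?q + q)"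
    using pq(6) by (simp add: push_simps[OF rhom_ev] push_simps[OF rhom_id] \<phi>_hp[OF add(2)] \<phi>_hp[OF add(3)] K_def)
  have 4: "?p + p \<in> carrier (free_tensors AC 2)"
    using add(2,3) pq(1) by (intro free_tensors_add free_tensors_single) (auto simp: tuples_def rees_hp)
  have 5: "?q + q \<in> carrier (free_tensors Hk 2)"
    using c pq(2) by (intro free_tensors_add free_tensors_single) (auto simp: tuples_def)
  have 6: "Poly_Mapping.keys (tens u v + d) \<subseteq> lwords2 \<nu>"
    using c pq(3) by (intro keys_add_subset keys_tens_lwords2) auto
  show ?case using 1 2 3 4 5 6 by blast
qed

lemma comult_lift:
  "y \<in> rees \<Longrightarrow> \<exists>p q. p \<in> carrier (free_tensors AC 2) \<and> q \<in> carrier (free_tensors Hk 2) \<and>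
     tc B 2 (pB p) = comult B (\<iota> y) \<and> tc Hk 2 q = comult Hk (ev y) \<and>
     push (\<lambda>c. poly c 1) (at_one_class Hh) p = push (\<lambda>c. c) \<phi> q"
proof (induction rule: rees.induct)
  case zero
  show ?case
    by (intro exI[of _ 0]) (simp add: push_simps[OF \<sigma>] push_simps[OF rhom_ev] push_simps[OF rhom_id]
      \<iota>_simps pmap_simps[OF rhom_ev] comult_H_alg delta_def)
next
  case (add x n y)
  then obtain p q where pq: "p \<in> carrier (free_tensors AC 2)" "q \<in> carrier (free_tensors Hk 2)"
    "tc B 2 (pB p) = comult B (\<iota> y)" "tc Hk 2 q = comult Hk (ev y)"
    "push (\<lambda>c. poly c 1) (at_one_class Hh) p = push (\<lambda>c. c) \<phi> q" by blast
  obtain p' q' where pq': "p' \<in> carrier (free_tensors AC 2)" "q' \<in> carrier (free_tensors Hk 2)"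
     "tc B 2 (pB p') = tc B 2 (rep2 (smul (\<sigma> hbar ^ n) (pmap \<kappa> (delta x))))"
     "tc Hk 2 q' = tc Hk 2 (rep2 (delta x))"
     "push (\<lambda>c. poly c 1) (at_one_class Hh) p' = push (\<lambda>c. c) \<phi> q'"
    using ftens_lift[OF F_delta[OF add(1)]] by blast
  have c: "\<iota> (hp n x) \<in> carrier B" "\<iota> y \<in> carrier B" "x \<in> carrier Hk" "ev y \<in> carrier Hk"
    using rees_keys[OF rees_hp[OF add(1)]] rees_keys[OF add(2)] ev_keys[OF add(2)] subsetD[OF F_sub add(1)] by (simp_all add: \<iota>_keys)
  have d: "delta (\<iota> (hp n x)) = smul (\<sigma> hbar ^ n) (pmap \<kappa> (delta x))"
    by (simp add: \<iota>_hp delta_smul pmap_delta[OF \<kappa>])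
  have 1: "tc B 2 (pB (p' + p)) = comult B (\<iota> (hp n x + y))"
    using slinD(2)[OF Hcom.comult_slin c(1,2)] pq(3) pq'(3) comult_H_alg[OF c(1)] d
    by (simp add: push_simps[OF \<sigma>] \<iota>_simps flip: tp_add)
  have 2: "tc Hk 2 (q' + q) = comult Hk (ev (hp n x + y))"
    using slinD(2)[OF Hcom.comult_slin c(3,4)] pq(4) pq'(4) comult_H_alg[OF c(3)]
    by (simp add: pmap_simps[OF rhom_ev] ev_hp flip: tp_add)
  have 3: "push (\<lambda>c. poly c 1) (at_one_class Hh) (p' + p) = push (\<lambda>c. c) \<phi> (q' + q)"
    using pq(5) pq'(5) by (simp add: push_simps[OF rhom_ev] push_simps[OF rhom_id])
  show ?case using 1 2 3 free_tensors_add[OF pq'(1) pq(1)] free_tensors_add[OF pq'(2) pq(2)] by blast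
qed

text \<open>The defining \<open>THE\<close> of the coproduct in \<open>sub_hopf\<close> is resolved
  here: any \<open>p\<close> with the right image qualifies, and \<open>tensor_square_inj\<close>
  excludes every other class. Such a \<open>p\<close> is provided by
  \<open>comult_lift\<close>.\<close>

lemma comult_Hh:
  assumes y: "y \<in> rees" and p: "p \<in> carrier (free_tensors AC 2)" "tc B 2 (pB p) = comult B (\<iota> y)"
  shows "comult Hh (\<iota> y) = tc AC 2 p"
proof -
  have "comult Hh (\<iota> y) = (THE t. t \<in> carrier (tensor_power AC 2) \<and> tensor_map \<sigma> B 2 (\<lambda>y. y) t = comult B (\<iota> y))"
    by (simp add: Hh_def sub_hopf_def module.defs hopf.defs AC_def)
  also have "\<dots> = tc AC 2 p"
  proof (rule the_equality)
    show "tc AC 2 p \<in> carrier (tensor_power AC 2) \<and> tensor_map \<sigma> B 2 (\<lambda>y. y) (tc AC 2 p) = comult B (\<iota> y)"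
      using p by (simp add: carrier_tensor_power tensor_map_push[OF \<sigma> AC_module id_slin])
    fix t assume t: "t \<in> carrier (tensor_power AC 2) \<and> tensor_map \<sigma> B 2 (\<lambda>y. y) t = comult B (\<iota> y)"
    then obtain p' where p': "p' \<in> carrier (free_tensors AC 2)" "t = tc AC 2 p'" by (auto simp: carrier_tensor_power)
    then have "tc B 2 (pB p') = tc B 2 (pB p)" using t p by (simp add: tensor_map_push[OF \<sigma> AC_module id_slin])
    then show "t = tc AC 2 p" using tensor_square_inj[OF p'(1) p(1)] p'(2) by simp
  qed
  finally show ?thesis .
qed

lemma some_K:
  assumes "y \<in> rees"
  obtains z where "(SOME x. x \<in> K y) = \<iota> z" "z \<in> rees" "ev z = ev y"
proof -
  have "(SOME x. x \<in> K y) \<in> K y" by (rule someI[of _ "\<iota> y"]) (rule K_self[OF assms])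
  then show ?thesis using that assms by (auto simp: K_eq)
qed

lemma comult_Ho:
  assumes y: "y \<in> rees" shows "comult Ho (K y) = tensor_map (\<lambda>c. c) Ho 2 \<phi> (comult Hk (ev y))"
proof -
  obtain z where z: "(SOME x. x \<in> K y) = \<iota> z" "z \<in> rees" "ev z = ev y" using some_K[OF y] .
  obtain p q where pq: "p \<in> carrier (free_tensors AC 2)" "q \<in> carrier (free_tensors Hk 2)"
     "tc B 2 (pB p) = comult B (\<iota> z)" "tc Hk 2 q = comult Hk (ev z)"
     "push (\<lambda>c. poly c 1) (at_one_class Hh) p = push (\<lambda>c. c) \<phi> q"
    using comult_lift[OF z(2)] by blast
  have "comult Ho (K y) = tensor_map (\<lambda>c. poly c 1) OA 2 (at_one_class Hh) (comult Hh (\<iota> z))"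
    by (simp add: at_one_def module.defs hopf.defs z(1))
  also have "\<dots> = tc OA 2 (push (\<lambda>c. poly c 1) (at_one_class Hh) p)"
    unfolding comult_Hh[OF z(2) pq(1,3)] by (rule tensor_map_push[OF rhom_ev AC_module cls_slin pq(1)])
  also have "\<dots> = tc Ho 2 (push (\<lambda>c. c) \<phi> q)" by (simp only: pq(5) Ho_OA)
  also have "\<dots> = tensor_map (\<lambda>c. c) Ho 2 \<phi> (comult Hk (ev y))"
    using tensor_map_push[OF rhom_id H_alg_module \<phi>_slin pq(2)] pq(4) z(3) by simp
  finally show ?thesis .
qed

lemma counit_Hh: "counit Hh (\<iota> y) = eps y"
  by (simp add: Hh_def sub_hopf_def module.defs hopf.defs eps_pmap[OF \<sigma>] \<sigma>_eq)

lemma homog_Hh: "homog Hh d = \<iota> ` rees \<inter> homog B d"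
  by (simp add: Hh_def sub_hopf_def module.defs hopf.defs)

theorem rees_at_one_iso: "graded_hopf_iso Hk Ho \<phi>"
proof -
  interpret T: hopf_transport Hk Ho \<phi>
  proof (rule hopf_transport.intro)
    show "is_graded_hopf_algebra Hk" by (rule H_alg_graded)
    show "bij_betw \<phi> (carrier Hk) (carrier Ho)"
      unfolding bij_betw_def
    proof
      show "inj_on \<phi> (carrier Hk)"
      proof (rule inj_onI)
        fix x y assume "x \<in> carrier Hk" "y \<in> carrier Hk" "\<phi> x = \<phi> y"
        moreover from this obtain u v where "u \<in> rees" "x = ev u" "v \<in> rees" "y = ev v" using Hk_ev by meson
        ultimately show "x = y" by (simp add: \<phi>_ev K_eq_iff)
      qed
      have "\<phi> ` carrier Hk \<subseteq> carrier Ho" using slinD(1)[OF \<phi>_slin] by blast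
      moreover have "carrier Ho \<subseteq> \<phi> ` carrier Hk"
      proof
        fix T assume "T \<in> carrier Ho"
        then obtain y where "y \<in> rees" "T = K y" by (auto simp: OA_carrier)
        then have "T = \<phi> (ev y)" "ev y \<in> carrier Hk" using ev_keys by (auto simp: \<phi>_ev)
        then show "T \<in> \<phi> ` carrier Hk" by blast
      qed
      ultimately show "\<phi> ` carrier Hk = carrier Ho" by blast
    qed
    show "\<phi> x \<oplus>\<^bsub>Ho\<^esub> \<phi> y = \<phi> (x \<oplus>\<^bsub>Hk\<^esub> y)" if "x \<in> carrier Hk" "y \<in> carrier Hk" for x y
      using slinD(2)[OF \<phi>_slin that] by simp
    show "c \<odot>\<^bsub>Ho\<^esub> \<phi> x = \<phi> (c \<odot>\<^bsub>Hk\<^esub> x)" if "x \<in> carrier Hk" for c x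
      using slinD(3)[OF \<phi>_slin that] by simp
    show "\<zero>\<^bsub>Ho\<^esub> = \<phi> \<zero>\<^bsub>Hk\<^esub>" using \<phi>_ev[OF rees.zero] by (simp add: OA_zero pmap_simps[OF rhom_ev])
    show "\<one>\<^bsub>Ho\<^esub> = \<phi> \<one>\<^bsub>Hk\<^esub>" using \<phi>_ev[OF rees_one] by (simp add: OA_one pmap_one[OF rhom_ev])
    show "\<phi> x \<otimes>\<^bsub>Ho\<^esub> \<phi> y = \<phi> (x \<otimes>\<^bsub>Hk\<^esub> y)" if xy: "x \<in> carrier Hk" "y \<in> carrier Hk" for x y
    proof -
      obtain u v where "u \<in> rees" "x = ev u" "v \<in> rees" "y = ev v" using Hk_ev xy by meson
      then show ?thesis using \<phi>_ev[OF rees_mult[of u v]] by (simp add: \<phi>_ev OA_mult pmap_mult[OF rhom_ev])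
    qed
    fix x assume x: "x \<in> carrier Hk"
    then obtain y where y: "y \<in> rees" "x = ev y" using Hk_ev by meson
    \<comment> \<open>The structure maps of \<open>at_one\<close> pick an element of the coset by
      \<open>SOME\<close>; what is known of the choice is its value under \<open>ev\<close>.\<close>
    obtain z where z: "(SOME x. x \<in> K y) = \<iota> z" "z \<in> rees" "ev z = ev y" using some_K[OF y(1)] .
    show "comult Ho (\<phi> x) = tensor_map (\<lambda>c. c) Ho 2 \<phi> (comult Hk x)"
      using y comult_Ho by (simp add: \<phi>_ev)
    have "counit Ho (K y) = poly (eps z) 1"
      by (simp add: at_one_def module.defs hopf.defs z(1) counit_Hh)
    then show "counit Ho (\<phi> x) = counit Hk x"
      using y z eps_pmap[OF rhom_ev, of z] by (simp add: \<phi>_ev)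
    have "antipode Ho (K y) = at_one_class Hh (ant (\<iota> z))"
      by (simp add: at_one_def module.defs hopf.defs z(1))
    also have "\<dots> = K (ant z)" by (simp add: K_def pmap_ant[OF \<sigma>])
    also have "\<dots> = \<phi> (ev (ant z))" using z rees_ant by (simp add: \<phi>_ev)
    finally show "antipode Ho (\<phi> x) = \<phi> (antipode Hk x)"
      using y z by (simp add: \<phi>_ev pmap_ant[OF rhom_ev])
  next
    fix d
    have "homog Ho d = at_one_class Hh ` homog Hh d"
      by (simp add: at_one_def module.defs hopf.defs)
    also have "\<dots> = \<phi> ` homog Hk d"
    proof (intro equalityI subsetI)
      fix T assume "T \<in> at_one_class Hh ` homog Hh d"
      then obtain y where y: "y \<in> rees" "\<iota> y \<in> homog B d" "T = K y" by (auto simp: homog_Hh K_def)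
      then have "Poly_Mapping.keys (ev y) \<subseteq> words (letters \<nu>) d"
        using keys_pmap[OF rhom_ev, of y] by (simp add: homog_H_alg \<iota>_keys)
      then show "T \<in> \<phi> ` homog Hk d" using y by (auto simp: homog_H_alg \<phi>_ev[symmetric])
    next
      fix T assume "T \<in> \<phi> ` homog Hk d"
      then obtain x where x: "Poly_Mapping.keys x \<subseteq> words (letters \<nu>) d" "T = \<phi> x" by (auto simp: homog_H_alg)
      then obtain n where n: "x \<in> F n" using F_exh words_lwords by (meson order_trans)
      have "Poly_Mapping.keys (hp n x) \<subseteq> words (letters \<nu>) d" using keys_hp[of n x] x(1) by (rule order_trans)
      then have "\<iota> (hp n x) \<in> homog Hh d" using rees_hp[OF n] by (simp add: homog_Hh homog_H_alg \<iota>_keys)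
      then show "T \<in> at_one_class Hh ` homog Hh d" using x(2) \<phi>_hp[OF n] by (auto simp: K_def)
    qed
    finally show "homog Ho d = \<phi> ` homog Hk d" .
  qed
  show ?thesis by (rule T.graded_iso)
qed

end

section \<open>The dual algebra and the coradical-type filtration\<close>

text \<open>Functionals on the free algebra are identified with functions on words; the product dual to the
  coproduct is \<open>conv\<close>, and \<open>ract g\<close>, \<open>lact f\<close> are the transposes of right and left multiplication.\<close>

definition conv :: "(nat list \<Rightarrow> 'r::comm_ring_1) \<Rightarrow> (nat list \<Rightarrow> 'r) \<Rightarrow> nat list \<Rightarrow> 'r" where
  "conv f g w = wsum (\<lambda>(u, v). f u * g v) (cow w)"

definition rac :: "(nat list \<Rightarrow> 'r::comm_ring_1) \<Rightarrow> (nat list \<times> nat list \<Rightarrow>\<^sub>0 'r) \<Rightarrow> 'r falg" where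
  "rac g = lext (\<lambda>(u, v). smul (g v) (W u))"

definition lac :: "(nat list \<Rightarrow> 'r::comm_ring_1) \<Rightarrow> (nat list \<times> nat list \<Rightarrow>\<^sub>0 'r) \<Rightarrow> 'r falg" where
  "lac f = lext (\<lambda>(u, v). smul (f u) (W v))"

abbreviation "ract g x \<equiv> rac g (delta x)"
abbreviation "lact f x \<equiv> lac f (delta x)"

lemma wsum_lext: "wsum f (lext G x) = wsum (\<lambda>u. wsum f (G u)) x"
  by (induction x rule: pm_induct) simp_all

lemma wsum_conv: "wsum (conv f g) x = wsum (\<lambda>(u, v). f u * g v) (delta x)"
  by (simp add: delta_def wsum_lext conv_def[abs_def])

lemma rac_tens: "rac g (tens x y) = smul (wsum g y) x"
proof -
  have *: "lext (\<lambda>v. smul (g v) z) y = smul (wsum g y) z" for z :: "'a falg"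
    by (induction y rule: pm_induct) (simp_all add: smul_add_left smul_smul)
  show ?thesis unfolding tens_lext rac_def
    by (simp only: lext_lext prod.case lext_simps(5) smul_one * lext_smul_W)
qed

lemma rac_simps [simp]: "rac g 0 = 0" "rac g (d + d') = rac g d + rac g d'" "rac g (smul c d) = smul c (rac g d)"
  "rac g (d - d') = rac g d - rac g d'"
  by (simp_all add: rac_def lext_smul)

lemma rac_sum: "rac g (sum f I) = (\<Sum>i\<in>I. rac g (f i))"
  by (simp add: rac_def lext_sum)

lemma lac_simps [simp]: "lac g 0 = 0" "lac g (d + d') = lac g d + lac g d'" "lac g (smul c d) = smul c (lac g d)"
  by (simp_all add: lac_def lext_smul)

lemma wsum_rac: "wsum f (rac g d) = wsum (\<lambda>(u, v). f u * g v) d"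
  by (simp add: rac_def wsum_lext case_prod_unfold mult.commute)

lemma wsum_lac: "wsum g (lac f d) = wsum (\<lambda>(u, v). f u * g v) d"
  by (simp add: lac_def wsum_lext case_prod_unfold)

lemma wsum_ract: "wsum f (ract g x) = wsum (conv f g) x"
  and wsum_lact: "wsum g (lact f x) = wsum (conv f g) x"
  by (simp_all add: wsum_rac wsum_lac wsum_conv)

lemma conv_assoc: "conv (conv f g) h = conv f (conv g h)"
proof
  fix w
  let ?M = "wsum (\<lambda>(u, v, w). f u * g v * h w)"
  have 1: "?M (e12 d * e3 (W b)) = wsum (\<lambda>(u, v). f u * g v) d * h b" for d b
  proof (induction d rule: pm_induct)
    case (add p c d)
    then show ?case by (cases p) (simp add: e_add distrib_right e12_def e3_def mult_single zero_list_def plus_list_def)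
  qed (simp add: e12_def)
  have 2: "?M (e1 (W a) * e23 d) = f a * wsum (\<lambda>(u, v). g u * h v) d" for d a
  proof (induction d rule: pm_induct)
    case (add p c d)
    then show ?case by (cases p) (simp add: e_add distrib_left e23_def e1_def mult_single zero_list_def plus_list_def mult_ac)
  qed (simp add: e23_def)
  have "conv (conv f g) h w = ?M (delta12 (cow w))"
  proof -
    have "(\<lambda>p. ?M (case p of (u, v) \<Rightarrow> e12 (cow u) * e3 (W v))) = (\<lambda>(u, v). conv f g u * h v)"
      by (intro ext, rename_tac p, case_tac p) (simp only: prod.case 1 conv_def[of f g])
    then show ?thesis by (simp only: conv_def[of "conv f g"] delta12_def wsum_lext)
  qed
  also have "\<dots> = ?M (delta23 (cow w))" using coassoc[of "W w :: 'a falg"] by (simp add: delta_W)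
  also have "\<dots> = conv f (conv g h) w"
  proof -
    have "(\<lambda>p. ?M (case p of (u, v) \<Rightarrow> e1 (W u) * e23 (cow v))) = (\<lambda>(u, v). f u * conv g h v)"
      by (intro ext, rename_tac p, case_tac p) (simp only: prod.case 2 conv_def[of g h])
    then show ?thesis by (simp only: conv_def[of f "conv g h"] delta23_def wsum_lext)
  qed
  finally show "conv (conv f g) h w = conv f (conv g h) w" .
qed

definition unit_fun :: "nat list \<Rightarrow> 'r::comm_ring_1" where
  "unit_fun w = (if w = [] then 1 else 0)"

lemma conv_unit: "conv unit_fun g = g" "conv g unit_fun = g"
proof -
  have "counit_left d = lac unit_fun d" "counit_right d = rac unit_fun d" for d :: "_ \<Rightarrow>\<^sub>0 'a"
    by (simp_all add: counit_left_def counit_right_def lac_def rac_def unit_fun_def[abs_def])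
  then have "lact unit_fun (W w) = (W w :: 'a falg)" "ract unit_fun (W w) = (W w :: 'a falg)" for w
    using counit_delta[of "W w :: 'a falg"] by simp_all
  then show "conv unit_fun g = g" "conv g unit_fun = g"
    using wsum_lact[of g unit_fun "W _"] wsum_ract[of g unit_fun "W _"] by (auto intro!: ext)
qed

lemma conv_Nil: "conv f g [] = f [] * g []"
proof -
  have "cow [] = (W ([], []) :: _ \<Rightarrow>\<^sub>0 'a)" by (simp add: cow_append zero_prod_def zero_list_def flip: W_zero)
  then show ?thesis by (simp add: conv_def)
qed

lemma wsum_ext: "(\<And>h. wsum h x = 0) \<Longrightarrow> x = 0"
proof (rule poly_mapping_eqI)
  fix w assume *: "\<And>h. wsum h x = 0"
  have "wsum (\<lambda>u. if u = w then 1 else 0) x = Poly_Mapping.lookup x w"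
    by (induction x rule: pm_induct) (auto simp: lookup_add lookup_single when_def)
  then show "Poly_Mapping.lookup x w = Poly_Mapping.lookup 0 w" using * by simp
qed

text \<open>\<open>Kf n\<close> is the annihilator of the \<open>n\<close>-th power of the ideal of functionals killing \<open>1\<close>.\<close>

definition Kf :: "nat \<Rightarrow> 'r::comm_ring_1 falg set" where
  "Kf n = {x. \<forall>h fs. length fs = n \<longrightarrow> (\<forall>f\<in>set fs. f [] = 0) \<longrightarrow> wsum (foldl conv h fs) x = 0}"

lemma KfD: "x \<in> Kf n \<Longrightarrow> length fs = n \<Longrightarrow> \<forall>f\<in>set fs. f [] = 0 \<Longrightarrow> wsum (foldl conv h fs) x = 0"
  by (simp add: Kf_def)

lemma Kf_0: "Kf 0 = {0}"
  using wsum_ext by (auto simp: Kf_def)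

text \<open>Removing the last functional of the product gives a recursion in \<open>n\<close>, along
  which the inductions about \<open>Kf\<close> run.\<close>

lemma Kf_ract: "x \<in> Kf (Suc n) \<longleftrightarrow> (\<forall>g. g [] = 0 \<longrightarrow> ract g x \<in> Kf n)"
proof
  assume x: "x \<in> Kf (Suc n)"
  show "\<forall>g. g [] = 0 \<longrightarrow> ract g x \<in> Kf n"
  proof (intro allI impI)
    fix g :: "nat list \<Rightarrow> 'a" assume g: "g [] = 0"
    show "ract g x \<in> Kf n"
      unfolding Kf_def
    proof (intro CollectI allI impI)
      fix h and fs :: "(nat list \<Rightarrow> 'a) list" assume "length fs = n" "\<forall>f\<in>set fs. f [] = 0"
      then have "wsum (foldl conv h (fs @ [g])) x = 0"
        using g by (intro KfD[OF x]) auto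
      then show "wsum (foldl conv h fs) (ract g x) = 0" by (simp add: wsum_ract)
    qed
  qed
next
  assume *: "\<forall>g. g [] = 0 \<longrightarrow> ract g x \<in> Kf n"
  show "x \<in> Kf (Suc n)"
    unfolding Kf_def
  proof (intro CollectI allI impI)
    fix h and fs :: "(nat list \<Rightarrow> 'a) list" assume fs: "length fs = Suc n" "\<forall>f\<in>set fs. f [] = 0"
    then obtain gs g where gs: "fs = gs @ [g]" by (metis length_Suc_conv_rev)
    then have "ract g x \<in> Kf n" "length gs = n" "\<forall>f\<in>set gs. f [] = 0" using * fs by auto
    then have "wsum (foldl conv h gs) (ract g x) = 0" by (rule KfD)
    then show "wsum (foldl conv h fs) x = 0" by (simp add: gs wsum_ract)
  qed
qed

lemma Kf_zero: "0 \<in> Kf n" and Kf_add: "x \<in> Kf n \<Longrightarrow> y \<in> Kf n \<Longrightarrow> x + y \<in> Kf n"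
  and Kf_smul: "x \<in> Kf n \<Longrightarrow> smul c x \<in> Kf n"
  by (simp_all add: Kf_def)

lemma Kf_diff: "x \<in> Kf n \<Longrightarrow> y \<in> Kf n \<Longrightarrow> x - y \<in> Kf n"
  by (simp add: Kf_def)

lemma Kf_sum: "(\<And>i. i \<in> I \<Longrightarrow> f i \<in> Kf n) \<Longrightarrow> sum f I \<in> Kf n"
  by (induction I rule: infinite_finite_induct) (auto intro: Kf_zero Kf_add)

lemma Kf_Suc: "Kf n \<subseteq> Kf (Suc n)"
proof
  fix x :: "'a falg" assume x: "x \<in> Kf n"
  show "x \<in> Kf (Suc n)"
    unfolding Kf_def
  proof (intro CollectI allI impI)
    fix h and fs :: "(nat list \<Rightarrow> 'a) list" assume "length fs = Suc n" "\<forall>f\<in>set fs. f [] = 0"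
    then obtain f gs where "fs = f # gs" "length gs = n" "\<forall>f\<in>set gs. f [] = 0" by (cases fs) auto
    then show "wsum (foldl conv h fs) x = 0" using x unfolding Kf_def by simp
  qed
qed

lemma Kf_mono: "m \<le> n \<Longrightarrow> Kf m \<subseteq> Kf n"
  using Kf_Suc by (rule lift_Suc_mono_le)

lemma rac_one: "rac g 1 = smul (g []) 1"
  using rac_tens[of g 1 1] wsum_simps(5)[of g "[]" 1] by (simp add: tens_one W_Nil)

lemma Kf_one: "1 \<in> Kf (Suc 0)"
  by (simp add: Kf_ract delta_one rac_one Kf_0)

text \<open>Every functional is a multiple of the counit plus a functional that kills 1, and the
  latter kind vanishes on \<open>x\<close>.\<close>

lemma Kf_1: "x \<in> Kf (Suc 0) \<Longrightarrow> x = smul (eps x) 1"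
proof -
  assume "x \<in> Kf (Suc 0)"
  then have x: "ract g x = 0" if "g [] = 0" for g using that by (simp add: Kf_ract Kf_0)
  have "wsum h (x - smul (eps x) 1) = 0" for h
  proof -
    define g where "g w = (if w = [] then 0 else h w)" for w
    have "g [] = 0" by (simp add: g_def)
    from x[of g, OF this] have "wsum g x = 0" using wsum_ract[of unit_fun g x] by (simp add: conv_unit)
    moreover have "wsum h y = wsum g y + eps y * h []" for y
      by (induction y rule: pm_induct) (auto simp: g_def algebra_simps)
    moreover have "wsum h (1 :: 'a falg) = h []" using wsum_simps(5)[of h "[]" 1] by (simp add: W_Nil)
    ultimately show ?thesis by simp
  qed
  then have "x - smul (eps x) 1 = 0" by (rule wsum_ext)
  then show ?thesis by simp
qed

definition dfun :: "nat list \<Rightarrow> nat list \<Rightarrow> 'r::comm_ring_1" where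
  "dfun w u = (if u = w then 1 else 0)"

lemma lookup_rac_dfun: "Poly_Mapping.lookup (rac (dfun v) d) u = Poly_Mapping.lookup d (u, v)"
proof (induction d rule: pm_induct)
  case (add p c d)
  then show ?case by (cases p) (auto simp: lookup_add rac_def dfun_def lookup_single when_def)
qed simp

lemma slice_right: "d = (\<Sum>v\<in>snd ` Poly_Mapping.keys d. tens (rac (dfun v) d) (W v))"
proof (rule poly_mapping_eqI)
  fix p :: "nat list \<times> nat list" obtain a b where p: "p = (a, b)" by (cases p)
  have "Poly_Mapping.lookup (\<Sum>v\<in>snd ` Poly_Mapping.keys d. tens (rac (dfun v) d) (W v)) p =
     (\<Sum>v\<in>snd ` Poly_Mapping.keys d. if v = b then Poly_Mapping.lookup d (a, b) else 0)"
    unfolding p lookup_sum lookup_tens lookup_rac_dfun lookup_single when_def by (intro sum.cong refl) auto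
  also have "\<dots> = Poly_Mapping.lookup d p"
    by (force simp: p in_keys_iff)
  finally show "Poly_Mapping.lookup d p = Poly_Mapping.lookup (\<Sum>v\<in>snd ` Poly_Mapping.keys d. tens (rac (dfun v) d) (W v)) p" by simp
qed

lemma rac_mult_tens: "rac g (d * tens y (W v)) = rac (\<lambda>u. g (u @ v)) d * y"
proof (induction d rule: pm_induct)
  case (add p c d)
  have "rac g (Poly_Mapping.single p c * tens y (W v)) = rac (\<lambda>u. g (u @ v)) (Poly_Mapping.single p c) * y"
  proof (induction y rule: pm_induct)
    case (add w e y)
    then show ?case
      by (cases p) (simp add: tens_add_left distrib_left tens_single mult_single rac_def plus_list_def smul_smul mult_ac)
  qed simp
  with add show ?case by (simp add: distrib_right)
qed simp

lemma rac_fun_add: "rac (\<lambda>u. g u + h u) d = rac g d + rac h d"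
  and rac_fun_smul: "rac (\<lambda>u. c * g u) d = smul c (rac g d)"
proof -
  show "rac (\<lambda>u. g u + h u) d = rac g d + rac h d"
  proof (induction d rule: pm_induct)
    case (add p c d)
    then show ?case by (cases p) (simp add: rac_def smul_add_left smul_add distrib_left single_add)
  qed simp
  show "rac (\<lambda>u. c * g u) d = smul c (rac g d)"
  proof (induction d rule: pm_induct)
    case (add p e d)
    then show ?case by (cases p) (simp add: rac_def smul_add mult_ac)
  qed simp
qed

lemma ract_unit: "ract unit_fun x = x"
proof -
  have "counit_right d = rac unit_fun d" for d :: "_ \<Rightarrow>\<^sub>0 'a"
    by (simp add: counit_right_def rac_def unit_fun_def[abs_def])
  then show ?thesis using counit_delta(2)[of x] by simp
qed

text \<open>The element \<open>g(x\<^sub>2 y\<^sub>2) x\<^sub>1 y\<^sub>1\<close> is expanded along the second leg of \<open>\<Delta> y\<close>, and the functional \<open>u \<mapsto> g(u v)\<close>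
  is split into a part killing \<open>1\<close> and a multiple of the counit.\<close>

lemma Kf_mult: "x \<in> Kf (Suc a) \<Longrightarrow> y \<in> Kf (Suc b) \<Longrightarrow> x * y \<in> Kf (Suc (a + b))"
proof (induction "a + b" arbitrary: a b x y rule: less_induct)
  case less
  have IH: "u * v \<in> Kf (a + b)" if "u \<in> Kf i" "v \<in> Kf j" "i + j \<le> Suc (a + b)" for u v :: "'a falg" and i j
  proof (cases "i = 0 \<or> j = 0")
    case True
    then have "u * v = 0" using that by (auto simp: Kf_0)
    then show ?thesis by (simp add: Kf_zero)
  next
    case False
    then obtain i' j' where ij: "i = Suc i'" "j = Suc j'" by (metis not0_implies_Suc)
    then have "u * v \<in> Kf (Suc (i' + j'))" using that by (intro less.hyps) auto
    moreover have "Suc (i' + j') \<le> a + b" using that ij by simp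
    ultimately show ?thesis using Kf_mono by blast
  qed
  show ?case
    unfolding Kf_ract
  proof (intro allI impI)
    fix g :: "nat list \<Rightarrow> 'a" assume g: "g [] = 0"
    let ?S = "snd ` Poly_Mapping.keys (delta y)"
    have "ract g (x * y) = (\<Sum>v\<in>?S. ract (\<lambda>u. g (u @ v)) x * ract (dfun v) y)"
    proof -
      have "ract g (x * y) = rac g (delta x * (\<Sum>v\<in>?S. tens (ract (dfun v) y) (W v)))"
        using slice_right[of "delta y"] by (simp add: delta_mult)
      then show ?thesis by (simp add: sum_distrib_left rac_sum rac_mult_tens)
    qed
    also have "\<dots> = (\<Sum>v\<in>?S. ract (\<lambda>u. if u = [] then 0 else g (u @ v)) x * ract (dfun v) y) + (\<Sum>v\<in>?S. smul (g v) (x * ract (dfun v) y))"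
    proof -
      have "ract (\<lambda>u. g (u @ v)) x = ract (\<lambda>u. if u = [] then 0 else g (u @ v)) x + smul (g v) x" for v
      proof -
        have "(\<lambda>u. g (u @ v)) = (\<lambda>u. (if u = [] then 0 else g (u @ v)) + g v * unit_fun u)"
          by (auto simp: unit_fun_def)
        then show ?thesis by (simp only: rac_fun_add rac_fun_smul ract_unit)
      qed
      then show ?thesis by (simp add: distrib_right sum.distrib mult_smul_left)
    qed
    also have "(\<Sum>v\<in>?S. smul (g v) (x * ract (dfun v) y)) = x * ract g y"
    proof -
      have "ract g y = (\<Sum>v\<in>?S. smul (g v) (ract (dfun v) y))"
      proof -
        have "ract g y = rac g (\<Sum>v\<in>?S. tens (ract (dfun v) y) (W v))" using slice_right[of "delta y"] by simp
        then show ?thesis by (simp add: rac_sum rac_tens)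
      qed
      then show ?thesis by (simp add: sum_distrib_left mult_smul_right)
    qed
    also have "(\<Sum>v\<in>?S. ract (\<lambda>u. if u = [] then 0 else g (u @ v)) x * ract (dfun v) y) + x * ract g y \<in> Kf (a + b)"
    proof (intro Kf_add Kf_sum)
      have y: "ract h y \<in> Kf b" if "h [] = 0" for h using less.prems(2) that by (simp add: Kf_ract)
      have x: "ract h x \<in> Kf a" if "h [] = 0" for h using less.prems(1) that by (simp add: Kf_ract)
      show "x * ract g y \<in> Kf (a + b)" using less.prems(1) y[of g, OF g] by (rule IH) simp
      fix v
      show "ract (\<lambda>u. if u = [] then 0 else g (u @ v)) x * ract (dfun v) y \<in> Kf (a + b)"
      proof (cases "v = []")
        case True
        then have "ract (dfun v) y = y" using ract_unit[of y] by (simp add: dfun_def[abs_def] unit_fun_def[abs_def])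
        then show ?thesis using less.prems(2) by (intro IH[OF x]) auto
      next
        case False
        then show ?thesis by (intro IH[OF x y]) (auto simp: dfun_def)
      qed
    qed
    finally show "ract g (x * y) \<in> Kf (a + b)" .
  qed
qed

text \<open>In the concatenated product the free functional \<open>h'\<close> is absorbed by the
  last member \<open>f\<close> of \<open>fs\<close>: \<open>conv f h'\<close> again kills 1 by
  \<open>conv_Nil\<close>. The whole is then one product with \<open>length fs + length gs\<close>
  factors killing 1. In \<open>Df_delta\<close> the two blocks act on the two legs of
  \<Delta>.\<close>

lemma Kf_conv:
  assumes "x \<in> Kf (length fs + length gs)" "\<forall>f\<in>set fs. f [] = 0" "\<forall>f\<in>set gs. f [] = 0"
  shows "wsum (conv (foldl conv h fs) (foldl conv h' gs)) x = 0"
proof -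
  have *: "conv P (foldl conv h' gs) = foldl conv (conv P h') gs" for P
    by (induction gs rule: rev_induct) (simp_all add: conv_assoc[symmetric])
  show ?thesis
  proof (cases fs rule: rev_cases)
    case Nil
    then show ?thesis using assms by (simp add: * Kf_def)
  next
    case (snoc fs' f)
    have "conv (foldl conv h fs) (foldl conv h' gs) = foldl conv h (fs' @ conv f h' # gs)"
      by (simp add: snoc * conv_assoc)
    moreover have "\<forall>f\<in>set (fs' @ conv f h' # gs). f [] = 0" "length (fs' @ conv f h' # gs) = length fs + length gs"
      using assms snoc by (auto simp: conv_Nil)
    ultimately show ?thesis using KfD[OF assms(1)] by metis
  qed
qed

subsection \<open>The generators in the filtration\<close>

lemma wsum_one: "wsum (h :: nat list \<Rightarrow> _) 1 = h []"
  using wsum_simps(5)[of h "[]" 1] by (simp add: W_Nil)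

lemma faa_at_1: "faa l 1 = smul (of_nat (Suc l)) (gen 1 :: 'r::comm_ring_1 falg)"
proof (induction l)
  case 0 show ?case by (simp add: faa_0)
next
  case (Suc l)
  have "faa (Suc l) 1 = faa l 0 * faa 0 1 + faa l 1 * (faa 0 (0::nat) :: 'r falg)"
    unfolding faa_Suc by (simp add: numeral_2_eq_2 atMost_Suc)
  then have "faa (Suc l) 1 = gen 1 + (faa l 1 :: 'r falg)" by (simp add: faa_at_0 faa_0)
  also have "faa l 1 = smul (of_nat (Suc l)) (gen 1 :: 'r falg)" by (rule Suc)
  also have "gen 1 + smul (of_nat (Suc l)) (gen 1) = smul (1 + of_nat (Suc l)) (gen 1 :: 'r falg)" by (simp only: smul_add_left smul_one)
  finally show ?case by (simp only: of_nat_Suc[of "Suc l"])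
qed

lemma com_1: "com 1 = tens 1 (gen 1) + tens (gen 1) 1"
  by (simp add: com_def atMost_Suc faa_0 faa_at_0 add.commute)

definition efun :: "(nat list \<Rightarrow> 'r::comm_ring_1) \<Rightarrow> nat list \<Rightarrow> 'r" where
  "efun h u = (if u = [] then 0 else h u)"

lemma ract_efun: "ract h x = ract (efun h) x + smul (h []) x"
proof -
  have "h = (\<lambda>u. efun h u + h [] * unit_fun u)" by (auto simp: efun_def unit_fun_def)
  then have "ract h x = ract (\<lambda>u. efun h u + h [] * unit_fun u) x" by metis
  then show ?thesis by (simp only: rac_fun_add rac_fun_smul ract_unit)
qed

lemma gen1_in_Kf: "gen 1 \<in> Kf 2"
proof -
  have "ract g (gen 1) \<in> Kf (Suc 0)" if "g [] = 0" for g :: "nat list \<Rightarrow> 'a"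
  proof -
    have "ract g (gen 1) = smul (wsum g (gen 1)) (1 :: 'a falg)"
      by (simp only: delta_gen com_1 rac_simps rac_tens wsum_one that smul_0 add_0_right)
    then show ?thesis using Kf_one Kf_smul by metis
  qed
  then show ?thesis by (simp add: numeral_2_eq_2 Kf_ract)
qed

lemma gen1_power_Kf: "(gen 1 :: 'r::comm_ring_1 falg) ^ n \<in> Kf (Suc n)"
proof (induction n)
  case 0 show ?case using Kf_one by simp
next
  case (Suc n)
  have "gen 1 \<in> (Kf (Suc 1) :: 'r falg set)" using gen1_in_Kf by (simp add: numeral_2_eq_2)
  from Kf_mult[OF Suc this] show ?case by (simp add: power_commutes)
qed

text \<open>As \<open>gen 1\<close> is primitive, the contraction behaves like a derivation up to
  lower terms: a single factor goes to the second leg in \<open>Suc n\<close> ways, which gives the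
  leading term, and the remaining terms lie deeper in the filtration.\<close>

lemma ract_gen1_power:
  assumes "h [] = 0"
  shows "ract h (gen 1 ^ Suc n) - smul (of_nat (Suc n) * h [1]) (gen 1 ^ n) \<in> Kf n"
proof (induction n)
  case 0
  have "ract h (gen 1) = smul (h [1]) 1"
    using assms by (simp only: delta_gen com_1 rac_simps rac_tens wsum_one) (simp add: gen_def)
  then show ?case by (simp add: Kf_0)
next
  case (Suc n)
  let ?g = "gen 1 :: 'a falg"
  have two: "smul (2 * c) z = smul c z + smul c z" for c :: 'a and z :: "'a falg"
    by (simp only: smul_add_left[symmetric] mult_2)
  define r where "r = ract h (?g ^ Suc n) - smul (of_nat (Suc n) * h [1]) (?g ^ n)"
  have r: "r \<in> Kf n" using Suc by (simp add: r_def)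
  have rg: "r * ?g \<in> Kf (Suc n)"
  proof (cases n)
    case 0 then show ?thesis using r by (simp add: Kf_0 Kf_zero)
  next
    case (Suc m)
    then have "r * ?g \<in> Kf (Suc (m + 1))" using r Kf_mult[of r m ?g 1] gen1_in_Kf by (simp add: numeral_2_eq_2)
    then show ?thesis using Suc by simp
  qed
  let ?h = "\<lambda>u. h (u @ [1])"
  \<comment> \<open>Multiplying by \<open>\<Delta> a\<^sub>1 = 1 \<otimes> a\<^sub>1 + a\<^sub>1
    \<otimes> 1\<close>, the first summand appends the letter 1 to the argument of \<open>h\<close>.
    The new functional has value \<open>h [1]\<close> at the empty word, which raises the
    multiplicity of the leading term by one.\<close>
  have "ract h (?g ^ Suc n * ?g) = ract ?h (?g ^ Suc n) + ract h (?g ^ Suc n) * ?g"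
  proof -
    have "delta ?g = tens 1 ?g + tens ?g 1" by (simp only: delta_gen com_1)
    then have "delta ?g = tens 1 (W [1]) + tens ?g (W [])" unfolding gen_def W_Nil .
    then have "ract h (?g ^ Suc n * ?g) = rac h (delta (?g ^ Suc n) * tens 1 (W [1])) + rac h (delta (?g ^ Suc n) * tens ?g (W []))"
      by (simp only: delta_mult distrib_left rac_simps)
    then show ?thesis by (simp only: rac_mult_tens append_Nil2 mult_1_right)
  qed
  also have "\<dots> = ract (efun ?h) (?g ^ Suc n) + smul (h [1]) (?g ^ Suc n) + (r + smul (of_nat (Suc n) * h [1]) (?g ^ n)) * ?g"
    by (subst ract_efun[of ?h]) (simp add: r_def)
  finally have "ract h (?g ^ Suc n * ?g) - smul (of_nat (Suc (Suc n)) * h [1]) (?g ^ Suc n) = ract (efun ?h) (?g ^ Suc n) + r * ?g"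
    by (simp add: distrib_right mult_smul_left power_commutes smul_add_left algebra_simps two)
  moreover have "ract (efun ?h) (?g ^ Suc n) \<in> Kf (Suc n)"
    by (rule iffD1[OF Kf_ract gen1_power_Kf[of "Suc n"], rule_format]) (simp add: efun_def)
  ultimately show ?case unfolding power_Suc2[of ?g "Suc n"] using rg by (simp only: Kf_add)
qed

text \<open>Modulo \<open>Kf (n - 1)\<close> the contractions of \<open>gen n\<close> and of
  \<open>gen 1 ^ n\<close> by \<open>h\<close> agree, both being \<open>n h(a\<^sub>1)\<close> times
  \<open>gen 1 ^ (n - 1)\<close>. For \<open>gen n\<close> this is the term \<open>m = n - 1\<close>
  of the coproduct, whose right factor is \<open>n a\<^sub>1\<close> and whose left factor is
  \<open>gen 1 ^ (n - 1)\<close> modulo lower terms by induction; the term \<open>m = n\<close> is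
  killed by \<open>h\<close>, and smaller \<open>m\<close> lie lower already. So the difference
  drops by one step.\<close>

lemma gen_in_Kf: "n \<ge> 1 \<Longrightarrow> gen n \<in> (Kf (Suc n) :: 'r falg set) \<and> gen n - gen 1 ^ n \<in> (Kf n :: 'r::comm_ring_1 falg set)"
proof (induction n rule: less_induct)
  case (less n)
  obtain k where n: "n = Suc k" using less.prems by (cases n) auto
  let ?g = "gen 1 :: 'r falg"
  have "gen n - ?g ^ n \<in> Kf (Suc k)"
    unfolding Kf_ract
  proof (intro allI impI)
    fix h :: "nat list \<Rightarrow> 'r" assume h: "h [] = 0"
    let ?c = "of_nat n * h [1]"
    have "ract h (gen n) = (\<Sum>m\<le>n. smul (wsum h (faa m (n - m))) (faa 0 m))"
      using n by (simp add: delta_gen com_def rac_sum rac_tens)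
    also have "\<dots> = (\<Sum>m<k. smul (wsum h (faa m (n - m))) (faa 0 m)) + smul (wsum h (faa k 1)) (faa 0 k)"
      using h by (simp add: n atMost_Suc faa_at_0 wsum_one lessThan_Suc_atMost[symmetric] add.commute)
    also have "wsum h (faa k 1) = ?c" by (simp only: faa_at_1) (simp add: gen_def n)
    finally have e: "ract h (gen n) = (\<Sum>m<k. smul (wsum h (faa m (n - m))) (faa 0 m)) + smul ?c (faa 0 k)" .
    have 1: "(\<Sum>m<k. smul (wsum h (faa m (n - m))) (faa 0 m)) \<in> Kf k"
    proof (intro Kf_sum Kf_smul)
      fix m assume m: "m \<in> {..<k}"
      have "faa 0 m \<in> (Kf (Suc m) :: 'r falg set)"
        using less.IH[of m] m n Kf_one by (cases "m = 0") (auto simp: faa_0)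
      then show "faa 0 m \<in> (Kf k :: 'r falg set)" using Kf_mono[of "Suc m" k] m by auto
    qed
    have 2: "faa 0 k - ?g ^ k \<in> Kf k"
      using less.IH[of k] n by (cases "k = 0") (auto simp: faa_0 Kf_zero)
    have 3: "ract h (?g ^ n) - smul ?c (?g ^ k) \<in> Kf k" using ract_gen1_power[of h k, OF h] by (simp add: n)
    have "ract h (gen n - ?g ^ n) = (\<Sum>m<k. smul (wsum h (faa m (n - m))) (faa 0 m)) + smul ?c (faa 0 k - ?g ^ k)
        - (ract h (?g ^ n) - smul ?c (?g ^ k))"
    proof -
      have "delta (x - y) = delta x - delta y" for x y :: "'r falg" by (simp add: delta_def)
      then show ?thesis by (simp add: e smul_diff)
    qed
    then show "ract h (gen n - ?g ^ n) \<in> Kf k" using 1 2 3 by (simp only: Kf_add Kf_diff Kf_smul)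
  qed
  then have b: "gen n - ?g ^ n \<in> Kf n" by (simp add: n)
  then have "(gen n - ?g ^ n) + ?g ^ n \<in> Kf (Suc n)" using Kf_Suc gen1_power_Kf by (intro Kf_add) auto
  with b show ?case by simp
qed

lemma W_in_Kf: "w \<in> lwords \<nu> \<Longrightarrow> W w \<in> Kf (Suc (sum_list w))"
proof (induction w)
  case Nil show ?case using Kf_one by (simp add: W_Nil)
next
  case (Cons n w)
  then have "gen n \<in> (Kf (Suc n) :: 'a falg set)" "W w \<in> (Kf (Suc (sum_list w)) :: 'a falg set)"
    using gen_in_Kf[of n] by (auto simp: lwords_def letters_def)
  from Kf_mult[OF this] show ?case by (simp add: gen_W)
qed

section \<open>Compatibility of the filtration \<open>Df\<close> with all structure maps\<close>

text \<open>\<open>Kf\<close> counts the functionals in a product, while \<delta> with index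
  \<open>n + 1\<close> belongs to \<open>D\<^sub>n\<close>; hence the shift by one. That
  \<open>D_ker\<close> is this set is shown in \<open>D_ker_H_alg\<close>.\<close>

definition Df :: "enat \<Rightarrow> nat \<Rightarrow> 'r::comm_ring_1 falg set" where
  "Df \<nu> n = {x. Poly_Mapping.keys x \<subseteq> lwords \<nu>} \<inter> Kf (Suc n)"

lemma Df_exh: "Poly_Mapping.keys x \<subseteq> lwords \<nu> \<Longrightarrow> \<exists>n. x \<in> Df \<nu> n"
proof (induction x rule: pm_induct_keys)
  case zero show ?case by (auto simp: Df_def Kf_zero)
next
  case (add w c x)
  then obtain n where n: "x \<in> Df \<nu> n" by blast
  have w: "W w \<in> (Kf (Suc (sum_list w)) :: 'a falg set)" using W_in_Kf[OF add(1)] .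
  let ?N = "n + sum_list w"
  have "smul c (W w) + x \<in> Kf (Suc ?N)"
    using w n Kf_mono[of "Suc n" "Suc ?N"] Kf_mono[of "Suc (sum_list w)" "Suc ?N"]
    by (intro Kf_add Kf_smul) (auto simp: Df_def)
  moreover have "Poly_Mapping.keys (Poly_Mapping.single w c + x) \<subseteq> lwords \<nu>"
    using add(1,2) by (intro keys_add_subset) auto
  ultimately show ?case by (auto simp: Df_def)
qed

lemma keys_ract: "Poly_Mapping.keys x \<subseteq> lwords \<nu> \<Longrightarrow> Poly_Mapping.keys (ract g x) \<subseteq> lwords \<nu>"
  and keys_lact: "Poly_Mapping.keys x \<subseteq> lwords \<nu> \<Longrightarrow> Poly_Mapping.keys (lact g x) \<subseteq> lwords \<nu>"
proof -
  assume "Poly_Mapping.keys x \<subseteq> lwords \<nu>"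
  then have k: "Poly_Mapping.keys (delta x) \<subseteq> lwords2 \<nu>" by (rule keys_delta_lwords2)
  have "Poly_Mapping.keys (case p of (u, v) \<Rightarrow> smul (g v) (W u)) \<subseteq> lwords \<nu>" if "p \<in> lwords2 \<nu>" for p
    using that by (cases p) (auto simp: lwords2_def)
  then show "Poly_Mapping.keys (ract g x) \<subseteq> lwords \<nu>"
    unfolding rac_def using k by (intro order_trans[OF keys_lext] UN_least) blast
  have "Poly_Mapping.keys (case p of (u, v) \<Rightarrow> smul (g u) (W v)) \<subseteq> lwords \<nu>" if "p \<in> lwords2 \<nu>" for p
    using that by (cases p) (auto simp: lwords2_def)
  then show "Poly_Mapping.keys (lact g x) \<subseteq> lwords \<nu>"
    unfolding lac_def using k by (intro order_trans[OF keys_lext] UN_least) blast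
qed

lemma Df_Suc: "Df \<nu> n \<subseteq> Df \<nu> (Suc n)"
  using Kf_Suc by (auto simp: Df_def)

lemma Df_add: "x \<in> Df \<nu> n \<Longrightarrow> y \<in> Df \<nu> n \<Longrightarrow> x + y \<in> Df \<nu> n"
  by (simp add: Df_def Kf_add keys_add_subset)

lemma Df_smul: "x \<in> Df \<nu> n \<Longrightarrow> smul c x \<in> Df \<nu> n"
  by (simp add: Df_def Kf_smul keys_smul_subset)

lemma Df_zero: "0 \<in> Df \<nu> n"
  by (simp add: Df_def Kf_zero)

lemma Df_one: "1 \<in> Df \<nu> 0"
  using Kf_one by (simp add: Df_def lwords_def zero_list_def)

lemma Df_mult: "x \<in> Df \<nu> i \<Longrightarrow> y \<in> Df \<nu> j \<Longrightarrow> x * y \<in> Df \<nu> (i + j)"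
  by (simp add: Df_def Kf_mult keys_mult_lwords)

lemma Df_diff: "x \<in> Df \<nu> n \<Longrightarrow> y \<in> Df \<nu> n \<Longrightarrow> x - y \<in> Df \<nu> n"
proof -
  have e: "x - y = x + smul (- 1) y" by (rule poly_mapping_eqI) (simp add: lookup_add lookup_minus)
  assume "x \<in> Df \<nu> n" "y \<in> Df \<nu> n"
  then show ?thesis unfolding e by (intro Df_add Df_smul)
qed

text \<open>With \<open>b\<close> running through a basis adapted to the filtration and \<open>\<chi>\<^sub>b\<close> its coordinate functions,
  \<open>\<Delta> x = \<Sum> b \<otimes> \<chi>\<^sub>b(x\<^sub>1) x\<^sub>2\<close>; the second leg of a term with \<open>deg b = i\<close> is annihilated by the right
  number of functionals because \<open>\<chi>\<^sub>b\<close> vanishes below degree \<open>i\<close>.\<close>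

lemma Df_delta:
  fixes x :: "'k::field_char_0 falg"
  assumes x: "x \<in> Df \<nu> n"
  shows "delta x \<in> ftens (Df \<nu>) n"
proof -
  obtain Bs :: "'k falg set" and deg \<chi> where
    b1: "\<And>b. b \<in> Bs \<Longrightarrow> b \<in> Df \<nu> (deg b)" and
    b2: "\<And>n x b. x \<in> Df \<nu> n \<Longrightarrow> \<chi> b x \<noteq> 0 \<Longrightarrow> b \<in> Bs \<and> deg b \<le> n" and
    b3: "\<And>n x. x \<in> Df \<nu> n \<Longrightarrow> finite {b. \<chi> b x \<noteq> 0}" and
    b4: "\<And>n x. x \<in> Df \<nu> n \<Longrightarrow> x = (\<Sum>b\<in>{b. \<chi> b x \<noteq> 0}. smul (\<chi> b x) b)" and
    b5: "\<And>m n x y b. x \<in> Df \<nu> m \<Longrightarrow> y \<in> Df \<nu> n \<Longrightarrow> \<chi> b (x + y) = \<chi> b x + \<chi> b y" and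
    b6: "\<And>n x c b. x \<in> Df \<nu> n \<Longrightarrow> \<chi> b (smul c x) = c * \<chi> b x"
    by (rule adapted_basis[of "Df \<nu>", OF Df_Suc], rule that; assumption)
  define f where "f b w = \<chi> b (W w)" for b w
  have f: "wsum (f b) z = \<chi> b z" if "Poly_Mapping.keys z \<subseteq> lwords \<nu>" for b z
    using that
  proof (induction z rule: pm_induct_keys)
    case zero
    from b6[OF Df_zero, of b 0] show ?case by simp
  next
    case (add w c z)
    obtain m where m: "(W w :: 'k falg) \<in> Df \<nu> m" using Df_exh[of "W w"] add(1) by auto
    obtain l where l: "z \<in> Df \<nu> l" using Df_exh add(2) by blast
    have "smul c (W w) \<in> Df \<nu> m" using m by (rule Df_smul)
    from b5[OF this l, of b] b6[OF m, of b c] show ?case using add(3) by (simp add: f_def)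
  qed
  have kx: "Poly_Mapping.keys x \<subseteq> lwords \<nu>" and Kx: "x \<in> Kf (Suc n)" using x by (auto simp: Df_def)
  define S where "S = (\<Union>p\<in>Poly_Mapping.keys (delta x). {b. \<chi> b (W (fst p)) \<noteq> 0})"
  have kd: "fst p \<in> lwords \<nu>" if "p \<in> Poly_Mapping.keys (delta x)" for p
    using that keys_delta_lwords2[OF kx] by (auto simp: lwords2_def)
  have ex: "\<exists>m. (W u :: 'k falg) \<in> Df \<nu> m" if "u \<in> lwords \<nu>" for u using Df_exh[of "W u"] that by auto
  have S: "finite S" "S \<subseteq> Bs"
    unfolding S_def using kd ex b2 b3 by (blast intro: finite_UN_I finite_keys)+
  have "d = (\<Sum>b\<in>S. tens b (lac (f b) d))" if "Poly_Mapping.keys d \<subseteq> Poly_Mapping.keys (delta x)" for d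
    using that
  proof (induction d rule: pm_induct_keys)
    case (add p c d)
    obtain u v where p: "p = (u, v)" by (cases p)
    obtain m where m: "(W u :: 'k falg) \<in> Df \<nu> m" using ex kd[OF add(1)] p by auto
    have "{b. \<chi> b (W u) \<noteq> 0} \<subseteq> S" using add(1) p by (force simp: S_def)
    then have "(\<Sum>b\<in>{b. \<chi> b (W u) \<noteq> 0}. smul (\<chi> b (W u)) b) = (\<Sum>b\<in>S. smul (\<chi> b (W u)) b)"
      using S(1) by (intro sum.mono_neutral_left) auto
    then have "W u = (\<Sum>b\<in>S. smul (\<chi> b (W u)) b)" using b4[OF m] by simp
    then have e: "tens (W u) (Poly_Mapping.single v c) = tens (\<Sum>b\<in>S. smul (\<chi> b (W u)) b) (Poly_Mapping.single v c)"
      by (rule arg_cong)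
    have "lac (f b) (Poly_Mapping.single p c) = smul (\<chi> b (W u)) (Poly_Mapping.single v c)" for b
      by (simp add: p lac_def f_def mult.commute)
    then have "(\<Sum>b\<in>S. tens b (lac (f b) (Poly_Mapping.single p c)))
        = tens (\<Sum>b\<in>S. smul (\<chi> b (W u)) b) (Poly_Mapping.single v c)"
      by (simp only: tens_sum_left tens_smul_left tens_smul_right)
    also have "\<dots> = Poly_Mapping.single p c" unfolding e[symmetric] by (simp add: p tens_single)
    finally have e2: "(\<Sum>b\<in>S. tens b (lac (f b) (Poly_Mapping.single p c))) = Poly_Mapping.single p c" .
    show ?case unfolding lac_simps tens_add_right sum.distrib e2 add(3)[symmetric] ..
  qed simp
  then have "delta x = (\<Sum>b\<in>S. tens b (lact (f b) x))" by blast
  also have "\<dots> \<in> ftens (Df \<nu>) n"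
  proof (rule ftens_sum)
    fix b assume "b \<in> S"
    then have b: "b \<in> Df \<nu> (deg b)" using b1 S by blast
    \<comment> \<open>The cap at \<open>Suc n\<close> treats \<open>deg b > n\<close> along with the
      rest: then \<open>Suc n - i = 0\<close>, and \<open>Kf 0 = {0}\<close> says that the second
      leg vanishes.\<close>
    define i where "i = min (deg b) (Suc n)"
    have "lact (f b) x \<in> Kf (Suc n - i)"
      unfolding Kf_def
    proof (intro CollectI allI impI)
      fix h' and gs :: "(nat list \<Rightarrow> 'k) list" assume gs: "length gs = Suc n - i" "\<forall>f\<in>set gs. f [] = 0"
      let ?Q = "foldl conv h' gs"
      have "ract ?Q x \<in> Kf i"
        unfolding Kf_def
      proof (intro CollectI allI impI)
        fix h and fs :: "(nat list \<Rightarrow> 'k) list" assume "length fs = i" "\<forall>f\<in>set fs. f [] = 0"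
        then show "wsum (foldl conv h fs) (ract ?Q x) = 0"
          unfolding wsum_ract using gs Kx by (intro Kf_conv) (auto simp: i_def)
      qed
      moreover have k: "Poly_Mapping.keys (ract ?Q x) \<subseteq> lwords \<nu>" using kx by (rule keys_ract)
      ultimately have "\<chi> b (ract ?Q x) = 0"
      proof (cases i)
        case 0
        then have "ract ?Q x = 0" using \<open>ract ?Q x \<in> Kf i\<close> by (simp add: Kf_0)
        then show ?thesis using f[of 0 b] by simp
      next
        case (Suc i')
        then have "ract ?Q x \<in> Df \<nu> i'" using \<open>ract ?Q x \<in> Kf i\<close> k by (simp add: Df_def)
        then have le: "\<chi> b (ract ?Q x) \<noteq> 0 \<Longrightarrow> deg b \<le> i'" using b2[of "ract ?Q x" i' b] by simp
        have "i' < deg b" using Suc by (simp add: i_def min_def split: if_splits)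
        then show ?thesis using le by (cases "\<chi> b (ract ?Q x) = 0") simp_all
      qed
      then show "wsum ?Q (lact (f b) x) = 0" using wsum_lact[of ?Q "f b" x] wsum_ract[of "f b" ?Q x] f[OF k] by simp
    qed
    then show "tens b (lact (f b) x) \<in> ftens (Df \<nu>) n"
    proof (cases "deg b \<le> n")
      case True
      assume "lact (f b) x \<in> Kf (Suc n - i)"
      then have "lact (f b) x \<in> Df \<nu> (n - deg b)" using True keys_lact[OF kx] by (simp add: Df_def i_def Suc_diff_le)
      then show ?thesis using b True by (intro ftens_tens)
    next
      case False
      assume "lact (f b) x \<in> Kf (Suc n - i)"
      then have "lact (f b) x = 0" using False by (simp add: i_def Kf_0)
      then show ?thesis by (simp add: ftens.zero)
    qed
  qed
  finally show ?thesis .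
qed

lemma ant_left_add: "ant_left (d + e) = ant_left d + ant_left e"
  and counit_right_add: "counit_right (d + e) = counit_right d + counit_right e"
  and counit_left_add: "counit_left (d + e) = counit_left d + counit_left e"
  by (simp_all add: ant_left_def counit_right_def counit_left_def)

lemma Df_mono: "m \<le> n \<Longrightarrow> Df \<nu> m \<subseteq> Df \<nu> n"
  using Df_Suc by (rule lift_Suc_mono_le)

text \<open>With \<Delta> x a sum of \<open>p \<otimes> q\<close> of degrees \<open>i\<close> and
  \<open>n - i\<close>, both S(x) = \<Sum> S(p) \<epsilon>(q) and \<epsilon>(x) = \<Sum> S(p) q
  hold, so \<epsilon>(x) - S(x) is the sum of the S(p) (q - \<epsilon>(q)). For \<open>i = n\<close>
  the element \<open>q\<close> is a scalar and the term vanishes; for \<open>i < n\<close> the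
  induction hypothesis applies to \<open>p\<close>.\<close>

lemma Df_ant: "x \<in> Df \<nu> n \<Longrightarrow> ant x \<in> Df \<nu> n" for x :: "'k::field_char_0 falg"
proof (induction n arbitrary: x rule: less_induct)
  case (less n)
  have "ant_left d - ant (counit_right d) \<in> Df \<nu> n" if "d \<in> ftens (Df \<nu>) n" for d :: "nat list \<times> nat list \<Rightarrow>\<^sub>0 'k"
    using that
  proof induction
    case zero
    show ?case by (simp add: ant_left_def counit_right_def Df_zero)
  next
    case (add i p q d)
    have z: "ant p * (q - smul (eps q) 1) \<in> Df \<nu> n"
    proof (cases "i = n")
      case True
      then have "q = smul (eps q) 1" using add(3) by (intro Kf_1) (simp add: Df_def)
      then have "q - smul (eps q) 1 = 0" by simp
      then show ?thesis by (simp add: Df_zero)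
    next
      case False
      have "smul (eps q) 1 \<in> Df \<nu> (n - i)" using Df_one Df_mono[of 0 "n - i"] by (intro Df_smul) blast
      then have "q - smul (eps q) 1 \<in> Df \<nu> (n - i)" using add(3) by (intro Df_diff)
      moreover have "ant p \<in> Df \<nu> i" using False add(1,2) by (intro less.IH) auto
      ultimately show ?thesis using Df_mult[of "ant p" \<nu> i "q - smul (eps q) 1" "n - i"] add(1) by simp
    qed
    have "ant_left (tens p q + d) - ant (counit_right (tens p q + d))
        = ant p * (q - smul (eps q) 1) + (ant_left d - ant (counit_right d))"
      by (simp add: ant_left_add counit_right_add ant_left_tens counit_right_tens right_diff_distrib mult_smul_right)
    then show ?case using Df_add[OF z add.IH] by simp
  qed
  from this[OF Df_delta[OF less.prems]] have "smul (eps x) 1 - ant x \<in> Df \<nu> n"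
    by (simp add: antipode_delta counit_delta)
  moreover have "smul (eps x) 1 \<in> Df \<nu> n" using Df_one Df_mono[of 0 n] by (intro Df_smul) blast
  ultimately have "smul (eps x) 1 - (smul (eps x) 1 - ant x) \<in> Df \<nu> n" by (rule Df_diff[rotated])
  then show ?case by simp
qed

lemma Df_hopf_filtration: "hopf_filtration \<nu> (Df \<nu> :: nat \<Rightarrow> 'k::field_char_0 falg set)"
proof (rule hopf_filtration.intro)
  show "Df \<nu> n \<subseteq> {x. Poly_Mapping.keys x \<subseteq> lwords \<nu>}" for n by (auto simp: Df_def)
qed (rule Df_zero Df_one Df_Suc | erule Df_exh Df_ant Df_delta Df_smul | erule (1) Df_add Df_mult)+

interpretation DF: hopf_filtration \<nu> "Df \<nu>" for \<nu>
  by (rule Df_hopf_filtration)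

section \<open>The filtration by kernels of the maps \<open>\<delta>\<^sub>n\<close>\<close>

lemma wsum_functional: "functional (\<lambda>c. c) (H_alg \<nu>) (wsum f)"
  by (simp add: functional_def)

lemma lookup_wsum: "Poly_Mapping.lookup x w = wsum (dfun w) x"
  by (induction x rule: pm_induct) (auto simp: lookup_add lookup_single when_def dfun_def)

lemma pairing_ins_rep2:
  "pairing (\<lambda>c. c) (wsum f # wsum g # gs) (ins [] ys (rep2 d)) = wsum (\<lambda>(u, v). f u * g v) d * pprod gs ys"
proof (induction d rule: pm_induct)
  case (add p c d)
  then show ?case by (cases p) (simp add: pairing_simps[OF rhom_id] algebra_simps)
qed (simp add: pairing_simps[OF rhom_id])

lemma pairing_Fr:
  assumes "Poly_Mapping.keys p \<subseteq> {xs. xs \<noteq> []}"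
  shows "pairing (\<lambda>c. c) (map wsum (f # g # gs)) (plin (\<lambda>xs c. smul c (Hcom.Fr 0 xs)) p)
    = pairing (\<lambda>c. c) (map wsum (conv f g # gs)) p"
  using assms
proof (induction p rule: pm_induct_keys)
  case zero show ?case by (simp add: pairing_simps[OF rhom_id])
next
  case (add xs c p)
  obtain x ys where xs: "xs = x # ys" using add(1) by (cases xs) auto
  note A = additive2_smul[OF rhom_id, of "Hcom.Fr 0"]
  have "pairing (\<lambda>c. c) (map wsum (f # g # gs)) (Hcom.Fr 0 xs) = pprod (map wsum (conv f g # gs)) xs"
    using pairing_ins_rep2[of f g "map wsum gs" ys "delta x"] by (simp add: Hcom.Fr_def xs wsum_conv)
  with add(3) show ?case
    by (simp only: plin_add[OF A] plin_single[OF A] pairing_simps[OF rhom_id] pairing_smul[OF rhom_id])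
qed

text \<open>Applying the coproduct in the first slot merges the first two functionals
  \<open>f\<close>, \<open>g\<close> into \<open>conv f g\<close> (\<open>pairing_Fr\<close>).
  Iterating gives left-nested products, which is why they appear in \<open>Kf\<close> as a
  \<open>foldl\<close>.\<close>

lemma iter_comult_pairing:
  assumes "Poly_Mapping.keys x \<subseteq> lwords \<nu>"
  shows "\<exists>p\<in>carrier (free_tensors (H_alg \<nu>) (Suc n)). iter_comult (H_alg \<nu>) (Suc n) x = tc (H_alg \<nu>) (Suc n) p \<and>
     (\<forall>f fs. length fs = n \<longrightarrow> pairing (\<lambda>c. c) (map wsum (f # fs)) p = wsum (foldl conv f fs) x)"
proof (induction n)
  case 0
  have "Poly_Mapping.single [x] 1 \<in> carrier (free_tensors (H_alg \<nu>) (Suc 0))"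
    using assms by (auto simp: tuples_def intro!: free_tensors_single)
  then show ?case by (intro bexI[of _ "Poly_Mapping.single [x] 1"]) (simp_all add: pure_tensor_def pairing_simps[OF rhom_id])
next
  case (Suc n)
  then obtain p where p: "p \<in> carrier (free_tensors (H_alg \<nu>) (Suc n))"
      "iter_comult (H_alg \<nu>) (Suc n) x = tc (H_alg \<nu>) (Suc n) p"
    and pp: "\<And>f fs. length fs = n \<Longrightarrow> pairing (\<lambda>c. c) (map wsum (f # fs)) p = wsum (foldl conv f fs) x" by blast
  let ?q = "plin (\<lambda>xs c. smul c (Hcom.Fr 0 xs)) p"
  have k: "Poly_Mapping.keys p \<subseteq> tuples (H_alg \<nu>) (Suc n)" using p(1) by (simp add: carrier_free_tensors)
  have "?q \<in> carrier (free_tensors (H_alg \<nu>) (Suc (Suc n)))"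
    using k by (auto simp: plin_def intro!: free_tensors_sum free_tensors_smul Hcom.Fr_free)
  moreover have "iter_comult (H_alg \<nu>) (Suc (Suc n)) x = tc (H_alg \<nu>) (Suc (Suc n)) ?q"
    using Hcom.comult_at_tc[of 0 "Suc n" p \<nu>] p by simp
  moreover have "pairing (\<lambda>c. c) (map wsum (f # fs)) ?q = wsum (foldl conv f fs) x" if fs: "length fs = Suc n" for f fs
  proof -
    obtain g gs where g: "fs = g # gs" "length gs = n" using fs by (cases fs) auto
    have "Poly_Mapping.keys p \<subseteq> {xs. xs \<noteq> []}" using k by (auto simp: tuples_def)
    from pairing_Fr[OF this] show ?thesis using pp[of gs "conv f g"] g by simp
  qed
  ultimately show ?case by blast
qed

lemma pprod_map: "pprod fs (map h xs) = pprod (map (\<lambda>f. f \<circ> h) fs) xs"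
proof (induction fs arbitrary: xs)
  case Nil
  show ?case by (cases xs) simp_all
next
  case (Cons f fs)
  then show ?case by (cases xs) simp_all
qed

lemma pairing_push: "pairing (\<lambda>c. c) fs (push (\<lambda>c. c) h p) = pairing (\<lambda>c. c) (map (\<lambda>f. f \<circ> h) fs) p"
proof (induction p rule: pm_induct)
  case (add xs c p)
  from add show ?case by (simp add: push_simps[OF rhom_id] pairing_simps[OF rhom_id] pprod_map o_def)
qed (simp add: push_simps[OF rhom_id] pairing_simps[OF rhom_id])

lemma H_alg_minus:
  assumes "Poly_Mapping.keys y \<subseteq> lwords \<nu>" shows "x \<ominus>\<^bsub>H_alg \<nu>\<^esub> y = x - y"
proof -
  have "abelian_group (H_alg \<nu> :: ('a, 'a falg) hopf)" using H_alg_ring by (rule ring.is_abelian_group)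
  then have "\<ominus>\<^bsub>H_alg \<nu>\<^esub> y = - y" using assms by (intro abelian_group.minus_equality) (auto simp: keys_uminus)
  then show ?thesis by (simp add: a_minus_def)
qed

lemma wsum_counit_complement: "wsum f (y - smul (eps y) 1) = wsum (f([] := 0)) y"
proof (induction y rule: pm_induct)
  case (add w c y)
  have "wsum f (Poly_Mapping.single w c + y - smul (eps (Poly_Mapping.single w c + y)) 1)
      = wsum f (y - smul (eps y) 1) + (c * f w - eps (Poly_Mapping.single w c) * f [])"
    by (simp add: wsum_one algebra_simps)
  with add show ?case by (auto simp: wsum_one algebra_simps)
qed simp

text \<open>The transpose of the projection id - u \<epsilon> resets a functional to 0 at the empty
  word, so vanishing under \<delta> with index \<open>n + 1\<close> means vanishing under all
  products of \<open>n + 1\<close> functionals killing 1. The extra leading functional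
  \<open>h\<close> of \<open>Kf\<close> is absorbed into the first factor, since
  \<open>conv h f\<close> kills 1 when \<open>f\<close> does; conversely one takes the counit for
  \<open>h\<close>.\<close>

lemma D_ker_H_alg: "D_ker (H_alg \<nu> :: ('r::comm_ring_1, 'r falg) hopf) n = Df \<nu> n"
proof -
  let ?H = "H_alg \<nu> :: ('r, 'r falg) hopf"
  let ?t = "\<lambda>y :: 'r falg. y - smul (eps y) 1"
  have one: "Poly_Mapping.keys (smul c (1 :: 'r falg)) \<subseteq> lwords \<nu>" for c
    by (intro keys_smul_subset) (simp add: lwords_def zero_list_def)
  have t: "(\<lambda>y. y \<ominus>\<^bsub>?H\<^esub> (counit ?H y \<odot>\<^bsub>?H\<^esub> \<one>\<^bsub>?H\<^esub>)) = ?t"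
    using H_alg_minus[OF one] by (simp add: fun_eq_iff)
  have sl: "?t \<in> slin (\<lambda>c. c) ?H ?H"
  proof -
    have "?t y = y + smul (- eps y) 1" for y :: "'r falg"
      by (rule poly_mapping_eqI) (simp add: lookup_add lookup_minus)
    then have "Poly_Mapping.keys (?t y) \<subseteq> lwords \<nu>" if "Poly_Mapping.keys y \<subseteq> lwords \<nu>" for y :: "'r falg"
      using keys_add_subset[OF that one] by metis
    then show ?thesis by (auto simp: slin_def smul_add_left smul_diff smul_smul)
  qed
  have "delta_map ?H (Suc n) x = \<zero>\<^bsub>tensor_power ?H (Suc n)\<^esub> \<longleftrightarrow> x \<in> Kf (Suc n)"
    if x: "Poly_Mapping.keys x \<subseteq> lwords \<nu>" for x
  proof -
    obtain p where p: "p \<in> carrier (free_tensors ?H (Suc n))" "iter_comult ?H (Suc n) x = tc ?H (Suc n) p"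
      and pp: "\<And>f fs. length fs = n \<Longrightarrow> pairing (\<lambda>c. c) (map wsum (f # fs)) p = wsum (foldl conv f fs) x"
      using iter_comult_pairing[OF x, of n] by blast
    let ?q = "push (\<lambda>c. c) ?t p"
    have q: "?q \<in> carrier (free_tensors ?H (Suc n))"
      using sl by (intro push_free[OF rhom_id _ p(1)]) (simp add: slin_def)
    have pq: "pairing (\<lambda>c. c) (map wsum (f # fs)) ?q = wsum (foldl conv (f([] := 0)) (map (\<lambda>f. f([] := 0)) fs)) x"
      if "length fs = n" for f fs
    proof -
      have "wsum g \<circ> ?t = wsum (g([] := 0))" for g :: "nat list \<Rightarrow> 'r"
        by (rule ext) (simp only: o_apply wsum_counit_complement)
      then have "map (\<lambda>g. g \<circ> ?t) (map wsum (f # fs)) = map wsum (map (\<lambda>f. f([] := 0)) (f # fs))" by simp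
      then show ?thesis using pp[of "map (\<lambda>f. f([] := 0)) fs" "f([] := 0)"] that
        by (simp only: pairing_push list.map length_map)
    qed
    have "delta_map ?H (Suc n) x = \<zero>\<^bsub>tensor_power ?H (Suc n)\<^esub> \<longleftrightarrow> ?q \<in> tensor_rels ?H (Suc n)"
      unfolding delta_map_def t p(2) tensor_map_push[OF rhom_id H_alg_module sl p(1)] tp_zero tc_eq_iff by simp
    also have "\<dots> \<longleftrightarrow> x \<in> Kf (Suc n)"
    proof
      assume r: "?q \<in> tensor_rels ?H (Suc n)"
      show "x \<in> Kf (Suc n)"
        unfolding Kf_def
      proof (intro CollectI allI impI)
        fix h and fs :: "(nat list \<Rightarrow> 'r) list" assume fs: "length fs = Suc n" "\<forall>f\<in>set fs. f [] = 0"
        then obtain f gs where g: "fs = f # gs" "length gs = n" by (cases fs) auto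
        have i: "(conv h f)([] := 0) = conv h f" "map (\<lambda>f. f([] := 0)) gs = gs"
          using fs(2) g by (auto simp: fun_upd_idem_iff conv_Nil intro!: map_idI)
        have "pairing (\<lambda>c. c) (map wsum (conv h f # gs)) ?q = 0"
          using g by (intro pairing_rels[OF rhom_id _ _ r]) (auto simp: wsum_functional)
        then show "wsum (foldl conv h fs) x = 0" using pq[OF g(2), of "conv h f"] i g by simp
      qed
    next
      assume x: "x \<in> Kf (Suc n)"
      show "?q \<in> tensor_rels ?H (Suc n)"
      proof (rule Hdual.rels_if_pairing_zero[OF q])
        fix js :: "nat list list" assume "length js = Suc n"
        then obtain i is' where j: "js = i # is'" "length is' = n" by (cases js) auto
        let ?f = "(dfun i :: _ \<Rightarrow> 'r)([] := 0)" and ?fs = "map ((\<lambda>f. f([] := 0)) \<circ> dfun) is' :: (nat list \<Rightarrow> 'r) list"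
        have l: "map (\<lambda>w x. Poly_Mapping.lookup x w) js = map wsum (dfun i # map dfun is')"
          using j by (simp add: lookup_wsum fun_eq_iff)
        have "wsum (foldl conv unit_fun (?f # ?fs)) x = 0"
          using j by (intro KfD[OF x]) auto
        then show "pairing (\<lambda>c. c) (map (\<lambda>w x. Poly_Mapping.lookup x w) js) ?q = 0"
          unfolding l using pq[of "map dfun is'" "dfun i"] j by (simp add: conv_unit)
      qed
    qed
    finally show ?thesis .
  qed
  then show ?thesis by (auto simp: D_ker_def Df_def)
qed

section \<open>The two Rees algebras\<close>

text \<open>The filtration whose Rees algebra is \<open>(\<H>\<^sub>\<hbar>')\<^sup>\<or>\<close>: elements of the augmentation ideal move down by one.\<close>

inductive Ep :: "enat \<Rightarrow> nat \<Rightarrow> 'k::field_char_0 falg \<Rightarrow> bool" for \<nu> where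
  zero: "Ep \<nu> n 0"
| one: "Ep \<nu> n 1"
| base: "x \<in> Df \<nu> (Suc n) \<Longrightarrow> eps x = 0 \<Longrightarrow> Ep \<nu> n x"
| mult: "Ep \<nu> m x \<Longrightarrow> Ep \<nu> n y \<Longrightarrow> Ep \<nu> (m + n) (x * y)"
| suc: "Ep \<nu> n x \<Longrightarrow> Ep \<nu> (Suc n) x"
| add: "Ep \<nu> n x \<Longrightarrow> Ep \<nu> n y \<Longrightarrow> Ep \<nu> n (x + y)"
| smul: "Ep \<nu> n x \<Longrightarrow> Ep \<nu> n (smul c x)"

definition Ef :: "enat \<Rightarrow> nat \<Rightarrow> 'k::field_char_0 falg set" where
  "Ef \<nu> n = {x. Ep \<nu> n x}"

definition aug :: "'r::comm_ring_1 falg \<Rightarrow> 'r falg" where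
  "aug x = x - smul (eps x) 1"

lemma aug_simps: "aug (x + y) = aug x + aug y" "aug 0 = 0"
  by (simp_all add: aug_def smul_add_left)

lemma eps_aug: "eps (aug x) = 0"
  by (simp add: aug_def)

lemma aug_Df: "x \<in> Df \<nu> n \<Longrightarrow> aug x \<in> Df \<nu> n" for x :: "'k::field_char_0 falg"
  unfolding aug_def using Df_one[where ?'a = 'k] Df_mono[of 0 n \<nu>] by (intro Df_diff Df_smul) auto

lemma aug_Df_0: "x \<in> Df \<nu> 0 \<Longrightarrow> aug x = 0" for x :: "'k::field_char_0 falg"
  using Kf_1[of x] by (simp add: Df_def aug_def)

lemma aug_Ep: "x \<in> Df \<nu> (Suc n) \<Longrightarrow> Ep \<nu> n (aug x)"
  by (intro Ep.base aug_Df eps_aug)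

lemma Df_Ep: "x \<in> Df \<nu> n \<Longrightarrow> Ep \<nu> n x"
proof -
  assume "x \<in> Df \<nu> n"
  then have "Ep \<nu> n (aug x)" using Df_Suc by (intro aug_Ep) blast
  then have "Ep \<nu> n (aug x + smul (eps x) 1)" by (intro Ep.add Ep.smul Ep.one)
  then show ?thesis by (simp add: aug_def)
qed

lemma Ep_mono: "m \<le> n \<Longrightarrow> Ep \<nu> m x \<Longrightarrow> Ep \<nu> n x"
  by (induction rule: dec_induct) (auto intro: Ep.suc)

lemma Ep_keys: "Ep \<nu> n x \<Longrightarrow> Poly_Mapping.keys x \<subseteq> lwords \<nu>"
proof (induction rule: Ep.induct)
  case (one n) show ?case by (simp add: lwords_def zero_list_def)
next
  case (base x n) then show ?case by (simp add: Df_def)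
qed (simp_all add: keys_mult_lwords keys_add_subset keys_smul_subset)

text \<open>Apply the counit to \<open>S(x\<^sub>1) x\<^sub>2 = \<epsilon>(x) 1\<close>: being
  multiplicative, it turns the left side into \<epsilon>(S(x)).\<close>

lemma eps_ant: "eps (ant x) = eps x"
proof -
  have "eps (ant_left d) = eps (ant (counit_right d))" for d :: "nat list \<times> nat list \<Rightarrow>\<^sub>0 'a"
  proof (induction d rule: pm_induct)
    case (add p c d)
    obtain u v where p: "p = (u, v)" by (cases p)
    have e: "Poly_Mapping.single p c = tens (W u) (Poly_Mapping.single v c)" by (simp add: p tens_single)
    show ?case unfolding e ant_left_add counit_right_add by (simp only: ant_left_tens counit_right_tens ant_simps eps_simps eps_mult add mult.commute)
  qed (simp add: ant_left_def counit_right_def)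
  from this[of "delta x"] show ?thesis by (simp add: antipode_delta counit_delta)
qed

lemma Ep_ant: "Ep \<nu> n x \<Longrightarrow> Ep \<nu> n (ant x)"
proof (induction rule: Ep.induct)
  case (base x n)
  then show ?case by (intro Ep.base Df_ant) (simp_all add: eps_ant)
next
  case (mult m x n y)
  then show ?case using Ep.mult[of \<nu> n "ant y" m "ant x"] by (simp add: ant_mult add.commute)
qed (auto intro: Ep.intros)

lemma ftens_smul:
  assumes "\<And>n x c. x \<in> F n \<Longrightarrow> smul c x \<in> F n" "d \<in> ftens F n" shows "smul c d \<in> ftens F n"
  using assms(2) by induction (auto simp: smul_add tens_smul_left[symmetric] intro!: ftens.zero ftens.add assms(1))

lemma ftens_Suc:
  assumes "\<And>n. F n \<subseteq> F (Suc n)" "d \<in> ftens F n" shows "d \<in> ftens F (Suc n)"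
  using assms(2)
proof induction
  case (add i p q d)
  then have "q \<in> F (Suc n - i)" using assms(1)[of "n - i"] by (auto simp: Suc_diff_le)
  with add show ?case by (intro ftens.add[of i]) auto
qed (rule ftens.zero)

lemma ftens_mult:
  assumes m: "\<And>m n x y. x \<in> F m \<Longrightarrow> y \<in> F n \<Longrightarrow> x * y \<in> F (m + n)" and "d \<in> ftens F a" and e: "e \<in> ftens F b"
  shows "d * e \<in> ftens F (a + b)"
  using assms(2)
proof induction
  case (add i p q d)
  have "tens p q * e \<in> ftens F (a + b)" using e
  proof induction
    case (add j r s e)
    have "tens (p * r) (q * s) + tens p q * e \<in> ftens F (a + b)"
    proof (rule ftens.add)
      show "i + j \<le> a + b" using add(1) \<open>i \<le> a\<close> by simp
      show "p * r \<in> F (i + j)" using m add(2) \<open>p \<in> F i\<close> by blast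
      have "(a - i) + (b - j) = a + b - (i + j)" using add(1) \<open>i \<le> a\<close> by simp
      then show "q * s \<in> F (a + b - (i + j))" using m[OF \<open>q \<in> F (a - i)\<close> add(3)] by simp
    qed (rule add.IH)
    then show ?case by (simp add: distrib_left tens_mult)
  qed (simp add: ftens.zero)
  then show ?case using add.IH by (simp add: distrib_right ftens_sum_mem)
qed (simp add: ftens.zero)

lemma tens_uminus_left: "tens (- x) y = - tens x y" and tens_uminus_right: "tens x (- y) = - tens x y"
  by (simp_all add: eq_neg_iff_add_eq_0 flip: tens_add_left tens_add_right)

text \<open>Up to \<open>x \<otimes> 1 + 1 \<otimes> x\<close>, which has the right degree, only
  \<open>(aug \<otimes> aug) (\<Delta> x)\<close> remains; this is \<open>T (delta x)\<close>,
  written through the counits. For \<open>p\<close> in \<open>D\<^sub>i\<close> and \<open>q\<close>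
  in \<open>D\<^sub>n\<^sub>+\<^sub>1\<^sub>-\<^sub>i\<close> both augmented legs drop by one, so
  the total degree is \<open>n - 1\<close> and certainly at most \<open>n\<close>. In the end cases,
  where a leg cannot drop, it is a scalar and \<open>aug\<close> kills it.\<close>

lemma Ep_delta_base:
  assumes x: "x \<in> Df \<nu> (Suc n)" "eps x = 0"
  shows "delta x \<in> ftens (Ef \<nu>) n"
proof -
  define T where "T d = d - tens (counit_right d) 1 - tens 1 (counit_left d) + smul (eps (counit_right d)) 1"
    for d :: "nat list \<times> nat list \<Rightarrow>\<^sub>0 'a"
  have "T d \<in> ftens (Ef \<nu>) n" if "d \<in> ftens (Df \<nu>) (Suc n)" for d
    using that
  proof induction
    case zero
    show ?case by (simp add: T_def counit_right_def counit_left_def ftens.zero)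
  next
    case (add i p q d)
    have "T (tens p q + d) = T (tens p q) + T d"
      by (simp add: T_def counit_right_add counit_left_add tens_add_left tens_add_right smul_add_left)
    moreover have "T (tens p q) = tens (aug p) (aug q)"
      unfolding T_def aug_def counit_right_tens counit_left_tens diff_conv_add_uminus
        tens_add_left tens_add_right
      by (simp add: tens_smul_left tens_smul_right smul_smul mult.commute tens_uminus_left tens_uminus_right smul_minus flip: tens_one)
    moreover have "tens (aug p) (aug q) \<in> ftens (Ef \<nu>) n"
    proof (cases "i = 0 \<or> i = Suc n")
      case True
      then have "aug p = 0 \<or> aug q = 0" using add(2,3) aug_Df_0 by auto
      then have "tens (aug p) (aug q) = 0" by auto
      then show ?thesis by (simp add: ftens.zero)
    next
      case False
      then obtain i' where i: "i = Suc i'" "i' < n" using add(1) by (cases i) auto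
      have "Suc n - i = Suc (n - i)" using i by simp
      then have "Ep \<nu> (n - i) (aug q)" using add(3) by (intro aug_Ep) simp
      then have "Ep \<nu> (n - i') (aug q)" using i by (intro Ep_mono[of "n - i" "n - i'"]) auto
      moreover have "Ep \<nu> i' (aug p)" using add(2) i by (intro aug_Ep) simp
      ultimately show ?thesis using i by (intro ftens_tens[of i']) (auto simp: Ef_def)
    qed
    ultimately show ?case using add.IH by (simp add: ftens_sum_mem)
  qed
  from this[OF Df_delta[OF x(1)]] have "T (delta x) \<in> ftens (Ef \<nu>) n" .
  moreover have "Ep \<nu> n x" using x by (rule Ep.base)
  then have "tens x 1 \<in> ftens (Ef \<nu>) n" "tens 1 x \<in> ftens (Ef \<nu>) n"
    using ftens_tens[of n n x "Ef \<nu>" 1] ftens_tens[of 0 n 1 "Ef \<nu>" x] by (simp_all add: Ef_def Ep.one)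
  ultimately have "T (delta x) + (tens x 1 + tens 1 x) \<in> ftens (Ef \<nu>) n" by (intro ftens_sum_mem)
  then show ?thesis using x(2) by (simp add: T_def counit_delta)
qed

lemma Ep_delta: "Ep \<nu> n x \<Longrightarrow> delta x \<in> ftens (Ef \<nu>) n"
proof (induction rule: Ep.induct)
  case (one n)
  have "tens 1 1 \<in> ftens (Ef \<nu>) n" by (intro ftens_tens[of 0]) (auto simp: Ef_def intro: Ep.one)
  then show ?case by (simp add: delta_one tens_one)
next
  case (base x n)
  then show ?case by (rule Ep_delta_base)
next
  case (mult m x n y)
  then show ?case unfolding delta_mult by (intro ftens_mult) (auto simp: Ef_def intro: Ep.mult)
next
  case (suc n x)
  then show ?case by (intro ftens_Suc) (auto simp: Ef_def intro: Ep.suc)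
next
  case (smul n x c)
  then show ?case unfolding delta_smul by (intro ftens_smul) (auto simp: Ef_def intro: Ep.smul)
next
  case zero
  have "delta 0 = smul 0 (delta (0 :: 'a falg))" by (simp flip: delta_smul)
  then show ?case by (simp add: ftens.zero)
qed (simp_all add: delta_add ftens_sum_mem)

lemma Ef_hopf_filtration: "hopf_filtration \<nu> (Ef \<nu> :: nat \<Rightarrow> 'k::field_char_0 falg set)"
proof (rule hopf_filtration.intro)
  show "Ef \<nu> n \<subseteq> {x. Poly_Mapping.keys x \<subseteq> lwords \<nu>}" for n using Ep_keys by (auto simp: Ef_def)
  show "\<exists>n. x \<in> Ef \<nu> n" if "Poly_Mapping.keys x \<subseteq> lwords \<nu>" for x :: "'k falg"
    using Df_exh[OF that] Df_Ep by (auto simp: Ef_def)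
  show "x \<in> Ef \<nu> n \<Longrightarrow> delta x \<in> ftens (Ef \<nu>) n" for x n using Ep_delta by (auto simp: Ef_def)
qed (auto simp: Ef_def intro: Ep.intros Ep_ant)

interpretation EF: hopf_filtration \<nu> "Ef \<nu>" for \<nu>
  by (rule Ef_hopf_filtration)

section \<open>The two constructions as Rees algebras\<close>

abbreviation "reesD \<nu> \<equiv> hopf_filtration.rees (Df \<nu>)"
abbreviation "reesE \<nu> \<equiv> hopf_filtration.rees (Ef \<nu>)"

lemma rhom_to_fract: "rhom to_fract"
  by (simp add: rhom_def)

interpretation RD: rees_hopf \<nu> "Df \<nu>" "\<lambda>c::'k::field_char_0 poly. c" for \<nu>
  by (intro rees_hopf.intro Df_hopf_filtration rees_hopf_axioms.intro rhom_id) (simp add: inj_on_def)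

interpretation RE: rees_hopf \<nu> "Ef \<nu>" "to_fract :: 'k::field_char_0 poly \<Rightarrow> _" for \<nu>
  by (intro rees_hopf.intro Ef_hopf_filtration rees_hopf_axioms.intro rhom_to_fract) (simp add: inj_on_def)

lemma scal_eq: "scal = smul"
  by (intro ext) (rule scal_smul)

lemma smul_module: "rhom \<sigma> \<Longrightarrow> Modules.module (\<lambda>c. smul (\<sigma> c))"
  by unfold_locales (simp_all add: smul_add smul_add_left smul_smul rhomD)

lemma H_prime_set_eq: "H_prime_set \<nu> = (reesD \<nu> :: 'k::field_char_0 poly falg set)"
proof -
  interpret Modules.module "smul :: 'k poly \<Rightarrow> _" by (rule smul_module[OF rhom_id])
  let ?S = "\<Union>n. hp n ` (Df \<nu> n :: 'k falg set)"
  have "H_prime_set \<nu> = span ?S" by (simp add: H_prime_set_def scal_eq D_ker_H_alg hp_def[abs_def] to_hbar_def)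
  moreover have "span ?S \<subseteq> reesD \<nu>"
    by (rule span_minimal) (auto simp: subspace_def intro: DF.rees_hp DF.rees.zero DF.rees_add DF.rees_smul)
  moreover have "y \<in> span ?S" if "y \<in> reesD \<nu>" for y
    using that
  proof (induction rule: DF.rees.induct)
    case (add x n y)
    have "hp n x \<in> span ?S" using add(1) by (intro span_base) auto
    then show ?case using add.IH by (rule span_add)
  qed (rule span_zero)
  ultimately show ?thesis by auto
qed

lemma H_prime_Hh: "H_prime \<nu> = rees_hopf.Hh \<nu> (Df \<nu>) (\<lambda>c. c)"
  by (simp add: H_prime_def RD.Hh_def H_prime_set_eq pmap_id[abs_def])

lemma carrier_H_prime: "carrier (H_prime \<nu>) = reesD \<nu>"
  by (simp add: H_prime_Hh pmap_id)

lemma counit_H_prime: "counit (H_prime \<nu>) x = eps x"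
  using RD.counit_Hh[of \<nu> x] by (simp add: H_prime_Hh pmap_id)

lemma mem_J_prime: "x \<in> J_prime \<nu> \<longleftrightarrow> x \<in> reesD \<nu> \<and> eps x = 0"
  by (simp add: J_prime_def carrier_H_prime counit_H_prime)

lemma H_prime_ops: "monoid.mult (H_prime \<nu>) = (*)" "add (H_prime \<nu>) = (+)"
  by (simp_all add: H_prime_Hh)

lemma J_prime_power_0: "J_prime_power \<nu> 0 = reesD \<nu>"
  and J_prime_power_Suc: "J_prime_power \<nu> (Suc n) = ideal_prod (H_prime \<nu>) (J_prime \<nu>) (J_prime_power \<nu> n)"
  by (simp_all add: J_prime_power_def carrier_H_prime)

lemma J_prime_power_prod: "x \<in> J_prime \<nu> \<Longrightarrow> y \<in> J_prime_power \<nu> n \<Longrightarrow> x * y \<in> J_prime_power \<nu> (Suc n)"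
  using ideal_prod.prod[of x "J_prime \<nu>" y "J_prime_power \<nu> n" "H_prime \<nu>"]
  by (simp add: J_prime_power_Suc H_prime_ops)

lemma J_prime_power_add: "x \<in> J_prime_power \<nu> n \<Longrightarrow> y \<in> J_prime_power \<nu> n \<Longrightarrow> x + y \<in> J_prime_power \<nu> n"
  by (cases n) (auto simp: J_prime_power_0 J_prime_power_Suc DF.rees_add H_prime_ops dest: ideal_prod.sum)

lemma J_prime_power_Suc_induct [consumes 1, case_names prod sum]:
  assumes "z \<in> J_prime_power \<nu> (Suc n)"
    and "\<And>x y. x \<in> J_prime \<nu> \<Longrightarrow> y \<in> J_prime_power \<nu> n \<Longrightarrow> P (x * y)"
    and "\<And>x y. P x \<Longrightarrow> P y \<Longrightarrow> P (x + y)"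
  shows "P z"
  using assms(1) unfolding J_prime_power_Suc
  by (induction rule: ideal_prod.induct) (simp_all add: H_prime_ops assms(2,3))

text \<open>The start of the induction in \<open>J_prime_power_mult\<close>, where the zeroth power
  is the whole algebra.\<close>

lemma J_prime_power_lmult:
  "x \<in> reesD \<nu> \<Longrightarrow> y \<in> J_prime_power \<nu> n \<Longrightarrow> x * y \<in> J_prime_power \<nu> n"
proof (cases n)
  case 0
  assume "x \<in> reesD \<nu>" "y \<in> J_prime_power \<nu> n"
  then show ?thesis using 0 by (simp add: J_prime_power_0 DF.rees_mult)
next
  case (Suc m)
  assume x: "x \<in> reesD \<nu>" and "y \<in> J_prime_power \<nu> n"
  then have "y \<in> J_prime_power \<nu> (Suc m)" using Suc by simp
  then have "x * y \<in> J_prime_power \<nu> (Suc m)"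
  proof (induction rule: J_prime_power_Suc_induct)
    case (prod i j)
    have "x * i \<in> J_prime \<nu>" using x prod(1) by (simp add: mem_J_prime DF.rees_mult)
    then show ?case using J_prime_power_prod[OF _ prod(2)] by (simp flip: mult.assoc)
  qed (simp add: distrib_left J_prime_power_add)
  then show ?thesis using Suc by simp
qed

lemma J_prime_power_mult:
  "x \<in> J_prime_power \<nu> m \<Longrightarrow> y \<in> J_prime_power \<nu> n \<Longrightarrow> x * y \<in> J_prime_power \<nu> (m + n)"
proof (induction m arbitrary: x)
  case 0
  then show ?case by (simp add: J_prime_power_0 J_prime_power_lmult)
next
  case (Suc m)
  from Suc.prems(1) show ?case
  proof (induction rule: J_prime_power_Suc_induct)
    case (prod i j)
    have "i * (j * y) \<in> J_prime_power \<nu> (Suc (m + n))"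
      using prod Suc.IH Suc.prems(2) by (intro J_prime_power_prod)
    then show ?case by (simp add: mult.assoc)
  qed (simp add: distrib_right J_prime_power_add)
qed

lemma mem_Ef: "x \<in> Ef \<nu> n \<longleftrightarrow> Ep \<nu> n x"
  by (simp add: Ef_def)

lemma reesD_reesE: "y \<in> reesD \<nu> \<Longrightarrow> y \<in> reesE \<nu>"
proof (induction rule: DF.rees.induct)
  case (add x n y)
  then show ?case using EF.rees.add[of x \<nu> n y] by (simp add: mem_Ef Df_Ep)
qed (rule EF.rees.zero)

lemma hp_1: "hp n 1 = smul (hbar ^ n) (1 :: 'k::field_char_0 poly falg)"
  using smul_hbar_hp(2)[of n 0 "1 :: 'k falg"] by (simp add: hp_one)

lemma eps_hp: "eps (hp n x) = hbar ^ n * [:eps x:]"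
  by (simp add: hp_def eps_pmap[OF rhom_const])

lemma hp_aug: "aug (hp n x) = hp n (aug x)" for x :: "'k::field_char_0 falg"
proof -
  have "hp n (aug x) = hp n x - hp n (smul (eps x) 1)"
    unfolding aug_def diff_conv_add_uminus by (simp only: hp_simps(2,4))
  moreover have "hp n (smul (eps x) (1 :: 'k falg)) = smul (eps (hp n x)) 1"
    by (simp add: hp_simps(3) hp_1 eps_hp smul_smul mult.commute)
  ultimately show ?thesis by (simp add: aug_def)
qed

text \<open>From \<open>\<hbar>\<^sup>n x\<close> with \<open>x\<close> in \<open>D\<^sub>n\<close>
  one factor \<hbar> splits off, and the augmentation part of \<open>x\<close> lies one step lower
  in \<open>Ef\<close>; for \<open>n = 0\<close> it is 0. Hence the augmentation ideal of
  \<open>H_prime\<close> lies in \<hbar> times the Rees algebra of \<open>Ef\<close>.\<close>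

lemma aug_reesD: "y \<in> reesD \<nu> \<Longrightarrow> \<exists>u\<in>reesE \<nu>. aug y = smul hbar u"
proof (induction rule: DF.rees.induct)
  case zero
  show ?case by (intro bexI[of _ 0]) (simp_all add: aug_simps EF.rees.zero)
next
  case (add x n y)
  then obtain u where u: "u \<in> reesE \<nu>" "aug y = smul hbar u" by blast
  show ?case
  proof (cases n)
    case 0
    then have "aug x = 0" using add(1) by (intro aug_Df_0[of x \<nu>]) simp
    then have "aug (hp n x) = 0" by (simp add: hp_aug hp_simps)
    then show ?thesis using u by (intro bexI[of _ u]) (simp_all add: aug_simps)
  next
    case (Suc m)
    then have "aug x \<in> Ef \<nu> m" using add(1) aug_Ep by (simp add: mem_Ef)
    moreover have "aug (hp n x) = smul hbar (hp m (aug x))" by (simp add: hp_aug Suc smul_hbar_hp)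
    ultimately show ?thesis using u
      by (intro bexI[of _ "hp m (aug x) + u"]) (simp_all add: aug_simps smul_add EF.rees_add EF.rees_hp)
  qed
qed

lemma J_prime_power_divide: "z \<in> J_prime_power \<nu> n \<Longrightarrow> \<exists>y\<in>reesE \<nu>. z = smul (hbar ^ n) y"
proof (induction n arbitrary: z)
  case 0
  then show ?case by (intro bexI[of _ z]) (simp_all add: J_prime_power_0 reesD_reesE)
next
  case (Suc n)
  from Suc.prems show ?case
  proof (induction rule: J_prime_power_Suc_induct)
    case (prod i j)
    obtain u where u: "u \<in> reesE \<nu>" "aug i = smul hbar u" using aug_reesD prod(1) by (auto simp: mem_J_prime)
    have i: "i = smul hbar u" using u(2) prod(1) by (simp add: aug_def mem_J_prime)
    obtain y where y: "y \<in> reesE \<nu>" "j = smul (hbar ^ n) y" using Suc.IH[OF prod(2)] by blast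
    have "i * j = smul (hbar ^ Suc n) (u * y)"
      unfolding i y(2) by (simp add: mult_smul_left mult_smul_right smul_smul mult.commute)
    then show ?case using EF.rees_mult[OF u(1) y(1)] by blast
  next
    case (sum x y)
    then obtain u v where "u \<in> reesE \<nu>" "v \<in> reesE \<nu>" "x = smul (hbar ^ Suc n) u" "y = smul (hbar ^ Suc n) v" by blast
    then show ?case using EF.rees_add[of u \<nu> v] by (intro bexI[of _ "u + v"]) (simp_all add: smul_add)
  qed
qed

lemma to_frac_simps: "to_frac 0 = 0" "to_frac (x + y) = to_frac x + to_frac y"
  "to_frac (smul c x) = smul (to_fract c) (to_frac x)" "to_frac (x' * y') = to_frac x' * to_frac y'"
  by (simp_all add: to_frac_def pmap_simps[OF rhom_to_fract] pmap_mult[OF rhom_to_fract])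

lemma to_fract_power: "to_fract (a ^ n) = to_fract a ^ n"
  by (induction n) simp_all

lemma hbar_ne: "to_fract (hbar :: 'k::field_char_0 poly) \<noteq> 0"
  by (simp add: hbar_def)

lemma hbar_cancel:
  fixes y :: "'k::field_char_0 poly falg"
  shows "smul (inverse (to_fract hbar) ^ n) (to_frac (smul (hbar ^ n) y)) = to_frac y"
  using hbar_ne[where ?'k = 'k] by (simp add: to_frac_simps to_fract_power smul_smul flip: power_mult_distrib)

text \<open>One inclusion is \<open>J_prime_power_divide\<close>. The other follows the generation
  of \<open>Ep\<close>: in the base case \<open>\<hbar>\<^sup>n x\<close> is
  \<open>\<hbar>\<^sup>-\<^sup>1\<close> times \<open>\<hbar>\<^sup>n\<^sup>+\<^sup>1 x\<close>,
  which belongs to the augmentation ideal since \<open>x\<close> lies in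
  \<open>D\<^sub>n\<^sub>+\<^sub>1\<close> and has counit 0; the remaining rules are closure
  properties of the span.\<close>

lemma H_prime_vee_set_eq: "H_prime_vee_set \<nu> = (to_frac ` reesE \<nu> :: 'k::field_char_0 poly fract falg set)"
proof -
  interpret Modules.module "\<lambda>c::'k poly. smul (to_fract c) :: 'k poly fract falg \<Rightarrow> _"
    by (rule smul_module[OF rhom_to_fract])
  let ?g = "\<lambda>n z. smul (inverse (to_fract hbar) ^ n) (to_frac z) :: 'k poly fract falg"
  let ?S = "\<Union>n. ?g n ` J_prime_power \<nu> n"
  let ?V = "span ?S"
  have V: "H_prime_vee_set \<nu> = ?V" by (simp add: H_prime_vee_set_def scal_eq)
  have "?V \<subseteq> to_frac ` reesE \<nu>"
  proof (rule span_minimal)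
    show "?S \<subseteq> to_frac ` reesE \<nu>"
    proof clarify
      fix n and z :: "'k poly falg" assume "z \<in> J_prime_power \<nu> n"
      then obtain y where y: "y \<in> reesE \<nu>" "z = smul (hbar ^ n) y" using J_prime_power_divide by blast
      then have "?g n z = to_frac y" by (simp only: hbar_cancel)
      then show "?g n z \<in> to_frac ` reesE \<nu>" using y(1) by blast
    qed
    show "subspace (to_frac ` reesE \<nu>)"
      unfolding subspace_def
    proof (intro conjI ballI allI)
      show "0 \<in> to_frac ` reesE \<nu>" using EF.rees.zero by (intro image_eqI[of _ _ 0]) (simp_all add: to_frac_simps)
      fix x :: "'k poly fract falg" and c assume "x \<in> to_frac ` reesE \<nu>"
      then obtain u where u: "u \<in> reesE \<nu>" "x = to_frac u" by blast
      then show "smul (to_fract c) x \<in> to_frac ` reesE \<nu>"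
        by (intro image_eqI[of _ _ "smul c u"]) (simp_all add: to_frac_simps EF.rees_smul)
      fix y :: "'k poly fract falg" assume "y \<in> to_frac ` reesE \<nu>"
      then obtain v where v: "v \<in> reesE \<nu>" "y = to_frac v" by blast
      show "x + y \<in> to_frac ` reesE \<nu>"
        using u v by (intro image_eqI[of _ _ "u + v"]) (simp_all add: to_frac_simps EF.rees_add)
    qed
  qed
  moreover have g: "?g n z \<in> ?V" if "z \<in> J_prime_power \<nu> n" for n and z :: "'k poly falg"
    using that by (intro span_base) blast
  \<comment> \<open>The exponents of \<hbar> and of the ideal powers add up in a product of two
    generators; bilinearity extends this to the span, one argument at a time.\<close>
  have Vmult: "a * b \<in> ?V" if a: "a \<in> ?V" and b: "b \<in> ?V" for a b
  proof -
    have sub: "subspace {a. a * b \<in> ?V}" "subspace {a. b * a \<in> ?V}" for b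
      by (auto simp: subspace_def distrib_right distrib_left mult_smul_left mult_smul_right span_zero span_add span_scale)
    have gg: "?g m z * ?g n w \<in> ?V" if "z \<in> J_prime_power \<nu> m" "w \<in> J_prime_power \<nu> n" for m n and z w :: "'k poly falg"
    proof -
      have "?g m z * ?g n w = ?g (m + n) (z * w)"
        by (simp add: mult_smul_left mult_smul_right smul_smul to_frac_simps power_add)
      then show ?thesis using g[OF J_prime_power_mult[OF that]] by simp
    qed
    have "?V \<subseteq> {a. a * ?g n w \<in> ?V}" if "w \<in> J_prime_power \<nu> n" for n and w :: "'k poly falg"
      using gg that sub(1) by (intro span_minimal) auto
    then have "a * ?g n w \<in> ?V" if "w \<in> J_prime_power \<nu> n" for n and w :: "'k poly falg" using that a by blast
    then have "?V \<subseteq> {b. a * b \<in> ?V}" using sub(2) by (intro span_minimal) auto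
    then show ?thesis using b by blast
  qed
  have one: "to_frac (1 :: 'k poly falg) \<in> ?V"
  proof -
    have "(1 :: 'k poly falg) \<in> reesD \<nu>" by (rule DF.rees_one)
    then show ?thesis using g[of 1 0] by (simp add: J_prime_power_0)
  qed
  have hpV: "to_frac (hp n x) \<in> ?V" if "Ep \<nu> n x" for n and x :: "'k falg"
    using that
  proof (induction rule: Ep.induct)
    case zero
    show ?case by (simp add: hp_simps to_frac_simps span_zero)
  next
    case (one n)
    show ?case using span_scale[OF \<open>to_frac 1 \<in> ?V\<close>, of "hbar ^ n"] by (simp add: hp_1 to_frac_simps)
  next
    case (base x n)
    have "hp (Suc n) x \<in> J_prime \<nu>"
      using base by (simp add: mem_J_prime DF.rees_hp) (simp add: eps_hp)
    then have "hp (Suc n) x * 1 \<in> J_prime_power \<nu> (Suc 0)"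
      using DF.rees_one by (intro J_prime_power_prod) (simp_all add: J_prime_power_0)
    from g[OF this] show ?case using hbar_cancel[of 1 "hp n x"] by (simp add: smul_hbar_hp)
  next
    case (mult m x n y)
    then show ?case using Vmult by (simp add: to_frac_simps flip: hp_mult)
  next
    case (suc n x)
    then show ?case using span_scale[OF suc.IH, of hbar] by (simp add: smul_hbar_hp flip: to_frac_simps)
  next
    case (add n x y)
    then show ?case by (simp add: hp_simps to_frac_simps span_add)
  next
    case (smul n x c)
    then show ?case by (simp add: hp_simps to_frac_simps span_scale)
  qed
  have "to_frac y \<in> ?V" if "y \<in> reesE \<nu>" for y :: "'k poly falg"
    using that
  proof (induction rule: EF.rees.induct)
    case zero
    show ?case by (simp add: to_frac_simps span_zero)
  next
    case (add x n y)
    have "to_frac (hp n x) \<in> ?V" using add(1) hpV by (simp add: mem_Ef)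
    then show ?case using add.IH by (simp add: to_frac_simps span_add)
  qed
  ultimately show ?thesis unfolding V by blast
qed

lemma H_prime_vee_Hh: "H_prime_vee \<nu> = rees_hopf.Hh \<nu> (Ef \<nu>) to_fract"
  by (simp add: H_prime_vee_def RE.Hh_def H_prime_vee_set_eq to_frac_def[abs_def])

section \<open>The isomorphisms\<close>

lemma eps_power: "n > 0 \<Longrightarrow> eps (gen m ^ n) = 0"
  by (cases n) simp_all

lemma keys_gen1_power: "1 \<in> letters \<nu> \<Longrightarrow> Poly_Mapping.keys (gen 1 ^ n :: 'r::comm_ring_1 falg) \<subseteq> lwords \<nu>"
proof (induction n)
  case (Suc n)
  have "Poly_Mapping.keys (gen 1 :: 'r falg) \<subseteq> lwords \<nu>" using Suc.prems by (simp add: gen_def lwords_def)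
  then show ?case using Suc by (simp add: keys_mult_lwords)
qed (simp add: lwords_def zero_list_def)

lemma letters_1: "n \<in> letters \<nu> \<Longrightarrow> 1 \<in> letters \<nu>"
  by (auto simp: letters_def intro: order_trans[of _ "enat n"])

text \<open>By truncated subtraction \<open>Suc (n - 2)\<close> is 1 for \<open>n = 1\<close> and
  \<open>n - 1\<close> for \<open>n \<ge> 2\<close>, which is the exponent of \<open>hbar\<close> in
  \<open>alpha_hat\<close>. The successor form is the one in which \<open>Ep.base\<close> lowers the
  degree to \<open>n - 2\<close>.\<close>

lemma alpha_Df:
  assumes n: "n \<in> letters \<nu>"
  shows "(alpha n :: 'k::field_char_0 falg) \<in> Df \<nu> (Suc (n - 2))" "eps (alpha n :: 'k falg) = 0"
proof -
  have n1: "n \<ge> 1" using n by (simp add: letters_def)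
  then show "eps (alpha n :: 'k falg) = 0" by (simp add: alpha_def eps_power)
  have k: "Poly_Mapping.keys (gen n :: 'k falg) \<subseteq> lwords \<nu>" using n by (simp add: gen_def lwords_def)
  have m: "gen n - gen 1 ^ n = gen n + smul (- 1) (gen 1 ^ n :: 'k falg)"
    by (rule poly_mapping_eqI) (simp add: lookup_add lookup_minus)
  have d: "Poly_Mapping.keys (gen n - gen 1 ^ n :: 'k falg) \<subseteq> lwords \<nu>"
    unfolding m using k keys_gen1_power[OF letters_1[OF n]] by (intro keys_add_subset keys_smul_subset)
  have K: "(gen n :: 'k falg) \<in> Kf (Suc n)" "gen n - gen 1 ^ n \<in> (Kf n :: 'k falg set)"
    using gen_in_Kf[of n] n1 by auto
  show "(alpha n :: 'k falg) \<in> Df \<nu> (Suc (n - 2))"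
  proof (cases "n = 1")
    case True
    then show ?thesis using k K(1) by (simp add: alpha_def Df_def)
  next
    case False
    then have "Suc (Suc (n - 2)) = n" using n1 by simp
    then show ?thesis using False d K(2) by (simp add: alpha_def Df_def)
  qed
qed

lemma alpha_keys: "n \<in> letters \<nu> \<Longrightarrow> Poly_Mapping.keys (alpha n :: 'k::field_char_0 falg) \<subseteq> lwords \<nu>"
  using alpha_Df(1)[where ?'k = 'k, of n \<nu>] by (simp add: Df_def)

lemma alpha_hat_hp: "n \<in> letters \<nu> \<Longrightarrow> alpha_hat n = hp (Suc (n - 2)) (alpha n)"
proof -
  assume "n \<in> letters \<nu>"
  then have "n = 1 \<or> n \<noteq> 1 \<and> n - 1 = Suc (n - 2)" by (auto simp: letters_def)
  then show ?thesis by (elim disjE) (simp_all add: alpha_hat_def hp_def to_hbar_def scal_eq)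
qed

lemma alpha_check_hp: "n \<in> letters \<nu> \<Longrightarrow> alpha_check n = to_frac (hp (n - 2) (alpha n))"
  using hbar_cancel[of 1 "hp (n - 2) (alpha n)"]
  by (simp add: alpha_check_def alpha_hat_hp[of n \<nu>] smul_hbar_hp scal_eq)

text \<open>The elements \<open>alpha n\<close> generate the algebra because \<open>gen n\<close> is
  \<open>alpha n + alpha 1 ^ n\<close> for \<open>n \<ge> 2\<close>, and the set where two
  homomorphisms agree is a subalgebra. This gives the uniqueness clauses of the theorem.\<close>

lemma alg_hom_eq:
  assumes f: "f \<in> alg_hom (H_alg \<nu> :: ('k::field_char_0, 'k falg) hopf) B" and g: "g \<in> alg_hom (H_alg \<nu>) B"
    and a: "\<And>n. n \<in> letters \<nu> \<Longrightarrow> f (alpha n) = g (alpha n)" and x: "Poly_Mapping.keys x \<subseteq> lwords \<nu>"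
  shows "f x = g x"
proof -
  let ?E = "{y. Poly_Mapping.keys y \<subseteq> lwords \<nu> \<and> f y = g y}"
  have hom: "h (y * z) = h y \<otimes>\<^bsub>B\<^esub> h z" "h (y + z) = h y \<oplus>\<^bsub>B\<^esub> h z" "h 1 = \<one>\<^bsub>B\<^esub>" "h (smul c y) = c \<odot>\<^bsub>B\<^esub> h y"
    if "h \<in> alg_hom (H_alg \<nu>) B" "Poly_Mapping.keys y \<subseteq> lwords \<nu>" "Poly_Mapping.keys z \<subseteq> lwords \<nu>" for h y z c
    using that ring_hom_mult[of h "H_alg \<nu>" B y z] ring_hom_add[of h "H_alg \<nu>" B y z] ring_hom_one[of h "H_alg \<nu>" B]
    by (auto simp: alg_hom_def)
  have E_mult: "y * z \<in> ?E" and E_add: "y + z \<in> ?E" and E_smul: "smul c y \<in> ?E" if "y \<in> ?E" "z \<in> ?E" for y z c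
    using that hom[OF f, of y z] hom[OF g, of y z] by (auto simp: keys_mult_lwords keys_add_subset keys_smul_subset)
  have E_one: "1 \<in> ?E" using hom(3)[OF f, of 0 0] hom(3)[OF g, of 0 0] by (simp add: lwords_def zero_list_def)
  have E_zero: "0 \<in> ?E" using E_smul[OF E_one E_one, of 0] by simp
  have E_alpha: "alpha n \<in> ?E" if "n \<in> letters \<nu>" for n using alpha_keys[OF that] a[OF that] by simp
  have E_gen: "gen n \<in> ?E" if n: "n \<in> letters \<nu>" for n
  proof -
    have 1: "gen 1 \<in> ?E" using E_alpha[OF letters_1[OF n]] by (simp add: alpha_def)
    have p: "gen 1 ^ m \<in> ?E" for m
    proof (induction m)
      case 0 show ?case using E_one by (simp only: power_0)
    next
      case (Suc m) show ?case unfolding power_Suc using 1 Suc by (rule E_mult)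
    qed
    show ?thesis
    proof (cases "n = 1")
      case True then show ?thesis using 1 by (simp only:)
    next
      case False
      have "alpha n + gen 1 ^ n \<in> ?E" using E_alpha[OF n] p by (rule E_add)
      then show ?thesis using False by (simp add: alpha_def)
    qed
  qed
  have E_W: "(W w :: 'k falg) \<in> ?E" if "w \<in> lwords \<nu>" for w
    using that
  proof (induction w)
    case Nil show ?case unfolding W_Nil by (rule E_one)
  next
    case (Cons n w)
    then have "gen n * W w \<in> ?E" by (intro E_mult E_gen) (auto simp: lwords_def)
    then show ?case by (simp only: gen_W)
  qed
  have "x \<in> ?E" using x
  proof (induction x rule: pm_induct_keys)
    case (add w c x)
    have "smul c (W w :: 'k falg) + x \<in> ?E" using E_W[OF add(1)] add(3) by (intro E_add E_smul)
    then show ?case by simp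
  qed (rule E_zero)
  then show ?thesis by simp
qed

lemma alg_hom_slin: "f \<in> alg_hom A B \<Longrightarrow> f \<in> slin (\<lambda>c. c) A B"
  by (auto simp: alg_hom_def slin_def ring_hom_closed ring_hom_add)

lemma push_id_cong:
  assumes "p \<in> carrier (free_tensors A n)" "\<And>x. x \<in> carrier A \<Longrightarrow> g (f x) = x"
  shows "push (\<lambda>c. c) g (push (\<lambda>c. c) f p) = p"
proof -
  have "Poly_Mapping.keys p \<subseteq> tuples A n" using assms(1) by (simp add: carrier_free_tensors)
  then show ?thesis
  proof (induction p rule: pm_induct_keys)
    case (add xs c p)
    have "map g (map f xs) = xs" using add(1) assms(2) by (auto simp: tuples_def intro!: map_idI)
    with add(3) show ?case by (simp only: push_simps[OF rhom_id])
  qed (simp add: push_simps[OF rhom_id])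
qed

text \<open>The specialisation theorem yields a map from \<H> to the quotient, whereas the second
  part of the theorem asks for the opposite direction.\<close>

lemma graded_hopf_iso_inverse:
  assumes iso: "graded_hopf_iso A B f"
  shows "graded_hopf_iso B A (inv_into (carrier A) f)"
proof -
  let ?g = "inv_into (carrier A) f"
  have gA: "is_graded_hopf_algebra A" and gB: "is_graded_hopf_algebra B" and f: "f \<in> alg_hom A B"
    and bij: "bij_betw f (carrier A) (carrier B)"
    and com: "\<And>x. x \<in> carrier A \<Longrightarrow> comult B (f x) = tensor_map (\<lambda>c. c) B 2 f (comult A x)"
    and cou: "\<And>x. x \<in> carrier A \<Longrightarrow> counit B (f x) = counit A x"
    and ant: "\<And>x. x \<in> carrier A \<Longrightarrow> antipode B (f x) = f (antipode A x)"
    and hom: "\<And>d. f ` homog A d = homog B d"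
    using iso by (auto simp: graded_hopf_iso_def)
  have aA: "is_algebra A" and aB: "is_algebra B" and cA: "comult A \<in> alg_hom A (tensor_power A 2)"
    and antA: "antipode A \<in> lin_map A A" and sub: "\<And>d. submodule (homog A d) rot A"
    using gA gB by (auto simp: is_graded_hopf_algebra_def is_hopf_algebra_def)
  have gf: "?g (f x) = x" if "x \<in> carrier A" for x using bij that by (simp add: bij_betw_def inv_into_f_f)
  have B: "\<exists>x\<in>carrier A. y = f x" if "y \<in> carrier B" for y using bij that by (auto simp: bij_betw_def)
  interpret A: ring A using aA by (simp add: is_algebra_def)
  interpret mA: Module.module rot A using aA by (rule is_algebraD(1))
  have fr: "f \<in> ring_hom A B" and fs: "\<And>c x. x \<in> carrier A \<Longrightarrow> f (c \<odot>\<^bsub>A\<^esub> x) = c \<odot>\<^bsub>B\<^esub> f x"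
    using f by (auto simp: alg_hom_def)
  have g: "?g \<in> alg_hom B A"
    unfolding alg_hom_def
  proof (intro CollectI conjI allI ballI ring_hom_memI)
    fix x y assume "x \<in> carrier B" "y \<in> carrier B"
    then obtain a b where ab: "a \<in> carrier A" "b \<in> carrier A" "x = f a" "y = f b" using B by blast
    have *: "x \<otimes>\<^bsub>B\<^esub> y = f (a \<otimes>\<^bsub>A\<^esub> b)" "x \<oplus>\<^bsub>B\<^esub> y = f (a \<oplus>\<^bsub>A\<^esub> b)"
      using fr ab by (simp_all add: ring_hom_mult ring_hom_add)
    show "?g (x \<otimes>\<^bsub>B\<^esub> y) = ?g x \<otimes>\<^bsub>A\<^esub> ?g y" "?g (x \<oplus>\<^bsub>B\<^esub> y) = ?g x \<oplus>\<^bsub>A\<^esub> ?g y"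
      unfolding * unfolding ab(3,4) using ab(1,2) by (simp_all add: gf)
    show "?g x \<in> carrier A" using ab gf by simp
  next
    have "?g (f \<one>\<^bsub>A\<^esub>) = \<one>\<^bsub>A\<^esub>" by (rule gf) simp
    then show "?g \<one>\<^bsub>B\<^esub> = \<one>\<^bsub>A\<^esub>" using ring_hom_one[OF fr] by simp
  next
    fix c x assume "x \<in> carrier B"
    then obtain a where a: "a \<in> carrier A" "x = f a" using B by blast
    then have "c \<odot>\<^bsub>A\<^esub> a \<in> carrier A" using mA.smult_closed[of c a] by simp
    then show "?g (c \<odot>\<^bsub>B\<^esub> x) = c \<odot>\<^bsub>A\<^esub> ?g x" using a gf by (simp flip: fs)
  qed
  have "comult A (?g y) = tensor_map (\<lambda>c. c) A 2 ?g (comult B y)" if y: "y \<in> carrier B" for y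
  proof -
    obtain x where x: "x \<in> carrier A" "y = f x" using B[OF y] by blast
    have "comult A x \<in> carrier (tensor_power A 2)" using cA x(1) by (auto simp: alg_hom_def intro: ring_hom_closed)
    then obtain p where p: "p \<in> carrier (free_tensors A 2)" "comult A x = tc A 2 p"
      by (auto simp: carrier_tensor_power)
    have fp: "push (\<lambda>c. c) f p \<in> carrier (free_tensors B 2)"
      using fr by (intro push_free[OF rhom_id _ p(1)]) (auto intro: ring_hom_closed)
    show ?thesis
      unfolding x(2) com[OF x(1)] gf[OF x(1)] p(2)
        tensor_map_push[OF rhom_id is_algebraD(1)[OF aA] alg_hom_slin[OF f] p(1)]
        tensor_map_push[OF rhom_id is_algebraD(1)[OF aB] alg_hom_slin[OF g] fp]
      using push_id_cong[of p A 2 ?g f, OF p(1) gf] by simp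
  qed
  moreover have "counit A (?g y) = counit B y" "antipode A (?g y) = ?g (antipode B y)" if y: "y \<in> carrier B" for y
  proof -
    obtain x where x: "x \<in> carrier A" "y = f x" using B[OF y] by blast
    then show "counit A (?g y) = counit B y" by (simp add: gf cou)
    have "antipode A x \<in> carrier A" using antA x(1) by (auto simp: lin_map_def)
    then show "antipode A (?g y) = ?g (antipode B y)" using x by (simp add: gf ant)
  qed
  moreover have "?g ` homog B d = homog A d" for d
  proof -
    have "homog A d \<subseteq> carrier A" using subgroup.subset[OF submodule.axioms(1)[OF sub[of d]]] by simp
    then have "(\<lambda>x. ?g (f x)) ` homog A d = (\<lambda>x. x) ` homog A d" using gf by (intro image_cong) auto
    then show ?thesis by (simp add: image_image flip: hom)
  qed
  moreover have "bij_betw ?g (carrier B) (carrier A)" using bij by (rule bij_betw_inv_into)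
  ultimately show ?thesis using gA gB g by (simp add: graded_hopf_iso_def)
qed

lemma alg_hom_comp:
  assumes f: "f \<in> alg_hom A B" and g: "g \<in> alg_hom B C" shows "(\<lambda>x. g (f x)) \<in> alg_hom A C"
proof -
  have h: "f \<in> ring_hom A B" "g \<in> ring_hom B C" using f g by (auto simp: alg_hom_def)
  then have "(\<lambda>x. g (f x)) \<in> ring_hom A C" using ring_hom_trans[OF h] by (simp add: o_def)
  then show ?thesis using f g ring_hom_closed[OF h(1)] by (auto simp: alg_hom_def)
qed

theorem mainTheorem7:
  fixes \<nu> :: enat
  assumes "\<nu> \<noteq> 0"
  shows
    "(\<forall>n\<in>letters \<nu>. (alpha_hat n :: 'k::field_char_0 poly falg) \<in> carrier (H_prime \<nu>)) \<and>
     (\<exists>\<phi> :: 'k falg \<Rightarrow> 'k poly falg set.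
        graded_hopf_iso (H_alg \<nu>) (at_one (H_prime \<nu>)) \<phi> \<and>
        (\<forall>n\<in>letters \<nu>. \<phi> (alpha n) = at_one_class (H_prime \<nu>) (alpha_hat n)) \<and>
        (\<forall>\<phi>' \<in> alg_hom (H_alg \<nu>) (at_one (H_prime \<nu>)).
           (\<forall>n\<in>letters \<nu>. \<phi>' (alpha n) = at_one_class (H_prime \<nu>) (alpha_hat n)) \<longrightarrow>
           (\<forall>x\<in>carrier (H_alg \<nu>). \<phi>' x = \<phi> x))) \<and>
     (\<forall>n\<in>letters \<nu>. (alpha_check n :: 'k poly fract falg) \<in> carrier (H_prime_vee \<nu>)) \<and>
     (\<exists>\<psi> :: 'k poly fract falg set \<Rightarrow> 'k falg.
        graded_hopf_iso (at_one (H_prime_vee \<nu>)) (H_alg \<nu>) \<psi> \<and>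
        (\<forall>n\<in>letters \<nu>. \<psi> (at_one_class (H_prime_vee \<nu>) (alpha_check n)) = alpha n) \<and>
        (\<forall>\<psi>' \<in> alg_hom (at_one (H_prime_vee \<nu>)) (H_alg \<nu>).
           (\<forall>n\<in>letters \<nu>. \<psi>' (at_one_class (H_prime_vee \<nu>) (alpha_check n)) = alpha n) \<longrightarrow>
           (\<forall>T\<in>carrier (at_one (H_prime_vee \<nu>)). \<psi>' T = \<psi> T)))"
proof (intro conjI ballI)
  let ?H = "H_alg \<nu> :: ('k, 'k falg) hopf"
  fix n assume n: "n \<in> letters \<nu>"
  show "(alpha_hat n :: 'k poly falg) \<in> carrier (H_prime \<nu>)"
    using DF.rees_hp[OF alpha_Df(1)[OF n]] by (simp add: carrier_H_prime alpha_hat_hp[OF n])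
  show "(alpha_check n :: 'k poly fract falg) \<in> carrier (H_prime_vee \<nu>)"
    using EF.rees_hp[of "alpha n" \<nu> "n - 2"] Ep.base[OF alpha_Df[OF n]]
    by (auto simp: H_prime_vee_Hh alpha_check_hp[OF n] to_frac_def Ef_def)
next
  let ?H = "H_alg \<nu> :: ('k, 'k falg) hopf"
  let ?f = "rees_hopf.\<phi> \<nu> (Df \<nu> :: nat \<Rightarrow> 'k falg set) (\<lambda>c. c)"
  have iso: "graded_hopf_iso ?H (at_one (H_prime \<nu>)) ?f"
    using RD.rees_at_one_iso[of \<nu>] by (simp only: H_prime_Hh)
  have val: "?f (alpha n) = at_one_class (H_prime \<nu>) (alpha_hat n)" if n: "n \<in> letters \<nu>" for n
    \<comment> \<open>The filtration degree of \<open>alpha n\<close> equals the exponent in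
      \<open>alpha_hat n\<close>, so \<phi> sends \<open>alpha n\<close> to the class of exactly
      this element.\<close>
    using RD.\<phi>_hp[OF alpha_Df(1)[OF n]] by (simp add: RD.K_def H_prime_Hh alpha_hat_hp[OF n] pmap_id)
  have f: "?f \<in> alg_hom ?H (at_one (H_prime \<nu>))" using iso by (simp only: graded_hopf_iso_def)
  have uniq: "\<phi>' x = ?f x" if h: "\<phi>' \<in> alg_hom ?H (at_one (H_prime \<nu>))"
      "\<forall>n\<in>letters \<nu>. \<phi>' (alpha n) = at_one_class (H_prime \<nu>) (alpha_hat n)" "x \<in> carrier ?H" for \<phi>' x
  proof (rule alg_hom_eq[OF h(1) f])
    show "\<phi>' (alpha n) = ?f (alpha n)" if "n \<in> letters \<nu>" for n
      unfolding val[OF that] using h(2) that by (rule bspec)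
    show "Poly_Mapping.keys x \<subseteq> lwords \<nu>" using h(3) by simp
  qed
  show "\<exists>\<phi>. graded_hopf_iso ?H (at_one (H_prime \<nu>)) \<phi> \<and>
        (\<forall>n\<in>letters \<nu>. \<phi> (alpha n) = at_one_class (H_prime \<nu>) (alpha_hat n)) \<and>
        (\<forall>\<phi>' \<in> alg_hom ?H (at_one (H_prime \<nu>)).
           (\<forall>n\<in>letters \<nu>. \<phi>' (alpha n) = at_one_class (H_prime \<nu>) (alpha_hat n)) \<longrightarrow>
           (\<forall>x\<in>carrier ?H. \<phi>' x = \<phi> x))"
    by (intro exI[of _ ?f] conjI ballI impI iso val uniq) (assumption | erule (1) bspec)+
next
  let ?H = "H_alg \<nu> :: ('k, 'k falg) hopf"
  let ?V = "at_one (H_prime_vee \<nu>) :: ('k, 'k poly fract falg set) hopf"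
  let ?f = "rees_hopf.\<phi> \<nu> (Ef \<nu> :: nat \<Rightarrow> 'k falg set) to_fract"
  let ?g = "inv_into (carrier ?H) ?f"
  have iso: "graded_hopf_iso ?H ?V ?f"
    using RE.rees_at_one_iso[of \<nu>] by (simp only: H_prime_vee_Hh)
  then have f: "?f \<in> alg_hom ?H ?V" and bij: "bij_betw ?f (carrier ?H) (carrier ?V)"
    by (simp_all only: graded_hopf_iso_def)
  have gf: "?g (?f x) = x" if "x \<in> carrier ?H" for x
    using bij that unfolding bij_betw_def by (intro inv_into_f_f) auto
  \<comment> \<open>In \<open>Ef\<close> the element \<open>alpha n\<close> has moved down to degree
    \<open>n - 2\<close>, the exponent in \<open>alpha_check n\<close>; truncation makes this 0 for
    \<open>n = 1\<close>, where \<open>alpha_check 1\<close> carries no power of \<hbar>.\<close>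
  have val: "?f (alpha n) = at_one_class (H_prime_vee \<nu>) (alpha_check n)" if n: "n \<in> letters \<nu>" for n
    using RE.\<phi>_hp[of "alpha n" \<nu> "n - 2"] Ep.base[OF alpha_Df[OF n]]
    by (simp add: RE.K_def H_prime_vee_Hh alpha_check_hp[OF n] to_frac_def Ef_def)
  have gval: "?g (at_one_class (H_prime_vee \<nu>) (alpha_check n)) = alpha n" if n: "n \<in> letters \<nu>" for n
    unfolding val[OF n, symmetric] using alpha_keys[OF n] by (intro gf) simp
  have uniq: "\<psi>' T = ?g T" if h: "\<psi>' \<in> alg_hom ?V ?H"
      "\<forall>n\<in>letters \<nu>. \<psi>' (at_one_class (H_prime_vee \<nu>) (alpha_check n)) = alpha n" and T: "T \<in> carrier ?V" for \<psi>' T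
  proof -
    obtain x where x: "x \<in> carrier ?H" "T = ?f x" using bij T unfolding bij_betw_def by blast
    have i: "(\<lambda>x. x) \<in> alg_hom ?H ?H" by (simp add: alg_hom_def ring_hom_def)
    have "\<psi>' (?f x) = x"
    proof (rule alg_hom_eq[OF alg_hom_comp[OF f h(1)] i])
      show "\<psi>' (?f (alpha n)) = alpha n" if "n \<in> letters \<nu>" for n
        unfolding val[OF that] using h(2) that by (rule bspec)
      show "Poly_Mapping.keys x \<subseteq> lwords \<nu>" using x(1) by simp
    qed
    then show ?thesis unfolding x(2) gf[OF x(1)] .
  qed
  show "\<exists>\<psi>. graded_hopf_iso ?V ?H \<psi> \<and>
        (\<forall>n\<in>letters \<nu>. \<psi> (at_one_class (H_prime_vee \<nu>) (alpha_check n)) = alpha n) \<and>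
        (\<forall>\<psi>' \<in> alg_hom ?V ?H.
           (\<forall>n\<in>letters \<nu>. \<psi>' (at_one_class (H_prime_vee \<nu>) (alpha_check n)) = alpha n) \<longrightarrow>
           (\<forall>T\<in>carrier ?V. \<psi>' T = \<psi> T))"
    by (intro exI[of _ ?g] conjI ballI impI graded_hopf_iso_inverse[OF iso] gval uniq) (assumption | erule (1) bspec)+
qed

end
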